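(* Let $I\subset(-a;a)$ be a relatively closed interval, let $S_j\in\mathcal U_a'$ with $\mathrm{supp}\,S_j=\{0\}$, $j=1,\dots,m$, and let $S_j*S_{j+1}\in\mathcal U_a'$, $j=1,\dots,m-1$. Then $W=\bigcap_{j=1}^m\ker T_{S_j,I}$ admits weak spectral synthesis, its residual interval is $I_W=I$, and the sequence of exponents of $\mathrm{Exp}(W)$ is $\bigcap_{j=1}^m\mathcal Z_{\varphi_j}$, where $\varphi_j=\mathcal F(S_j)$.
   Context: Weight. $\omega:[0;\infty)\to[0;\infty)$ is a non-decreasing continuous function such that: $\varphi_\omega(t):=\omega(e^t)$ is convex on $[0;\infty)$; $\omega(x)=o(x)$ and $\ln x=o(\omega(x))$ as $x\to\infty$; for every $\sigma>1$ there is $C>0$ with $\omega(x+y)\le\sigma(\omega(x)+\omega(y))+C$ for all $x,y\ge0$; $\int_1^\infty\omega(x)x^{-2}\,dx<\infty$. Fix $0<a\le+\infty$, a sequence $0<c_k\nearrow a$ such that $\{[-c_k;c_k]\}$ is an increasing sequence of closed intervals exhausting $(-a;a)$, and a sequence $0<r_k\nearrow1$. Ultradifferentiable functions. Put $\varphi_\omega^*(s)=\sup_t(st-\varphi_\omega(t))$ and, for $f\in C^\infty(-a;a)$, $q\in(0;1)$, $k\in\mathbb N$, $\|f\|_{\omega,q,k}=\sup_{j\in\mathbb N_0}\sup_{|x|\le c_k}|f^{(j)}(x)|e^{-q\varphi_\omega^*(j/q)}$. $\mathcal U_a$ is the space of all $f\in C^\infty(-a;a)$ with $\|f\|_{\omega,q,k}<\infty$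 for all $q\in(0;1)$, $k\in\mathbb N$, with the locally convex topology given by these semi-norms. Its strong dual $\mathcal U_a'$ is the space of all ultradistributions with compact supports in $(-a;a)$. $D=d/dx$. A $D$-invariant subspace is a closed subspace $W\subset\mathcal U_a$ with $D(W)\subset W$. $\mathrm{Exp}(W)$ is the set of all exponential monomials $t^je^{-\mathrm i\lambda t}$ ($j\in\mathbb Z_+$, $\lambda\in\mathbb C$) contained in $W$; its sequence of exponents is the sequence of multiple points $\{(\lambda_k;m_k)\}$ such that $\mathrm{Exp}(W)=\{t^je^{-\mathrm i\lambda_kt}: j=0,1,\dots,m_k-1\}_k$. Fourier-Laplace transform. $P_k$ is the Banach space of entire functions $\varphi$ with $\sup_{z\in\mathbb C}|\varphi(z)|e^{-r_k\omega(|z|)-c_k|\mathrm{Im}\,z|}<\infty$ and $\mathcal P_a$ is the locally convex inductive limit of the $P_k$; $\mathcal F(S)(z)=S(e^{-\mathrm itz})$ is a linear topological isomorphism of $\mathcal U_a'$ onto $\mathcal P_a$. Convolution corresponds to multiplication of Fourier-Laplace transforms, so $S_j*S_{j+1}\in\mathcal U_a'$ means $\varphi_j\varphi_{j+1}\in\mathcal P_a$. $\mathcal Z_\varphi$ is the zero set of $\varphi$ with multiplicities; an intersection of zero sets consists of the common zeros, taken with the minimal multiplicities. Weak spectral synthesis. For an interval $I\subset(-a;a)$ relatively closed in $(-a;a)$ put $W_I=\{f\in\mathcal U_a: f=0\text{ on }I\}$. The residual interval $I_W$ of a $D$-invariant subspace $W$ is defined by the requirements: $I_W$ is relatively closed in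 $(-a;a)$, $W_{I_W}\subset W$, and $W_I\setminus W\ne\emptyset$ for every relatively closed interval $I\subsetneq I_W$. $W$ admits weak spectral synthesis if $W=\overline{\mathrm{span}(\mathrm{Exp}(W))+W_{I_W}}$ (closure in $\mathcal U_a$). Local convolution. For $S\in\mathcal U_a'$ with $\mathrm{supp}\,S=\{0\}$ the local convolution operator $T_{S,I}$ maps $f\in\mathcal U_a$ to the function $g$ on $I$ given by $g(y)=S(f(x+y))$, $y\in I$ ($S$ acting in the variable $x$). Thus $\ker T_{S,I}=\{f\in\mathcal U_a: S(f(x+y))=0\ \forall y\in I\}$. *)

theory Defs
  imports
    "HOL-Complex_Analysis.Complex_Analysis"
    "HOL-Library.Landau_Symbols"
    "HOL-Library.Function_Algebras"
begin

section \<open>Weights and the standing choices\<close>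

definition weight :: "(real \<Rightarrow> real) \<Rightarrow> bool" where
  "weight \<omega> \<longleftrightarrow>
     (\<forall>x\<ge>0. 0 \<le> \<omega> x) \<and>
     mono_on {0..} \<omega> \<and>
     continuous_on {0..} \<omega> \<and>
     convex_on {0..} (\<lambda>t. \<omega> (exp t)) \<and>
     \<omega> \<in> o[at_top](\<lambda>x. x) \<and>
     ln \<in> o[at_top](\<omega>) \<and>
     (\<forall>\<sigma>>1. \<exists>C>0. \<forall>x\<ge>0. \<forall>y\<ge>0. \<omega> (x + y) \<le> \<sigma> * (\<omega> x + \<omega> y) + C) \<and>
     set_integrable lborel {1..} (\<lambda>x. \<omega> x / x\<^sup>2)"

text \<open>The open interval $(-a;a)$, where $a = \infty$ is allowed.\<close>

definition sym_ival :: "ereal \<Rightarrow> real set" where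
  "sym_ival a = {x. - a < ereal x \<and> ereal x < a}"

definition exhausting_seq :: "ereal \<Rightarrow> (nat \<Rightarrow> real) \<Rightarrow> bool" where
  "exhausting_seq a c \<longleftrightarrow>
     incseq c \<and> (\<forall>k. 0 < c k \<and> ereal (c k) < a) \<and> (\<lambda>k. ereal (c k)) \<longlonglongrightarrow> a"

definition unit_seq :: "(nat \<Rightarrow> real) \<Rightarrow> bool" where
  "unit_seq r \<longleftrightarrow> incseq r \<and> (\<forall>k. 0 < r k \<and> r k < 1) \<and> r \<longlonglongrightarrow> 1"

section \<open>Ultradifferentiable functions\<close>

text \<open>
  A function on $(-a;a)$ is represented by the function on the whole real line that
  vanishes outside $(-a;a)$; this makes equality of functions on $(-a;a)$ plain equality.
  The complex vector space structure is the pointwise one.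
\<close>

definition cscale :: "complex \<Rightarrow> (real \<Rightarrow> complex) \<Rightarrow> real \<Rightarrow> complex" where
  "cscale z f = (\<lambda>x. z * f x)"

interpretation cfun: vector_space cscale
  by unfold_locales (auto simp: cscale_def fun_eq_iff algebra_simps)

definition D_op :: "ereal \<Rightarrow> (real \<Rightarrow> complex) \<Rightarrow> real \<Rightarrow> complex" where
  "D_op a f = (\<lambda>x. if x \<in> sym_ival a then vector_derivative f (at x) else 0)"

definition smooth_fun :: "ereal \<Rightarrow> (real \<Rightarrow> complex) \<Rightarrow> bool" where
  "smooth_fun a f \<longleftrightarrow> (\<forall>j. \<forall>x\<in>sym_ival a. ((D_op a ^^ j) f) differentiable (at x))"

text \<open>The Young conjugate of $\varphi_\omega(t) = \omega(e^t)$, $t \ge 0$.\<close>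

definition phi_star :: "(real \<Rightarrow> real) \<Rightarrow> real \<Rightarrow> real" where
  "phi_star \<omega> s = (SUP t\<in>{0..}. s * t - \<omega> (exp t))"

definition seminorm_U ::
  "(real \<Rightarrow> real) \<Rightarrow> ereal \<Rightarrow> (nat \<Rightarrow> real) \<Rightarrow> real \<Rightarrow> nat \<Rightarrow> (real \<Rightarrow> complex) \<Rightarrow> ereal" where
  "seminorm_U \<omega> a c q k f =
     (SUP j. SUP x\<in>{- c k..c k}.
        ereal (norm ((D_op a ^^ j) f x) * exp (- q * phi_star \<omega> (real j / q))))"

definition U_space :: "(real \<Rightarrow> real) \<Rightarrow> ereal \<Rightarrow> (nat \<Rightarrow> real) \<Rightarrow> (real \<Rightarrow> complex) set" where
  "U_space \<omega> a c =
     {f. (\<forall>x. x \<notin> sym_ival a \<longrightarrow> f x = 0) \<and> smooth_fun a f \<and>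
         (\<forall>q\<in>{0<..<1}. \<forall>k. seminorm_U \<omega> a c q k f < \<infinity>)}"

text \<open>
  The locally convex topology given by the semi-norms: the open semi-balls form a subbase.
\<close>

definition U_top :: "(real \<Rightarrow> real) \<Rightarrow> ereal \<Rightarrow> (nat \<Rightarrow> real) \<Rightarrow> (real \<Rightarrow> complex) topology" where
  "U_top \<omega> a c = topology_generated_by
     {{g \<in> U_space \<omega> a c. seminorm_U \<omega> a c q k (g - f) < ereal \<epsilon>} | f q k \<epsilon>.
        f \<in> U_space \<omega> a c \<and> q \<in> {0<..<1} \<and> 0 < \<epsilon>}"

lemma topspace_U_top: "topspace (U_top \<omega> a c) = U_space \<omega> a c"
proof -
  have D0: "D_op a (\<lambda>x. 0) = (\<lambda>x. 0)"
    by (auto simp: D_op_def)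
  have Dj0: "(D_op a ^^ j) (\<lambda>x. 0) = (\<lambda>x. 0)" for j
    by (induction j) (auto simp: D0)
  have S0: "seminorm_U \<omega> a c q k (f - f) \<le> 0" for q k f
    by (auto simp: seminorm_U_def Dj0 zero_fun_def intro!: SUP_least)
  have *: "f \<in> {g \<in> U_space \<omega> a c. seminorm_U \<omega> a c (1/2) 0 (g - f) < ereal 1}"
    if "f \<in> U_space \<omega> a c" for f
    using that le_less_trans[OF S0, of "ereal 1"] by auto
  show ?thesis
    unfolding U_top_def topology_generated_by_topspace
  proof (intro equalityI subsetI)
    fix f assume f: "f \<in> U_space \<omega> a c"
    have "{g \<in> U_space \<omega> a c. seminorm_U \<omega> a c (1/2) 0 (g - f) < ereal 1}
      \<in> {{g \<in> U_space \<omega> a c. seminorm_U \<omega> a c q k (g - f) < ereal \<epsilon>} | f q k \<epsilon>.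
        f \<in> U_space \<omega> a c \<and> q \<in> {0<..<1} \<and> 0 < \<epsilon>}"
      unfolding mem_Collect_eq
      by (rule exI[of _ f], rule exI[of _ "1/2"], rule exI[of _ 0], rule exI[of _ 1])
        (simp add: f)
    from UnionI[OF this *[OF f]]
    show "f \<in> \<Union>{{g \<in> U_space \<omega> a c. seminorm_U \<omega> a c q k (g - f) < ereal \<epsilon>} | f q k \<epsilon>.
        f \<in> U_space \<omega> a c \<and> q \<in> {0<..<1} \<and> 0 < \<epsilon>}" .
  qed blast
qed

definition D_invariant_subspace ::
  "(real \<Rightarrow> real) \<Rightarrow> ereal \<Rightarrow> (nat \<Rightarrow> real) \<Rightarrow> (real \<Rightarrow> complex) set \<Rightarrow> bool" where
  "D_invariant_subspace \<omega> a c W \<longleftrightarrow>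
     module.subspace cscale W \<and> closedin (U_top \<omega> a c) W \<and> D_op a ` W \<subseteq> W"

section \<open>Ultradistributions and the Fourier-Laplace transform\<close>

text \<open>
  Elements of the dual are only ever applied to members of \<^const>\<open>U_space\<close>; their values
  elsewhere are irrelevant. Only the underlying set of the strong dual is needed.
\<close>

definition U_dual ::
  "(real \<Rightarrow> real) \<Rightarrow> ereal \<Rightarrow> (nat \<Rightarrow> real) \<Rightarrow> ((real \<Rightarrow> complex) \<Rightarrow> complex) set" where
  "U_dual \<omega> a c =
     {S. (\<forall>f\<in>U_space \<omega> a c. \<forall>g\<in>U_space \<omega> a c. S (f + g) = S f + S g) \<and>
         (\<forall>z. \<forall>f\<in>U_space \<omega> a c. S (cscale z f) = z * S f) \<and>
         continuous_map (U_top \<omega> a c) euclidean S}"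

definition supp_U ::
  "(real \<Rightarrow> real) \<Rightarrow> ereal \<Rightarrow> (nat \<Rightarrow> real) \<Rightarrow> ((real \<Rightarrow> complex) \<Rightarrow> complex) \<Rightarrow> real set" where
  "supp_U \<omega> a c S = sym_ival a -
     \<Union>{V. open V \<and> V \<subseteq> sym_ival a \<and>
         (\<forall>f\<in>U_space \<omega> a c.
            compact (closure {x. f x \<noteq> 0}) \<and> closure {x. f x \<noteq> 0} \<subseteq> V \<longrightarrow> S f = 0)}"

definition exp_monomial :: "ereal \<Rightarrow> nat \<Rightarrow> complex \<Rightarrow> real \<Rightarrow> complex" where
  "exp_monomial a j l =
     (\<lambda>t. if t \<in> sym_ival a then of_real t ^ j * exp (- \<i> * l * of_real t) else 0)"

definition fourier_laplace ::
  "ereal \<Rightarrow> ((real \<Rightarrow> complex) \<Rightarrow> complex) \<Rightarrow> complex \<Rightarrow> complex" where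
  "fourier_laplace a S = (\<lambda>z. S (exp_monomial a 0 z))"

text \<open>As a set, the inductive limit is the union of its steps.\<close>

definition P_step ::
  "(real \<Rightarrow> real) \<Rightarrow> (nat \<Rightarrow> real) \<Rightarrow> (nat \<Rightarrow> real) \<Rightarrow> nat \<Rightarrow> (complex \<Rightarrow> complex) set" where
  "P_step \<omega> c r k =
     {\<phi>. \<phi> holomorphic_on UNIV \<and>
         bdd_above (range (\<lambda>z. norm (\<phi> z) * exp (- r k * \<omega> (norm z) - c k * \<bar>Im z\<bar>)))}"

definition P_space ::
  "(real \<Rightarrow> real) \<Rightarrow> (nat \<Rightarrow> real) \<Rightarrow> (nat \<Rightarrow> real) \<Rightarrow> (complex \<Rightarrow> complex) set" where
  "P_space \<omega> c r = (\<Union>k. P_step \<omega> c r k)"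

text \<open>
  The condition that the convolution $S * T$ again belongs to the dual of \<^const>\<open>U_space\<close>;
  convolution is multiplication of Fourier-Laplace transforms, and these transforms
  identify the dual with \<^const>\<open>P_space\<close>.
\<close>

definition convolution_in_dual ::
  "(real \<Rightarrow> real) \<Rightarrow> ereal \<Rightarrow> (nat \<Rightarrow> real) \<Rightarrow> (nat \<Rightarrow> real) \<Rightarrow>
   ((real \<Rightarrow> complex) \<Rightarrow> complex) \<Rightarrow> ((real \<Rightarrow> complex) \<Rightarrow> complex) \<Rightarrow> bool" where
  "convolution_in_dual \<omega> a c r S T \<longleftrightarrow>
     (\<lambda>z. fourier_laplace a S z * fourier_laplace a T z) \<in> P_space \<omega> c r"

section \<open>Exponents and zero sets\<close>

definition Exp_set :: "ereal \<Rightarrow> (real \<Rightarrow> complex) set \<Rightarrow> (real \<Rightarrow> complex) set" where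
  "Exp_set a W = {f \<in> W. \<exists>j l. f = exp_monomial a j l}"

text \<open>
  A sequence of multiple points is encoded by the set of pairs (point, multiplicity),
  the enumeration being immaterial.
\<close>

definition exponent_sequence ::
  "ereal \<Rightarrow> (real \<Rightarrow> complex) set \<Rightarrow> (complex \<times> nat) set \<Rightarrow> bool" where
  "exponent_sequence a W \<Lambda> \<longleftrightarrow>
     countable \<Lambda> \<and> single_valued \<Lambda> \<and> (\<forall>(l, n)\<in>\<Lambda>. 0 < n) \<and>
     Exp_set a W = {exp_monomial a j l | j l n. (l, n) \<in> \<Lambda> \<and> j < n}"

definition zero_set :: "(complex \<Rightarrow> complex) \<Rightarrow> (complex \<times> nat) set" where
  "zero_set \<phi> = {(l, nat (zorder \<phi> l)) | l. \<phi> l = 0}"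

definition inter_mult :: "'i set \<Rightarrow> ('i \<Rightarrow> (complex \<times> nat) set) \<Rightarrow> (complex \<times> nat) set" where
  "inter_mult J Z =
     {(l, n). (\<forall>j\<in>J. l \<in> Domain (Z j)) \<and> n = Min {k. \<exists>j\<in>J. (l, k) \<in> Z j}}"

section \<open>Weak spectral synthesis\<close>

text \<open>The empty set and single points count as intervals here.\<close>

definition rel_closed_interval :: "ereal \<Rightarrow> real set \<Rightarrow> bool" where
  "rel_closed_interval a I \<longleftrightarrow>
     is_interval I \<and> closedin (top_of_set (sym_ival a)) I"

definition W_ival ::
  "(real \<Rightarrow> real) \<Rightarrow> ereal \<Rightarrow> (nat \<Rightarrow> real) \<Rightarrow> real set \<Rightarrow> (real \<Rightarrow> complex) set" where
  "W_ival \<omega> a c I = {f \<in> U_space \<omega> a c. \<forall>x\<in>I. f x = 0}"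

definition is_residual_interval ::
  "(real \<Rightarrow> real) \<Rightarrow> ereal \<Rightarrow> (nat \<Rightarrow> real) \<Rightarrow> (real \<Rightarrow> complex) set \<Rightarrow> real set \<Rightarrow> bool" where
  "is_residual_interval \<omega> a c W J \<longleftrightarrow>
     rel_closed_interval a J \<and> W_ival \<omega> a c J \<subseteq> W \<and>
     (\<forall>I. rel_closed_interval a I \<and> I \<subset> J \<longrightarrow> W_ival \<omega> a c I - W \<noteq> {})"

definition residual_interval ::
  "(real \<Rightarrow> real) \<Rightarrow> ereal \<Rightarrow> (nat \<Rightarrow> real) \<Rightarrow> (real \<Rightarrow> complex) set \<Rightarrow> real set" where
  "residual_interval \<omega> a c W = (THE J. is_residual_interval \<omega> a c W J)"

definition weak_spectral_synthesis ::
  "(real \<Rightarrow> real) \<Rightarrow> ereal \<Rightarrow> (nat \<Rightarrow> real) \<Rightarrow> (real \<Rightarrow> complex) set \<Rightarrow> bool" where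
  "weak_spectral_synthesis \<omega> a c W \<longleftrightarrow>
     D_invariant_subspace \<omega> a c W \<and>
     W = U_top \<omega> a c closure_of
           {f + g | f g. f \<in> module.span cscale (Exp_set a W) \<and>
                         g \<in> W_ival \<omega> a c (residual_interval \<omega> a c W)}"

section \<open>Local convolution operators\<close>

text \<open>
  The translate $x \mapsto f(x+y)$ is defined only for those $x$ with $x + y \in (-a;a)$,
  which is a neighbourhood of the support point $0$ of $S$. Hence $S$ is applied to an
  element of \<^const>\<open>U_space\<close> that agrees with the translate near $0$; as the support
  of $S$ is $\{0\}$, the value does not depend on the choice.
\<close>

definition local_conv ::
  "(real \<Rightarrow> real) \<Rightarrow> ereal \<Rightarrow> (nat \<Rightarrow> real) \<Rightarrow>
   ((real \<Rightarrow> complex) \<Rightarrow> complex) \<Rightarrow> (real \<Rightarrow> complex) \<Rightarrow> real \<Rightarrow> complex" where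
  "local_conv \<omega> a c S f y =
     S (SOME g. g \<in> U_space \<omega> a c \<and> (\<forall>\<^sub>F x in nhds 0. g x = f (x + y)))"

definition ker_local_conv ::
  "(real \<Rightarrow> real) \<Rightarrow> ereal \<Rightarrow> (nat \<Rightarrow> real) \<Rightarrow>
   ((real \<Rightarrow> complex) \<Rightarrow> complex) \<Rightarrow> real set \<Rightarrow> (real \<Rightarrow> complex) set" where
  "ker_local_conv \<omega> a c S I = {f \<in> U_space \<omega> a c. \<forall>y\<in>I. local_conv \<omega> a c S f y = 0}"

end

(*
  Let T be a continuous functional that annihilates the exponential monomials of W and all
  functions vanishing on I; it lives on the compact windows of I, and by Hahn-Banach it
  suffices to show T F = 0 for every compactly supported F that agrees with an element of W on
  a neighbourhood of a window [b, d]. Let g_z be the solution of g' + i z g = F vanishing near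
  minus infinity. Since S_j * F = 0 on [b, d], the function S_j * g_z equals c_j(z) e^{-izy} there.
  The quotient c_j / phi_j is independent of j, and
      A(z) = T(g_z) - c_j(z) FL T(z) / phi_j(z)
  is entire, because FL T vanishes on the common zeros of the phi_j. The function A phi_j is
  estimated with g_z in the lower half-plane and with the solution vanishing near plus infinity
  in the upper one; by a Phragmen-Lindelof argument A is then bounded, hence constant.
  Comparing the constants belonging to F and to F', where A_{F'}(z) = T F - i z A_F(z), gives
  A_F = 0, and the same for F' yields T F = 0.
*)
theory Submission
  imports Defs
begin

text \<open>Two features of a window with b < d carry the argument. First, a coefficient such as c_j
  can be read off at either endpoint, so it is estimated at b in the lower half-plane and at d in
  the upper one. Hence c_1 \<phi>_2 - c_2 \<phi>_1, recentred at the midpoint, decays like exp (- l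
  |Im z|) with l = (d - b) / 2, up to factors of exponential type zero; only the zero function does
  that, which is why the quotients coincide. Second, the same gain l compensates exactly the growth
  that the support of T gives to its transform. No lower bound for \<phi>_j is available, so A
  \<phi>_j cannot simply be divided by \<phi>_j: where |A| is large the estimate says that \<phi>_j
  / FL T is small, and high powers of A are played off against this smallness. The quotient A has to
  be of type zero beforehand, which comes from a Harnack estimate after the zeros of \<phi>_j are
  exchanged for Blaschke factors. Multiplication by cutoffs is used throughout and rests on the
  convergence of the integral of \<omega>(x) / x^2.\<close>

section \<open>Entire functions of exponential type zero\<close>

text \<open>In the double sector about the imaginary axis the decay in Im z dominates the growth in
  norm z. In the remaining double sector about the real axis, where Re (z^2) is comparable to (norm
  z)^2, a factor exp (- \<delta> z^2) wins against any exponential; it disappears as \<delta> tends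
  to 0.\<close>

lemma phragmen_lindelof_bounded:
  fixes \<Phi> :: "complex \<Rightarrow> complex" and l :: real
  assumes "open \<Omega>" and hol: "\<Phi> holomorphic_on \<Omega>" and cont: "continuous_on (closure \<Omega>) \<Phi>"
    and l: "0 < l" and fr: "\<And>z. z \<in> frontier \<Omega> \<Longrightarrow> norm (\<Phi> z) \<le> 1"
    and gr: "\<And>e. 0 < e \<Longrightarrow> \<exists>C. \<forall>z\<in>closure \<Omega>. norm (\<Phi> z) \<le> C * exp (e * norm z - l * \<bar>Im z\<bar>)"
  shows "\<exists>K. \<forall>z\<in>\<Omega>. norm (\<Phi> z) \<le> K"
proof -
  \<comment> \<open>Where |Re z| \<le> 2 |Im z| one has norm z \<le> 3 |Im z|, so the rate l / 3 is
    just small enough.\<close>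
  obtain C where C: "\<And>z. z \<in> closure \<Omega> \<Longrightarrow> norm (\<Phi> z) \<le> C * exp (l / 3 * norm z - l * \<bar>Im z\<bar>)"
    using gr[of "l / 3"] l by auto
  obtain C1 where C1: "\<And>z. z \<in> closure \<Omega> \<Longrightarrow> norm (\<Phi> z) \<le> C1 * exp (norm z - l * \<bar>Im z\<bar>)"
    using gr[of 1] by auto
  define K where "K = max 1 C"
  have off: "norm (\<Phi> z) \<le> K" if z: "z \<in> closure \<Omega>" and y: "\<bar>Re z\<bar> \<le> 2 * \<bar>Im z\<bar>" for z
  proof -
    have "norm z \<le> \<bar>Re z\<bar> + \<bar>Im z\<bar>" by (rule cmod_le)
    then have "norm z \<le> 3 * \<bar>Im z\<bar>" using y by linarith
    then have "l / 3 * norm z - l * \<bar>Im z\<bar> \<le> 0" using l by (simp add: field_simps)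
    then have e1: "exp (l / 3 * norm z - l * \<bar>Im z\<bar>) \<le> 1" by simp
    have "norm (\<Phi> z) \<le> C * exp (l / 3 * norm z - l * \<bar>Im z\<bar>)" using C z by blast
    also have "\<dots> \<le> K * 1"
      by (rule mult_mono) (use e1 in \<open>auto simp: K_def\<close>)
    finally show ?thesis by simp
  qed
  have main: "norm (\<Phi> z) \<le> K * exp (\<delta> * (norm z)\<^sup>2)" if z: "z \<in> \<Omega>" and yz: "2 * \<bar>Im z\<bar> < \<bar>Re z\<bar>" and \<delta>: "0 < \<delta>" for z \<delta>
  proof -
    define f where "f w = \<Phi> w * exp (- of_real \<delta> * w\<^sup>2)" for w
    \<comment> \<open>The last summand makes 3/5 * \<delta> * R at least 1 + |C1|, so that on the
      circle norm w = R the Gaussian brings the bound |C1| * exp R down to at most 1.\<close>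
    define R where "R = norm z + 1 + (1 + \<bar>C1\<bar>) * 5 / (3 * \<delta>)"
    have R: "norm z < R" "1 \<le> R" using \<delta> by (auto simp: R_def add_pos_nonneg field_simps)
    define S where "S = \<Omega> \<inter> {w. 2 * \<bar>Im w\<bar> < \<bar>Re w\<bar>} \<inter> ball 0 R"
    have opS: "open S" unfolding S_def
      by (intro open_Int \<open>open \<Omega>\<close> open_ball open_Collect_less continuous_intros)
    have clS: "closure S \<subseteq> closure \<Omega> \<inter> {w. 2 * \<bar>Im w\<bar> \<le> \<bar>Re w\<bar>} \<inter> cball 0 R"
    proof (rule closure_minimal)
      show "closed (closure \<Omega> \<inter> {w. 2 * \<bar>Im w\<bar> \<le> \<bar>Re w\<bar>} \<inter> cball 0 R)"
        by (intro closed_Int closed_closure closed_cball closed_Collect_le continuous_intros)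
      show "S \<subseteq> closure \<Omega> \<inter> {w. 2 * \<bar>Im w\<bar> \<le> \<bar>Re w\<bar>} \<inter> cball 0 R"
        using closure_subset[of \<Omega>] by (auto simp: S_def)
    qed
    have re: "Re (w\<^sup>2) \<ge> 3 / 5 * (norm w)\<^sup>2" if "2 * \<bar>Im w\<bar> \<le> \<bar>Re w\<bar>" for w
    proof -
      have "(2 * \<bar>Im w\<bar>)\<^sup>2 \<le> \<bar>Re w\<bar>\<^sup>2" using that by (intro power_mono) auto
      then have "4 * (Im w)\<^sup>2 \<le> (Re w)\<^sup>2" by (simp add: power_mult_distrib)
      then show ?thesis using cmod_power2[of w] by (simp add: Re_power2)
    qed
    have nf: "norm (f w) = norm (\<Phi> w) * exp (- \<delta> * Re (w\<^sup>2))" for w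
      by (simp add: f_def norm_mult norm_exp_eq_Re)
    have nf1: "norm (f w) \<le> norm (\<Phi> w)" if "2 * \<bar>Im w\<bar> \<le> \<bar>Re w\<bar>" for w
    proof -
      have "0 \<le> Re (w\<^sup>2)" using re[OF that] by (meson order_trans zero_le_mult_iff zero_le_power2 divide_nonneg_nonneg zero_le_numeral)
      then have "exp (- \<delta> * Re (w\<^sup>2)) \<le> 1" using \<delta> by simp
      then show ?thesis unfolding nf by (simp add: mult_left_le)
    qed
    have "norm (f z) \<le> K"
    proof (rule maximum_modulus_frontier[of f S])
      show "f holomorphic_on interior S" unfolding f_def
        by (intro holomorphic_intros holomorphic_on_subset[OF hol])
           (use interior_subset in \<open>auto simp: S_def\<close>)
      show "continuous_on (closure S) f" unfolding f_def
        by (intro continuous_intros continuous_on_subset[OF cont]) (use clS in auto)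
      show "bounded S" by (rule bounded_subset[of "ball 0 R"]) (auto simp: S_def)
      show "z \<in> S" using z yz R by (auto simp: S_def)
      fix w assume w: "w \<in> frontier S"
      then have wc: "w \<in> closure \<Omega>" "2 * \<bar>Im w\<bar> \<le> \<bar>Re w\<bar>" "norm w \<le> R" and wn: "w \<notin> S"
        using clS opS by (auto simp: frontier_def interior_open)
      consider "w \<notin> \<Omega>" | "2 * \<bar>Im w\<bar> = \<bar>Re w\<bar>" | "norm w = R"
        using wn wc by (fastforce simp: S_def)
      then show "norm (f w) \<le> K"
      proof cases
        case 1
        then have "w \<in> frontier \<Omega>" using wc \<open>open \<Omega>\<close> by (auto simp: frontier_def interior_open)
        from fr[OF this] nf1[OF wc(2)] show ?thesis by (auto simp: K_def)
      next
        case 2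
        then show ?thesis using off[OF wc(1)] nf1[OF wc(2)] by fastforce
      next
        case 3
        have "norm (f w) \<le> (C1 * exp (norm w - l * \<bar>Im w\<bar>)) * exp (- \<delta> * (3/5 * (norm w)\<^sup>2))"
          unfolding nf using re[OF wc(2)] \<delta> C1[OF wc(1)]
          by (intro mult_mono) (auto intro: order_trans[OF norm_ge_zero])
        also have "\<dots> = C1 * (exp (norm w - l * \<bar>Im w\<bar>) * exp (- \<delta> * (3/5 * (norm w)\<^sup>2)))" by simp
        also have "\<dots> \<le> \<bar>C1\<bar> * (exp R * exp (- \<delta> * (3/5 * R\<^sup>2)))"
          using 3 l by (intro mult_mono) auto
        also have "\<dots> = \<bar>C1\<bar> * exp (R * (1 - 3/5 * \<delta> * R))"
          by (simp add: exp_add[symmetric] power2_eq_square algebra_simps)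
        also have "\<dots> \<le> \<bar>C1\<bar> * exp (- \<bar>C1\<bar>)"
        proof -
          have "3/5 * \<delta> * R \<ge> 3/5 * \<delta> * ((1 + \<bar>C1\<bar>) * 5 / (3 * \<delta>))"
            using \<delta> by (intro mult_left_mono) (auto simp: R_def)
          also have "3/5 * \<delta> * ((1 + \<bar>C1\<bar>) * 5 / (3 * \<delta>)) = 1 + \<bar>C1\<bar>" using \<delta> by (simp add: field_simps)
          finally have "1 - 3/5 * \<delta> * R \<le> - \<bar>C1\<bar>" by simp
          then have "R * (1 - 3/5 * \<delta> * R) \<le> R * (- \<bar>C1\<bar>)" using R by (intro mult_left_mono) auto
          also have "\<dots> \<le> - \<bar>C1\<bar>" using R by (simp add: mult_le_cancel_right1)
          finally show ?thesis by (intro mult_left_mono) auto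
        qed
        also have "\<dots> \<le> 1"
        proof -
          have "\<bar>C1\<bar> \<le> exp \<bar>C1\<bar>" using exp_ge_add_one_self[of "\<bar>C1\<bar>"] by linarith
          then show ?thesis by (simp add: exp_minus field_simps)
        qed
        finally show ?thesis by (simp add: K_def)
      qed
    qed
    moreover have "norm (\<Phi> z) = norm (f z) * exp (\<delta> * Re (z\<^sup>2))"
      unfolding nf by (simp add: exp_minus field_simps)
    moreover have "Re (z\<^sup>2) \<le> (norm z)\<^sup>2" by (metis complex_Re_le_cmod norm_power)
    ultimately show ?thesis using \<delta>
      by (simp, intro mult_mono) (auto simp: K_def)
  qed
  have "norm (\<Phi> z) \<le> K" if z: "z \<in> \<Omega>" for z
  proof (cases "\<bar>Re z\<bar> \<le> 2 * \<bar>Im z\<bar>")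
    case True
    then show ?thesis using off z closure_subset by blast
  next
    case False
    have "((\<lambda>\<delta>. K * exp (\<delta> * (norm z)\<^sup>2)) \<longlongrightarrow> K * exp (0 * (norm z)\<^sup>2)) (at_right 0)"
      by (intro tendsto_intros)
    moreover have "\<forall>\<^sub>F \<delta> in at_right 0. norm (\<Phi> z) \<le> K * exp (\<delta> * (norm z)\<^sup>2)"
      using main[OF z] False by (auto simp: eventually_at_right_less eventually_at_filter)
    ultimately show ?thesis
      using tendsto_lowerbound[of _ _ "at_right (0::real)"] by fastforce
  qed
  then show ?thesis by blast
qed

text \<open>A point p off the closure makes 1 / (z - p) a bounded factor that tends to 0 at
  infinity. For \<Phi>^n / (z - p) the maximum principle then sees only the frontier of \<Omega>,
  giving norm (\<Phi> z)^n \<le> norm (z - p) / d for every n; a value of modulus above 1 is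
  excluded by letting n grow.\<close>

lemma phragmen_lindelof_domain:
  fixes \<Phi> :: "complex \<Rightarrow> complex" and l :: real
  assumes "open \<Omega>" and hol: "\<Phi> holomorphic_on \<Omega>" and cont: "continuous_on (closure \<Omega>) \<Phi>"
    and l: "0 < l" and fr: "\<And>z. z \<in> frontier \<Omega> \<Longrightarrow> norm (\<Phi> z) \<le> 1"
    and gr: "\<And>e. 0 < e \<Longrightarrow> \<exists>C. \<forall>z\<in>closure \<Omega>. norm (\<Phi> z) \<le> C * exp (e * norm z - l * \<bar>Im z\<bar>)"
    and p: "p \<notin> closure \<Omega>" and z: "z \<in> \<Omega>"
  shows "norm (\<Phi> z) \<le> 1"
proof (rule ccontr)
  assume "\<not> norm (\<Phi> z) \<le> 1"
  then have gt: "1 < norm (\<Phi> z)" by simp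
  obtain K0 where K0: "\<And>z. z \<in> \<Omega> \<Longrightarrow> norm (\<Phi> z) \<le> K0"
    using phragmen_lindelof_bounded[OF assms(1-6)] by blast
  define K where "K = max 1 K0"
  have K: "norm (\<Phi> z) \<le> K" if "z \<in> closure \<Omega>" for z
    using that K0[of z] fr[of z] \<open>open \<Omega>\<close> by (cases "z \<in> \<Omega>") (auto simp: K_def frontier_def interior_open le_max_iff_disj)
  have "open (- closure \<Omega>)" "p \<in> - closure \<Omega>" using p by auto
  then obtain d where d: "d > 0" "ball p d \<subseteq> - closure \<Omega>" by (rule openE)
  have dist: "d \<le> norm (w - p)" if "w \<in> closure \<Omega>" for w
  proof -
    have "w \<notin> ball p d" using d that by auto
    then show ?thesis by (simp add: dist_norm norm_minus_commute)
  qed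
  have pow: "norm (\<Phi> z) ^ n \<le> norm (z - p) / d" for n
  proof -
    define f where "f w = \<Phi> w ^ n / (w - p)" for w
    \<comment> \<open>On norm w = R the distance to p is at least d * K^n, which offsets the crude
      bound K^n.\<close>
    define R where "R = norm p + norm z + 1 + d * K ^ n"
    have K1: "K \<ge> 1" by (auto simp: K_def)
    define S where "S = \<Omega> \<inter> ball 0 R"
    have opS: "open S" unfolding S_def using \<open>open \<Omega>\<close> by auto
    have clS: "closure S \<subseteq> closure \<Omega> \<inter> cball 0 R"
      using closure_subset[of \<Omega>] by (intro closure_minimal closed_Int) (auto simp: S_def)
    have "norm (f z) \<le> 1 / d"
    proof (rule maximum_modulus_frontier[of f S])
      show "f holomorphic_on interior S" unfolding f_def
        by (intro holomorphic_intros holomorphic_on_subset[OF hol])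
           (use interior_subset closure_subset p in \<open>auto simp: S_def\<close>)
      show "continuous_on (closure S) f" unfolding f_def
        by (intro continuous_intros continuous_on_subset[OF cont]) (use clS p in auto)
      show "bounded S" by (rule bounded_subset[of "ball 0 R"]) (auto simp: S_def)
      show "z \<in> S" using z d K1 by (auto simp: S_def R_def add_nonneg_pos add.commute intro!: add_pos_nonneg)
      fix w assume w: "w \<in> frontier S"
      then have wc: "w \<in> closure \<Omega>" "norm w \<le> R" and wn: "w \<notin> S"
        using clS opS by (auto simp: frontier_def interior_open)
      have dw: "d \<le> norm (w - p)" using dist wc by blast
      consider "w \<notin> \<Omega>" | "norm w = R"
        using wn wc by (fastforce simp: S_def)
      then show "norm (f w) \<le> 1 / d"
      proof cases
        case 1
        then have "w \<in> frontier \<Omega>" using wc \<open>open \<Omega>\<close> by (auto simp: frontier_def interior_open)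
        then have "norm (\<Phi> w) ^ n \<le> 1" using fr by (simp add: power_le_one)
        then show ?thesis unfolding f_def norm_divide norm_power using dw d
          by (intro frac_le) auto
      next
        case 2
        have "norm w - norm p \<le> norm (w - p)" by (rule norm_triangle_ineq2)
        then have "d * K ^ n \<le> norm (w - p)" using 2 norm_ge_zero[of z] unfolding R_def by linarith
        then have "K ^ n / norm (w - p) \<le> 1 / d" using d(1) less_le_trans[OF d(1) dw] by (simp add: field_simps)
        moreover have "norm (\<Phi> w) ^ n \<le> K ^ n" using K wc by (intro power_mono) auto
        ultimately show ?thesis unfolding f_def norm_divide norm_power
          using d dw by (meson divide_right_mono norm_ge_zero order_trans)
      qed
    qed
    moreover have "0 < norm (z - p)" using less_le_trans[OF d(1) dist] z closure_subset by blast
    ultimately show ?thesis using d(1)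
      by (simp add: f_def norm_divide norm_power field_simps)
  qed
  obtain n where "norm (z - p) / d < norm (\<Phi> z) ^ n"
    using real_arch_pow[OF gt] by blast
  with pow[of n] show False by simp
qed

text \<open>With the whole plane as domain there is no frontier, so boundedness and Liouville make E
  constant; the decay along the imaginary axis leaves only 0.\<close>

lemma entire_decay_imp_zero:
  fixes E :: "complex \<Rightarrow> complex"
  assumes hol: "E holomorphic_on UNIV" and l: "0 < l"
    and gr: "\<And>e. 0 < e \<Longrightarrow> \<exists>C. \<forall>z. norm (E z) \<le> C * exp (e * norm z - l * \<bar>Im z\<bar>)"
  shows "E z = 0"
proof -
  obtain K where K: "\<And>z. norm (E z) \<le> K"
    using phragmen_lindelof_bounded[of UNIV E l] assms holomorphic_on_imp_continuous_on[OF hol] by auto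
  then have "E constant_on UNIV"
    using Liouville_theorem[OF hol] by (auto simp: bounded_iff constant_on_def)
  then obtain k where k: "\<And>z. E z = k" by (auto simp: constant_on_def)
  obtain C where C: "\<And>z. norm (E z) \<le> C * exp (l/2 * norm z - l * \<bar>Im z\<bar>)"
    using gr[of "l/2"] l by auto
  have "norm k \<le> C * exp (- (l/2) * y)" if "y \<ge> 0" for y
    using C[of "\<i> * of_real y"] that k by (simp add: norm_mult)
  then have "\<forall>\<^sub>F y in at_top. norm k \<le> C * exp (- (l/2) * y)"
    by (auto simp: eventually_at_top_linorder)
  moreover have "((\<lambda>y. C * exp (- (l/2) * y)) \<longlongrightarrow> C * 0) at_top"
  proof (intro tendsto_intros filterlim_compose[OF exp_at_bot])
    have "filterlim (\<lambda>x. - (l/2 * x)) at_bot at_top"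
      unfolding filterlim_uminus_at_bot minus_minus
      by (rule filterlim_tendsto_pos_mult_at_top[OF tendsto_const _ filterlim_ident]) (use l in simp)
    then show "filterlim (\<lambda>x. - (l/2) * x) at_bot at_top" by simp
  qed
  ultimately have "norm k \<le> C * 0"
    by (intro tendsto_lowerbound) auto
  then show ?thesis using k by simp
qed

section \<open>Quotients of functions of exponential type zero\<close>

text \<open>Harnack's inequality for the positive harmonic function ln (M / norm g): on the half
  disc its value is at most (1 + 1/2) / (1 - 1/2) = 3 times the value at 0. It is obtained from the
  Schwarz lemma for a Cayley transform of the logarithm of g.\<close>

lemma nonvanishing_lower_bound:
  fixes g :: "complex \<Rightarrow> complex"
  assumes hol: "g holomorphic_on ball 0 R" and R: "0 < R"
    and nz: "\<And>z. norm z < R \<Longrightarrow> g z \<noteq> 0" and lt: "\<And>z. norm z < R \<Longrightarrow> norm (g z) < M"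
    and z: "norm z \<le> R / 2"
  shows "norm (g 0) ^ 3 \<le> M\<^sup>2 * norm (g z)"
proof -
  have M: "0 < M" using le_less_trans[OF norm_ge_zero lt[of 0]] R by simp
  obtain h where h: "h holomorphic_on ball 0 R" "\<And>z. z \<in> ball 0 R \<Longrightarrow> g z = exp (h z)"
    using contractible_imp_holomorphic_log[OF hol convex_imp_contractible[OF convex_ball]] nz by auto
  define u where "u z = h z - of_real (ln M)" for z
  have gu: "norm (g w) = M * exp (Re (u w))" if "norm w < R" for w
    using h(2)[of w] that M by (simp add: u_def norm_exp_eq_Re exp_diff)
  have neg: "Re (u w) < 0" if "norm w < R" for w
  proof -
    have "M * exp (Re (u w)) < M * 1" using gu[OF that] lt[OF that] by simp
    then show ?thesis using M by simp
  qed
  \<comment> \<open>Cayley transform of the left half-plane onto the unit disc, taking u 0 to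
    0.\<close>
  define v where "v w = (u (of_real R * w) - u 0) / (u (of_real R * w) + cnj (u 0))" for w
  have Rw: "norm (of_real R * w) < R" if "norm w < 1" for w :: complex
    using that R by (simp add: norm_mult)
  have den: "u w + cnj (u 0) \<noteq> 0" if "norm w < R" for w
  proof
    assume "u w + cnj (u 0) = 0"
    then have "Re (u w + cnj (u 0)) = 0" by simp
    then show False using neg[OF that] neg[of 0] R by simp
  qed
  have hu: "(\<lambda>w. u (of_real R * w)) holomorphic_on ball 0 1"
    unfolding u_def
    by (intro holomorphic_intros holomorphic_on_compose_gen[OF _ h(1), unfolded o_def])
       (use R in \<open>auto simp: norm_mult\<close>)
  have "norm (v w) \<le> norm w" if w: "norm w < 1" for w
  proof (rule Schwarz_Lemma(1))
    show "v holomorphic_on ball 0 1" unfolding v_def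
      by (intro holomorphic_intros hu) (use den Rw in auto)
    show "v 0 = 0" by (simp add: v_def)
    show "norm w < 1" by fact
    fix w :: complex assume w: "norm w < 1"
    have "norm (u (of_real R * w) - u 0) < norm (u (of_real R * w) + cnj (u 0))"
    proof (rule power2_less_imp_less)
      have "0 < Re (u (of_real R * w)) * Re (u 0)"
        using neg[OF Rw[OF w]] neg[of 0] R by (simp add: mult_neg_neg)
      then show "(norm (u (of_real R * w) - u 0))\<^sup>2 < (norm (u (of_real R * w) + cnj (u 0)))\<^sup>2"
        unfolding cmod_power2 by (simp add: power2_eq_square algebra_simps)
    qed simp
    then show "norm (v w) < 1" unfolding v_def norm_divide
      using den[OF Rw[OF w]] by simp
  qed
  moreover have "norm (z / of_real R) < 1" using z R by (simp add: norm_divide)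
  ultimately have "norm (v (z / of_real R)) \<le> norm (z / of_real R)" by blast
  also have "\<dots> \<le> 1/2" using z R by (simp add: norm_divide field_simps)
  finally have "norm (u z - u 0) \<le> norm (u z + cnj (u 0)) / 2"
    using R den[of z] z by (simp add: v_def norm_divide field_simps)
  then have "(2 * norm (u z - u 0))\<^sup>2 \<le> (norm (u z + cnj (u 0)))\<^sup>2"
    by (intro power_mono) auto
  then have "4 * (norm (u z - u 0))\<^sup>2 \<le> (norm (u z + cnj (u 0)))\<^sup>2"
    by (simp add: power_mult_distrib)
  \<comment> \<open>u z - u 0 and u z + cnj (u 0) have the same imaginary part, so the inequality
    survives for the real parts alone.\<close>
  then have "4 * ((Re (u z) - Re (u 0))\<^sup>2 + (Im (u z) - Im (u 0))\<^sup>2) \<le> (Re (u z) + Re (u 0))\<^sup>2 + (Im (u z) - Im (u 0))\<^sup>2"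
    unfolding cmod_power2 by simp
  moreover have "4 * p \<le> r" if "4 * (p + q) \<le> r + q" "0 \<le> q" for p q r :: real
    using that by (simp add: distrib_left)
  ultimately have "4 * (Re (u z) - Re (u 0))\<^sup>2 \<le> (Re (u z) + Re (u 0))\<^sup>2"
    using zero_le_power2 by blast
  moreover have "(2 * x)\<^sup>2 = 4 * x\<^sup>2" for x :: real by (simp add: power_mult_distrib)
  ultimately have "(2 * (Re (u z) - Re (u 0)))\<^sup>2 \<le> (Re (u z) + Re (u 0))\<^sup>2" by metis
  then have "\<bar>2 * (Re (u z) - Re (u 0))\<bar> \<le> \<bar>Re (u z) + Re (u 0)\<bar>"
    by (simp add: abs_le_square_iff)
  then have le: "3 * Re (u 0) \<le> Re (u z)"
    using neg[of z] neg[of 0] z R by (simp add: abs_if split: if_splits)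
  have "norm (g 0) ^ 3 = M ^ 3 * exp (3 * Re (u 0))"
    using gu[of 0] R by (simp add: power_mult_distrib exp_of_nat_mult[of 3, simplified])
  also have "\<dots> \<le> M ^ 3 * exp (Re (u z))" using le M by simp
  also have "\<dots> = M\<^sup>2 * norm (g z)" using gu[of z] z R by (simp add: power3_eq_cube power2_eq_square)
  finally show ?thesis .
qed

lemma entire_factor_zero:
  fixes f :: "complex \<Rightarrow> complex"
  assumes hol: "f holomorphic_on UNIV" and nz: "f w \<noteq> 0"
  obtains q k where "q holomorphic_on UNIV" "q a \<noteq> 0" "\<And>z. f z = (z - a) ^ k * q z"
proof -
  define g where "g = zor_poly f a"
  define k where "k = nat (zorder f a)"
  obtain r where r: "r > 0" "g holomorphic_on cball a r"
      "\<And>w. w \<in> cball a r \<Longrightarrow> f w = g w * (w - a) ^ k \<and> g w \<noteq> 0"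
    using zorder_exist_zero[OF hol open_UNIV connected_UNIV UNIV_I, of a] nz
    unfolding g_def k_def by blast
  define q where "q z = (if z = a then g a else f z / (z - a) ^ k)" for z
  have qg: "q z = g z" if "z \<in> ball a r" for z
    using r(3)[of z] that by (auto simp: q_def)
  have "q holomorphic_on ball a r"
    using holomorphic_transform[OF holomorphic_on_subset[OF r(2) ball_subset_cball], of q] qg by simp
  moreover have "q holomorphic_on (- {a})"
  proof -
    have "(\<lambda>z. f z / (z - a) ^ k) holomorphic_on (- {a})"
      by (intro holomorphic_intros holomorphic_on_subset[OF hol]) auto
    then show ?thesis by (rule holomorphic_transform) (auto simp: q_def)
  qed
  ultimately have "q holomorphic_on (ball a r \<union> - {a})"
    by (intro holomorphic_on_Un) auto
  moreover have "ball a r \<union> - {a} = UNIV" using r(1) by auto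
  ultimately have "q holomorphic_on UNIV" by simp
  moreover have "q a \<noteq> 0" using r(1) r(3)[of a] by (simp add: q_def)
  moreover have "f z = (z - a) ^ k * q z" for z
    using r(1) r(3)[of a] by (simp add: q_def)
  ultimately show ?thesis using that by blast
qed

text \<open>A zero-free \<phi> falls under the Harnack bound. Otherwise a zero a is removed by
  replacing (z - a)^k with the k-th power of its Blaschke partner (R^2 - cnj a * z) / R. This has
  the same modulus on the circle, so both upper bounds persist by the maximum principle, and no
  smaller modulus at 0. The induction counts distinct zeros in the disc.\<close>

lemma quotient_bound_on_half_disc:
  fixes A \<phi> :: "complex \<Rightarrow> complex"
  assumes "A holomorphic_on UNIV" "\<phi> holomorphic_on UNIV" "0 < R" "\<phi> 0 \<noteq> 0"
    and "\<And>z. norm z \<le> R \<Longrightarrow> norm (\<phi> z) < M" "\<And>z. norm z \<le> R \<Longrightarrow> norm (A z * \<phi> z) \<le> N"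
    and "norm z \<le> R / 2"
  shows "norm (A z) * norm (\<phi> 0) ^ 3 \<le> N * M\<^sup>2"
  using assms(2,4-6)
proof (induction "card {z \<in> ball 0 R. \<phi> z = 0}" arbitrary: \<phi> rule: less_induct)
  case (less \<phi>)
  have M: "0 < M" using le_less_trans[OF norm_ge_zero less(4)[of 0]] \<open>0 < R\<close> by simp
  have nc: "\<not> \<phi> constant_on UNIV" if "\<phi> a = 0" for a
    using that less(3) by (metis UNIV_I constant_on_def)
  show ?case
  proof (cases "{z \<in> ball 0 R. \<phi> z = 0} = {}")
    case True
    have "norm (\<phi> 0) ^ 3 \<le> M\<^sup>2 * norm (\<phi> z)"
      by (rule nonvanishing_lower_bound[OF holomorphic_on_subset[OF less(2)] \<open>0 < R\<close>])
         (use True less(4) assms in auto)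
    then have "norm (A z) * norm (\<phi> 0) ^ 3 \<le> norm (A z) * (M\<^sup>2 * norm (\<phi> z))"
      by (intro mult_left_mono) auto
    also have "\<dots> = norm (A z * \<phi> z) * M\<^sup>2" by (simp add: norm_mult)
    also have "\<dots> \<le> N * M\<^sup>2"
      using less(5)[of z] assms(3,7) by (intro mult_right_mono) auto
    finally show ?thesis .
  next
    case False
    then obtain a where a: "norm a < R" "\<phi> a = 0" by auto
    obtain q k where q: "q holomorphic_on UNIV" "q a \<noteq> 0" "\<And>z. \<phi> z = (z - a) ^ k * q z"
      using entire_factor_zero[OF less(2,3), of a] by blast
    define b where "b z = (of_real (R\<^sup>2) - cnj a * z) / of_real R" for z
    have bnz: "b z \<noteq> 0" if "norm z \<le> R" for z
    proof
      assume "b z = 0"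
      then have "of_real (R\<^sup>2) = cnj a * z" using \<open>0 < R\<close> by (simp add: b_def)
      then have "R\<^sup>2 = norm a * norm z"
        by (metis complex_mod_cnj norm_mult norm_of_real abs_power2)
      also have "\<dots> \<le> norm a * R" using that by (intro mult_left_mono) auto
      also have "\<dots> < R * R" using a \<open>0 < R\<close> by simp
      finally show False by (simp add: power2_eq_square)
    qed
    have bs: "norm (b z) = norm (z - a)" if "norm z = R" for z
    proof -
      have "of_real (R\<^sup>2) = z * cnj z" using that complex_norm_square[of z] by simp
      then have "b z = z * cnj (z - a) / of_real R" by (simp add: b_def algebra_simps)
      then show ?thesis using that \<open>0 < R\<close> by (simp add: norm_divide norm_mult del: complex_cnj_diff)
    qed
    define \<phi>1 where "\<phi>1 z = b z ^ k * q z" for z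
    have h1: "\<phi>1 holomorphic_on UNIV" unfolding \<phi>1_def b_def
      by (intro holomorphic_intros q) (use \<open>0 < R\<close> in auto)
    have eqs: "norm (\<phi>1 z) = norm (\<phi> z)" if "norm z = R" for z
      using bs[OF that] q(3)[of z] by (simp add: \<phi>1_def norm_mult norm_power)
    have max: "norm (f z) \<le> B" if "f holomorphic_on UNIV" "\<And>z. norm z = R \<Longrightarrow> norm (f z) \<le> B" "norm z \<le> R" for f :: "complex \<Rightarrow> complex" and B z
      by (rule maximum_modulus_frontier[of f "cball 0 R"])
         (use that holomorphic_on_subset[OF that(1)] holomorphic_on_imp_continuous_on[OF holomorphic_on_subset[OF that(1)]] in auto)
    \<comment> \<open>The bound stays strict because the maximum over the compact circle is
      attained.\<close>
    have lt: "norm (\<phi>1 z) < M" if "norm z \<le> R" for z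
    proof -
      have "continuous_on (sphere 0 R) (\<lambda>z. norm (\<phi> z))"
        by (intro continuous_intros holomorphic_on_imp_continuous_on holomorphic_on_subset[OF less(2)]) auto
      moreover have "sphere (0::complex) R \<noteq> {}" using \<open>0 < R\<close> by simp
      ultimately obtain w where "w \<in> sphere 0 R" "\<forall>z\<in>sphere 0 R. norm (\<phi> z) \<le> norm (\<phi> w)"
        using continuous_attains_sup[OF compact_sphere] by blast
      then have "norm (\<phi>1 z) \<le> norm (\<phi> w)"
        by (intro max[OF h1 _ that]) (simp add: eqs)
      also have "\<dots> < M" using \<open>w \<in> sphere 0 R\<close> by (intro less(4)) auto
      finally show ?thesis .
    qed
    have bd: "norm (A z * \<phi>1 z) \<le> N" if "norm z \<le> R" for z
    proof (rule max[OF _ _ that])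
      show "(\<lambda>z. A z * \<phi>1 z) holomorphic_on UNIV" by (intro holomorphic_intros assms h1)
      show "norm (A z * \<phi>1 z) \<le> N" if "norm z = R" for z
        using less(5)[of z] that eqs[OF that] by (simp add: norm_mult)
    qed
    have p0: "norm (\<phi> 0) \<le> norm (\<phi>1 0)"
    proof -
      have "norm (b 0) = R" using \<open>0 < R\<close> by (simp add: b_def norm_divide power2_eq_square)
      then show ?thesis using a by (auto simp: \<phi>1_def q(3)[of 0] norm_mult norm_power intro!: mult_right_mono power_mono)
    qed
    have "{z \<in> ball 0 R. \<phi>1 z = 0} \<subset> {z \<in> ball 0 R. \<phi> z = 0}"
    proof
      show "{z \<in> ball 0 R. \<phi>1 z = 0} \<subseteq> {z \<in> ball 0 R. \<phi> z = 0}"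
        using bnz by (auto simp: \<phi>1_def q(3))
      show "{z \<in> ball 0 R. \<phi>1 z = 0} \<noteq> {z \<in> ball 0 R. \<phi> z = 0}"
      proof
        assume "{z \<in> ball 0 R. \<phi>1 z = 0} = {z \<in> ball 0 R. \<phi> z = 0}"
        then have "\<phi>1 a = 0" using a by auto
        then show False using bnz[of a] a q(2) by (auto simp: \<phi>1_def)
      qed
    qed
    moreover have "finite {z \<in> ball 0 R. \<phi> z = 0}"
      using finite_subset[OF _ holomorphic_compact_finite_zeros[OF less(2) open_UNIV connected_UNIV compact_cball[of 0 R]]]
        nc[OF a(2)] by (auto simp: subset_eq)
    ultimately have "card {z \<in> ball 0 R. \<phi>1 z = 0} < card {z \<in> ball 0 R. \<phi> z = 0}"
      by (rule psubset_card_mono[rotated])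
    then have "norm (A z) * norm (\<phi>1 0) ^ 3 \<le> N * M\<^sup>2"
      using less(1)[of \<phi>1] h1 lt bd p0 less(3) by force
    moreover have "norm (A z) * norm (\<phi> 0) ^ 3 \<le> norm (A z) * norm (\<phi>1 0) ^ 3"
      using p0 by (intro mult_left_mono power_mono) auto
    ultimately show ?thesis by linarith
  qed
qed

text \<open>Growth of order at most one and minimal type; transforms of functionals supported at the
  point 0 have it.\<close>

definition zero_type :: "(complex \<Rightarrow> complex) \<Rightarrow> bool" where
  "zero_type f \<longleftrightarrow> (\<forall>e>0. \<exists>C. \<forall>z. norm (f z) \<le> C * exp (e * norm z))"

text \<open>The preceding estimate, applied on discs of radius 2 * norm z + 1 about a point where
  \<phi> does not vanish.\<close>

lemma zero_type_quotient:
  assumes A: "A holomorphic_on UNIV" and \<phi>: "\<phi> holomorphic_on UNIV" and nz: "\<phi> z0 \<noteq> 0"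
    and t1: "zero_type \<phi>" and t2: "zero_type (\<lambda>z. A z * \<phi> z)"
  shows "zero_type A"
  unfolding zero_type_def
proof (intro allI impI)
  fix e :: real assume e: "0 < e"
  \<comment> \<open>The bound contains three factors of rate e/6 on a disc of about twice the
    radius: 3 * 2 * e/6 = e.\<close>
  obtain C1 where C1: "\<And>z. norm (\<phi> z) \<le> C1 * exp (e/6 * norm z)"
    using t1 e unfolding zero_type_def by (meson divide_pos_pos zero_less_numeral)
  obtain C2 where C2: "\<And>z. norm (A z * \<phi> z) \<le> C2 * exp (e/6 * norm z)"
    using t2 e unfolding zero_type_def by (meson divide_pos_pos zero_less_numeral)
  have C1p: "0 \<le> C1" "0 \<le> C2"
    using order_trans[OF norm_ge_zero C1[of 0]] order_trans[OF norm_ge_zero C2[of 0]] by auto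
  define D where "D = C2 * (C1 + 1)\<^sup>2 / norm (\<phi> z0) ^ 3"
  define Q where "Q = e/6 * (1 + norm z0)"
  have main: "norm (A (z0 + z)) \<le> D * exp (3 * Q + e * norm z)" for z
  proof -
    define R where "R = 2 * norm z + 1"
    define X where "X = exp (e/6 * (R + norm z0))"
    have X: "exp (e/6 * norm (z0 + w)) \<le> X" if "norm w \<le> R" for w
      using that e norm_triangle_ineq[of z0 w] by (auto simp: X_def intro!: mult_left_mono)
    have X1: "1 \<le> X" using e by (auto simp: X_def R_def)
    have "norm ((A \<circ> (+) z0) z) * norm ((\<phi> \<circ> (+) z0) 0) ^ 3 \<le> (C2 * X) * ((C1 + 1) * X)\<^sup>2"
    proof (rule quotient_bound_on_half_disc[where R=R and A="A \<circ> (+) z0" and \<phi>="\<phi> \<circ> (+) z0"])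
      show "(A \<circ> (+) z0) holomorphic_on UNIV" "(\<phi> \<circ> (+) z0) holomorphic_on UNIV"
        by (intro holomorphic_on_compose holomorphic_intros holomorphic_on_subset[OF A] holomorphic_on_subset[OF \<phi>] subset_UNIV)+
      show "0 < R" "norm z \<le> R / 2" by (auto simp: R_def add_nonneg_pos)
      show "(\<phi> \<circ> (+) z0) 0 \<noteq> 0" using nz by simp
      fix w :: complex assume w: "norm w \<le> R"
      have "norm (\<phi> (z0 + w)) \<le> C1 * X"
        using C1[of "z0 + w"] mult_left_mono[OF X[OF w] C1p(1)] by linarith
      then show "norm ((\<phi> \<circ> (+) z0) w) < (C1 + 1) * X" using X1 by (simp add: algebra_simps)
      show "norm ((A \<circ> (+) z0) w * (\<phi> \<circ> (+) z0) w) \<le> C2 * X"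
        using C2[of "z0 + w"] mult_left_mono[OF X[OF w] C1p(2)] by simp
    qed
    then have "norm (A (z0 + z)) \<le> D * X ^ 3" using nz
      by (simp add: D_def field_simps power_mult_distrib power3_eq_cube power2_eq_square)
    also have "X ^ 3 = exp (3 * (e/6 * (R + norm z0)))"
      unfolding X_def using exp_of_nat_mult[of 3 "e/6 * (R + norm z0)"] by simp
    also have "3 * (e/6 * (R + norm z0)) = 3 * Q + e * norm z" by (simp add: R_def Q_def algebra_simps)
    finally show ?thesis .
  qed
  have D: "0 \<le> D" using C1p by (simp add: D_def)
  have "norm (A z) \<le> (D * exp (3 * Q + e * norm z0)) * exp (e * norm z)" for z
  proof -
    have "norm (A z) \<le> D * exp (3 * Q + e * norm (z - z0))" using main[of "z - z0"] by simp
    also have "\<dots> \<le> D * exp (3 * Q + e * (norm z + norm z0))"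
      using D e norm_triangle_ineq4[of z z0] by (intro mult_left_mono) auto
    finally show ?thesis by (simp add: exp_add algebra_simps)
  qed
  then show "\<exists>C. \<forall>z. norm (A z) \<le> C * exp (e * norm z)" by blast
qed

text \<open>
  On $\Omega = \{|A| > K\}$ the hypothesis bounds $A \phi / \psi$ by $e^{-l |\mathrm{Im}\, z|}$. Phragmen--Lindelof then gives
  $|A / K|^{n+1} |\phi / \psi| \le 1$ on $\Omega$ for every $n$, so that $\Omega$ is empty.
\<close>

lemma bounded_of_bounded_modulo:
  fixes A \<phi> \<psi> :: "complex \<Rightarrow> complex"
  assumes A: "A holomorphic_on UNIV" and \<phi>: "\<phi> holomorphic_on UNIV" and \<psi>: "\<psi> holomorphic_on UNIV"
    and nz: "\<phi> z0 \<noteq> 0" and zt: "zero_type A" and l: "0 < l" and C: "0 \<le> C"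
    and le: "\<And>z. norm (A z * \<phi> z) \<le> C * (norm (\<phi> z) + exp (- l * \<bar>Im z\<bar>) * norm (\<psi> z))"
  shows "\<exists>K. \<forall>z. norm (A z) \<le> K"
proof -
  \<comment> \<open>K > 2 * C lets the term C * norm (\<phi> z) be absorbed on \<Omega>; K > norm (A
    0) keeps 0 off the closure of \<Omega>, where it serves as the exterior point of
    \<open>phragmen_lindelof_domain\<close>.\<close>
  define K where "K = 2 * C + norm (A 0) + 1"
  have K: "2 * C < K" "norm (A 0) < K" "1 \<le> K" using C by (auto simp: K_def add_nonneg_pos)
  have key: "norm (\<phi> z) * norm (A z) \<le> K * (exp (- l * \<bar>Im z\<bar>) * norm (\<psi> z))" if "2 * C \<le> norm (A z)" for z
  proof -
    have "norm (\<phi> z) * norm (A z) / 2 \<le> norm (\<phi> z) * (norm (A z) - C)"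
      using mult_left_mono[of "norm (A z) / 2" "norm (A z) - C" "norm (\<phi> z)"] that by simp
    also have "\<dots> \<le> C * (exp (- l * \<bar>Im z\<bar>) * norm (\<psi> z))"
      using le[of z] by (simp add: norm_mult algebra_simps)
    finally have "norm (\<phi> z) * norm (A z) \<le> (2 * C) * (exp (- l * \<bar>Im z\<bar>) * norm (\<psi> z))" by simp
    also have "\<dots> \<le> K * (exp (- l * \<bar>Im z\<bar>) * norm (\<psi> z))"
      using K by (intro mult_right_mono) auto
    finally show ?thesis .
  qed
  have an: "f analytic_on S" if "f holomorphic_on UNIV" for f :: "complex \<Rightarrow> complex" and S
    using that by (metis analytic_on_open analytic_on_subset open_UNIV subset_UNIV)
  have isoz: "\<forall>\<^sub>F w in at z. f w \<noteq> 0" if "f holomorphic_on UNIV" "f u \<noteq> 0" for f :: "complex \<Rightarrow> complex" and z u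
    using non_zero_neighbour_alt[OF that(1) open_UNIV connected_UNIV UNIV_I UNIV_I that(2)]
    by (auto elim: eventually_mono)
  have contA: "continuous_on UNIV (\<lambda>z. norm (A z))"
    by (intro continuous_intros holomorphic_on_imp_continuous_on A)
  define \<Omega> where "\<Omega> = {z. K < norm (A z)}"
  have op: "open \<Omega>" unfolding \<Omega>_def
    by (rule open_Collect_less) (use contA in \<open>auto intro: continuous_intros\<close>)
  have cl: "closure \<Omega> \<subseteq> {z. K \<le> norm (A z)}"
    by (intro closure_minimal closed_Collect_le) (use contA in \<open>auto simp: \<Omega>_def intro: continuous_intros\<close>)
  have "\<Omega> = {}"
  proof (rule ccontr)
    assume "\<Omega> \<noteq> {}"
    then obtain z1 where z1: "z1 \<in> \<Omega>" by blast
    have "\<forall>\<^sub>F w in at z1. w \<in> \<Omega>" using op z1 by (simp add: eventually_at_in_open')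
    with isoz[OF \<phi> nz, of z1] have "\<forall>\<^sub>F w in at z1. w \<in> \<Omega> \<and> \<phi> w \<noteq> 0" by eventually_elim auto
    then obtain w where w: "w \<in> \<Omega>" "\<phi> w \<noteq> 0" using eventually_happens'[OF at_neq_bot] by blast
    have w2: "2 * C \<le> norm (A w)" using w(1) K by (simp add: \<Omega>_def)
    have \<psi>w: "\<psi> w \<noteq> 0"
    proof
      assume "\<psi> w = 0"
      then have "norm (\<phi> w) * norm (A w) \<le> 0" using key[OF w2] by simp
      then have "A w = 0" using w(2) by (simp add: mult_le_0_iff)
      then show False using w(1) K by (simp add: \<Omega>_def)
    qed
    \<comment> \<open>The quotient \<phi> / \<psi> continued across the zeros of \<psi>:
      \<open>key\<close> excludes poles wherever norm (A z) > 2 * C.\<close>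
    define X where "X = remove_sings (\<lambda>z. \<phi> z / \<psi> z)"
    \<comment> \<open>An open neighbourhood of the closure of \<Omega> on which \<open>key\<close>
      still applies.\<close>
    define O' where "O' = {z. 2 * C < norm (A z)}"
    have opO: "open O'" unfolding O'_def
      by (rule open_Collect_less) (use contA in \<open>auto intro: continuous_intros\<close>)
    have clO: "closure \<Omega> \<subseteq> O'" using cl K by (force simp: O'_def)
    have X_eq: "X z = \<phi> z / \<psi> z" if "\<psi> z \<noteq> 0" for z
    proof -
      have "(\<lambda>z. \<phi> z / \<psi> z) analytic_on {z}"
        using that by (intro analytic_intros an \<phi> \<psi>) auto
      then show ?thesis unfolding X_def by simp
    qed
    have anX: "X analytic_on {z}" and leX: "norm (X z * (A z / of_real K)) \<le> exp (- l * \<bar>Im z\<bar>)" if z: "z \<in> O'" for z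
    proof -
      have "(\<lambda>z. \<phi> z / \<psi> z) meromorphic_on {z}"
        by (intro meromorphic_intros analytic_on_imp_meromorphic_on an \<phi> \<psi>)
      then have iso: "isolated_singularity_at (\<lambda>z. \<phi> z / \<psi> z) z" and ne: "not_essential (\<lambda>z. \<phi> z / \<psi> z) z"
        by (auto simp: meromorphic_at_iff)
      have ev: "\<forall>\<^sub>F w in at z. norm (\<phi> w / \<psi> w * (A w / of_real K)) \<le> exp (- l * \<bar>Im w\<bar>)"
      proof -
        have "\<forall>\<^sub>F w in at z. w \<in> O'" using opO z by (simp add: eventually_at_in_open')
        with isoz[OF \<psi> \<psi>w, of z] show ?thesis
        proof eventually_elim
          case (elim v)
          then have "norm (\<phi> v) * norm (A v) \<le> K * (exp (- l * \<bar>Im v\<bar>) * norm (\<psi> v))"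
            by (intro key) (auto simp: O'_def)
          then show ?case using elim K by (simp add: norm_mult norm_divide field_simps)
        qed
      qed
      have Az: "A z \<noteq> 0" using z C by (auto simp: O'_def)
      have contAz: "A \<midarrow>z\<rightarrow> A z"
        using A by (metis UNIV_I continuous_on_def holomorphic_on_imp_continuous_on)
      have "\<not> is_pole (\<lambda>z. \<phi> z / \<psi> z) z"
      proof
        assume "is_pole (\<lambda>z. \<phi> z / \<psi> z) z"
        then have "filterlim (\<lambda>w. A w / of_real K * (\<phi> w / \<psi> w)) at_infinity (at z)"
          unfolding is_pole_def
          by (rule tendsto_mult_filterlim_at_infinity[where c="A z / of_real K", rotated 2])
             (use K Az in \<open>auto intro!: tendsto_intros contAz\<close>)
        then have "filterlim (\<lambda>w. \<phi> w / \<psi> w * (A w / of_real K)) at_infinity (at z)"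
          by (simp only: mult.commute[of "A _ / _"])
        then have "\<forall>\<^sub>F w in at z. 2 \<le> norm (\<phi> w / \<psi> w * (A w / of_real K))"
          by (auto simp: filterlim_at_infinity[of 0])
        with ev have "\<forall>\<^sub>F w in at z. False"
        proof eventually_elim
          case (elim v)
          then have "2 \<le> exp (- l * \<bar>Im v\<bar>)" by linarith
          moreover have "exp (- l * \<bar>Im v\<bar>) \<le> 1" using l by simp
          ultimately show ?case by linarith
        qed
        then show False by simp
      qed
      with ne obtain x where x: "(\<lambda>z. \<phi> z / \<psi> z) \<midarrow>z\<rightarrow> x" by (auto simp: not_essential_def)
      show "X analytic_on {z}" unfolding X_def by (rule remove_sings_analytic_at[OF iso x])
      have "X z = x" unfolding X_def using x by (rule remove_sings_eqI)
      have l1: "((\<lambda>w. norm (\<phi> w / \<psi> w * (A w / of_real K))) \<longlongrightarrow> norm (x * (A z / of_real K))) (at z)"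
        using K by (intro tendsto_intros x contAz) auto
      have l2: "((\<lambda>w. exp (- l * \<bar>Im w\<bar>)) \<longlongrightarrow> exp (- l * \<bar>Im z\<bar>)) (at z)"
        by (intro tendsto_intros)
      show "norm (X z * (A z / of_real K)) \<le> exp (- l * \<bar>Im z\<bar>)"
        unfolding \<open>X z = x\<close> by (rule tendsto_le[OF at_neq_bot l2 l1 ev])
    qed
    have holX: "X holomorphic_on O'"
      by (rule analytic_imp_holomorphic, subst analytic_on_analytic_at) (use anX in blast)
    have pow: "norm (A w / of_real K) ^ Suc n * norm (X w) \<le> 1" for n
    proof -
      define \<Phi> where "\<Phi> z = (A z / of_real K) ^ Suc n * X z" for z
      have "norm (\<Phi> w) \<le> 1"
      proof (rule phragmen_lindelof_domain[OF op _ _ l, of \<Phi> 0])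
        have "\<Phi> holomorphic_on O'" unfolding \<Phi>_def
          by (intro holomorphic_intros holX holomorphic_on_subset[OF A]) (use K in auto)
        then show "\<Phi> holomorphic_on \<Omega>" "continuous_on (closure \<Omega>) \<Phi>"
          using clO closure_subset[of \<Omega>]
          by (auto intro: holomorphic_on_subset holomorphic_on_imp_continuous_on continuous_on_subset)
        show "0 \<notin> closure \<Omega>" using cl K by auto
        show "w \<in> \<Omega>" by fact
        have bd: "norm (\<Phi> z) \<le> norm (A z / of_real K) ^ n * exp (- l * \<bar>Im z\<bar>)" if "z \<in> closure \<Omega>" for z
        proof -
          have "z \<in> O'" using clO that by blast
          have "norm (\<Phi> z) = norm (A z / of_real K) ^ n * norm (X z * (A z / of_real K))"
            by (simp add: \<Phi>_def norm_mult norm_divide norm_power)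
          also have "\<dots> \<le> norm (A z / of_real K) ^ n * exp (- l * \<bar>Im z\<bar>)"
            by (intro mult_left_mono leX[OF \<open>z \<in> O'\<close>]) auto
          finally show ?thesis .
        qed
        show "norm (\<Phi> z) \<le> 1" if "z \<in> frontier \<Omega>" for z
        proof -
          have z: "z \<in> closure \<Omega>" "norm (A z) \<le> K"
            using that op by (auto simp: frontier_def interior_open \<Omega>_def)
          have "norm (A z / of_real K) ^ n \<le> 1" using z K by (intro power_le_one) (auto simp: norm_divide)
          moreover have "exp (- l * \<bar>Im z\<bar>) \<le> 1" using l by simp
          ultimately have "norm (A z / of_real K) ^ n * exp (- l * \<bar>Im z\<bar>) \<le> 1 * 1"
            by (intro mult_mono) auto
          then show ?thesis using bd[OF z(1)] by simp
        qed
        fix e :: real assume e: "0 < e"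
        \<comment> \<open>One power of A is spent on the smallness of X; the other n together grow
          at a rate below e.\<close>
        define e' where "e' = e / real (Suc n)"
        have "0 < e'" using e by (simp add: e'_def)
        then obtain B where B: "\<And>z. norm (A z) \<le> B * exp (e' * norm z)"
          using zt unfolding zero_type_def by blast
        have B0: "0 \<le> B" using order_trans[OF norm_ge_zero B[of 0]] by simp
        have "norm (\<Phi> z) \<le> (B / K) ^ n * exp (e * norm z - l * \<bar>Im z\<bar>)" if "z \<in> closure \<Omega>" for z
        proof -
          have "norm (A z / of_real K) \<le> B / K * exp (e' * norm z)"
            using divide_right_mono[OF B[of z], of K] K by (simp add: norm_divide)
          then have "norm (A z / of_real K) ^ n \<le> (B / K * exp (e' * norm z)) ^ n"
            by (rule power_mono) simp
          also have "\<dots> = (B / K) ^ n * exp (real n * (e' * norm z))"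
            by (simp only: power_mult_distrib exp_of_nat_mult)
          also have "\<dots> \<le> (B / K) ^ n * exp (e * norm z)"
          proof (intro mult_left_mono)
            have "real n * e' \<le> e" using e by (simp add: e'_def field_simps)
            then show "exp (real n * (e' * norm z)) \<le> exp (e * norm z)"
              using mult_right_mono[of "real n * e'" e "norm z"] by (simp add: mult.assoc)
          qed (use B0 K in auto)
          finally have "norm (A z / of_real K) ^ n * exp (- l * \<bar>Im z\<bar>) \<le> (B / K) ^ n * exp (e * norm z) * exp (- l * \<bar>Im z\<bar>)"
            by (intro mult_right_mono) auto
          also have "\<dots> = (B / K) ^ n * exp (e * norm z - l * \<bar>Im z\<bar>)" by (simp add: exp_diff exp_minus divide_inverse)
          finally show ?thesis using bd[OF that] by linarith
        qed
        then show "\<exists>C. \<forall>z\<in>closure \<Omega>. norm (\<Phi> z) \<le> C * exp (e * norm z - l * \<bar>Im z\<bar>)" by blast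
      qed
      then show ?thesis by (simp add: \<Phi>_def norm_mult norm_power norm_divide)
    qed
    have gt: "1 < norm (A w / of_real K)" using w(1) K by (simp add: \<Omega>_def norm_divide)
    have "X w \<noteq> 0" using X_eq[OF \<psi>w] w(2) \<psi>w by simp
    then have pos: "0 < norm (X w)" by simp
    obtain n where "1 / norm (X w) < norm (A w / of_real K) ^ n"
      using real_arch_pow[OF gt] by blast
    also have "\<dots> \<le> norm (A w / of_real K) ^ Suc n" using gt by (intro power_increasing) auto
    finally show False using pow[of n] pos by (simp add: field_simps)
  qed
  then have "norm (A z) \<le> K" for z by (auto simp: \<Omega>_def not_less)
  then show ?thesis by blast
qed

section \<open>Smooth steps with prescribed derivative bounds\<close>

definition average :: "real \<Rightarrow> (real \<Rightarrow> real) \<Rightarrow> real \<Rightarrow> real" where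
  "average r f x = integral {x - r..x + r} f / (2 * r)"

lemma average_derivative:
  assumes f: "continuous_on UNIV f" and r: "0 < r"
  shows "(average r f has_real_derivative (f (x + r) - f (x - r)) / (2 * r)) (at x)"
proof -
  define A where "A = x - r - 1"
  define B where "B = x + r + 1"
  define P where "P u = integral {A..u} f" for u
  have cont: "continuous_on {u..v} f" for u v using f continuous_on_subset by blast
  have P: "(P has_real_derivative f u) (at u)" if "A < u" "u < B" for u
  proof -
    have "(P has_real_derivative f u) (at u within {A..B})" unfolding P_def
      using integral_has_real_derivative[OF cont[of A B], of u] that by auto
    moreover have "u \<in> interior {A..B}" using that by simp
    ultimately show ?thesis using at_within_interior by metis
  qed
  have "((\<lambda>u. (P (u + r) - P (u - r)) / (2 * r)) has_real_derivative (f (x + r) - f (x - r)) / (2 * r)) (at x)"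
  proof -
    have "((\<lambda>u. P (u + r)) has_real_derivative f (x + r)) (at x)"
      using DERIV_shift[of P "f (x + r)" x r] P[of "x + r"] r by (simp add: A_def B_def)
    moreover have "((\<lambda>u. P (u - r)) has_real_derivative f (x - r)) (at x)"
      using DERIV_shift[of P "f (x - r)" x "- r"] P[of "x - r"] r by (simp add: A_def B_def)
    ultimately show ?thesis by (intro DERIV_cdivide DERIV_diff)
  qed
  moreover have "(P (u + r) - P (u - r)) / (2 * r) = average r f u" if "u \<in> {x - 1<..<x + 1}" for u
  proof -
    have "P (u - r) + integral {u - r..u + r} f = P (u + r)" unfolding P_def
      by (rule Henstock_Kurzweil_Integration.integral_combine)
         (use that r integrable_continuous_interval[OF cont] in \<open>auto simp: A_def\<close>)
    then show ?thesis by (simp add: average_def)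
  qed
  ultimately show ?thesis
    using has_field_derivative_transform_within_open[of _ _ x "{x - 1<..<x + 1}" "average r f"] by simp
qed

lemma continuous_on_average:
  assumes "continuous_on UNIV f" "0 < r"
  shows "continuous_on UNIV (average r f)"
  using DERIV_isCont[OF average_derivative[OF assms]] by (simp add: continuous_at_imp_continuous_on)

lemma average_bounds:
  assumes f: "continuous_on UNIV f" and r: "0 < r"
    and le: "\<And>y. x - r \<le> y \<Longrightarrow> y \<le> x + r \<Longrightarrow> m \<le> f y \<and> f y \<le> M"
  shows "m \<le> average r f x" "average r f x \<le> M"
proof -
  have int: "f integrable_on {x - r..x + r}"
    using f continuous_on_subset by (intro integrable_continuous_interval) blast
  have "integral {x - r..x + r} (\<lambda>_. m) \<le> integral {x - r..x + r} f"
    "integral {x - r..x + r} f \<le> integral {x - r..x + r} (\<lambda>_. M)"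
    by (intro integral_le int; use le in auto)+
  then have "2 * r * m \<le> integral {x - r..x + r} f" "integral {x - r..x + r} f \<le> 2 * r * M"
    using r by auto
  then show "m \<le> average r f x" "average r f x \<le> M"
    using r by (auto simp: average_def field_simps)
qed

lemma average_diff:
  assumes "continuous_on UNIV f" "continuous_on UNIV g"
  shows "average r (\<lambda>x. f x - g x) x = average r f x - average r g x"
proof -
  have "integral {x - r..x + r} (\<lambda>x. f x - g x) = integral {x - r..x + r} f - integral {x - r..x + r} g"
    by (intro Henstock_Kurzweil_Integration.integral_diff integrable_continuous_interval)
       (use assms continuous_on_subset in blast)+
  then show ?thesis by (simp add: average_def diff_divide_distrib)
qed

lemma average_dist_le:
  assumes "continuous_on UNIV f" "continuous_on UNIV g" "0 < r" and "\<And>y. \<bar>f y - g y\<bar> \<le> e"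
  shows "\<bar>average r f x - average r g x\<bar> \<le> e"
proof -
  have c: "continuous_on UNIV (\<lambda>x. f x - g x)" using assms by (intro continuous_intros)
  have "- e \<le> f y - g y \<and> f y - g y \<le> e" for y using assms(4)[of y] by (auto simp: abs_le_iff)
  then have "- e \<le> average r (\<lambda>x. f x - g x) x" "average r (\<lambda>x. f x - g x) x \<le> e"
    using average_bounds[OF c assms(3), of x "- e" e] by auto
  then show ?thesis using average_diff[OF assms(1,2), of r x] by (simp add: abs_le_iff)
qed

text \<open>Convolution with m box kernels of radii b j, b (j + 1), and so on. The starting index is
  kept because differentiation undoes the outermost average and leaves the same construction started
  at j + 1.\<close>

fun iter_average :: "(nat \<Rightarrow> real) \<Rightarrow> (real \<Rightarrow> real) \<Rightarrow> nat \<Rightarrow> nat \<Rightarrow> real \<Rightarrow> real" where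
  "iter_average b f j 0 = f"
| "iter_average b f j (Suc m) = average (b j) (iter_average b f (Suc j) m)"

definition sym_diff :: "real \<Rightarrow> (real \<Rightarrow> real) \<Rightarrow> real \<Rightarrow> real" where
  "sym_diff r g x = (g (x + r) - g (x - r)) / (2 * r)"

text \<open>The new radius b j acts on g first; this matches the derivative of
  \<open>average (b j)\<close>, which is \<open>sym_diff (b j)\<close>.\<close>

fun iter_sym_diff :: "(nat \<Rightarrow> real) \<Rightarrow> nat \<Rightarrow> (real \<Rightarrow> real) \<Rightarrow> real \<Rightarrow> real" where
  "iter_sym_diff b 0 g = g"
| "iter_sym_diff b (Suc j) g = iter_sym_diff b j (sym_diff (b j) g)"

lemma iter_sym_diff_derivative:
  assumes "\<And>x. (g has_real_derivative h x) (at x)"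
  shows "(iter_sym_diff b j g has_real_derivative iter_sym_diff b j h x) (at x)"
  using assms
proof (induction j arbitrary: g h)
  case (Suc j)
  have "(sym_diff (b j) g has_real_derivative sym_diff (b j) h x) (at x)" for x
  proof -
    have "((\<lambda>x. g (x + b j)) has_real_derivative h (x + b j)) (at x)"
      using DERIV_shift[of g "h (x + b j)" x "b j"] Suc.prems by simp
    moreover have "((\<lambda>x. g (x - b j)) has_real_derivative h (x - b j)) (at x)"
      using DERIV_shift[of g "h (x - b j)" x "- b j"] Suc.prems by simp
    ultimately show ?thesis unfolding sym_diff_def by (intro DERIV_cdivide DERIV_diff)
  qed
  from Suc.IH[OF this] show ?case by simp
qed simp

lemma iter_sym_diff_bound:
  assumes "\<And>n. 0 < b n" "\<And>x. \<bar>g x\<bar> \<le> B"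
  shows "\<bar>iter_sym_diff b j g x\<bar> \<le> B * (\<Prod>n<j. 1 / b n)"
  using assms(2)
proof (induction j arbitrary: g B)
  case (Suc j)
  have "\<bar>sym_diff (b j) g x\<bar> \<le> B * (1 / b j)" for x
  proof -
    have "\<bar>g (x + b j) - g (x - b j)\<bar> \<le> 2 * B"
      using Suc.prems[of "x + b j"] Suc.prems[of "x - b j"] by linarith
    then show ?thesis using assms(1)[of j] by (simp add: sym_diff_def field_simps)
  qed
  from Suc.IH[OF this] show ?case by (simp add: mult_ac)
qed simp

text \<open>The classical infinite convolution: a ramp averaged over b 0, b 1, and so on. Since the
  ramp is Lipschitz, each further average moves the result by at most its radius over e, so the
  process converges uniformly; each derivative costs a factor 1 / b n.\<close>

lemma smooth_step_core:
  fixes b :: "nat \<Rightarrow> real"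
  assumes b: "\<And>n. 0 < b n" and sm: "summable b" and tot: "suminf b \<le> e / 2" and e: "0 < e"
  obtains \<sigma> :: "nat \<Rightarrow> real \<Rightarrow> real" where
    "\<And>j x. (\<sigma> j has_real_derivative \<sigma> (Suc j) x) (at x)"
    "\<And>j x. \<bar>\<sigma> j x\<bar> \<le> (\<Prod>n<j. 1 / b n)"
    "\<And>x. x \<le> s - e \<Longrightarrow> \<sigma> 0 x = 0" "\<And>x. s + e \<le> x \<Longrightarrow> \<sigma> 0 x = 1"
proof -
  \<comment> \<open>Ramp of slope 1 / e, equal to 0 below s - e/2 and to 1 above s + e/2; the
    averages spread it by at most the remaining e/2.\<close>
  define f where "f x = max 0 (min 1 ((x - s) / e + 1 / 2))" for x
  have f01: "0 \<le> f x" "f x \<le> 1" for x by (auto simp: f_def)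
  have contf: "continuous_on UNIV f" unfolding f_def using e by (intro continuous_intros) auto
  have lip: "\<bar>f x - f y\<bar> \<le> \<bar>x - y\<bar> / e" for x y
  proof -
    have "\<bar>f x - f y\<bar> \<le> \<bar>((x - s) / e + 1 / 2) - ((y - s) / e + 1 / 2)\<bar>" by (auto simp: f_def)
    also have "\<dots> = \<bar>x - y\<bar> / e" using e by (simp add: diff_divide_distrib[symmetric])
    finally show ?thesis .
  qed
  have f0: "f x = 0" if "x \<le> s - e/2" for x
  proof -
    have "(x - s) / e + 1/2 \<le> 0" using that e by (simp add: field_simps)
    then show ?thesis by (simp add: f_def)
  qed
  have f1: "f x = 1" if "s + e/2 \<le> x" for x
  proof -
    have "1 \<le> (x - s) / e + 1/2" using that e by (simp add: field_simps)
    then show ?thesis by (simp add: f_def)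
  qed
  define G where "G = iter_average b f"
  have G0: "G j 0 = f" and GS: "G j (Suc m) = average (b j) (G (Suc j) m)" for j m
    by (simp_all add: G_def)
  have contG: "continuous_on UNIV (G j m)" for j m
    by (induction m arbitrary: j) (simp_all add: G0 GS contf b continuous_on_average)
  have G01: "0 \<le> G j m x \<and> G j m x \<le> 1" for j m x
  proof (induction m arbitrary: j x)
    case (Suc m)
    then show ?case unfolding GS using average_bounds[OF contG b] by blast
  qed (simp add: G0 f01)
  \<comment> \<open>For m = 0 this is the Lipschitz bound; averaging does not increase uniform
    distances, so the bound passes on to larger m.\<close>
  have step: "\<bar>G j (Suc m) x - G j m x\<bar> \<le> b (j + m) / e" for j m x
  proof (induction m arbitrary: j x)
    case 0
    have "f x - b j / e \<le> average (b j) f x" "average (b j) f x \<le> f x + b j / e"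
    proof -
      have "f x - b j / e \<le> f y \<and> f y \<le> f x + b j / e" if "x - b j \<le> y" "y \<le> x + b j" for y
      proof -
        have "\<bar>x - y\<bar> \<le> b j" using that by (simp add: abs_le_iff)
        then have "\<bar>x - y\<bar> / e \<le> b j / e" using e by (simp add: divide_right_mono)
        then show ?thesis using lip[of x y] by (auto simp: abs_le_iff)
      qed
      from average_bounds[OF contf b this] show "f x - b j / e \<le> average (b j) f x" "average (b j) f x \<le> f x + b j / e" by blast+
    qed
    then show ?case by (simp add: G0 GS abs_le_iff)
  next
    case (Suc m)
    show ?case unfolding GS[of j]
      using average_dist_le[OF contG contG b Suc.IH[of "Suc j"], of j x] by (simp add: GS)
  qed
  have G0s: "G j m x = 0" if "x \<le> s - e/2 - (\<Sum>i<m. b (j + i))" for j m x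
    using that
  proof (induction m arbitrary: j x)
    case (Suc m)
    have "0 \<le> average (b j) (G (Suc j) m) x \<and> average (b j) (G (Suc j) m) x \<le> 0"
    proof -
      have "0 \<le> G (Suc j) m y \<and> G (Suc j) m y \<le> 0" if "x - b j \<le> y" "y \<le> x + b j" for y
        using Suc.IH[of y "Suc j"] Suc.prems that by (simp add: sum.lessThan_Suc_shift del: sum.lessThan_Suc)
      then show ?thesis using average_bounds[OF contG b] by blast
    qed
    then show ?case by (simp add: GS)
  qed (simp add: G0 f0)
  have G1s: "G j m x = 1" if "s + e/2 + (\<Sum>i<m. b (j + i)) \<le> x" for j m x
    using that
  proof (induction m arbitrary: j x)
    case (Suc m)
    have "1 \<le> average (b j) (G (Suc j) m) x \<and> average (b j) (G (Suc j) m) x \<le> 1"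
    proof -
      have "1 \<le> G (Suc j) m y \<and> G (Suc j) m y \<le> 1" if "x - b j \<le> y" "y \<le> x + b j" for y
        using Suc.IH[of "Suc j" y] Suc.prems that by (simp add: sum.lessThan_Suc_shift del: sum.lessThan_Suc)
      then show ?thesis using average_bounds[OF contG b] by blast
    qed
    then show ?case by (simp add: GS)
  qed (simp add: G0 f1)
  have tail: "summable (\<lambda>i. b (j + i))" for j
    using summable_ignore_initial_segment[OF sm, of j] by (simp add: add.commute)
  have W: "uniform_limit UNIV (\<lambda>m x. \<Sum>i<m. G j (Suc i) x - G j i x) (\<lambda>x. \<Sum>i. G j (Suc i) x - G j i x) sequentially" for j
    by (rule Weierstrass_m_test[where M="\<lambda>i. b (j + i) / e"])
       (use step tail summable_divide in auto)
  have tele: "(\<Sum>i<m. G j (Suc i) x - G j i x) = G j m x - f x" for j m x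
    using sum_lessThan_telescope[of "\<lambda>i. G j i x" m] by (simp add: G0)
  have ul: "\<exists>L. uniform_limit UNIV (\<lambda>m x. G j m x - f x) L sequentially" for j
    using W[of j] unfolding tele by blast
  have "\<exists>L. uniform_limit UNIV (G j) L sequentially" for j
  proof -
    obtain L where "uniform_limit UNIV (\<lambda>m x. G j m x - f x) L sequentially" using ul by blast
    from uniform_limit_add[OF this uniform_limit_const[where c=f]] show ?thesis by auto
  qed
  then obtain H where H: "\<And>j. uniform_limit UNIV (G j) (H j) sequentially" by metis
  have contH: "continuous_on UNIV (H j)" for j
    by (rule uniform_limit_theorem[OF _ H]) (auto intro: always_eventually contG)
  have lim: "(\<lambda>m. G j m x) \<longlonglongrightarrow> H j x" for j x
    using tendsto_uniform_limitI[OF H] by simp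
  have H01: "0 \<le> H j x" "H j x \<le> 1" for j x
    using LIMSEQ_le_const[OF lim] LIMSEQ_le_const2[OF lim] G01 by blast+
  have HH: "H j = average (b j) (H (Suc j))" for j
  proof
    fix x
    have "(\<lambda>m. average (b j) (G (Suc j) m) x) \<longlonglongrightarrow> average (b j) (H (Suc j)) x"
    proof (rule tendstoI)
      fix \<epsilon> :: real assume "0 < \<epsilon>"
      then have "\<forall>\<^sub>F m in sequentially. \<forall>y\<in>UNIV. dist (G (Suc j) m y) (H (Suc j) y) < \<epsilon> / 2"
        using uniform_limitD[OF H[of "Suc j"], of "\<epsilon> / 2"] by simp
      then show "\<forall>\<^sub>F m in sequentially. dist (average (b j) (G (Suc j) m) x) (average (b j) (H (Suc j)) x) < \<epsilon>"
      proof eventually_elim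
        case (elim m)
        have "\<bar>G (Suc j) m y - H (Suc j) y\<bar> \<le> \<epsilon> / 2" for y
          using elim by (auto simp: dist_real_def less_imp_le)
        from average_dist_le[OF contG contH b this] have "\<bar>average (b j) (G (Suc j) m) x - average (b j) (H (Suc j)) x\<bar> \<le> \<epsilon> / 2" .
        then show ?case using \<open>0 < \<epsilon>\<close> by (simp add: dist_real_def)
      qed
    qed
    moreover have "(\<lambda>m. G j (Suc m) x) \<longlonglongrightarrow> H j x" using LIMSEQ_Suc[OF lim] .
    ultimately show "H j x = average (b j) (H (Suc j)) x"
      unfolding GS using LIMSEQ_unique by blast
  qed
  \<comment> \<open>The j-th derivative of H 0: each differentiation trades one average for one
    symmetric difference.\<close>
  define \<sigma> where "\<sigma> j = iter_sym_diff b j (H j)" for j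
  have sum_le: "(\<Sum>i<m. b i) \<le> e / 2" for m
    using sum_le_suminf[OF sm, of "{..<m}"] b tot by (force intro: less_imp_le)
  show ?thesis
  proof (rule that[of \<sigma>])
    fix j x
    have "(H j has_real_derivative sym_diff (b j) (H (Suc j)) x) (at x)" for x
      using average_derivative[OF contH[of "Suc j"] b[of j], of x] HH[of j] by (simp add: sym_diff_def)
    from iter_sym_diff_derivative[OF this]
    show "(\<sigma> j has_real_derivative \<sigma> (Suc j) x) (at x)" by (simp add: \<sigma>_def)
    show "\<bar>\<sigma> j x\<bar> \<le> (\<Prod>n<j. 1 / b n)"
      using iter_sym_diff_bound[where b=b and g="H j" and B=1 and j=j and x=x] b H01 by (simp add: \<sigma>_def)
  next
    fix x assume "x \<le> s - e"
    then have "G 0 m x = 0" for m using sum_le[of m] by (intro G0s) simp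
    then show "\<sigma> 0 x = 0" using LIMSEQ_unique[OF lim[of 0 x], of 0] by (simp add: \<sigma>_def)
  next
    fix x assume "s + e \<le> x"
    then have "G 0 m x = 1" for m using sum_le[of m] by (intro G1s) simp
    then show "\<sigma> 0 x = 1" using LIMSEQ_unique[OF lim[of 0 x], of 1] by (simp add: \<sigma>_def)
  qed
qed

text \<open>Shrinking finitely many radii makes the total as small as desired and costs only a
  constant factor in the derivative bounds, so mere summability suffices.\<close>

lemma smooth_step_exists:
  fixes u :: "nat \<Rightarrow> real"
  assumes u: "\<And>n. 0 < u n" and sm: "summable u" and e: "0 < e"
  obtains \<sigma> :: "nat \<Rightarrow> real \<Rightarrow> real" and C where
    "\<And>j x. (\<sigma> j has_real_derivative \<sigma> (Suc j) x) (at x)"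
    "\<And>j x. \<bar>\<sigma> j x\<bar> \<le> C * (\<Prod>n<j. 1 / u n)"
    "\<And>x. x \<le> s - e \<Longrightarrow> \<sigma> 0 x = 0" "\<And>x. s + e \<le> x \<Longrightarrow> \<sigma> 0 x = 1"
proof -
  obtain N where N: "\<And>n. n \<ge> N \<Longrightarrow> norm (\<Sum>i. u (i + n)) < e / 4"
    using suminf_exist_split[OF _ sm, of "e / 4"] e by auto
  \<comment> \<open>N radii \<delta> add up to at most e / 4, and so does the tail.\<close>
  define \<delta> where "\<delta> = e / (4 * (real N + 1))"
  have \<delta>: "0 < \<delta>" using e by (auto simp: \<delta>_def)
  define b where "b n = (if n < N then \<delta> else u n)" for n
  have b: "0 < b n" for n using u \<delta> by (simp add: b_def)
  have bt: "(\<lambda>i. b (i + N)) = (\<lambda>i. u (i + N))" by (auto simp: b_def)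
  have smb: "summable b"
    using summable_iff_shift[of b N] summable_ignore_initial_segment[OF sm, of N] by (simp add: bt)
  have "suminf b = (\<Sum>i. b (i + N)) + sum b {..<N}" by (rule suminf_split_initial_segment[OF smb])
  also have "sum b {..<N} = N * \<delta>" by (simp add: b_def)
  also have "N * \<delta> \<le> e / 4" using e by (simp add: \<delta>_def field_simps)
  also have "(\<Sum>i. b (i + N)) \<le> e / 4" using N[of N] unfolding bt by (simp add: abs_less_iff)
  finally have tot: "suminf b \<le> e / 2" by simp
  obtain \<sigma> :: "nat \<Rightarrow> real \<Rightarrow> real" where \<sigma>: "\<And>j x. (\<sigma> j has_real_derivative \<sigma> (Suc j) x) (at x)"
    "\<And>j x. \<bar>\<sigma> j x\<bar> \<le> (\<Prod>n<j. 1 / b n)"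
    "\<And>x. x \<le> s - e \<Longrightarrow> \<sigma> 0 x = 0" "\<And>x. s + e \<le> x \<Longrightarrow> \<sigma> 0 x = 1"
    using smooth_step_core[OF b smb tot e] by blast
  \<comment> \<open>The maximum with 1 makes the full product dominate its partial products, which
    occur for j < N.\<close>
  define C where "C = (\<Prod>n<N. max 1 (u n / \<delta>))"
  have "(\<Prod>n<j. 1 / b n) \<le> C * (\<Prod>n<j. 1 / u n)" for j
  proof -
    have "(\<Prod>n<j. 1 / b n) = (\<Prod>n<j. (u n / b n) * (1 / u n))"
      by (intro prod.cong) (use u in \<open>auto simp: less_imp_neq[symmetric]\<close>)
    also have "\<dots> = (\<Prod>n<j. u n / b n) * (\<Prod>n<j. 1 / u n)" by (rule prod.distrib)
    also have "(\<Prod>n<j. u n / b n) \<le> (\<Prod>n<j. if n < N then max 1 (u n / \<delta>) else 1)"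
      by (intro prod_mono) (use u b \<delta> in \<open>auto simp: b_def less_imp_le less_imp_neq[symmetric]\<close>)
    also have "\<dots> = (\<Prod>n\<in>{..<j} \<inter> {n. n < N}. max 1 (u n / \<delta>))"
      by (simp add: prod.If_cases)
    also have "\<dots> \<le> C" unfolding C_def
      by (intro prod_mono2) auto
    finally show ?thesis using u by (simp add: mult_right_mono prod_nonneg less_imp_le)
  qed
  then show ?thesis using that[of \<sigma> C] \<sigma> order_trans by blast
qed

section \<open>The weight sequence of the semi-norms\<close>

locale weight_setting =
  fixes \<omega> :: "real \<Rightarrow> real" and a :: ereal and c :: "nat \<Rightarrow> real"
  assumes w: "weight \<omega>" and a_pos: "0 < a" and c_exh: "exhausting_seq a c"
begin

text \<open>The weights of the semi-norms with index q. By \<open>M_ge\<close> and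
  \<open>M_le\<close>, M q j is the supremum of x^j * exp (- q * \<omega> x) over x \<ge> 1, and
  every later inequality between values of M is read off from this.\<close>

definition M :: "real \<Rightarrow> nat \<Rightarrow> real" where
  "M q j = exp (q * phi_star \<omega> (real j / q))"

lemma M_pos: "0 < M q j" by (simp add: M_def)

lemma w_nonneg: "0 \<le> x \<Longrightarrow> 0 \<le> \<omega> x" using w by (auto simp: weight_def)

lemma w_mono: "0 \<le> x \<Longrightarrow> x \<le> y \<Longrightarrow> \<omega> x \<le> \<omega> y"
  using w by (auto simp: weight_def mono_on_def)

lemma w_sub: "1 < \<sigma> \<Longrightarrow> \<exists>C. \<forall>x\<ge>0. \<forall>y\<ge>0. \<omega> (x + y) \<le> \<sigma> * (\<omega> x + \<omega> y) + C"
  using w unfolding weight_def by blast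

text \<open>Since ln x = o(\<omega> x), the function \<omega> (exp t) eventually exceeds every
  multiple of t, so the supremum in \<open>phi_star\<close> is a genuine one.\<close>

lemma phi_bdd: "bdd_above ((\<lambda>t. s * t - \<omega> (exp t)) ` {0..})"
proof -
  have "ln \<in> o[at_top](\<omega>)" using w by (simp add: weight_def)
  from landau_o.smallD[OF this, of "1 / (\<bar>s\<bar> + 1)"]
  have "\<forall>\<^sub>F x in at_top. \<bar>ln x\<bar> \<le> 1 / (\<bar>s\<bar> + 1) * \<bar>\<omega> x\<bar>" by (simp add: add_nonneg_pos)
  then obtain X where X: "\<And>x. X \<le> x \<Longrightarrow> \<bar>ln x\<bar> \<le> 1 / (\<bar>s\<bar> + 1) * \<bar>\<omega> x\<bar>"
    by (auto simp: eventually_at_top_linorder)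
  define T where "T = ln (max 1 X)"
  show ?thesis
  proof (rule bdd_aboveI2)
    fix t :: real assume t: "t \<in> {0..}"
    show "s * t - \<omega> (exp t) \<le> \<bar>s\<bar> * T"
    proof (cases "T \<le> t")
      case True
      then have "exp T \<le> exp t" by simp
      moreover have "exp T = max 1 X" by (simp add: T_def)
      ultimately have "X \<le> exp t" by simp
      from X[OF this] have "t * (\<bar>s\<bar> + 1) \<le> \<omega> (exp t)"
        using t w_nonneg[of "exp t"] by (simp add: field_simps add_nonneg_pos split: if_splits)
      moreover have "s * t \<le> \<bar>s\<bar> * t" using t by (intro mult_right_mono) auto
      moreover have "0 \<le> \<bar>s\<bar> * T" by (simp add: T_def)
      ultimately show ?thesis using t by (simp add: algebra_simps)
    next
      case False
      then have "s * t \<le> \<bar>s\<bar> * T" using t by (intro mult_mono) auto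
      then show ?thesis using w_nonneg[of "exp t"] by simp
    qed
  qed
qed

lemma M_ge:
  assumes q: "0 < q" and x: "1 \<le> x"
  shows "x ^ j * exp (- q * \<omega> x) \<le> M q j"
proof -
  have "real j / q * ln x - \<omega> (exp (ln x)) \<le> phi_star \<omega> (real j / q)"
    unfolding phi_star_def using x by (intro cSUP_upper phi_bdd) auto
  then have "real j / q * ln x - \<omega> x \<le> phi_star \<omega> (real j / q)" using x by simp
  then have "real j * ln x - q * \<omega> x \<le> q * phi_star \<omega> (real j / q)"
    using mult_left_mono[of "real j / q * ln x - \<omega> x" _ q] q by (simp add: right_diff_distrib)
  then have "exp (real j * ln x - q * \<omega> x) \<le> M q j" by (simp add: M_def)
  moreover have "exp (real j * ln x) = x ^ j" using x by (simp add: exp_of_nat_mult)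
  ultimately show ?thesis by (simp add: exp_diff exp_minus divide_inverse)
qed

lemma M_le:
  assumes q: "0 < q" and B: "\<And>x. 1 \<le> x \<Longrightarrow> x ^ j * exp (- q * \<omega> x) \<le> B"
  shows "M q j \<le> B"
proof -
  have "0 < (1::real) ^ j * exp (- q * \<omega> 1)" by simp
  then have B0: "0 < B" using B[of 1] by linarith
  have "phi_star \<omega> (real j / q) \<le> ln B / q" unfolding phi_star_def
  proof (rule cSUP_least)
    fix t :: real assume t: "t \<in> {0..}"
    have "exp (real j * t - q * \<omega> (exp t)) \<le> B"
      using B[of "exp t"] t by (simp add: exp_of_nat_mult exp_diff exp_minus divide_inverse)
    then have "real j * t - q * \<omega> (exp t) \<le> ln B" using B0 by (simp add: ln_ge_iff)
    moreover have "real j / q * t - \<omega> (exp t) = (real j * t - q * \<omega> (exp t)) / q"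
      using q by (simp add: field_simps)
    ultimately show "real j / q * t - \<omega> (exp t) \<le> ln B / q"
      using q by (metis divide_right_mono less_imp_le)
  qed simp
  then have "q * phi_star \<omega> (real j / q) \<le> ln B" using q by (simp add: field_simps)
  then show ?thesis using B0 by (simp add: M_def ln_ge_iff)
qed

text \<open>Lowering q frees the factor exp (- (q - q') * \<omega> x), which pays for the extra x.
  This is what a differentiation costs.\<close>

lemma M_shift:
  assumes "0 < q'" "q' < q"
  shows "M q (Suc j) \<le> M (q - q') 1 * M q' j"
proof (rule M_le)
  fix x :: real assume x: "1 \<le> x"
  have "x ^ Suc j * exp (- q * \<omega> x) = (x ^ 1 * exp (- (q - q') * \<omega> x)) * (x ^ j * exp (- q' * \<omega> x))"
    by (simp add: exp_add[symmetric] algebra_simps)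
  also have "\<dots> \<le> M (q - q') 1 * M q' j"
    using assms x by (intro mult_mono M_ge) (auto intro: less_imp_le M_pos)
  finally show "x ^ Suc j * exp (- q * \<omega> x) \<le> M (q - q') 1 * M q' j" .
qed (use assms in simp)

lemma M_antimono:
  assumes "0 < q'" "q' \<le> q"
  shows "M q j \<le> M q' j"
proof (rule M_le)
  fix x :: real assume x: "1 \<le> x"
  have "x ^ j * exp (- q * \<omega> x) \<le> x ^ j * exp (- q' * \<omega> x)"
    using x assms w_nonneg[of x] by (intro mult_left_mono) (auto intro: mult_right_mono)
  also have "\<dots> \<le> M q' j" using assms x by (intro M_ge) auto
  finally show "x ^ j * exp (- q * \<omega> x) \<le> M q' j" .
qed (use assms in simp)

lemma power_le_M:
  assumes "0 < q" "1 \<le> x"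
  shows "x ^ j \<le> exp (q * \<omega> x) * M q j"
  using M_ge[OF assms, of j] by (simp add: exp_minus field_simps)

text \<open>(j + 1) * x^j is one term in the expansion of (x + 1)^(j + 1). The shift of the argument
  is absorbed by the near-subadditivity of \<omega>, the extra power by
  \<open>M_shift\<close>.\<close>

lemma M_linear_factor:
  assumes "0 < q'" "q' < q"
  shows "\<exists>C. \<forall>j. (real j + 1) * M q j \<le> C * M q' j"
proof -
  define p where "p = (q + q') / 2"
  have p: "q' < p" "p < q" "0 < p" "0 < q" using assms by (auto simp: p_def)
  have "1 < q / p" using p by simp
  from w_sub[OF this] obtain C0 where C0: "\<And>x y. 0 \<le> x \<Longrightarrow> 0 \<le> y \<Longrightarrow> \<omega> (x + y) \<le> q / p * (\<omega> x + \<omega> y) + C0"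
    by blast
  define D where "D = exp (q * \<omega> 1 + p * C0)"
  have "(real j + 1) * M q j \<le> D * M p (Suc j)" for j
  proof -
    have "M q j \<le> D * M p (Suc j) / (real j + 1)"
    proof (rule M_le)
      fix x :: real assume x: "1 \<le> x"
      have "(real j + 1) * x ^ j \<le> (x + 1) ^ Suc j"
      proof -
        have "(\<Sum>k\<in>{j}. of_nat (Suc j choose k) * x ^ k * 1 ^ (Suc j - k)) \<le> (\<Sum>k\<le>Suc j. of_nat (Suc j choose k) * x ^ k * 1 ^ (Suc j - k))"
          using x by (intro sum_mono2) auto
        also have "\<dots> = (x + 1) ^ Suc j" by (rule binomial_ring[symmetric])
        finally show ?thesis by (simp add: add.commute)
      qed
      then have "(real j + 1) * x ^ j * exp (- q * \<omega> x) \<le> (x + 1) ^ Suc j * exp (- q * \<omega> x)"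
        by (intro mult_right_mono) auto
      also have "\<dots> \<le> (x + 1) ^ Suc j * (D * exp (- p * \<omega> (x + 1)))"
      proof (intro mult_left_mono)
        have "p * \<omega> (x + 1) \<le> p * (q / p * (\<omega> x + \<omega> 1) + C0)"
          using C0[of x 1] x p by (intro mult_left_mono) auto
        also have "\<dots> = q * \<omega> x + q * \<omega> 1 + p * C0" using p by (simp add: field_simps)
        finally show "exp (- q * \<omega> x) \<le> D * exp (- p * \<omega> (x + 1))"
          by (simp add: D_def exp_add[symmetric])
      qed (use x in auto)
      also have "\<dots> = D * ((x + 1) ^ Suc j * exp (- p * \<omega> (x + 1)))" by simp
      also have "\<dots> \<le> D * M p (Suc j)"
        using p x by (intro mult_left_mono M_ge) (auto simp: D_def)
      finally show "x ^ j * exp (- q * \<omega> x) \<le> D * M p (Suc j) / (real j + 1)"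
        by (simp add: field_simps)
    qed (use p in simp)
    then show ?thesis by (simp add: field_simps)
  qed
  moreover have "D * M p (Suc j) \<le> D * (M (p - q') 1 * M q' j)" for j
    using M_shift[of q' p j] p assms by (intro mult_left_mono) (auto simp: D_def)
  ultimately have "(real j + 1) * M q j \<le> D * M (p - q') 1 * M q' j" for j
    by (metis order_trans mult.assoc)
  then show ?thesis by blast
qed

text \<open>Each term is dominated separately: the binomial coefficient times x^i * y^(j - i) is at
  most (x + y)^j, and \<omega> is subadditive up to the factor q / p and a constant. Taking suprema
  first in x, then in y, gives a bound by M p j; the number j + 1 of terms is absorbed by
  \<open>M_linear_factor\<close>.\<close>

lemma M_leibniz:
  assumes "0 < q'" "q' < q" "q \<le> 1"
  shows "\<exists>C. \<forall>j. (\<Sum>i\<le>j. real (j choose i) * M 1 i * M q (j - i)) \<le> C * M q' j"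
proof -
  \<comment> \<open>Half of the loss from q to q' goes into the subadditivity of \<omega>, the other
    half into the number of terms.\<close>
  define p where "p = (q + q') / 2"
  have p: "q' < p" "p < q" "0 < p" "0 < q" using assms by (auto simp: p_def)
  have "1 < q / p" using p by simp
  from w_sub[OF this] obtain C0 where C0: "\<And>x y. 0 \<le> x \<Longrightarrow> 0 \<le> y \<Longrightarrow> \<omega> (x + y) \<le> q / p * (\<omega> x + \<omega> y) + C0"
    by blast
  obtain C1 where C1: "\<And>j. (real j + 1) * M p j \<le> C1 * M q' j"
    using M_linear_factor[of q' p] assms p by blast
  have t: "real (j choose i) * M 1 i * M q (j - i) \<le> exp (p * C0) * M p j" if "i \<le> j" for i j
  proof -
    have xy: "real (j choose i) * (x ^ i * exp (- 1 * \<omega> x)) * (y ^ (j - i) * exp (- q * \<omega> y)) \<le> exp (p * C0) * M p j"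
      if "1 \<le> x" "1 \<le> y" for x y
    proof -
      have h1: "real (j choose i) * x ^ i * y ^ (j - i) \<le> (x + y) ^ j"
      proof -
        have "(\<Sum>k\<in>{i}. of_nat (j choose k) * x ^ k * y ^ (j - k)) \<le> (\<Sum>k\<le>j. of_nat (j choose k) * x ^ k * y ^ (j - k))"
          using that \<open>i \<le> j\<close> by (intro sum_mono2) auto
        also have "\<dots> = (x + y) ^ j" by (rule binomial_ring[symmetric])
        finally show ?thesis by simp
      qed
      have h2: "exp (- 1 * \<omega> x) * exp (- q * \<omega> y) \<le> exp (p * C0) * exp (- p * \<omega> (x + y))"
      proof -
        have "p * \<omega> (x + y) \<le> p * (q / p * (\<omega> x + \<omega> y) + C0)"
          using C0[of x y] that p by (intro mult_left_mono) auto
        also have "\<dots> = q * \<omega> x + q * \<omega> y + p * C0" using p by (simp add: field_simps)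
        also have "q * \<omega> x \<le> 1 * \<omega> x" using assms w_nonneg[of x] that by (intro mult_right_mono) auto
        finally show ?thesis by (simp add: exp_add[symmetric])
      qed
      have "(real (j choose i) * x ^ i * y ^ (j - i)) * (exp (- 1 * \<omega> x) * exp (- q * \<omega> y)) \<le> (x + y) ^ j * (exp (p * C0) * exp (- p * \<omega> (x + y)))"
        by (rule mult_mono[OF h1 h2]) (use that in auto)
      also have "\<dots> = exp (p * C0) * ((x + y) ^ j * exp (- p * \<omega> (x + y)))" by simp
      also have "\<dots> \<le> exp (p * C0) * M p j"
        using that p by (intro mult_left_mono M_ge) auto
      finally show ?thesis by (simp add: mult_ac)
    qed
    have ch: "0 < real (j choose i)" using \<open>i \<le> j\<close> by simp
    have "M 1 i \<le> exp (p * C0) * M p j / (real (j choose i) * (y ^ (j - i) * exp (- q * \<omega> y)))" if "1 \<le> y" for y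
      by (rule M_le) (use xy[OF _ that] ch that in \<open>auto simp: field_simps\<close>)
    then have "y ^ (j - i) * exp (- q * \<omega> y) \<le> exp (p * C0) * M p j / (real (j choose i) * M 1 i)" if "1 \<le> y" for y
      using that ch M_pos[of 1 i] by (simp add: field_simps)
    then have "M q (j - i) \<le> exp (p * C0) * M p j / (real (j choose i) * M 1 i)"
      by (intro M_le) (use p in auto)
    then show ?thesis using ch M_pos[of 1 i] by (simp add: field_simps)
  qed
  have "(\<Sum>i\<le>j. real (j choose i) * M 1 i * M q (j - i)) \<le> exp (p * C0) * C1 * M q' j" for j
  proof -
    have "(\<Sum>i\<le>j. real (j choose i) * M 1 i * M q (j - i)) \<le> (\<Sum>i\<le>j. exp (p * C0) * M p j)"
      using t by (intro sum_mono) auto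
    also have "\<dots> = exp (p * C0) * ((real j + 1) * M p j)" by (simp add: algebra_simps)
    also have "\<dots> \<le> exp (p * C0) * (C1 * M q' j)" using C1 by (intro mult_left_mono) auto
    finally show ?thesis by simp
  qed
  then show ?thesis by blast
qed

text \<open>The suprema are compared pointwise. Points y \<ge> x gain a factor x directly; points y
  < x are compared with the single point exp 1 * x, where the gain exp n in the n-th power
  compensates the weight, which is at least exp (- n).\<close>

lemma M_ratio:
  assumes x: "1 \<le> x" and le: "\<omega> (exp 1 * x) \<le> real n"
  shows "M 1 n / M 1 (Suc n) \<le> 1 / x"
proof -
  have "M 1 n \<le> M 1 (Suc n) / x"
  proof (rule M_le)
    fix y :: real assume y: "1 \<le> y"
    show "y ^ n * exp (- 1 * \<omega> y) \<le> M 1 (Suc n) / x"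
    proof (cases "x \<le> y")
      case True
      have "x * (y ^ n * exp (- 1 * \<omega> y)) \<le> y * (y ^ n * exp (- 1 * \<omega> y))"
        using True y by (intro mult_right_mono) auto
      also have "\<dots> \<le> M 1 (Suc n)" using M_ge[of 1 y "Suc n"] y by simp
      finally show ?thesis using x by (simp add: field_simps)
    next
      case False
      have ex: "1 \<le> exp 1 * x" using mult_mono[of 1 "exp 1" 1 x] x by simp
      have "x * (y ^ n * exp (- 1 * \<omega> y)) \<le> x * (x ^ n * 1)"
        using False y x w_nonneg[of y] by (intro mult_left_mono mult_mono power_mono) auto
      also have "\<dots> = x * x ^ n * (exp (real n) * exp (- real n))" by (simp add: exp_minus)
      also have "\<dots> \<le> (exp 1 * x) * x ^ n * (exp (real n) * exp (- 1 * \<omega> (exp 1 * x)))"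
        using x le by (intro mult_mono) auto
      also have "\<dots> = (exp 1 * x) ^ Suc n * exp (- 1 * \<omega> (exp 1 * x))"
        using exp_of_nat_mult[of n "1::real"] by (simp add: power_mult_distrib)
      also have "\<dots> \<le> M 1 (Suc n)" using ex by (intro M_ge) auto
      finally show ?thesis using x by (simp add: field_simps)
    qed
  qed simp
  then show ?thesis using x M_pos[of 1 "Suc n"] by (simp add: field_simps)
qed

text \<open>Integral test on the blocks from exp (k + 1) to exp (k + 2), with \<omega> bounded below
  by its value at the left end and 1 / x^2 by its value at the right end.\<close>

lemma summable_w_exp: "summable (\<lambda>k. exp (- real k) * \<omega> (exp (real k + 1)))"
proof -
  \<comment> \<open>The length of the k-th block times exp (- 2 * (k + 2)) is \<kappa> * exp (-
    k).\<close>
  define \<kappa> where "\<kappa> = exp (-4) * (exp 2 - exp 1 :: real)"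
  have \<kappa>: "0 < \<kappa>" by (simp add: \<kappa>_def)
  define g where "g x = \<omega> x / x\<^sup>2" for x
  have int: "set_integrable lborel {1..} g" using w by (simp add: weight_def g_def[abs_def])
  have sub: "set_integrable lborel S g" if "S \<subseteq> {1..}" "S \<in> sets lborel" for S
    using set_integrable_subset[OF int] that by blast
  have e1: "1 \<le> exp (real k + 1)" for k by simp
  have e4: "exp (4 :: real) = exp 2 * exp 2" by (simp add: exp_add[symmetric])
  have step: "\<kappa> * (exp (- real k) * \<omega> (exp (real k + 1))) \<le> (LINT x:{exp (real k + 1)..<exp (real k + 2)}|lborel. g x)" for k
  proof -
    define S where "S = {exp (real k + 1)..<exp (real k + 2)}"
    have S1: "S \<subseteq> {1..}" unfolding S_def using order_trans[OF e1[of k]] by force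
    have "\<kappa> * (exp (- real k) * \<omega> (exp (real k + 1))) = (exp (real k + 2) - exp (real k + 1)) * (\<omega> (exp (real k + 1)) / (exp (real k + 2))\<^sup>2)"
      using e4 by (simp add: \<kappa>_def power2_eq_square exp_add exp_minus field_simps)
    also have "\<dots> = (LINT x:S|lborel. \<omega> (exp (real k + 1)) / (exp (real k + 2))\<^sup>2)"
      by (simp add: S_def set_lebesgue_integral_def mult.commute)
    also have "\<dots> \<le> (LINT x:S|lborel. g x)"
    proof (rule set_integral_mono)
      show "set_integrable lborel S (\<lambda>x. \<omega> (exp (real k + 1)) / (exp (real k + 2))\<^sup>2)"
        unfolding set_integrable_def by (rule integrable_scaleR_left) (simp add: S_def)
      show "set_integrable lborel S g" by (rule sub[OF S1]) (simp add: S_def)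
      fix x assume x: "x \<in> S"
      have "0 < x" using x by (auto simp: S_def intro: less_le_trans[OF exp_gt_zero])
      then show "\<omega> (exp (real k + 1)) / (exp (real k + 2))\<^sup>2 \<le> g x" unfolding g_def
        using x w_nonneg[of x] by (intro frac_le power_mono w_mono) (auto simp: S_def)
    qed
    finally show ?thesis by (simp add: S_def)
  qed
  have part: "(\<Sum>k<N. \<kappa> * (exp (- real k) * \<omega> (exp (real k + 1)))) \<le> (LINT x:{exp 1..<exp (real N + 1)}|lborel. g x)" for N
  proof (induction N)
    case (Suc N)
    have "(LINT x:{exp 1..<exp (real N + 1)} \<union> {exp (real N + 1)..<exp (real N + 2)}|lborel. g x)
       = (LINT x:{exp 1..<exp (real N + 1)}|lborel. g x) + (LINT x:{exp (real N + 1)..<exp (real N + 2)}|lborel. g x)"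
    proof (rule set_integral_Un)
      show "set_integrable lborel {exp 1..<exp (real N + 1)} g" "set_integrable lborel {exp (real N + 1)..<exp (real N + 2)} g"
        using order_trans[OF e1[of N]] order_trans[OF e1[of 0]] by (force intro!: sub)+
    qed auto
    moreover have "{exp 1..<exp (real N + 1)} \<union> {exp (real N + 1)..<exp (real N + 2)} = {exp 1..<exp (real (Suc N) + 1)}"
      by (subst ivl_disj_un_two(3)) (auto simp: add_ac)
    ultimately show ?case using Suc step[of N] by simp
  qed (simp add: set_lebesgue_integral_def)
  have "(LINT x:{exp 1..<exp (real N + 1)}|lborel. g x) \<le> (LINT x:{1..}|lborel. g x)" for N
  proof -
    have S: "{exp 1..<exp (real N + 1)} \<subseteq> {1..}" using order_trans[OF e1[of 0]] by force
    show ?thesis unfolding set_lebesgue_integral_def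
    proof (rule integral_mono)
      show "integrable lborel (\<lambda>x. indicat_real {exp 1..<exp (real N + 1)} x *\<^sub>R g x)"
        using sub[OF S] by (simp add: set_integrable_def)
      show "integrable lborel (\<lambda>x. indicat_real {1..} x *\<^sub>R g x)"
        using int by (simp add: set_integrable_def)
      show "indicat_real {exp 1..<exp (real N + 1)} x *\<^sub>R g x \<le> indicat_real {1..} x *\<^sub>R g x" for x
        using S w_nonneg[of x] by (auto simp: g_def indicator_def subset_eq)
    qed
  qed
  then have "(\<Sum>k<N. \<kappa> * (exp (- real k) * \<omega> (exp (real k + 1)))) \<le> (LINT x:{1..}|lborel. g x)" for N
    using part order_trans by blast
  then have "summable (\<lambda>k. \<kappa> * (exp (- real k) * \<omega> (exp (real k + 1))))"
    using \<kappa> w_nonneg by (intro summableI_nonneg_bounded) auto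
  then show ?thesis using \<kappa> by simp
qed

text \<open>
  Non-quasianalyticity: here the convergence of the integral of $\omega(x)/x^2$ enters.
\<close>

lemma summable_M_ratio: "summable (\<lambda>n. M 1 n / M 1 (Suc n))"
proof -
  define u where "u n = M 1 n / M 1 (Suc n)" for n
  \<comment> \<open>Double counting: for n \<ge> N0 the ratio u n is at most exp 1 times the sum
    over k of f k n. Summed over n first, each k contributes at most exp (- k) * (\<omega> (exp (k +
    1)) + 1).\<close>
  define f where "f k n = exp (- real k) * (if real n < \<omega> (exp (real k + 1)) then 1 else 0)" for k n
  \<comment> \<open>From this index on, the least index K chosen below is positive and has a
    predecessor to which \<open>M_ratio\<close> applies.\<close>
  define N0 where "N0 = nat \<lceil>\<omega> (exp 1)\<rceil>"
  have geo: "summable (\<lambda>k. exp (- real k))"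
  proof -
    have "(\<lambda>k. exp (- real k)) = (\<lambda>k. exp (-1) ^ k)" by (auto simp: exp_of_nat_mult[symmetric])
    then show ?thesis by (simp add: summable_geometric)
  qed
  have smf: "summable (\<lambda>k. f k n)" for n
    by (rule summable_comparison_test'[OF geo, of 0]) (simp add: f_def)
  have ub: "u n \<le> exp 1 * (\<Sum>k. f k n)" if n: "N0 \<le> n" for n
  proof -
    have ex: "\<exists>k. real n < \<omega> (exp (real k + 1))"
    proof -
      have "ln \<in> o[at_top](\<omega>)" using w by (simp add: weight_def)
      from landau_o.smallD[OF this, of "1 / (real n + 1)"]
      have "\<forall>\<^sub>F x in at_top. \<bar>ln x\<bar> \<le> 1 / (real n + 1) * \<bar>\<omega> x\<bar>" by simp
      then obtain X where X: "\<And>x. X \<le> x \<Longrightarrow> \<bar>ln x\<bar> \<le> 1 / (real n + 1) * \<bar>\<omega> x\<bar>"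
        by (auto simp: eventually_at_top_linorder)
      obtain k where k: "ln (max 1 X) \<le> real k" using real_arch_simple by blast
      then have "max 1 X \<le> exp (real k)" by (metis exp_le_cancel_iff exp_ln less_le_trans max.cobounded1 zero_less_one)
      also have "exp (real k) \<le> exp (real k + 1)" by simp
      finally have "\<bar>ln (exp (real k + 1))\<bar> \<le> 1 / (real n + 1) * \<bar>\<omega> (exp (real k + 1))\<bar>"
        by (intro X) simp
      then have "(real k + 1) * (real n + 1) \<le> \<omega> (exp (real k + 1))"
        using w_nonneg[of "exp (real k + 1)"] by (simp add: field_simps)
      moreover have "real n + 1 \<le> (real k + 1) * (real n + 1)" by (simp add: mult_le_cancel_right1)
      ultimately show ?thesis by (intro exI[of _ k]) linarith
    qed
    define K where "K = (LEAST k. real n < \<omega> (exp (real k + 1)))"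
    have K: "real n < \<omega> (exp (real K + 1))" unfolding K_def using ex by (rule LeastI_ex)
    have "K \<noteq> 0"
    proof
      assume "K = 0"
      then have "real n < \<omega> (exp 1)" using K by simp
      then show False using n unfolding N0_def by linarith
    qed
    then obtain k where k: "K = Suc k" by (cases K) auto
    have "\<not> real n < \<omega> (exp (real k + 1))" using not_less_Least[of k "\<lambda>k. real n < \<omega> (exp (real k + 1))"] k unfolding K_def by simp
    then have "\<omega> (exp 1 * exp (real k)) \<le> real n" by (simp add: exp_add[symmetric] add.commute)
    then have "u n \<le> 1 / exp (real k)" unfolding u_def by (intro M_ratio) auto
    also have "\<dots> = exp 1 * f K n" using K by (simp add: f_def k exp_add exp_minus exp_diff field_simps)
    also have "f K n \<le> (\<Sum>k. f k n)"
      using sum_le_suminf[OF smf, of "{K}"] by (simp add: f_def)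
    finally show ?thesis by simp
  qed
  have smS: "summable (\<lambda>k. exp (- real k) * (\<omega> (exp (real k + 1)) + 1))"
    using summable_add[OF summable_w_exp geo] by (simp add: algebra_simps)
  have "(\<Sum>n<N. u (n + N0)) \<le> exp 1 * (\<Sum>k. exp (- real k) * (\<omega> (exp (real k + 1)) + 1))" for N
  proof -
    have "(\<Sum>n<N. u (n + N0)) \<le> (\<Sum>n<N. exp 1 * (\<Sum>k. f k (n + N0)))"
      by (intro sum_mono ub) simp
    also have "\<dots> = exp 1 * (\<Sum>k. \<Sum>n<N. f k (n + N0))"
      unfolding sum_distrib_left[symmetric] by (subst suminf_sum) (auto intro: smf)
    also have "(\<Sum>k. \<Sum>n<N. f k (n + N0)) \<le> (\<Sum>k. exp (- real k) * (\<omega> (exp (real k + 1)) + 1))"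
    proof (rule suminf_le)
      fix k
      define W where "W = \<omega> (exp (real k + 1))"
      have W: "0 \<le> W" by (simp add: W_def w_nonneg)
      have "(\<Sum>n<N. if real (n + N0) < W then 1 else 0 :: real) \<le> (\<Sum>n<N. if real n < W then 1 else 0)"
        by (intro sum_mono) auto
      also have "\<dots> = real (card {n\<in>{..<N}. real n < W})" by (simp add: sum.If_cases Int_def)
      also have "card {n\<in>{..<N}. real n < W} \<le> card {..<nat \<lceil>W\<rceil>}"
        by (intro card_mono) (auto, linarith)
      also have "real (card {..<nat \<lceil>W\<rceil>}) \<le> W + 1" using W by simp
      finally have "(\<Sum>n<N. if real (n + N0) < W then 1 else 0 :: real) \<le> W + 1" by simp
      then show "(\<Sum>n<N. f k (n + N0)) \<le> exp (- real k) * (\<omega> (exp (real k + 1)) + 1)"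
        unfolding f_def sum_distrib_left[symmetric] W_def by (intro mult_left_mono) auto
    qed (auto intro!: summable_sum smf smS)
    finally show ?thesis by simp
  qed
  then have "summable (\<lambda>n. u (n + N0))"
    by (intro summableI_nonneg_bounded) (auto simp: u_def less_imp_le M_pos)
  then show ?thesis using summable_iff_shift[of u N0] unfolding u_def by blast
qed

text \<open>With the ratios M 1 n / M 1 (Suc n) as radii the derivative bounds telescope to a
  multiple of M 1 j.\<close>

lemma smooth_step:
  assumes "0 < e"
  obtains \<sigma> :: "nat \<Rightarrow> real \<Rightarrow> real" and C where
    "\<And>j x. (\<sigma> j has_real_derivative \<sigma> (Suc j) x) (at x)"
    "\<And>j x. \<bar>\<sigma> j x\<bar> \<le> C * M 1 j"
    "\<And>x. x \<le> s - e \<Longrightarrow> \<sigma> 0 x = 0" "\<And>x. s + e \<le> x \<Longrightarrow> \<sigma> 0 x = 1"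
proof -
  define u where "u n = M 1 n / M 1 (Suc n)" for n
  have u: "0 < u n" for n by (simp add: u_def M_pos)
  have "summable u" using summable_M_ratio by (simp add: u_def[abs_def])
  from smooth_step_exists[OF u this assms, where s=s] obtain \<sigma> C where \<sigma>:
    "\<And>j x. (\<sigma> j has_real_derivative \<sigma> (Suc j) x) (at x)"
    "\<And>j x. \<bar>\<sigma> j x\<bar> \<le> C * (\<Prod>n<j. 1 / u n)"
    "\<And>x. x \<le> s - e \<Longrightarrow> \<sigma> 0 x = 0" "\<And>x. s + e \<le> x \<Longrightarrow> \<sigma> 0 x = 1" by blast
  have "(\<Prod>n<j. 1 / u n) = M 1 j / M 1 0" for j
    using M_pos[of 1] by (induction j) (auto simp: u_def less_imp_neq[symmetric])
  then have "\<bar>\<sigma> j x\<bar> \<le> C / M 1 0 * M 1 j" for j x using \<sigma>(2)[of j x] by simp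
  then show ?thesis using that \<sigma> by blast
qed

end

section \<open>Functions given by the sequence of their derivatives\<close>

text \<open>Functions are carried together with the family of all their derivatives, so that bounds
  on every derivative are plain inequalities; multiplication becomes this operation on
  families.\<close>

definition leibniz :: "(nat \<Rightarrow> real \<Rightarrow> real) \<Rightarrow> (nat \<Rightarrow> real \<Rightarrow> complex) \<Rightarrow> nat \<Rightarrow> real \<Rightarrow> complex" where
  "leibniz \<eta> F j x = (\<Sum>i\<le>j. of_nat (j choose i) * of_real (\<eta> i x) * F (j - i) x)"

lemma leibniz_0 [simp]: "leibniz \<eta> F 0 x = of_real (\<eta> 0 x) * F 0 x"
  by (simp add: leibniz_def)

lemma leibniz_derivative:
  assumes \<eta>: "\<And>j. (\<eta> j has_real_derivative \<eta> (Suc j) x) (at x)"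
    and F: "\<And>j. (F j has_vector_derivative F (Suc j) x) (at x)"
  shows "(leibniz \<eta> F j has_vector_derivative leibniz \<eta> F (Suc j) x) (at x)"
proof -
  have \<eta>v: "((\<lambda>x. complex_of_real (\<eta> i x)) has_vector_derivative of_real (\<eta> (Suc i) x)) (at x)" for i
    by (rule has_vector_derivative_of_real[OF \<eta>])
  have "((\<lambda>x. \<Sum>i\<le>j. of_nat (j choose i) * (of_real (\<eta> i x) * F (j - i) x)) has_vector_derivative
     (\<Sum>i\<le>j. of_nat (j choose i) * (of_real (\<eta> i x) * F (Suc (j - i)) x + of_real (\<eta> (Suc i) x) * F (j - i) x))) (at x)"
    by (intro has_vector_derivative_sum has_vector_derivative_mult_right has_vector_derivative_mult \<eta>v F)
  moreover have "(\<Sum>i\<le>j. of_nat (j choose i) * (of_real (\<eta> i x) * F (Suc (j - i)) x + of_real (\<eta> (Suc i) x) * F (j - i) x)) = leibniz \<eta> F (Suc j) x"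
  proof -
    define P where "P i = complex_of_real (\<eta> i x) * F (Suc j - i) x" for i
    have "(\<Sum>i\<le>j. of_nat (j choose i) * (of_real (\<eta> i x) * F (Suc (j - i)) x + of_real (\<eta> (Suc i) x) * F (j - i) x))
       = (\<Sum>i\<le>j. of_nat (j choose i) * P i) + (\<Sum>i\<le>j. of_nat (j choose i) * P (Suc i))"
      unfolding P_def sum.distrib[symmetric]
      by (intro sum.cong) (auto simp: Suc_diff_le algebra_simps)
    also have "(\<Sum>i\<le>j. of_nat (j choose i) * P i) = P 0 + (\<Sum>i\<le>j. of_nat (j choose Suc i) * P (Suc i))"
    proof -
      have "(\<Sum>i\<le>j. of_nat (j choose i) * P i) = (\<Sum>i\<le>Suc j. of_nat (j choose i) * P i)" by simp
      also have "\<dots> = P 0 + (\<Sum>i\<le>j. of_nat (j choose Suc i) * P (Suc i))"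
        by (subst sum.atMost_Suc_shift) simp
      finally show ?thesis .
    qed
    also have "P 0 + (\<Sum>i\<le>j. of_nat (j choose Suc i) * P (Suc i)) + (\<Sum>i\<le>j. of_nat (j choose i) * P (Suc i))
       = P 0 + (\<Sum>i\<le>j. of_nat (Suc j choose Suc i) * P (Suc i))"
      by (simp add: sum.distrib[symmetric] algebra_simps)
    also have "\<dots> = (\<Sum>i\<le>Suc j. of_nat (Suc j choose i) * P i)"
      by (subst sum.atMost_Suc_shift) simp
    also have "\<dots> = leibniz \<eta> F (Suc j) x" by (simp add: leibniz_def P_def mult.assoc del: sum.atMost_Suc)
    finally show ?thesis .
  qed
  ultimately show ?thesis by (simp add: leibniz_def[abs_def] mult.assoc)
qed

lemma family_zero_on_open:
  assumes d: "\<And>j x. x \<in> S \<Longrightarrow> (F j has_vector_derivative F (Suc j) x) (at x)"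
    and "open S" and z: "\<And>x. x \<in> S \<Longrightarrow> F 0 x = (0 :: complex)" and x: "x \<in> S"
  shows "F j x = 0"
  using x
proof (induction j arbitrary: x)
  case (Suc j)
  have "(F j has_vector_derivative 0) (at x)"
    by (rule has_vector_derivative_transform_within_open[of "\<lambda>_. 0" _ _ S])
       (use Suc \<open>open S\<close> in auto)
  then show ?case using d[OF Suc.prems, of j] vector_derivative_at by metis
qed (simp add: z)

lemma family_zero_on_interval:
  assumes d: "\<And>j x. (F j has_vector_derivative F (Suc j) x) (at x)"
    and st: "s < t" and z: "\<And>x. s \<le> x \<Longrightarrow> x \<le> t \<Longrightarrow> F 0 x = (0 :: complex)" and x: "s \<le> x" "x \<le> t"
  shows "F j x = 0"
proof -
  have zo: "F j y = 0" if "y \<in> {s<..<t}" for y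
    by (rule family_zero_on_open[of "{s<..<t}" F]) (use d z that in auto)
  have "continuous_on {s..t} (F j)"
    using d by (meson continuous_at_imp_continuous_on has_vector_derivative_continuous)
  moreover have "x \<in> closure {s<..<t}" using x st by simp
  ultimately show ?thesis
    using continuous_constant_on_closure[of "{s<..<t}" "F j" 0 x] zo st by simp
qed

lemma sym_ival_open: "open (sym_ival a)"
proof -
  have "sym_ival a = ereal -` {- a<..<a}" by (auto simp: sym_ival_def)
  then show ?thesis by (simp add: open_ereal_vimage)
qed

section \<open>The space of ultradifferentiable functions and its whole-line version\<close>

context weight_setting
begin

abbreviation "U \<equiv> U_space \<omega> a c"

definition Dn :: "(real \<Rightarrow> complex) \<Rightarrow> nat \<Rightarrow> real \<Rightarrow> complex" where
  "Dn f j = (D_op a ^^ j) f"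

lemma Dn_0 [simp]: "Dn f 0 = f" by (simp add: Dn_def)
lemma Dn_Suc: "Dn f (Suc j) = D_op a (Dn f j)" by (simp add: Dn_def)

lemma c_pos: "0 < c k" using c_exh by (simp add: exhausting_seq_def)

lemma c_mono: "k \<le> l \<Longrightarrow> c k \<le> c l" using c_exh by (auto simp: exhausting_seq_def incseq_def)

lemma sym_abs: "x \<in> sym_ival a \<longleftrightarrow> ereal \<bar>x\<bar> < a"
proof -
  have "(- a < ereal x) = (ereal (- x) < a)"
    by (metis ereal_minus_less_minus ereal_uminus_uminus uminus_ereal.simps(1))
  moreover have "ereal \<bar>x\<bar> < a \<longleftrightarrow> ereal x < a \<and> ereal (- x) < a"
    by (cases a) (auto simp: abs_less_iff)
  ultimately show ?thesis by (auto simp: sym_ival_def)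
qed

lemma sym_c: "\<bar>x\<bar> \<le> c k \<Longrightarrow> x \<in> sym_ival a"
  using c_exh unfolding sym_abs exhausting_seq_def by (metis ereal_less_eq(3) le_less_trans)

lemma sym_obtain:
  assumes "x \<in> sym_ival a" obtains k where "\<bar>x\<bar> < c k"
proof -
  have "(\<lambda>k. ereal (c k)) \<longlonglongrightarrow> a" using c_exh by (simp add: exhausting_seq_def)
  then have "\<forall>\<^sub>F k in sequentially. ereal \<bar>x\<bar> < ereal (c k)"
    using assms unfolding sym_abs by (rule order_tendstoD(1))
  then show ?thesis using that eventually_happens'[OF sequentially_bot] by force
qed

lemma zero_in_sym: "0 \<in> sym_ival a" using sym_c[of 0 0] c_pos[of 0] by simp

text \<open>
  Elements of \<open>TF\<close> live on the whole line, whatever $a$ is, so that they can be translated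
  freely; \<open>emb\<close> returns to $(-a;a)$.
\<close>

definition TF :: "(nat \<Rightarrow> real \<Rightarrow> complex) set" where
  "TF = {F. (\<forall>j x. (F j has_vector_derivative F (Suc j) x) (at x)) \<and>
        (\<forall>q R. 0 < q \<longrightarrow> q < 1 \<longrightarrow> (\<exists>B. \<forall>j x. \<bar>x\<bar> \<le> R \<longrightarrow> norm (F j x) \<le> B * M q j))}"

definition emb :: "(nat \<Rightarrow> real \<Rightarrow> complex) \<Rightarrow> real \<Rightarrow> complex" where
  "emb F x = (if x \<in> sym_ival a then F 0 x else 0)"

text \<open>
  \<open>bd q k B f\<close> says $\|f\|_{\omega,q,k} \le B$; it replaces the extended-real semi-norm.
\<close>

definition bd :: "real \<Rightarrow> nat \<Rightarrow> real \<Rightarrow> (real \<Rightarrow> complex) \<Rightarrow> bool" where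
  "bd q k B f \<longleftrightarrow> (\<forall>j x. \<bar>x\<bar> \<le> c k \<longrightarrow> norm (Dn f j x) \<le> B * M q j)"

lemma TF_D: "F \<in> TF \<Longrightarrow> (F j has_vector_derivative F (Suc j) x) (at x)"
  by (simp add: TF_def)

lemma TF_B:
  assumes "F \<in> TF" "0 < q" "q < 1"
  obtains B where "0 < B" "\<And>j x. \<bar>x\<bar> \<le> R \<Longrightarrow> norm (F j x) \<le> B * M q j"
proof -
  obtain B where B: "\<And>j x. \<bar>x\<bar> \<le> R \<Longrightarrow> norm (F j x) \<le> B * M q j"
    using assms unfolding TF_def by blast
  have "norm (F j x) \<le> max B 1 * M q j" if "\<bar>x\<bar> \<le> R" for j x
    using B[OF that, of j] mult_right_mono[OF max.cobounded1[of B 1], of "M q j"] M_pos[of q j]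
    by linarith
  then show ?thesis using that[of "max B 1"] by auto
qed

lemma seminorm_le_iff: "seminorm_U \<omega> a c q k f \<le> ereal B \<longleftrightarrow> bd q k B f"
proof -
  have "exp (- q * phi_star \<omega> (real j / q)) = inverse (M q j)" for j by (simp add: M_def exp_minus)
  then show ?thesis
    unfolding seminorm_U_def bd_def SUP_le_iff Dn_def
    using M_pos by (auto simp: abs_le_iff divide_inverse[symmetric] pos_divide_le_eq)
qed

lemma seminorm_finite_iff: "seminorm_U \<omega> a c q k f < \<infinity> \<longleftrightarrow> (\<exists>B. bd q k B f)"
proof
  assume "seminorm_U \<omega> a c q k f < \<infinity>"
  then obtain B where "seminorm_U \<omega> a c q k f < ereal B" using ereal_dense2 by blast
  then show "\<exists>B. bd q k B f" using seminorm_le_iff less_imp_le by blast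
next
  assume "\<exists>B. bd q k B f"
  then show "seminorm_U \<omega> a c q k f < \<infinity>" using seminorm_le_iff
    by (metis ereal_infty_less(1) ereal_less_eq(1) leD not_MInfty_nonneg order_le_less_trans less_ereal.simps(4) order.strict_iff_order)
qed

lemma bd_mono:
  assumes "bd q k B f" "0 < q'" "q' \<le> q" "k' \<le> k" "B \<le> B'" "0 \<le> B'"
  shows "bd q' k' B' f"
  unfolding bd_def
proof (intro allI impI)
  fix j x assume "\<bar>x\<bar> \<le> c k'"
  then have "norm (Dn f j x) \<le> B * M q j" using assms(1) c_mono[OF assms(4)] by (auto simp: bd_def)
  also have "\<dots> \<le> B' * M q' j"
    using assms M_antimono[of q' q j] M_pos[of q j] by (intro mult_mono) (auto intro: less_imp_le)
  finally show "norm (Dn f j x) \<le> B' * M q' j" .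
qed

lemma bd_nonneg: "bd q k B f \<Longrightarrow> 0 \<le> B"
proof -
  assume "bd q k B f"
  then have "norm (Dn f 0 0) \<le> B * M q 0" using c_pos[of k] unfolding bd_def
    by (metis abs_zero less_imp_le)
  then have "0 \<le> B * M q 0" by (meson norm_ge_zero order_trans)
  then show ?thesis using M_pos[of q 0] by (simp add: zero_le_mult_iff)
qed

lemma Dn_eq:
  assumes "\<And>x. x \<in> sym_ival a \<Longrightarrow> f x = G 0 x"
    and "\<And>j x. x \<in> sym_ival a \<Longrightarrow> (G j has_vector_derivative G (Suc j) x) (at x)"
    and "x \<in> sym_ival a"
  shows "Dn f j x = G j x"
  using assms(3)
proof (induction j arbitrary: x)
  case (Suc j)
  have "(Dn f j has_vector_derivative G (Suc j) x) (at x)"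
    by (rule has_vector_derivative_transform_within_open[OF assms(2)[OF Suc.prems, of j] sym_ival_open Suc.prems])
       (simp add: Suc.IH)
  then show ?case using Suc.prems by (simp add: Dn_Suc D_op_def vector_derivative_at)
qed (simp add: assms(1))

lemma U_intro:
  assumes "\<And>x. x \<in> sym_ival a \<Longrightarrow> f x = G 0 x" "\<And>x. x \<notin> sym_ival a \<Longrightarrow> f x = 0"
    and "\<And>j x. x \<in> sym_ival a \<Longrightarrow> (G j has_vector_derivative G (Suc j) x) (at x)"
    and "\<And>q k. 0 < q \<Longrightarrow> q < 1 \<Longrightarrow> \<exists>B. \<forall>j x. \<bar>x\<bar> \<le> c k \<longrightarrow> norm (G j x) \<le> B * M q j"
  shows "f \<in> U"
proof -
  have eq: "Dn f j x = G j x" if "x \<in> sym_ival a" for j x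
    using Dn_eq[where f=f and G=G] assms that by blast
  have "smooth_fun a f" unfolding smooth_fun_def Dn_def[symmetric]
  proof (intro allI ballI)
    fix j x assume x: "x \<in> sym_ival a"
    have "(Dn f j has_vector_derivative G (Suc j) x) (at x)"
      by (rule has_vector_derivative_transform_within_open[OF assms(3)[OF x, of j] sym_ival_open x]) (simp add: eq)
    then show "Dn f j differentiable at x" by (rule differentiableI_vector)
  qed
  moreover have "seminorm_U \<omega> a c q k f < \<infinity>" if "q \<in> {0<..<1}" for q k
  proof -
    obtain B where "\<forall>j x. \<bar>x\<bar> \<le> c k \<longrightarrow> norm (G j x) \<le> B * M q j" using assms(4)[of q k] \<open>q \<in> _\<close> by auto
    then have "bd q k B f" using eq[OF sym_c] by (simp add: bd_def)
    then show ?thesis using seminorm_finite_iff by blast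
  qed
  ultimately show ?thesis using assms(2) by (simp add: U_space_def)
qed

lemma U_D:
  assumes "f \<in> U" "x \<in> sym_ival a"
  shows "(Dn f j has_vector_derivative Dn f (Suc j) x) (at x)"
proof -
  have "Dn f j differentiable at x" using assms by (auto simp: U_space_def smooth_fun_def Dn_def)
  then show ?thesis using assms(2) by (simp add: Dn_Suc D_op_def vector_derivative_works)
qed

lemma U_0: "f \<in> U \<Longrightarrow> x \<notin> sym_ival a \<Longrightarrow> f x = 0" by (auto simp: U_space_def)

lemma U_bd: "f \<in> U \<Longrightarrow> 0 < q \<Longrightarrow> q < 1 \<Longrightarrow> \<exists>B. bd q k B f"
  using seminorm_finite_iff by (auto simp: U_space_def)

lemma Dn_add: "f \<in> U \<Longrightarrow> g \<in> U \<Longrightarrow> x \<in> sym_ival a \<Longrightarrow> Dn (f + g) j x = Dn f j x + Dn g j x"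
  by (rule Dn_eq[of _ "\<lambda>j x. Dn f j x + Dn g j x"]) (auto intro!: has_vector_derivative_add U_D)

lemma Dn_scale: "f \<in> U \<Longrightarrow> x \<in> sym_ival a \<Longrightarrow> Dn (cscale z f) j x = z * Dn f j x"
  by (rule Dn_eq[of _ "\<lambda>j x. z * Dn f j x"]) (auto intro!: has_vector_derivative_mult_right U_D simp: cscale_def)

lemma bd_add: "f \<in> U \<Longrightarrow> g \<in> U \<Longrightarrow> bd q k B f \<Longrightarrow> bd q k B' g \<Longrightarrow> bd q k (B + B') (f + g)"
  unfolding bd_def
proof (intro allI impI)
  fix j x
  assume f: "f \<in> U" and g: "g \<in> U" and B: "\<forall>j x. \<bar>x\<bar> \<le> c k \<longrightarrow> norm (Dn f j x) \<le> B * M q j"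
    and B': "\<forall>j x. \<bar>x\<bar> \<le> c k \<longrightarrow> norm (Dn g j x) \<le> B' * M q j" and x: "\<bar>x\<bar> \<le> c k"
  show "norm (Dn (f + g) j x) \<le> (B + B') * M q j"
    unfolding Dn_add[OF f g sym_c[OF x]] distrib_right
    using B x B' by (intro norm_triangle_le add_mono) blast+
qed

lemma bd_scale:
  assumes "f \<in> U" "bd q k B f" shows "bd q k (norm z * B) (cscale z f)"
  unfolding bd_def
proof (intro allI impI)
  fix j x assume x: "\<bar>x\<bar> \<le> c k"
  have "norm z * norm (Dn f j x) \<le> norm z * (B * M q j)"
    using assms x by (intro mult_left_mono) (auto simp: bd_def)
  then show "norm (Dn (cscale z f) j x) \<le> norm z * B * M q j"
    using Dn_scale[OF assms(1) sym_c[OF x]] by (simp add: norm_mult mult.assoc)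
qed

lemma U_add: "f \<in> U \<Longrightarrow> g \<in> U \<Longrightarrow> f + g \<in> U"
proof -
  assume f: "f \<in> U" and g: "g \<in> U"
  have "\<exists>B. \<forall>j x. \<bar>x\<bar> \<le> c k \<longrightarrow> norm (Dn f j x + Dn g j x) \<le> B * M q j" if q: "0 < q" "q < 1" for q k
  proof -
    obtain B B' where "bd q k B f" "bd q k B' g" using U_bd[OF f q] U_bd[OF g q] by blast
    then have "\<bar>x\<bar> \<le> c k \<longrightarrow> norm (Dn f j x + Dn g j x) \<le> (B + B') * M q j" for j x
      unfolding bd_def distrib_right by (auto intro!: norm_triangle_le add_mono)
    then show ?thesis by blast
  qed
  then show ?thesis
    by (intro U_intro[of _ "\<lambda>j x. Dn f j x + Dn g j x"])
       (auto intro!: has_vector_derivative_add U_D f g simp: U_0[OF f] U_0[OF g])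
qed

lemma U_scale: "f \<in> U \<Longrightarrow> cscale z f \<in> U"
proof -
  assume f: "f \<in> U"
  have "\<exists>B. \<forall>j x. \<bar>x\<bar> \<le> c k \<longrightarrow> norm (z * Dn f j x) \<le> B * M q j" if q: "0 < q" "q < 1" for q k
  proof -
    obtain B where B: "bd q k B f" using U_bd[OF f q] by blast
    have "\<bar>x\<bar> \<le> c k \<longrightarrow> norm (z * Dn f j x) \<le> (norm z * B) * M q j" for j x
      using B unfolding bd_def norm_mult mult.assoc by (auto intro!: mult_left_mono)
    then show ?thesis by blast
  qed
  then show ?thesis
    by (intro U_intro[of _ "\<lambda>j x. z * Dn f j x"])
       (auto intro!: has_vector_derivative_mult_right U_D f simp: U_0[OF f] cscale_def)
qed

lemma U_zero: "0 \<in> U"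
  by (rule U_intro[of _ "\<lambda>j x. 0"]) (auto intro!: exI[of _ 0])

lemma U_diff: "f \<in> U \<Longrightarrow> g \<in> U \<Longrightarrow> f - g \<in> U"
proof -
  assume "f \<in> U" "g \<in> U"
  moreover have "f - g = f + cscale (-1) g" by (auto simp: cscale_def fun_eq_iff)
  ultimately show ?thesis by (metis U_add U_scale)
qed

lemma subspace_U: "module.subspace cscale U"
  by (auto simp: cfun.subspace_def U_zero U_add U_scale)

lemma U_Dop: "f \<in> U \<Longrightarrow> D_op a f \<in> U"
proof -
  assume f: "f \<in> U"
  have eq: "Dn (D_op a f) j = Dn f (Suc j)" for j by (simp only: Dn_def funpow_Suc_right o_apply)
  have "\<exists>B. \<forall>j x. \<bar>x\<bar> \<le> c k \<longrightarrow> norm (Dn f (Suc j) x) \<le> B * M q j" if q: "0 < q" "q < 1" for q k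
  proof -
    \<comment> \<open>Intermediate index between q and 1: the loss from p to q pays for the
      derivative.\<close>
    define p where "p = (q + 1) / 2"
    have p: "q < p" "p < 1" "0 < p" using q by (auto simp: p_def)
    obtain B where B: "bd p k B f" using U_bd[OF f p(3,2)] by blast
    have "norm (Dn f (Suc j) x) \<le> (B * M (p - q) 1) * M q j" if "\<bar>x\<bar> \<le> c k" for j x
    proof -
      have "norm (Dn f (Suc j) x) \<le> B * M p (Suc j)" using B that unfolding bd_def by blast
      also have "\<dots> \<le> B * (M (p - q) 1 * M q j)"
        using bd_nonneg[OF B] M_shift[of q p j] q p by (intro mult_left_mono) auto
      finally show ?thesis by simp
    qed
    then show ?thesis by blast
  qed
  then show ?thesis using U_D[OF f]
    by (intro U_intro[of _ "\<lambda>j. Dn f (Suc j)"]) (auto simp: Dn_Suc[of f 0] D_op_def[of a f])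
qed

lemma Dn_emb: "F \<in> TF \<Longrightarrow> x \<in> sym_ival a \<Longrightarrow> Dn (emb F) j x = F j x"
  by (rule Dn_eq) (auto simp: emb_def TF_D)

lemma emb_U: "F \<in> TF \<Longrightarrow> emb F \<in> U"
  by (rule U_intro[of _ F]) (simp_all add: emb_def TF_def)

lemma bd_emb: "F \<in> TF \<Longrightarrow> bd q k B (emb F) \<longleftrightarrow> (\<forall>j x. \<bar>x\<bar> \<le> c k \<longrightarrow> norm (F j x) \<le> B * M q j)"
  unfolding bd_def using Dn_emb sym_c by auto

lemma TF_add: "F \<in> TF \<Longrightarrow> G \<in> TF \<Longrightarrow> F + G \<in> TF"
proof -
  assume F: "F \<in> TF" and G: "G \<in> TF"
  have "\<exists>B. \<forall>j x. \<bar>x\<bar> \<le> R \<longrightarrow> norm ((F + G) j x) \<le> B * M q j" if q: "0 < q" "q < 1" for q R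
  proof -
    obtain B B' where "\<And>j x. \<bar>x\<bar> \<le> R \<Longrightarrow> norm (F j x) \<le> B * M q j" "\<And>j x. \<bar>x\<bar> \<le> R \<Longrightarrow> norm (G j x) \<le> B' * M q j"
      using TF_B[OF F q] TF_B[OF G q] by metis
    then have "\<bar>x\<bar> \<le> R \<longrightarrow> norm ((F + G) j x) \<le> (B + B') * M q j" for j x
      by (auto simp: distrib_right intro!: norm_triangle_le add_mono)
    then show ?thesis by blast
  qed
  moreover have "((F + G) j has_vector_derivative (F + G) (Suc j) x) (at x)" for j x
    using has_vector_derivative_add[OF TF_D[OF F, of j x] TF_D[OF G, of j x]] by (simp add: plus_fun_def)
  ultimately show ?thesis by (simp add: TF_def)
qed

lemma TF_scale: "F \<in> TF \<Longrightarrow> (\<lambda>j. cscale z (F j)) \<in> TF"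
proof -
  assume F: "F \<in> TF"
  have "\<exists>B. \<forall>j x. \<bar>x\<bar> \<le> R \<longrightarrow> norm (cscale z (F j) x) \<le> B * M q j" if q: "0 < q" "q < 1" for q R
  proof -
    obtain B where B: "\<And>j x. \<bar>x\<bar> \<le> R \<Longrightarrow> norm (F j x) \<le> B * M q j" using TF_B[OF F q] by blast
    have "\<bar>x\<bar> \<le> R \<longrightarrow> norm (cscale z (F j) x) \<le> (norm z * B) * M q j" for j x
      using B by (auto simp: cscale_def norm_mult mult.assoc intro!: mult_left_mono)
    then show ?thesis by blast
  qed
  moreover have "(cscale z (F j) has_vector_derivative cscale z (F (Suc j)) x) (at x)" for j x
    using has_vector_derivative_mult_right[OF TF_D[OF F]] by (simp add: cscale_def)
  ultimately show ?thesis by (simp add: TF_def)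
qed

lemma TF_diff: "F \<in> TF \<Longrightarrow> G \<in> TF \<Longrightarrow> F - G \<in> TF"
proof -
  assume "F \<in> TF" "G \<in> TF"
  moreover have "F - G = F + (\<lambda>j. cscale (-1) (G j))" by (auto simp: cscale_def fun_eq_iff)
  ultimately show ?thesis by (metis TF_add TF_scale)
qed

lemma emb_add: "emb (F + G) = emb F + emb G" by (auto simp: emb_def fun_eq_iff)
lemma emb_scale: "emb (\<lambda>j. cscale z (F j)) = cscale z (emb F)" by (auto simp: emb_def fun_eq_iff cscale_def)
lemma emb_diff: "emb (F - G) = emb F - emb G" by (auto simp: emb_def fun_eq_iff)

lemma TF_shift: "F \<in> TF \<Longrightarrow> (\<lambda>j. F (Suc j)) \<in> TF"
proof -
  assume F: "F \<in> TF"
  have "\<exists>B. \<forall>j x. \<bar>x\<bar> \<le> R \<longrightarrow> norm (F (Suc j) x) \<le> B * M q j" if q: "0 < q" "q < 1" for q R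
  proof -
    define p where "p = (q + 1) / 2"
    have p: "q < p" "p < 1" "0 < p" using q by (auto simp: p_def)
    obtain B where B: "0 < B" "\<And>j x. \<bar>x\<bar> \<le> R \<Longrightarrow> norm (F j x) \<le> B * M p j" using TF_B[OF F p(3,2)] by blast
    have "norm (F (Suc j) x) \<le> (B * M (p - q) 1) * M q j" if "\<bar>x\<bar> \<le> R" for j x
    proof -
      have "norm (F (Suc j) x) \<le> B * M p (Suc j)" using B that by blast
      also have "\<dots> \<le> B * (M (p - q) 1 * M q j)"
        using B M_shift[of q p j] q p by (intro mult_left_mono) auto
      finally show ?thesis by simp
    qed
    then show ?thesis by blast
  qed
  then show ?thesis using F by (auto simp: TF_def)
qed

definition translate :: "real \<Rightarrow> (nat \<Rightarrow> real \<Rightarrow> complex) \<Rightarrow> nat \<Rightarrow> real \<Rightarrow> complex" where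
  "translate y F j x = F j (x + y)"

lemma TF_translate: "F \<in> TF \<Longrightarrow> translate y F \<in> TF"
proof -
  assume F: "F \<in> TF"
  have "\<exists>B. \<forall>j x. \<bar>x\<bar> \<le> R \<longrightarrow> norm (translate y F j x) \<le> B * M q j" if q: "0 < q" "q < 1" for q R
  proof -
    obtain B where B: "\<And>j x. \<bar>x\<bar> \<le> R + \<bar>y\<bar> \<Longrightarrow> norm (F j x) \<le> B * M q j" using TF_B[OF F q] by blast
    have "\<bar>x\<bar> \<le> R \<longrightarrow> norm (translate y F j x) \<le> B * M q j" for j x
      using B[of "x + y" j] by (auto simp: translate_def)
    then show ?thesis by blast
  qed
  moreover have "(translate y F j has_vector_derivative translate y F (Suc j) x) (at x)" for j x
    unfolding translate_def[abs_def]
    using vector_diff_chain_at[of "\<lambda>x. x + y" 1 x "F j" "F (Suc j) (x + y)"] TF_D[OF F, of j "x + y"]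
    by (simp add: o_def has_vector_derivative_def has_derivative_add_const)
  ultimately show ?thesis by (simp add: TF_def)
qed

text \<open>The bound is at the limiting index 1, which lies beyond all semi-norms of the space;
  multiplication then maps each index q < 1 into any smaller one.\<close>

definition step_fam :: "(nat \<Rightarrow> real \<Rightarrow> real) \<Rightarrow> bool" where
  "step_fam \<eta> \<longleftrightarrow> (\<forall>j x. (\<eta> j has_real_derivative \<eta> (Suc j) x) (at x)) \<and> (\<exists>C. \<forall>j x. \<bar>\<eta> j x\<bar> \<le> C * M 1 j)"

text \<open>The constant does not depend on F, B or S; this uniformity makes multiplication
  continuous, and localised to any set S.\<close>

lemma leibniz_bound:
  assumes \<eta>: "step_fam \<eta>" and q: "0 < q'" "q' < q" "q < 1"
  shows "\<exists>C>0. \<forall>F B S. (\<forall>j. \<forall>x\<in>S. norm (F j x) \<le> B * M q j) \<longrightarrow> (\<forall>j. \<forall>x\<in>S. norm (leibniz \<eta> F j x) \<le> C * B * M q' j)"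
proof -
  obtain C where C: "\<And>j x. \<bar>\<eta> j x\<bar> \<le> C * M 1 j" using \<eta> by (auto simp: step_fam_def)
  obtain D where D: "\<And>j. (\<Sum>i\<le>j. real (j choose i) * M 1 i * M q (j - i)) \<le> D * M q' j"
    using M_leibniz[of q' q] q by auto
  have "0 \<le> C * M 1 0" using C[of 0 0] by linarith
  then have C0: "0 \<le> C" using M_pos[of 1 0] by (simp add: zero_le_mult_iff)
  have "norm (leibniz \<eta> F j x) \<le> (max 1 (C * D)) * B * M q' j"
    if F: "\<forall>j. \<forall>x\<in>S. norm (F j x) \<le> B * M q j" and x: "x \<in> S" for F B S j x
  proof -
    have "0 \<le> B * M q 0" using F x norm_ge_zero order_trans by blast
    then have B0: "0 \<le> B" using M_pos[of q 0] by (simp add: zero_le_mult_iff)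
    have "norm (leibniz \<eta> F j x) \<le> (\<Sum>i\<le>j. real (j choose i) * (C * M 1 i) * (B * M q (j - i)))"
      unfolding leibniz_def
    proof (intro sum_norm_le)
      fix i
      have "norm (of_real (\<eta> i x) :: complex) \<le> C * M 1 i" using C by simp
      moreover have "norm (F (j - i) x) \<le> B * M q (j - i)" using F x by blast
      ultimately show "norm (of_nat (j choose i) * of_real (\<eta> i x) * F (j - i) x) \<le> real (j choose i) * (C * M 1 i) * (B * M q (j - i))"
        unfolding norm_mult norm_of_nat using C0 M_pos[of 1 i] by (intro mult_mono) auto
    qed
    also have "\<dots> = C * B * (\<Sum>i\<le>j. real (j choose i) * M 1 i * M q (j - i))"
      by (simp add: sum_distrib_left mult_ac)
    also have "\<dots> \<le> C * B * (D * M q' j)" using D C0 B0 by (intro mult_left_mono) auto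
    also have "\<dots> = (C * D) * (B * M q' j)" by simp
    also have "\<dots> \<le> max 1 (C * D) * (B * M q' j)"
      using B0 M_pos[of q' j] by (intro mult_right_mono) auto
    finally show ?thesis by (simp add: mult.assoc)
  qed
  then show ?thesis by (intro exI[of _ "max 1 (C * D)"]) auto
qed

lemma TF_leibniz:
  assumes \<eta>: "step_fam \<eta>" and F: "F \<in> TF"
  shows "leibniz \<eta> F \<in> TF"
proof -
  have "\<exists>B. \<forall>j x. \<bar>x\<bar> \<le> R \<longrightarrow> norm (leibniz \<eta> F j x) \<le> B * M q j" if q: "0 < q" "q < 1" for q R
  proof -
    define p where "p = (q + 1) / 2"
    have p: "q < p" "p < 1" "0 < p" using q by (auto simp: p_def)
    obtain C where C: "\<And>F B S. (\<forall>j. \<forall>x\<in>S. norm (F j x) \<le> B * M p j) \<Longrightarrow> (\<forall>j. \<forall>x\<in>S. norm (leibniz \<eta> F j x) \<le> C * B * M q j)"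
      using leibniz_bound[OF \<eta>, of q p] p q by metis
    obtain B where "\<And>j x. \<bar>x\<bar> \<le> R \<Longrightarrow> norm (F j x) \<le> B * M p j" using TF_B[OF F p(3,2)] by blast
    then have "\<forall>j. \<forall>x\<in>{-R..R}. norm (F j x) \<le> B * M p j" by (auto simp: abs_le_iff)
    from C[OF this] show ?thesis by (intro exI[of _ "C * B"]) (auto simp: abs_le_iff)
  qed
  moreover have "(leibniz \<eta> F j has_vector_derivative leibniz \<eta> F (Suc j) x) (at x)" for j x
    using \<eta> TF_D[OF F] by (intro leibniz_derivative) (auto simp: step_fam_def)
  ultimately show ?thesis by (simp add: TF_def)
qed

section \<open>Cutoff functions and extension to the whole line\<close>

lemma smooth_step_fam:
  assumes "0 < e"
  obtains \<sigma> where "step_fam \<sigma>" "\<And>x. x \<le> s - e \<Longrightarrow> \<sigma> 0 x = 0" "\<And>x. s + e \<le> x \<Longrightarrow> \<sigma> 0 x = 1"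
proof -
  obtain \<sigma> C where "\<And>j x. (\<sigma> j has_real_derivative \<sigma> (Suc j) x) (at x)"
    "\<And>j x. \<bar>\<sigma> j x\<bar> \<le> C * M 1 j"
    "\<And>x. x \<le> s - e \<Longrightarrow> \<sigma> 0 x = 0" "\<And>x. s + e \<le> x \<Longrightarrow> \<sigma> 0 x = 1"
    using smooth_step[OF assms, where s=s] by blast
  then show ?thesis using that[of \<sigma>] unfolding step_fam_def by blast
qed

lemma step_fam_diff: "step_fam \<sigma> \<Longrightarrow> step_fam \<tau> \<Longrightarrow> step_fam (\<lambda>j x. \<sigma> j x - \<tau> j x)"
proof -
  assume s: "step_fam \<sigma>" and t: "step_fam \<tau>"
  then obtain C D where "\<And>j x. \<bar>\<sigma> j x\<bar> \<le> C * M 1 j" "\<And>j x. \<bar>\<tau> j x\<bar> \<le> D * M 1 j"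
    unfolding step_fam_def by metis
  then have "\<bar>\<sigma> j x - \<tau> j x\<bar> \<le> (C + D) * M 1 j" for j x
    unfolding distrib_right by (meson abs_triangle_ineq4 add_mono order_trans)
  then show ?thesis using s t unfolding step_fam_def by (auto intro!: DERIV_diff)
qed

text \<open>The difference of two steps centred at s - e/2 and t + e/2, each with transition
  half-width e/4.\<close>

lemma cutoff:
  assumes "s \<le> t" "0 < e"
  obtains \<eta> where "step_fam \<eta>" "\<And>x. s - e/4 \<le> x \<Longrightarrow> x \<le> t + e/4 \<Longrightarrow> \<eta> 0 x = 1"
    "\<And>j x. x \<le> s - e \<or> t + e \<le> x \<Longrightarrow> \<eta> j x = 0"
proof -
  obtain \<sigma> where \<sigma>: "step_fam \<sigma>" "\<And>x. x \<le> (s - e/2) - e/4 \<Longrightarrow> \<sigma> 0 x = 0" "\<And>x. (s - e/2) + e/4 \<le> x \<Longrightarrow> \<sigma> 0 x = 1"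
    using smooth_step_fam[of "e/4" "s - e/2"] assms by auto
  obtain \<tau> where \<tau>: "step_fam \<tau>" "\<And>x. x \<le> (t + e/2) - e/4 \<Longrightarrow> \<tau> 0 x = 0" "\<And>x. (t + e/2) + e/4 \<le> x \<Longrightarrow> \<tau> 0 x = 1"
    using smooth_step_fam[of "e/4" "t + e/2"] assms by auto
  define \<eta> where "\<eta> j x = \<sigma> j x - \<tau> j x" for j x
  have st: "step_fam \<eta>" using step_fam_diff[OF \<sigma>(1) \<tau>(1)] by (simp add: \<eta>_def[abs_def])
  have der: "((\<lambda>x. complex_of_real (\<eta> j x)) has_vector_derivative of_real (\<eta> (Suc j) x)) (at x)" for j x
    using st by (intro has_vector_derivative_of_real) (auto simp: step_fam_def)
  have z: "\<eta> j x = 0" if x: "x \<le> s - e \<or> t + e \<le> x" for j x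
  proof -
    have "complex_of_real (\<eta> j x) = 0"
    \<comment> \<open>This open set reaches up to 3/4 * e, so it contains the closed region in
      question and all derivatives vanish at the ends too.\<close>
    proof (rule family_zero_on_open[of "{..<s - 3/4 * e} \<union> {t + 3/4 * e<..}" "\<lambda>j x. complex_of_real (\<eta> j x)"])
      fix x assume "x \<in> {..<s - 3/4 * e} \<union> {t + 3/4 * e<..}"
      then show "complex_of_real (\<eta> 0 x) = 0"
        using \<sigma>(2)[of x] \<sigma>(3)[of x] \<tau>(2)[of x] \<tau>(3)[of x] assms by (auto simp: \<eta>_def field_simps)
    qed (use der x assms in auto)
    then show ?thesis by simp
  qed
  have "\<eta> 0 x = 1" if "s - e/4 \<le> x" "x \<le> t + e/4" for x
    using \<sigma>(3)[of x] \<tau>(2)[of x] that by (simp add: \<eta>_def field_simps)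
  with st z show ?thesis using that by blast
qed

text \<open>Every point outside (-a;a) has |x| > c k, so near it the extension by 0 is identically 0
  and no regularity is lost.\<close>

lemma cutoff_extension:
  assumes f: "f \<in> U" and \<eta>: "step_fam \<eta>" and z: "\<And>j x. c k \<le> \<bar>x\<bar> \<Longrightarrow> \<eta> j x = 0"
  shows "(\<lambda>j x. if x \<in> sym_ival a then leibniz \<eta> (Dn f) j x else 0) \<in> TF" (is "?P \<in> TF")
proof -
  have P0: "?P j x = 0" if "c k \<le> \<bar>x\<bar>" for j x using z[OF that] by (simp add: leibniz_def)
  have "(?P j has_vector_derivative ?P (Suc j) x) (at x)" for j x
  proof (cases "x \<in> sym_ival a")
    case True
    have "(leibniz \<eta> (Dn f) j has_vector_derivative leibniz \<eta> (Dn f) (Suc j) x) (at x)"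
      by (rule leibniz_derivative) (use \<eta> U_D[OF f True] in \<open>simp_all add: step_fam_def\<close>)
    then have "(?P j has_vector_derivative leibniz \<eta> (Dn f) (Suc j) x) (at x)"
      by (rule has_vector_derivative_transform_within_open[OF _ sym_ival_open True]) auto
    then show ?thesis using True by simp
  next
    case False
    then have x: "c k < \<bar>x\<bar>" using sym_c[of x k] by force
    have "(?P j has_vector_derivative 0) (at x)"
    proof (rule has_vector_derivative_transform_within_open[of "\<lambda>_. 0"])
      show "open {x. c k < \<bar>x\<bar>}" by (intro open_Collect_less continuous_intros)
    qed (use x P0 in auto)
    then show ?thesis using False by simp
  qed
  moreover have "\<exists>B. \<forall>j x. \<bar>x\<bar> \<le> R \<longrightarrow> norm (?P j x) \<le> B * M q j" if q: "0 < q" "q < 1" for q R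
  proof -
    define p where "p = (q + 1) / 2"
    have p: "q < p" "p < 1" "0 < p" using q by (auto simp: p_def)
    obtain C where C: "0 < C" "\<And>F B S. (\<forall>j. \<forall>x\<in>S. norm (F j x) \<le> B * M p j) \<Longrightarrow> (\<forall>j. \<forall>x\<in>S. norm (leibniz \<eta> F j x) \<le> C * B * M q j)"
      using leibniz_bound[OF \<eta>, of q p] p q by metis
    obtain B where B: "bd p k B f" using U_bd[OF f p(3,2)] by blast
    then have "\<forall>j. \<forall>x\<in>{-c k..c k}. norm (Dn f j x) \<le> B * M p j" by (auto simp: bd_def abs_le_iff)
    from C(2)[OF this] have "norm (?P j x) \<le> C * B * M q j" if "\<bar>x\<bar> \<le> c k" for j x
      using that sym_c[OF that] by (auto simp: abs_le_iff)
    moreover have "norm (?P j x) \<le> C * B * M q j" if "c k \<le> \<bar>x\<bar>" for j x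
      using P0[OF that] C(1) bd_nonneg[OF B] M_pos[of q j] by simp
    ultimately show ?thesis by (meson linear)
  qed
  ultimately show ?thesis unfolding TF_def by blast
qed

text \<open>Replaces an element of the space by a compactly supported whole-line family without
  changing it near the window [-c k;c k]. The margin e, taken from a later c l > c k, makes all
  derivatives agree on the closed window.\<close>

lemma extension:
  assumes f: "f \<in> U"
  obtains F e R where "F \<in> TF" "0 < e" "\<And>x. \<bar>x\<bar> \<le> c k + e \<Longrightarrow> F 0 x = f x \<and> x \<in> sym_ival a"
    "\<And>j x. R \<le> \<bar>x\<bar> \<Longrightarrow> F j x = 0" "R \<in> sym_ival a" "0 < R"
proof -
  obtain l where l: "c k < c l" using sym_obtain[OF sym_c[of "c k" k]] c_pos[of k] by auto
  define d where "d = c l - c k"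
  have d: "0 < d" using l by (simp add: d_def)
  obtain \<eta> where \<eta>: "step_fam \<eta>" "\<And>x. - c k - d/4 \<le> x \<Longrightarrow> x \<le> c k + d/4 \<Longrightarrow> \<eta> 0 x = 1"
    "\<And>j x. x \<le> - c k - d \<or> c k + d \<le> x \<Longrightarrow> \<eta> j x = 0"
    using cutoff[of "- c k" "c k" d] d c_pos[of k] by auto
  have z: "\<eta> j x = 0" if "c l \<le> \<bar>x\<bar>" for j x
    using that by (intro \<eta>(3)) (auto simp: d_def abs_if split: if_splits)
  define F where "F = (\<lambda>j x. if x \<in> sym_ival a then leibniz \<eta> (Dn f) j x else 0)"
  show ?thesis
  proof (rule that[of F "d/4" "c l"])
    show "F \<in> TF" unfolding F_def by (rule cutoff_extension[OF f \<eta>(1) z])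
    show "0 < d / 4" using d by simp
    fix x assume x: "\<bar>x\<bar> \<le> c k + d/4"
    then have "\<bar>x\<bar> \<le> c l" using d unfolding d_def by argo
    then have xs: "x \<in> sym_ival a" by (rule sym_c)
    moreover have "\<eta> 0 x = 1" using x by (intro \<eta>(2)) auto
    ultimately show "F 0 x = f x \<and> x \<in> sym_ival a" by (simp add: F_def)
  next
    fix j x assume "c l \<le> \<bar>x\<bar>"
    then show "F j x = 0" using z by (simp add: F_def leibniz_def)
  next
    show "c l \<in> sym_ival a" "0 < c l" using sym_c[of "c l" l] c_pos[of l] by auto
  qed
qed

lemma U_leibniz:
  assumes f: "f \<in> U" and \<eta>: "step_fam \<eta>"
  shows "(\<lambda>x. of_real (\<eta> 0 x) * f x) \<in> U"
proof (rule U_intro[of _ "leibniz \<eta> (Dn f)"])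
  fix x assume "x \<notin> sym_ival a"
  then show "of_real (\<eta> 0 x) * f x = 0" using U_0[OF f] by simp
next
  fix j x assume x: "x \<in> sym_ival a"
  show "(leibniz \<eta> (Dn f) j has_vector_derivative leibniz \<eta> (Dn f) (Suc j) x) (at x)"
    by (rule leibniz_derivative) (use \<eta> U_D[OF f x] in \<open>simp_all add: step_fam_def\<close>)
next
  fix q k assume q: "0 < (q::real)" "q < 1"
  define p where "p = (q + 1) / 2"
  have p: "q < p" "p < 1" "0 < p" using q by (auto simp: p_def)
  obtain C where C: "0 < C" "\<And>F B S. (\<forall>j. \<forall>x\<in>S. norm (F j x) \<le> B * M p j) \<Longrightarrow> (\<forall>j. \<forall>x\<in>S. norm (leibniz \<eta> F j x) \<le> C * B * M q j)"
    using leibniz_bound[OF \<eta>, of q p] p q by metis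
  obtain B where B: "bd p k B f" using U_bd[OF f p(3,2)] by blast
  then have "\<forall>j. \<forall>x\<in>{-c k..c k}. norm (Dn f j x) \<le> B * M p j" by (auto simp: bd_def abs_le_iff)
  from C(2)[OF this] show "\<exists>B. \<forall>j x. \<bar>x\<bar> \<le> c k \<longrightarrow> norm (leibniz \<eta> (Dn f) j x) \<le> B * M q j"
    by (intro exI[of _ "C * B"]) (auto simp: abs_le_iff)
qed simp

section \<open>Continuous functionals\<close>

lemma semiball_open:
  assumes "f \<in> U" "0 < q" "q < 1" "0 < \<epsilon>"
  shows "openin (U_top \<omega> a c) {g \<in> U. seminorm_U \<omega> a c q k (g - f) < ereal \<epsilon>}"
  unfolding U_top_def
proof (rule topology_generated_by_Basis)
  show "{g \<in> U. seminorm_U \<omega> a c q k (g - f) < ereal \<epsilon>} \<in>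
    {{g \<in> U. seminorm_U \<omega> a c q k (g - f) < ereal \<epsilon>} | f q k \<epsilon>. f \<in> U \<and> q \<in> {0<..<1} \<and> 0 < \<epsilon>}"
    unfolding mem_Collect_eq
    by (rule exI[of _ f], rule exI[of _ q], rule exI[of _ k], rule exI[of _ \<epsilon>]) (simp add: assms)
qed

lemma bd_diff_self: "bd q k 0 (f - f)"
proof -
  have "Dn (\<lambda>x. 0) j = (\<lambda>x. 0)" for j
    by (induction j) (auto simp: Dn_Suc D_op_def)
  then show ?thesis by (simp add: bd_def zero_fun_def)
qed

text \<open>The semi-norms grow with q and k, so two of them are dominated by one. A subbasic
  semi-ball centred elsewhere contains one centred at f, with radius taken from the slack that the
  triangle inequality leaves.\<close>

lemma U_nhds:
  assumes "openin (U_top \<omega> a c) V" "f \<in> V"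
  shows "\<exists>q k \<epsilon>. 0 < q \<and> q < 1 \<and> 0 < \<epsilon> \<and> (\<forall>g\<in>U. bd q k \<epsilon> (g - f) \<longrightarrow> g \<in> V)"
proof -
  have fU: "f \<in> U" using openin_subset[OF assms(1)] assms(2) topspace_U_top by blast
  have "generate_topology_on {{g \<in> U. seminorm_U \<omega> a c q k (g - f) < ereal \<epsilon>} | f q k \<epsilon>. f \<in> U \<and> q \<in> {0<..<1} \<and> 0 < \<epsilon>} V"
    using assms(1) unfolding U_top_def openin_topology_generated_by_iff .
  then show ?thesis using assms(2)
  proof induction
    case Empty
    then show ?case by simp
  next
    case (Int A B)
    obtain q1 k1 e1 where 1: "0 < q1" "q1 < 1" "0 < e1" "\<And>g. g \<in> U \<Longrightarrow> bd q1 k1 e1 (g - f) \<Longrightarrow> g \<in> A"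
      using Int by blast
    obtain q2 k2 e2 where 2: "0 < q2" "q2 < 1" "0 < e2" "\<And>g. g \<in> U \<Longrightarrow> bd q2 k2 e2 (g - f) \<Longrightarrow> g \<in> B"
      using Int by blast
    show ?case
    proof (rule exI[of _ "max q1 q2"], rule exI[of _ "max k1 k2"], rule exI[of _ "min e1 e2"], intro conjI ballI impI)
      show "0 < max q1 q2" "max q1 q2 < 1" "0 < min e1 e2" using 1 2 by auto
      fix g assume g: "g \<in> U" "bd (max q1 q2) (max k1 k2) (min e1 e2) (g - f)"
      have "bd q1 k1 e1 (g - f)" "bd q2 k2 e2 (g - f)"
        by (rule bd_mono[OF g(2)]; use 1 2 in simp)+
      then show "g \<in> A \<inter> B" using 1 2 g by blast
    qed
  next
    case (UN K)
    then obtain A where "A \<in> K" "f \<in> A" by blast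
    with UN.IH[OF this] show ?case by blast
  next
    case (Basis s)
    then obtain f0 q k e where s: "s = {g \<in> U. seminorm_U \<omega> a c q k (g - f0) < ereal e}" and f0: "f0 \<in> U"
      and q: "0 < q" "q < 1" by auto
    have "seminorm_U \<omega> a c q k (f - f0) < ereal e" using Basis s by simp
    then obtain t where t: "seminorm_U \<omega> a c q k (f - f0) < ereal t" "t < e" using ereal_dense2 by force
    have bt: "bd q k t (f - f0)" using t(1) less_imp_le seminorm_le_iff by blast
    show ?case
    proof (rule exI[of _ q], rule exI[of _ k], rule exI[of _ "(e - t) / 2"], intro conjI ballI impI)
      show "0 < (e - t) / 2" using t by simp
      fix g assume g: "g \<in> U" "bd q k ((e - t) / 2) (g - f)"
      have "bd q k ((e - t) / 2 + t) ((g - f) + (f - f0))"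
        by (rule bd_add) (use g bt fU f0 U_diff in auto)
      then have "seminorm_U \<omega> a c q k (g - f0) \<le> ereal ((e - t) / 2 + t)"
        by (simp add: seminorm_le_iff)
      also have "\<dots> < ereal e" using t by (simp add: field_simps)
      finally show "g \<in> s" using g s by simp
    qed (use q in auto)
  qed
qed

text \<open>Continuity in working form, as domination by one semi-norm. Elements of the dual have it
  by \<open>U_dual_lf\<close>, a Hahn-Banach functional has it by construction.\<close>

definition lf :: "((real \<Rightarrow> complex) \<Rightarrow> complex) \<Rightarrow> bool" where
  "lf T \<longleftrightarrow> (\<forall>f\<in>U. \<forall>g\<in>U. T (f + g) = T f + T g) \<and> (\<forall>z. \<forall>f\<in>U. T (cscale z f) = z * T f) \<and>
     (\<exists>q k C. 0 < q \<and> q < 1 \<and> 0 \<le> C \<and> (\<forall>f\<in>U. \<forall>B. bd q k B f \<longrightarrow> norm (T f) \<le> C * B))"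

lemma lf_add: "lf T \<Longrightarrow> f \<in> U \<Longrightarrow> g \<in> U \<Longrightarrow> T (f + g) = T f + T g" by (simp add: lf_def)
lemma lf_scale: "lf T \<Longrightarrow> f \<in> U \<Longrightarrow> T (cscale z f) = z * T f" by (simp add: lf_def)

lemma lf_diff: "lf T \<Longrightarrow> f \<in> U \<Longrightarrow> g \<in> U \<Longrightarrow> T (f - g) = T f - T g"
proof -
  assume T: "lf T" and f: "f \<in> U" and g: "g \<in> U"
  have "T ((f - g) + g) = T (f - g) + T g" by (rule lf_add[OF T U_diff[OF f g] g])
  then show ?thesis by simp
qed

lemma lf_bound:
  assumes "lf T"
  obtains q k C where "0 < q" "q < 1" "0 \<le> C" "\<And>f B. f \<in> U \<Longrightarrow> bd q k B f \<Longrightarrow> norm (T f) \<le> C * B"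
proof -
  from assms have "\<exists>q k C. 0 < q \<and> q < 1 \<and> 0 \<le> C \<and> (\<forall>f\<in>U. \<forall>B. bd q k B f \<longrightarrow> norm (T f) \<le> C * B)"
    unfolding lf_def by simp
  then show ?thesis by (elim exE conjE, intro that) auto
qed

lemma lf_zero: "lf T \<Longrightarrow> T 0 = 0"
  using lf_diff[of T 0 0] U_zero by simp

lemma U_dual_lf: "T \<in> U_dual \<omega> a c \<Longrightarrow> lf T"
proof -
  assume T: "T \<in> U_dual \<omega> a c"
  then have lin: "\<forall>f\<in>U. \<forall>g\<in>U. T (f + g) = T f + T g" "\<forall>z. \<forall>f\<in>U. T (cscale z f) = z * T f"
    and cont: "continuous_map (U_top \<omega> a c) euclidean T" by (auto simp: U_dual_def)
  have "T (0 + 0) = T 0 + T 0" using lin(1) U_zero by blast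
  then have T0: "T 0 = 0" by simp
  have "openin (U_top \<omega> a c) {f \<in> topspace (U_top \<omega> a c). T f \<in> ball 0 1}"
    using cont by (rule openin_continuous_map_preimage) simp
  then obtain q k \<epsilon> where q: "0 < q" "q < 1" "0 < \<epsilon>" and
    b: "\<And>g. g \<in> U \<Longrightarrow> bd q k \<epsilon> (g - 0) \<Longrightarrow> norm (T g) < 1"
    using U_nhds[of "{f \<in> topspace (U_top \<omega> a c). T f \<in> ball 0 1}" 0] T0 U_zero by (auto simp: topspace_U_top)
  have pos: "norm (T f) \<le> B / \<epsilon>" if f: "f \<in> U" "bd q k B f" "0 < B" for f B
  proof -
    have "bd q k (norm (of_real (\<epsilon> / B) :: complex) * B) (cscale (of_real (\<epsilon> / B)) f)"
      by (rule bd_scale[OF f(1,2)])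
    then have "bd q k \<epsilon> (cscale (of_real (\<epsilon> / B)) f - 0)" using f(3) q(3) by (simp add: norm_divide)
    then have "norm (T (cscale (of_real (\<epsilon> / B)) f)) < 1" using b U_scale f by blast
    then have "\<epsilon> / B * norm (T f) < 1" using lin(2) f q by (simp add: norm_mult norm_divide)
    then show ?thesis using f q by (simp add: field_simps)
  qed
  have "norm (T f) \<le> inverse \<epsilon> * B" if f: "f \<in> U" "bd q k B f" for f B
  \<comment> \<open>B may be 0, where rescaling f is impossible; it is therefore increased to B +
    \<epsilon> * e.\<close>
  proof (rule field_le_epsilon)
    fix e :: real assume e: "0 < e"
    have B: "0 \<le> B" using bd_nonneg f by blast
    have "bd q k (B + \<epsilon> * e) f" by (rule bd_mono[OF f(2)]) (use q e B in auto)
    then have "norm (T f) \<le> (B + \<epsilon> * e) / \<epsilon>" using pos f B q e by (simp add: add_nonneg_pos)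
    also have "\<dots> = inverse \<epsilon> * B + e" using q by (simp add: field_simps)
    finally show "norm (T f) \<le> inverse \<epsilon> * B + e" .
  qed
  then have "\<exists>q k C. 0 < q \<and> q < 1 \<and> 0 \<le> C \<and> (\<forall>f\<in>U. \<forall>B. bd q k B f \<longrightarrow> norm (T f) \<le> C * B)"
    using q by (intro exI[of _ q], intro exI[of _ k] exI[of _ "inverse \<epsilon>"]) auto
  then show ?thesis using lin by (simp add: lf_def)
qed

text \<open>Working form of supp S = {0}: no compact support is asked of f, so S can be evaluated on
  any function known near 0.\<close>

definition point_lf :: "((real \<Rightarrow> complex) \<Rightarrow> complex) \<Rightarrow> bool" where
  "point_lf S \<longleftrightarrow> lf S \<and> (\<forall>f\<in>U. \<forall>\<delta>>0. (\<forall>x. \<bar>x\<bar> < \<delta> \<longrightarrow> f x = 0) \<longrightarrow> S f = 0) \<and> (\<exists>f\<in>U. S f \<noteq> 0)"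

text \<open>The support gives vanishing only on small open sets around the points other than 0.
  Bolzano's bisection takes the place of a partition of unity: vanishing passes to the union of
  adjacent intervals by splitting with one smooth step. A general f is first cut off outside the
  window that S sees and then split at 0.\<close>

lemma supp_imp_point_lf:
  assumes S: "lf S" and supp: "supp_U \<omega> a c S = {0}"
  shows "point_lf S"
proof -
  define van where "van V \<longleftrightarrow> open V \<and> V \<subseteq> sym_ival a \<and>
     (\<forall>f\<in>U. compact (closure {x. f x \<noteq> 0}) \<and> closure {x. f x \<noteq> 0} \<subseteq> V \<longrightarrow> S f = 0)" for V
  have supp': "sym_ival a - \<Union>{V. van V} = {0}" using supp by (simp add: supp_U_def van_def)
  have cover: "\<exists>V. van V \<and> x \<in> V" if "x \<in> sym_ival a" "x \<noteq> 0" for x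
    using supp' that by blast
  \<comment> \<open>The enlargement by e leaves room for the transition of the step when two
    intervals are joined.\<close>
  define P where "P s t \<longleftrightarrow> (\<exists>e>0. \<forall>f\<in>U. (\<forall>x. f x \<noteq> 0 \<longrightarrow> s - e \<le> x \<and> x \<le> t + e) \<longrightarrow> S f = 0)" for s t
  have Pz: "S g = 0" if P: "P s t" and g: "g \<in> U" and z: "\<And>x. g x \<noteq> 0 \<Longrightarrow> s \<le> x \<and> x \<le> t" for s t g
  proof -
    obtain e where e: "0 < e" "\<forall>f\<in>U. (\<forall>x. f x \<noteq> 0 \<longrightarrow> s - e \<le> x \<and> x \<le> t + e) \<longrightarrow> S f = 0"
      using P unfolding P_def by blast
    have "\<forall>x. g x \<noteq> 0 \<longrightarrow> s - e \<le> x \<and> x \<le> t + e"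
      using z e(1) by (meson add_increasing2 diff_le_eq less_imp_le order_trans)
    then show ?thesis using e(2) g by blast
  qed
  have PP: "P s t" if st: "s \<le> t" and sub: "{s..t} \<subseteq> sym_ival a - {0}" for s t
    using st
  proof (induction rule: Bolzano)
    case (trans u v w)
    obtain e1 where e1: "0 < e1" "\<And>f. f \<in> U \<Longrightarrow> (\<forall>x. f x \<noteq> 0 \<longrightarrow> u - e1 \<le> x \<and> x \<le> v + e1) \<Longrightarrow> S f = 0"
      using trans(1) unfolding P_def by blast
    obtain e2 where e2: "0 < e2" "\<And>f. f \<in> U \<Longrightarrow> (\<forall>x. f x \<noteq> 0 \<longrightarrow> v - e2 \<le> x \<and> x \<le> w + e2) \<Longrightarrow> S f = 0"
      using trans(2) unfolding P_def by blast
    define e where "e = min e1 e2"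
    have e: "0 < e" "e \<le> e1" "e \<le> e2" using e1 e2 by (auto simp: e_def)
    obtain \<sigma> where \<sigma>: "step_fam \<sigma>" "\<And>x. x \<le> v - e \<Longrightarrow> \<sigma> 0 x = 0" "\<And>x. v + e \<le> x \<Longrightarrow> \<sigma> 0 x = 1"
      using smooth_step_fam[OF e(1), where s=v] by blast
    have "S f = 0" if f: "f \<in> U" and z: "\<And>x. f x \<noteq> 0 \<Longrightarrow> u - e \<le> x \<and> x \<le> w + e" for f
    proof -
      define g where "g x = of_real (\<sigma> 0 x) * f x" for x
      have gU: "g \<in> U" unfolding g_def[abs_def] by (rule U_leibniz[OF f \<sigma>(1)])
      have "S g = 0"
      proof (rule e2(2)[OF gU], intro allI impI)
        fix x assume "g x \<noteq> 0"
        then have "f x \<noteq> 0" "\<not> x \<le> v - e" using \<sigma>(2)[of x] by (auto simp: g_def)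
        then show "v - e2 \<le> x \<and> x \<le> w + e2" using z[of x] e by auto
      qed
      moreover have "S (f - g) = 0"
      proof (rule e1(2)[OF U_diff[OF f gU]], intro allI impI)
        fix x assume "(f - g) x \<noteq> 0"
        then have "f x \<noteq> 0" "\<not> v + e \<le> x" using \<sigma>(3)[of x] by (auto simp: g_def)
        then show "u - e1 \<le> x \<and> x \<le> v + e1" using z[of x] e by auto
      qed
      ultimately show ?thesis using lf_diff[OF S f gU] by simp
    qed
    then show ?case unfolding P_def using e(1) by blast
  next
    case (local x)
    then have "x \<in> sym_ival a" "x \<noteq> 0" using sub by auto
    then obtain V where V: "van V" "x \<in> V" using cover by blast
    then obtain d where d: "0 < d" "ball x d \<subseteq> V" unfolding van_def using openE by blast
    show ?case
    proof (intro exI conjI allI impI)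
      show "0 < d / 4" using d by simp
      fix u v assume uv: "u \<le> x \<and> x \<le> v \<and> v - u < d / 4"
      have "S f = 0" if f: "f \<in> U" "\<forall>x. f x \<noteq> 0 \<longrightarrow> u - d/4 \<le> x \<and> x \<le> v + d/4" for f
      proof -
        have cl: "closure {x. f x \<noteq> 0} \<subseteq> {u - d/4..v + d/4}"
          using f(2) by (intro closure_minimal) auto
        also have "\<dots> \<subseteq> ball x d" using uv d by (auto simp: dist_real_def abs_less_iff)
        finally have "closure {x. f x \<noteq> 0} \<subseteq> V" using d by blast
        moreover have "compact (closure {x. f x \<noteq> 0})"
          using cl by (metis bounded_closed_interval bounded_subset closed_closure compact_eq_bounded_closed)
        ultimately show ?thesis using V f(1) unfolding van_def by blast
      qed
      then show "P u v" unfolding P_def using \<open>0 < d / 4\<close> by blast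
    qed
  qed
  have van0: "S f = 0" if f: "f \<in> U" and \<delta>: "0 < \<delta>" and z: "\<And>x. \<bar>x\<bar> < \<delta> \<Longrightarrow> f x = 0" for f \<delta>
  proof -
    obtain q k C where q: "0 < q" "q < 1" "0 \<le> C" and b: "\<And>f B. f \<in> U \<Longrightarrow> bd q k B f \<Longrightarrow> norm (S f) \<le> C * B"
      by (rule lf_bound[OF S]) (rule that)
    obtain F e R where F: "F \<in> TF" "0 < e" "\<And>x. \<bar>x\<bar> \<le> c k + e \<Longrightarrow> F 0 x = f x \<and> x \<in> sym_ival a"
      and R: "\<And>j x. R \<le> \<bar>x\<bar> \<Longrightarrow> F j x = 0" "R \<in> sym_ival a" "0 < R"
      by (rule extension[OF f, where k=k]) (rule that)
    \<comment> \<open>On the window of S all derivatives of g vanish, so the semi-norm bound already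
      gives S g = 0 and f may be replaced by the compactly supported F.\<close>
    define g where "g = f - emb F"
    have gU: "g \<in> U" unfolding g_def by (rule U_diff[OF f emb_U[OF F(1)]])
    have Eg: "emb F \<in> U" by (rule emb_U[OF F(1)])
    have "Dn g j x = 0" if x: "\<bar>x\<bar> \<le> c k" for j x
    proof (rule family_zero_on_open[of "{x. \<bar>x\<bar> < c k + e}" "Dn g"])
      show "open {x. \<bar>x\<bar> < c k + e}" by (intro open_Collect_less continuous_intros)
      fix y assume y: "y \<in> {x. \<bar>x\<bar> < c k + e}"
      then have "F 0 y = f y" "y \<in> sym_ival a" using F(3)[of y] by auto
      then show "Dn g 0 y = 0" by (simp add: g_def emb_def)
      show "(Dn g j has_vector_derivative Dn g (Suc j) y) (at y)" for j
        by (rule U_D[OF gU \<open>y \<in> sym_ival a\<close>])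
    qed (use x F(2) in auto)
    then have "bd q k 0 g" by (simp add: bd_def)
    from b[OF gU this] have "S g = 0" by simp
    then have Sf: "S f = S (emb F)" using lf_diff[OF S f Eg] by (simp add: g_def)
    \<comment> \<open>Half-width of the step at 0, small enough for f to vanish there and for F to
      agree with f; \<delta>' \<le> R keeps the two outer intervals nonempty.\<close>
    define \<delta>' where "\<delta>' = min \<delta> (min R (c k))"
    have \<delta>': "0 < \<delta>'" "\<delta>' \<le> \<delta>" "\<delta>' \<le> R" "\<delta>' \<le> c k" using \<delta> R c_pos[of k] by (auto simp: \<delta>'_def)
    have Rs: "x \<in> sym_ival a" if "\<bar>x\<bar> \<le> R" for x
      using that R(2,3) unfolding sym_abs by (metis abs_of_pos ereal_less_eq(3) le_less_trans)
    have P1: "P \<delta>' R" and P2: "P (- R) (- \<delta>')"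
    proof -
      show "P \<delta>' R"
      proof (rule PP)
        show "\<delta>' \<le> R" by fact
        show "{\<delta>'..R} \<subseteq> sym_ival a - {0}" using Rs \<delta>'(1) by force
      qed
      show "P (- R) (- \<delta>')"
      proof (rule PP)
        show "- R \<le> - \<delta>'" using \<delta>'(3) by simp
        show "{- R..- \<delta>'} \<subseteq> sym_ival a - {0}"
        proof
          fix x assume "x \<in> {- R..- \<delta>'}"
          then have x: "- R \<le> x" "x \<le> - \<delta>'" by simp_all
          then have "\<bar>x\<bar> \<le> R" "x \<noteq> 0" using \<delta>'(1) by linarith+
          then show "x \<in> sym_ival a - {0}" using Rs by simp
        qed
      qed
    qed
    have zF: "\<delta>' \<le> \<bar>x\<bar> \<and> \<bar>x\<bar> \<le> R" if "emb F x \<noteq> 0" for x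
    proof
      have "F 0 x \<noteq> 0" using that by (auto simp: emb_def split: if_splits)
      then show "\<bar>x\<bar> \<le> R" using R(1)[of x 0] by linarith
      show "\<delta>' \<le> \<bar>x\<bar>"
      proof (rule ccontr)
        assume "\<not> \<delta>' \<le> \<bar>x\<bar>"
        then have "F 0 x = f x" "f x = 0" using F(3)[of x] F(2) z[of x] \<delta>' by auto
        then show False using \<open>F 0 x \<noteq> 0\<close> by simp
      qed
    qed
    obtain \<sigma> where \<sigma>: "step_fam \<sigma>" "\<And>x. x \<le> 0 - \<delta>' \<Longrightarrow> \<sigma> 0 x = 0" "\<And>x. 0 + \<delta>' \<le> x \<Longrightarrow> \<sigma> 0 x = 1"
      using smooth_step_fam[OF \<delta>'(1), where s=0] by blast
    define h where "h x = of_real (\<sigma> 0 x) * emb F x" for x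
    have hU: "h \<in> U" unfolding h_def[abs_def] by (rule U_leibniz[OF Eg \<sigma>(1)])
    have "S h = 0"
    proof (rule Pz[OF P1 hU])
      fix x assume "h x \<noteq> 0"
      then have "emb F x \<noteq> 0" "\<not> x \<le> - \<delta>'" using \<sigma>(2)[of x] by (auto simp: h_def)
      then show "\<delta>' \<le> x \<and> x \<le> R" using zF[of x] by auto
    qed
    moreover have "S (emb F - h) = 0"
    proof (rule Pz[OF P2 U_diff[OF Eg hU]])
      fix x assume "(emb F - h) x \<noteq> 0"
      then have "emb F x \<noteq> 0" "\<not> \<delta>' \<le> x" using \<sigma>(3)[of x] by (auto simp: h_def)
      then show "- R \<le> x \<and> x \<le> - \<delta>'" using zF[of x] by auto
    qed
    ultimately show ?thesis using lf_diff[OF S Eg hU] Sf by simp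
  qed
  have "\<exists>f\<in>U. S f \<noteq> 0"
  proof (rule ccontr)
    assume "\<not> (\<exists>f\<in>U. S f \<noteq> 0)"
    then have "van (sym_ival a)" unfolding van_def using sym_ival_open by blast
    then have "sym_ival a - \<Union>{V. van V} = {}" by blast
    then show False using supp' by simp
  qed
  then show ?thesis unfolding point_lf_def using S van0 by blast
qed

end

section \<open>Exponentials and Fourier-Laplace transforms\<close>

text \<open>The t-derivatives of t^n exp (- i z t). The second clause is the Leibniz rule for the
  factor t; for j = 0 the truncated j - 1 is harmless because of the factor j.\<close>

fun exp_fam :: "nat \<Rightarrow> complex \<Rightarrow> nat \<Rightarrow> real \<Rightarrow> complex" where
  "exp_fam 0 z j t = (- \<i> * z) ^ j * exp (- \<i> * z * of_real t)"
| "exp_fam (Suc n) z j t = of_real t * exp_fam n z j t + of_nat j * exp_fam n z (j - 1) t"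

lemma exp_fam_deriv_t: "(exp_fam n z j has_vector_derivative exp_fam n z (Suc j) t) (at t)"
proof (induction n arbitrary: j)
  case 0
  have "((\<lambda>w. (- \<i> * z) ^ j * exp (- \<i> * z * w)) has_field_derivative (- \<i> * z) ^ Suc j * exp (- \<i> * z * of_real t)) (at (of_real t))"
    by (auto intro!: derivative_eq_intros)
  from has_vector_derivative_real_field[OF this] show ?case by (simp add: o_def exp_fam.simps(1)[abs_def])
next
  case (Suc n)
  have id: "((\<lambda>t. complex_of_real t) has_vector_derivative 1) (at t)"
    using has_vector_derivative_of_real[of "\<lambda>t. t" 1 "at t"] by simp
  show ?case
  proof (cases j)
    case 0
    have "((\<lambda>t. of_real t * exp_fam n z 0 t) has_vector_derivative of_real t * exp_fam n z (Suc 0) t + 1 * exp_fam n z 0 t) (at t)"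
      by (rule has_vector_derivative_mult[OF id Suc.IH])
    then show ?thesis using 0 by (simp add: exp_fam.simps(2)[abs_def])
  next
    case (Suc i)
    have "((\<lambda>t. of_real t * exp_fam n z j t + of_nat j * exp_fam n z i t) has_vector_derivative
       (of_real t * exp_fam n z (Suc j) t + 1 * exp_fam n z j t) + of_nat j * exp_fam n z (Suc i) t) (at t)"
      by (intro has_vector_derivative_add has_vector_derivative_mult[OF id] has_vector_derivative_mult_right Suc.IH)
    then show ?thesis using Suc by (simp add: exp_fam.simps(2)[abs_def] algebra_simps)
  qed
qed

text \<open>Differentiating in z multiplies by - i t, that is, raises n. Hence the derivatives of a
  transform are, up to powers of - i, the values of the functional on exponential monomials.\<close>

lemma exp_fam_deriv_z: "((\<lambda>z. exp_fam n z j t) has_field_derivative - \<i> * exp_fam (Suc n) z j t) (at z)"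
proof (induction n arbitrary: j)
  case 0
  show ?case
  proof (cases j)
    case 0
    then show ?thesis by (auto intro!: derivative_eq_intros)
  next
    case (Suc i)
    have "((\<lambda>z. (- \<i> * z) ^ j * exp (- \<i> * z * of_real t)) has_field_derivative
       (of_nat j * (- \<i> * z) ^ (j - 1) * (- \<i>)) * exp (- \<i> * z * of_real t) + (- \<i> * z) ^ j * (exp (- \<i> * z * of_real t) * (- \<i> * of_real t))) (at z)"
      by (auto intro!: derivative_eq_intros simp: algebra_simps)
    then show ?thesis by (simp add: algebra_simps)
  qed
next
  case (Suc n)
  have "((\<lambda>z. of_real t * exp_fam n z j t + of_nat j * exp_fam n z (j - 1) t) has_field_derivative
     of_real t * (- \<i> * exp_fam (Suc n) z j t) + of_nat j * (- \<i> * exp_fam (Suc n) z (j - 1) t)) (at z)"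
    by (intro DERIV_add DERIV_cmult Suc.IH)
  moreover have "of_real t * (- \<i> * exp_fam (Suc n) z j t) + of_nat j * (- \<i> * exp_fam (Suc n) z (j - 1) t)
     = - \<i> * exp_fam (Suc (Suc n)) z j t"
    by (subst (3) exp_fam.simps(2)) (simp add: distrib_left mult.left_commute del: exp_fam.simps)
  ultimately show ?case by simp
qed

lemma power_Suc_ge:
  fixes \<rho> :: real
  assumes "0 \<le> \<rho>"
  shows "\<rho> ^ j + real j * \<rho> ^ (j - 1) \<le> (\<rho> + 1) ^ j"
proof (induction j)
  case (Suc j)
  have "\<rho> ^ Suc j + real (Suc j) * \<rho> ^ j = \<rho> * (\<rho> ^ j + real j * \<rho> ^ (j - 1)) + \<rho> ^ j"
    by (cases j) (simp_all add: algebra_simps)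
  also have "\<dots> \<le> \<rho> * (\<rho> + 1) ^ j + (\<rho> + 1) ^ j"
    using assms Suc by (intro add_mono mult_left_mono power_mono) auto
  finally show ?case by (simp add: algebra_simps)
qed simp

text \<open>Each multiplication by t adds j times a lower derivative; raising the base of the j-th
  power by 1 absorbs it.\<close>

lemma exp_fam_bound:
  "norm (exp_fam n z j t) \<le> exp (t * Im z) * (\<bar>t\<bar> + 1) ^ n * (max 1 (norm z) + real n) ^ j"
proof (induction n arbitrary: j)
  case 0
  have "norm (exp_fam 0 z j t) = norm z ^ j * exp (t * Im z)"
    by (simp add: norm_mult norm_power norm_exp_eq_Re mult.commute)
  also have "\<dots> \<le> (max 1 (norm z)) ^ j * exp (t * Im z)" by (intro mult_right_mono power_mono) auto
  finally show ?case by (simp add: mult.commute)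
next
  case (Suc n)
  define X where "X = exp (t * Im z) * (\<bar>t\<bar> + 1) ^ n"
  define \<rho> where "\<rho> = max 1 (norm z) + real n"
  have \<rho>: "0 \<le> \<rho>" by (simp add: \<rho>_def)
  have X: "0 \<le> X" by (simp add: X_def)
  have "norm (exp_fam (Suc n) z j t) \<le> \<bar>t\<bar> * (X * \<rho> ^ j) + real j * (X * \<rho> ^ (j - 1))"
    unfolding exp_fam.simps X_def \<rho>_def
    by (intro norm_triangle_le add_mono) (auto simp: norm_mult intro!: mult_left_mono Suc.IH)
  also have "\<dots> \<le> \<bar>t\<bar> * (X * (\<rho> + 1) ^ j) + X * (\<rho> + 1) ^ j"
  proof (intro add_mono mult_left_mono)
    show "\<rho> ^ j \<le> (\<rho> + 1) ^ j" using \<rho> by (intro power_mono) auto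
    have "real j * \<rho> ^ (j - 1) \<le> (\<rho> + 1) ^ j" using power_Suc_ge[OF \<rho>, of j] \<rho> zero_le_power[OF \<rho>, of j] by linarith
    then show "real j * (X * \<rho> ^ (j - 1)) \<le> X * (\<rho> + 1) ^ j"
      using mult_left_mono[OF _ X] by (simp add: mult.left_commute)
  qed (use X in auto)
  finally show ?case by (simp add: X_def \<rho>_def algebra_simps)
qed

text \<open>Taylor's formula with Cauchy's estimate on unit circles; radius 2 covers all circles
  about points at distance at most 1 from z.\<close>

lemma entire_second_order:
  fixes h :: "complex \<Rightarrow> complex"
  assumes hol: "h holomorphic_on UNIV" and B: "\<And>w. norm (w - z) \<le> 2 \<Longrightarrow> norm (h w) \<le> B" and u: "norm u \<le> 1"
  shows "norm (h (z + u) - h z - deriv h z * u) \<le> 2 * B * (norm u)\<^sup>2"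
proof -
  define f where "f n = (deriv ^^ n) h" for n
  have f: "(f i has_field_derivative f (Suc i) w) (at w)" for i w
    unfolding f_def using holomorphic_higher_deriv[OF hol open_UNIV, of i] holomorphic_derivI[OF _ open_UNIV]
    by simp
  have "norm (f 0 (z + u) - (\<Sum>i\<le>1. f i z * ((z + u) - z) ^ i / fact i)) \<le> 2 * B * norm ((z + u) - z) ^ Suc 1 / fact 1"
  proof (rule complex_Taylor[where S="cball z 1"])
    show "(f i has_field_derivative f (Suc i) x) (at x within cball z 1)" for i x
      using f has_field_derivative_at_within by blast
    fix x assume x: "x \<in> cball z 1"
    have "norm ((deriv ^^ 2) h x) \<le> fact 2 * B / 1 ^ 2"
    proof (rule Cauchy_inequality)
      show "h holomorphic_on ball x 1" using hol holomorphic_on_subset by blast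
      show "continuous_on (cball x 1) h"
        using hol holomorphic_on_imp_continuous_on continuous_on_subset by blast
      show "norm (h w) \<le> B" if "norm (x - w) = 1" for w
      proof (rule B)
        have "norm (w - z) \<le> norm (w - x) + norm (x - z)"
          using norm_triangle_ineq[of "w - x" "x - z"] by simp
        then show "norm (w - z) \<le> 2" using that x by (simp add: dist_norm norm_minus_commute)
      qed
    qed simp
    then show "norm (f (Suc 1) x) \<le> 2 * B" by (simp add: f_def numeral_2_eq_2)
  qed (use u in \<open>auto simp: dist_norm\<close>)
  then show ?thesis by (simp add: f_def power2_eq_square algebra_simps)
qed

context weight_setting
begin

lemma TF_exp: "exp_fam n z \<in> TF"
proof -
  have "\<exists>B. \<forall>j t. \<bar>t\<bar> \<le> R \<longrightarrow> norm (exp_fam n z j t) \<le> B * M q j" if q: "0 < q" "q < 1" for q R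
  proof -
    define \<rho> where "\<rho> = max 1 (norm z) + real n"
    have \<rho>: "1 \<le> \<rho>" by (simp add: \<rho>_def add_increasing2)
    have "norm (exp_fam n z j t) \<le> exp (\<bar>R\<bar> * norm z) * (\<bar>R\<bar> + 1) ^ n * exp (q * \<omega> \<rho>) * M q j" if t: "\<bar>t\<bar> \<le> R" for j t
    proof -
      have "norm (exp_fam n z j t) \<le> exp (t * Im z) * (\<bar>t\<bar> + 1) ^ n * \<rho> ^ j"
        unfolding \<rho>_def by (rule exp_fam_bound)
      also have "\<dots> \<le> exp (\<bar>R\<bar> * norm z) * (\<bar>R\<bar> + 1) ^ n * (exp (q * \<omega> \<rho>) * M q j)"
      proof (intro mult_mono power_mono)
        have "t * Im z \<le> \<bar>t\<bar> * \<bar>Im z\<bar>" by (metis abs_ge_self abs_mult)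
        also have "\<dots> \<le> \<bar>R\<bar> * norm z" using t abs_Im_le_cmod[of z] by (intro mult_mono) auto
        finally show "exp (t * Im z) \<le> exp (\<bar>R\<bar> * norm z)" by simp
        show "\<rho> ^ j \<le> exp (q * \<omega> \<rho>) * M q j" by (rule power_le_M[OF q(1) \<rho>])
      qed (use t \<rho> in auto)
      finally show ?thesis by (simp add: mult_ac)
    qed
    then show ?thesis by blast
  qed
  then show ?thesis unfolding TF_def using exp_fam_deriv_t by blast
qed

lemma exp_monomial_eq: "exp_monomial a n z = emb (exp_fam n z)"
proof -
  have "exp_fam n z 0 t = of_real t ^ n * exp (- \<i> * z * of_real t)" for t
    by (induction n) auto
  then show ?thesis by (auto simp: exp_monomial_def emb_def fun_eq_iff simp del: exp_fam.simps)
qed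

lemma fourier_laplace_eq: "fourier_laplace a S z = S (emb (exp_fam 0 z))"
  by (simp add: fourier_laplace_def exp_monomial_eq)

lemma lf_TF_bound:
  assumes T: "lf T"
  shows "\<exists>q k C. 0 < q \<and> q < 1 \<and> 0 \<le> C \<and>
    (\<forall>F B. F \<in> TF \<longrightarrow> (\<forall>j x. \<bar>x\<bar> \<le> c k \<longrightarrow> norm (F j x) \<le> B * M q j) \<longrightarrow> norm (T (emb F)) \<le> C * B)"
proof -
  obtain q k C where *: "0 < q" "q < 1" "0 \<le> C" "\<And>f B. f \<in> U \<Longrightarrow> bd q k B f \<Longrightarrow> norm (T f) \<le> C * B"
    by (rule lf_bound[OF T]) (rule that)
  have "norm (T (emb F)) \<le> C * B" if F: "F \<in> TF" and "\<forall>j x. \<bar>x\<bar> \<le> c k \<longrightarrow> norm (F j x) \<le> B * M q j" for F B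
  proof -
    have "bd q k B (emb F)" using that bd_emb by blast
    then show ?thesis using *(4) emb_U[OF F] by blast
  qed
  then show ?thesis using *(1-3) by blast
qed

lemma lf_emb_add: "lf T \<Longrightarrow> F \<in> TF \<Longrightarrow> G \<in> TF \<Longrightarrow> T (emb (F + G)) = T (emb F) + T (emb G)"
  by (simp add: emb_add lf_add emb_U)
lemma lf_emb_diff: "lf T \<Longrightarrow> F \<in> TF \<Longrightarrow> G \<in> TF \<Longrightarrow> T (emb (F - G)) = T (emb F) - T (emb G)"
  by (simp add: emb_diff lf_diff emb_U)
lemma lf_emb_scale: "lf T \<Longrightarrow> F \<in> TF \<Longrightarrow> T (emb (\<lambda>j. cscale z (F j))) = z * T (emb F)"
  by (simp add: emb_scale lf_scale emb_U)

text \<open>Holomorphic dependence on a parameter, with bounds locally uniform in it: enough to move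
  a functional past differentiation in z.\<close>

definition hol_fam :: "(complex \<Rightarrow> nat \<Rightarrow> real \<Rightarrow> complex) \<Rightarrow> bool" where
  "hol_fam G \<longleftrightarrow> (\<forall>z. G z \<in> TF) \<and> (\<forall>j t. (\<lambda>z. G z j t) holomorphic_on UNIV) \<and>
     (\<forall>\<rho> R q. 0 < q \<longrightarrow> q < 1 \<longrightarrow> (\<exists>B. \<forall>z j t. norm z \<le> \<rho> \<longrightarrow> \<bar>t\<bar> \<le> R \<longrightarrow> norm (G z j t) \<le> B * M q j))"

lemma hol_fam_quotient:
  assumes G: "hol_fam G" and q: "0 < q" "q < 1"
  shows "\<exists>C\<ge>0. \<forall>u j t. u \<noteq> 0 \<longrightarrow> norm u \<le> 1 \<longrightarrow> \<bar>t\<bar> \<le> R \<longrightarrow>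
     norm (inverse u * (G (z + u) j t - G z j t) - deriv (\<lambda>z. G z j t) z) \<le> C * norm u * M q j"
proof -
  obtain B where B: "\<And>w j t. norm w \<le> norm z + 2 \<Longrightarrow> \<bar>t\<bar> \<le> R \<Longrightarrow> norm (G w j t) \<le> B * M q j"
    using G q unfolding hol_fam_def by blast
  have "norm (inverse u * (G (z + u) j t - G z j t) - deriv (\<lambda>z. G z j t) z) \<le> (2 * \<bar>B\<bar>) * norm u * M q j"
    if u: "u \<noteq> 0" "norm u \<le> 1" and t: "\<bar>t\<bar> \<le> R" for u j t
  proof -
    have "norm (G (z + u) j t - G z j t - deriv (\<lambda>z. G z j t) z * u) \<le> 2 * (\<bar>B\<bar> * M q j) * (norm u)\<^sup>2"
    proof (rule entire_second_order)
      show "(\<lambda>z. G z j t) holomorphic_on UNIV" using G by (simp add: hol_fam_def)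
      fix w assume "norm (w - z) \<le> 2"
      then have "norm w \<le> norm z + 2" using norm_triangle_ineq2[of w z] by linarith
      from B[OF this t, of j] show "norm (G w j t) \<le> \<bar>B\<bar> * M q j"
        using mult_right_mono[of B "\<bar>B\<bar>" "M q j"] M_pos[of q j] by linarith
    qed fact
    moreover have "inverse u * (G (z + u) j t - G z j t) - deriv (\<lambda>z. G z j t) z
       = inverse u * (G (z + u) j t - G z j t - deriv (\<lambda>z. G z j t) z * u)"
      using u by (simp add: field_simps)
    ultimately have "norm (inverse u * (G (z + u) j t - G z j t) - deriv (\<lambda>z. G z j t) z) \<le> inverse (norm u) * (2 * (\<bar>B\<bar> * M q j) * (norm u)\<^sup>2)"
      using u by (auto simp: norm_mult norm_inverse intro!: mult_left_mono)
    then show ?thesis using u by (simp add: power2_eq_square field_simps)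
  qed
  then show ?thesis by (intro exI[of _ "2 * \<bar>B\<bar>"]) auto
qed

lemma quotient_TF:
  assumes "hol_fam G"
  shows "(\<lambda>j. cscale (inverse u) ((G (z + u) - G z) j)) \<in> TF"
  using assms by (intro TF_scale TF_diff) (auto simp: hol_fam_def)

lemma quotient_lf:
  assumes "lf T" "hol_fam G"
  shows "T (emb (\<lambda>j. cscale (inverse u) ((G (z + u) - G z) j))) = inverse u * (T (emb (G (z + u))) - T (emb (G z)))"
  using assms lf_emb_scale[OF assms(1) TF_diff, of "G (z + u)" "G z" "inverse u"] lf_emb_diff[OF assms(1), of "G (z + u)" "G z"]
  by (simp add: hol_fam_def)

lemma lf_deriv:
  assumes T: "lf T" and G: "hol_fam G" and D: "D \<in> TF" "\<And>j t. deriv (\<lambda>z. G z j t) z = D j t"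
  shows "((\<lambda>z. T (emb (G z))) has_field_derivative T (emb D)) (at z)"
proof -
  obtain q k C where q: "0 < q" "q < 1" "0 \<le> C" and
    b: "\<forall>F B. F \<in> TF \<longrightarrow> (\<forall>j x. \<bar>x\<bar> \<le> c k \<longrightarrow> norm (F j x) \<le> B * M q j) \<longrightarrow> norm (T (emb F)) \<le> C * B"
    using lf_TF_bound[OF T] by (elim exE conjE)
  obtain K where K: "0 \<le> K" "\<And>u j t. u \<noteq> 0 \<Longrightarrow> norm u \<le> 1 \<Longrightarrow> \<bar>t\<bar> \<le> c k \<Longrightarrow>
     norm (inverse u * (G (z + u) j t - G z j t) - deriv (\<lambda>z. G z j t) z) \<le> K * norm u * M q j"
    using hol_fam_quotient[OF G q(1,2), of "c k" z] by blast
  have le: "norm (inverse u * (T (emb (G (z + u))) - T (emb (G z))) - T (emb D)) \<le> C * K * norm u"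
    if u: "u \<noteq> 0" "norm u \<le> 1" for u
  proof -
    let ?X = "(\<lambda>j. cscale (inverse u) ((G (z + u) - G z) j))"
    have "norm (T (emb (?X - D))) \<le> C * (K * norm u)"
    proof (rule b[rule_format])
      show "?X - D \<in> TF" by (rule TF_diff[OF quotient_TF[OF G] D(1)])
      show "norm ((?X - D) j x) \<le> K * norm u * M q j" if "\<bar>x\<bar> \<le> c k" for j x
        using K(2)[OF u that, of j] by (simp add: cscale_def D(2))
    qed
    then show ?thesis
      unfolding lf_emb_diff[OF T quotient_TF[OF G] D(1)] quotient_lf[OF T G] by (simp add: mult.assoc)
  qed
  have "((\<lambda>u. (T (emb (G (z + u))) - T (emb (G z))) / u) \<longlongrightarrow> T (emb D)) (at 0)"
  proof (rule Lim_null_comparison[THEN Lim_null[THEN iffD2]])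
    show "\<forall>\<^sub>F u in at 0. norm ((T (emb (G (z + u))) - T (emb (G z))) / u - T (emb D)) \<le> C * K * norm u"
      unfolding eventually_at using le by (intro exI[of _ 1]) (auto simp: divide_inverse mult.commute)
    show "((\<lambda>u. C * K * norm u) \<longlongrightarrow> 0) (at (0::complex))"
      by (intro tendsto_mult_right_zero tendsto_norm_zero tendsto_ident_at)
  qed
  then show ?thesis by (simp add: DERIV_def)
qed

text \<open>The z-derivative of G is not known to lie in \<open>TF\<close>, but the difference
  quotients do. They are shown to have the Cauchy property under T; the pointwise derivative occurs
  only as a comparison term inside the estimate.\<close>

lemma lf_holomorphic:
  assumes T: "lf T" and G: "hol_fam G"
  shows "(\<lambda>z. T (emb (G z))) holomorphic_on UNIV"
proof -
  obtain q k C where q: "0 < q" "q < 1" "0 \<le> C" and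
    b: "\<forall>F B. F \<in> TF \<longrightarrow> (\<forall>j x. \<bar>x\<bar> \<le> c k \<longrightarrow> norm (F j x) \<le> B * M q j) \<longrightarrow> norm (T (emb F)) \<le> C * B"
    using lf_TF_bound[OF T] by (elim exE conjE)
  have "\<exists>L. ((\<lambda>z. T (emb (G z))) has_field_derivative L) (at z)" for z
  proof -
    obtain K where K: "0 \<le> K" "\<And>u j t. u \<noteq> 0 \<Longrightarrow> norm u \<le> 1 \<Longrightarrow> \<bar>t\<bar> \<le> c k \<Longrightarrow>
       norm (inverse u * (G (z + u) j t - G z j t) - deriv (\<lambda>z. G z j t) z) \<le> K * norm u * M q j"
      using hol_fam_quotient[OF G q(1,2), of "c k" z] by blast
    define Q where "Q u = inverse u * (T (emb (G (z + u))) - T (emb (G z)))" for u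
    have le: "norm (Q u - Q v) \<le> C * K * (norm u + norm v)"
      if u: "u \<noteq> 0" "norm u \<le> 1" and v: "v \<noteq> 0" "norm v \<le> 1" for u v
    proof -
      let ?X = "\<lambda>u. (\<lambda>j. cscale (inverse u) ((G (z + u) - G z) j))"
      have "norm (T (emb (?X u - ?X v))) \<le> C * (K * (norm u + norm v))"
      proof (rule b[rule_format])
        show "?X u - ?X v \<in> TF" by (intro TF_diff quotient_TF G)
        fix j x assume x: "\<bar>x\<bar> \<le> c k"
        have eq: "(?X u - ?X v) j x = (inverse u * (G (z + u) j x - G z j x) - deriv (\<lambda>z. G z j x) z) - (inverse v * (G (z + v) j x - G z j x) - deriv (\<lambda>z. G z j x) z)"
          by (simp add: cscale_def)
        show "norm ((?X u - ?X v) j x) \<le> K * (norm u + norm v) * M q j"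
          unfolding eq distrib_left distrib_right
          by (rule norm_triangle_le_diff[OF add_mono[OF K(2)[OF u x, of j] K(2)[OF v x, of j]]])
      qed
      then show ?thesis
        unfolding lf_emb_diff[OF T quotient_TF[OF G] quotient_TF[OF G]] quotient_lf[OF T G] Q_def
        by (simp add: mult.assoc)
    qed
    define u where "u n = complex_of_real (1 / (real n + 1))" for n :: nat
    have nun: "norm (u n) = 1 / (real n + 1)" for n unfolding u_def norm_of_real by simp
    have u: "u n \<noteq> 0" "norm (u n) \<le> 1" for n
    proof -
      have "0 < norm (u n)" "norm (u n) \<le> 1" unfolding nun by simp_all
      then show "u n \<noteq> 0" "norm (u n) \<le> 1" by auto
    qed
    have nu: "(\<lambda>n. norm (u n)) \<longlonglongrightarrow> 0"
      using LIMSEQ_inverse_real_of_nat by (simp add: nun inverse_eq_divide add.commute)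
    have "Cauchy (\<lambda>n. Q (u n))"
    proof (rule metric_CauchyI)
      fix e :: real assume e: "0 < e"
      have "(\<lambda>n. C * K * norm (u n)) \<longlonglongrightarrow> 0" by (intro tendsto_mult_right_zero nu)
      from order_tendstoD(2)[OF this, of "e/2"] e
      obtain N where N: "\<And>n. N \<le> n \<Longrightarrow> C * K * norm (u n) < e / 2" by (auto simp: eventually_sequentially)
      show "\<exists>M. \<forall>m\<ge>M. \<forall>n\<ge>M. dist (Q (u m)) (Q (u n)) < e"
      proof (intro exI[of _ N] allI impI)
        fix m n assume "N \<le> m" "N \<le> n"
        then show "dist (Q (u m)) (Q (u n)) < e"
          using le[OF u u, of m n] N[of m] N[of n] by (simp add: dist_norm distrib_left)
      qed
    qed
    then obtain L where L: "(\<lambda>n. Q (u n)) \<longlonglongrightarrow> L" using Cauchy_convergent convergent_def by blast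
    have leL: "norm (Q v - L) \<le> C * K * norm v" if v: "v \<noteq> 0" "norm v \<le> 1" for v
    proof (rule LIMSEQ_le)
      show "(\<lambda>n. norm (Q v - Q (u n))) \<longlonglongrightarrow> norm (Q v - L)" by (intro tendsto_intros L)
      show "(\<lambda>n. C * K * (norm v + norm (u n))) \<longlonglongrightarrow> C * K * norm v"
        using tendsto_mult_left[OF tendsto_add[OF tendsto_const nu], of "C * K" "norm v"] by simp
      show "\<exists>N. \<forall>n\<ge>N. norm (Q v - Q (u n)) \<le> C * K * (norm v + norm (u n))" using le[OF v u] by blast
    qed
    have "((\<lambda>u. (T (emb (G (z + u))) - T (emb (G z))) / u) \<longlongrightarrow> L) (at 0)"
    proof (rule Lim_null_comparison[THEN Lim_null[THEN iffD2]])
      show "\<forall>\<^sub>F u in at 0. norm ((T (emb (G (z + u))) - T (emb (G z))) / u - L) \<le> C * K * norm u"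
        unfolding eventually_at using leL by (intro exI[of _ 1]) (auto simp: Q_def divide_inverse mult.commute)
      show "((\<lambda>u. C * K * norm u) \<longlongrightarrow> 0) (at (0::complex))"
        by (intro tendsto_mult_right_zero tendsto_norm_zero tendsto_ident_at)
    qed
    then show ?thesis by (auto simp: DERIV_def)
  qed
  then show ?thesis by (auto simp: holomorphic_on_open)
qed

lemma hol_fam_exp: "hol_fam (exp_fam n)"
  unfolding hol_fam_def
proof (intro conjI allI impI)
  show "exp_fam n z \<in> TF" for z by (rule TF_exp)
  show "(\<lambda>z. exp_fam n z j t) holomorphic_on UNIV" for j t
    using exp_fam_deriv_z holomorphic_on_open by blast
  fix \<rho> R q :: real assume q: "0 < q" "q < 1"
  define r where "r = max 1 \<rho> + real n"
  have r: "1 \<le> r" by (simp add: r_def add_increasing2)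
  have "norm (exp_fam n z j t) \<le> exp (\<bar>R\<bar> * \<bar>\<rho>\<bar>) * (\<bar>R\<bar> + 1) ^ n * exp (q * \<omega> r) * M q j" if z: "norm z \<le> \<rho>" and t: "\<bar>t\<bar> \<le> R" for z j t
  proof -
    have "norm (exp_fam n z j t) \<le> exp (t * Im z) * (\<bar>t\<bar> + 1) ^ n * (max 1 (norm z) + real n) ^ j"
      by (rule exp_fam_bound)
    also have "\<dots> \<le> exp (\<bar>R\<bar> * \<bar>\<rho>\<bar>) * (\<bar>R\<bar> + 1) ^ n * (exp (q * \<omega> r) * M q j)"
    proof (intro mult_mono power_mono)
      have "t * Im z \<le> \<bar>t\<bar> * \<bar>Im z\<bar>" by (metis abs_ge_self abs_mult)
      also have "\<dots> \<le> \<bar>R\<bar> * \<bar>\<rho>\<bar>" using t z abs_Im_le_cmod[of z] by (intro mult_mono) auto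
      finally show "exp (t * Im z) \<le> exp (\<bar>R\<bar> * \<bar>\<rho>\<bar>)" by simp
      have "(max 1 (norm z) + real n) ^ j \<le> r ^ j" using z by (intro power_mono) (auto simp: r_def)
      also have "\<dots> \<le> exp (q * \<omega> r) * M q j" by (rule power_le_M[OF q(1) r])
      finally show "(max 1 (norm z) + real n) ^ j \<le> exp (q * \<omega> r) * M q j" .
    qed (use t in auto)
    finally show ?thesis by (simp add: mult_ac)
  qed
  then show "\<exists>B. \<forall>z j t. norm z \<le> \<rho> \<longrightarrow> \<bar>t\<bar> \<le> R \<longrightarrow> norm (exp_fam n z j t) \<le> B * M q j" by blast
qed

lemma lf_exp_deriv:
  assumes T: "lf T"
  shows "((\<lambda>z. T (emb (exp_fam n z))) has_field_derivative - \<i> * T (emb (exp_fam (Suc n) z))) (at z)"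
proof -
  have "((\<lambda>z. T (emb (exp_fam n z))) has_field_derivative T (emb (\<lambda>j. cscale (- \<i>) (exp_fam (Suc n) z j)))) (at z)"
    by (rule lf_deriv[OF T hol_fam_exp TF_scale[OF TF_exp]])
       (use DERIV_imp_deriv[OF exp_fam_deriv_z] in \<open>simp add: cscale_def del: exp_fam.simps\<close>)
  then show ?thesis unfolding lf_emb_scale[OF T TF_exp] .
qed

lemma lf_exp_higher_deriv:
  assumes T: "lf T"
  shows "(deriv ^^ n) (\<lambda>z. T (emb (exp_fam 0 z))) z = (- \<i>) ^ n * T (emb (exp_fam n z))"
proof (induction n arbitrary: z)
  case (Suc n)
  have "(deriv ^^ n) (\<lambda>z. T (emb (exp_fam 0 z))) = (\<lambda>z. (- \<i>) ^ n * T (emb (exp_fam n z)))"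
    using Suc by (rule ext)
  then have "(deriv ^^ Suc n) (\<lambda>z. T (emb (exp_fam 0 z))) z = deriv (\<lambda>z. (- \<i>) ^ n * T (emb (exp_fam n z))) z"
    by (simp del: exp_fam.simps)
  also have "\<dots> = (- \<i>) ^ n * (- \<i> * T (emb (exp_fam (Suc n) z)))"
    by (intro DERIV_imp_deriv DERIV_cmult lf_exp_deriv T)
  finally show ?case by (simp del: exp_fam.simps)
qed simp

end

section \<open>Translation and compact supports\<close>

lemma vector_mean_value_bound:
  fixes u :: "real \<Rightarrow> complex"
  assumes "\<And>s. s \<in> closed_segment t0 t \<Longrightarrow> (u has_vector_derivative u' s) (at s)"
    and "\<And>s. s \<in> closed_segment t0 t \<Longrightarrow> norm (u' s) \<le> K"
  shows "norm (u t - u t0) \<le> K * \<bar>t - t0\<bar>"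
proof -
  have "norm (u t - u t0) \<le> K * norm (t - t0)"
  proof (rule differentiable_bound[where S="closed_segment t0 t" and f'="\<lambda>s h. h *\<^sub>R u' s"])
    fix s assume s: "s \<in> closed_segment t0 t"
    show "(u has_derivative (\<lambda>h. h *\<^sub>R u' s)) (at s within closed_segment t0 t)"
      using assms(1)[OF s] has_derivative_at_withinI by (auto simp: has_vector_derivative_def)
    show "onorm (\<lambda>h. h *\<^sub>R u' s) \<le> K"
      by (rule onorm_le) (use assms(2)[OF s] in \<open>auto simp: mult.commute[of K] intro: mult_left_mono\<close>)
  qed auto
  then show ?thesis by simp
qed

context weight_setting
begin

text \<open>The difference quotients of translates converge in every semi-norm, because the error in
  the j-th derivative is at most |h| times a bound for \<open>F (Suc (Suc j))\<close>.\<close>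

lemma translate_deriv:
  assumes S: "lf S" and F: "F \<in> TF"
  shows "((\<lambda>y. S (emb (translate y F))) has_vector_derivative S (emb (translate y (\<lambda>j. F (Suc j))))) (at y)"
proof -
  obtain q k C where q: "0 < q" "q < 1" "0 \<le> C" and
    b: "\<forall>F B. F \<in> TF \<longrightarrow> (\<forall>j x. \<bar>x\<bar> \<le> c k \<longrightarrow> norm (F j x) \<le> B * M q j) \<longrightarrow> norm (S (emb F)) \<le> C * B"
    using lf_TF_bound[OF S] by (elim exE conjE)
  have F2: "(\<lambda>j. F (Suc (Suc j))) \<in> TF" by (intro TF_shift[of "\<lambda>j. F (Suc j)"] TF_shift F)
  obtain B where B: "0 < B" "\<And>j x. \<bar>x\<bar> \<le> c k + \<bar>y\<bar> + 1 \<Longrightarrow> norm (F (Suc (Suc j)) x) \<le> B * M q j"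
    using TF_B[OF F2 q(1,2)] by blast
  let ?D = "translate y (\<lambda>j. F (Suc j))"
  have DT: "?D \<in> TF" by (intro TF_translate TF_shift F)
  let ?X = "\<lambda>h. (\<lambda>j. cscale (of_real (inverse h)) ((translate (y + h) F - translate y F) j))"
  have XT: "?X h \<in> TF" for h by (intro TF_scale TF_diff TF_translate F)
  have le: "norm (inverse h *\<^sub>R (S (emb (translate (y + h) F)) - S (emb (translate y F))) - S (emb ?D)) \<le> C * (B * \<bar>h\<bar>)"
    if h: "h \<noteq> 0" "\<bar>h\<bar> \<le> 1" for h
  proof -
    have "norm (S (emb (?X h - ?D))) \<le> C * (B * \<bar>h\<bar>)"
    proof (rule b[rule_format])
      show "?X h - ?D \<in> TF" by (rule TF_diff[OF XT DT])
      fix j x assume x: "\<bar>x\<bar> \<le> c k"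
      define p where "p = x + y"
      have seg: "\<bar>s\<bar> \<le> c k + \<bar>y\<bar> + 1 \<and> \<bar>s - p\<bar> \<le> \<bar>h\<bar>" if "s \<in> closed_segment p (p + h)" for s
        using that x h by (auto simp: closed_segment_eq_real_ivl p_def split: if_splits)
      have d1: "norm (F (Suc j) s - F (Suc j) p) \<le> B * M q j * \<bar>h\<bar>" if s: "s \<in> closed_segment p (p + h)" for s
      proof -
        have sub: "closed_segment p s \<subseteq> closed_segment p (p + h)" using s by (simp add: closed_segment_subset)
        have "norm (F (Suc j) s - F (Suc j) p) \<le> B * M q j * \<bar>s - p\<bar>"
          by (rule vector_mean_value_bound[where u'="F (Suc (Suc j))"]) (use TF_D[OF F] B(2) seg sub in blast)+
        also have "\<dots> \<le> B * M q j * \<bar>h\<bar>" using seg[OF s] B(1) M_pos[of q j] by (intro mult_left_mono) auto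
        finally show ?thesis .
      qed
      have "norm (F j (p + h) - F j p - ((p + h) - p) *\<^sub>R F (Suc j) p) \<le> norm ((p + h) - p) * (B * M q j * \<bar>h\<bar>)"
        by (rule vector_differentiable_bound_linearization[where S="closed_segment p (p + h)" and f'="F (Suc j)"])
           (use has_vector_derivative_at_within[OF TF_D[OF F]] d1 in auto)
      then have lin: "norm (F j (p + h) - F j p - h *\<^sub>R F (Suc j) p) \<le> \<bar>h\<bar> * (B * M q j * \<bar>h\<bar>)" by simp
      have "(?X h - ?D) j x = inverse h *\<^sub>R (F j (p + h) - F j p - h *\<^sub>R F (Suc j) p)"
        using h by (simp add: cscale_def translate_def p_def algebra_simps scaleR_conv_of_real)
      then have "norm ((?X h - ?D) j x) = inverse \<bar>h\<bar> * norm (F j (p + h) - F j p - h *\<^sub>R F (Suc j) p)"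
        by simp
      also have "\<dots> \<le> inverse \<bar>h\<bar> * (\<bar>h\<bar> * (B * M q j * \<bar>h\<bar>))"
        by (intro mult_left_mono lin) simp
      also have "\<dots> = B * \<bar>h\<bar> * M q j" using h by (simp add: field_simps)
      finally show "norm ((?X h - ?D) j x) \<le> B * \<bar>h\<bar> * M q j" .
    qed
    then show ?thesis
      unfolding lf_emb_diff[OF S XT DT] lf_emb_scale[OF S TF_diff[OF TF_translate[OF F] TF_translate[OF F]]]
        lf_emb_diff[OF S TF_translate[OF F] TF_translate[OF F]]
      by (simp add: scaleR_conv_of_real)
  qed
  have "((\<lambda>h. norm (S (emb (translate (y + h) F)) - S (emb (translate y F)) - h *\<^sub>R S (emb ?D)) / norm h) \<longlongrightarrow> 0) (at 0)"
  proof (rule Lim_null_comparison)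
    have "norm (S (emb (translate (y + h) F)) - S (emb (translate y F)) - h *\<^sub>R S (emb ?D)) / norm h \<le> C * (B * \<bar>h\<bar>)"
      if h: "h \<noteq> 0" "\<bar>h\<bar> \<le> 1" for h
    proof -
      have "S (emb (translate (y + h) F)) - S (emb (translate y F)) - h *\<^sub>R S (emb ?D)
         = h *\<^sub>R (inverse h *\<^sub>R (S (emb (translate (y + h) F)) - S (emb (translate y F))) - S (emb ?D))"
        using h by (simp add: scaleR_right_diff_distrib)
      then have "norm (S (emb (translate (y + h) F)) - S (emb (translate y F)) - h *\<^sub>R S (emb ?D)) / norm h
         = norm (inverse h *\<^sub>R (S (emb (translate (y + h) F)) - S (emb (translate y F))) - S (emb ?D))"
        using h by simp
      then show ?thesis using le[OF h] by simp
    qed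
    then show "\<forall>\<^sub>F h in at 0. norm (norm (S (emb (translate (y + h) F)) - S (emb (translate y F)) - h *\<^sub>R S (emb ?D)) / norm h) \<le> C * (B * \<bar>h\<bar>)"
      unfolding eventually_at by (intro exI[of _ 1]) auto
    show "((\<lambda>h. C * (B * \<bar>h\<bar>)) \<longlongrightarrow> 0) (at (0::real))"
      by (intro tendsto_mult_right_zero tendsto_rabs_zero tendsto_ident_at)
  qed
  then show ?thesis
    by (simp add: has_vector_derivative_def has_derivative_at bounded_linear_scaleR_left)
qed

definition supp_in :: "((real \<Rightarrow> complex) \<Rightarrow> complex) \<Rightarrow> real \<Rightarrow> real \<Rightarrow> bool" where
  "supp_in T b d \<longleftrightarrow> (\<forall>F\<in>TF. \<forall>\<delta>>0. (\<forall>x. b - \<delta> < x \<and> x < d + \<delta> \<longrightarrow> F 0 x = 0) \<longrightarrow> T (emb F) = 0)"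

lemma supp_in_eq:
  assumes T: "lf T" "supp_in T b d" and F: "F \<in> TF" "G \<in> TF" and "0 < \<delta>"
    and eq: "\<And>x. b - \<delta> < x \<Longrightarrow> x < d + \<delta> \<Longrightarrow> F 0 x = G 0 x"
  shows "T (emb F) = T (emb G)"
proof -
  have "T (emb (F - G)) = 0"
    using T(2) TF_diff[OF F] \<open>0 < \<delta>\<close> eq unfolding supp_in_def by auto
  then show ?thesis using lf_emb_diff[OF T(1) F] by simp
qed

lemma point_lf_lf: "point_lf S \<Longrightarrow> lf S" by (simp add: point_lf_def)

lemma point_lf_supp_in: "point_lf S \<Longrightarrow> supp_in S 0 0"
  unfolding supp_in_def
proof (intro ballI allI impI)
  fix F and \<delta> :: real
  assume S: "point_lf S" and F: "F \<in> TF" and \<delta>: "0 < \<delta>" and z: "\<forall>x. 0 - \<delta> < x \<and> x < 0 + \<delta> \<longrightarrow> F 0 x = 0"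
  have "\<forall>x. \<bar>x\<bar> < \<delta> \<longrightarrow> emb F x = 0" using z by (auto simp: emb_def abs_less_iff)
  then show "S (emb F) = 0" using S emb_U[OF F] \<delta> unfolding point_lf_def by blast
qed

text \<open>Multiplication by a cutoff equal to 1 near [b;d] does not change the value of T, so only
  points within distance \<epsilon> of [b;d] enter; the price is a larger index q.\<close>

lemma supp_in_bound:
  assumes T: "lf T" "supp_in T b d" and bd: "b \<le> d" and \<epsilon>: "0 < \<epsilon>"
  shows "\<exists>q C. 0 < q \<and> q < 1 \<and> 0 \<le> C \<and> (\<forall>F B. F \<in> TF \<longrightarrow>
     (\<forall>j x. b - \<epsilon> \<le> x \<and> x \<le> d + \<epsilon> \<longrightarrow> norm (F j x) \<le> B * M q j) \<longrightarrow> norm (T (emb F)) \<le> C * B)"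
proof -
  obtain q k C where q: "0 < q" "q < 1" "0 \<le> C" and
    b: "\<forall>F B. F \<in> TF \<longrightarrow> (\<forall>j x. \<bar>x\<bar> \<le> c k \<longrightarrow> norm (F j x) \<le> B * M q j) \<longrightarrow> norm (T (emb F)) \<le> C * B"
    using lf_TF_bound[OF T(1)] by (elim exE conjE)
  define p where "p = (q + 1) / 2"
  have p: "q < p" "p < 1" "0 < p" using q by (auto simp: p_def)
  obtain \<eta> where \<eta>: "step_fam \<eta>" "\<And>x. b - \<epsilon>/4 \<le> x \<Longrightarrow> x \<le> d + \<epsilon>/4 \<Longrightarrow> \<eta> 0 x = 1"
    "\<And>j x. x \<le> b - \<epsilon> \<or> d + \<epsilon> \<le> x \<Longrightarrow> \<eta> j x = 0"
    by (rule cutoff[OF bd \<epsilon>]) (rule that)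
  obtain K where K: "0 < K" "\<forall>F B S. (\<forall>j. \<forall>x\<in>S. norm (F j x) \<le> B * M p j) \<longrightarrow> (\<forall>j. \<forall>x\<in>S. norm (leibniz \<eta> F j x) \<le> K * B * M q j)"
    using leibniz_bound[OF \<eta>(1) q(1) p(1) p(2)] by (elim exE conjE)
  have "norm (T (emb F)) \<le> (C * K) * B" if F: "F \<in> TF" and B: "\<forall>j x. b - \<epsilon> \<le> x \<and> x \<le> d + \<epsilon> \<longrightarrow> norm (F j x) \<le> B * M p j" for F B
  proof -
    have "0 \<le> norm (F 0 b)" by simp
    also have "norm (F 0 b) \<le> B * M p 0" using B bd \<epsilon> by auto
    finally have B0: "0 \<le> B" using M_pos[of p 0] by (simp add: zero_le_mult_iff)
    have "T (emb F) = T (emb (leibniz \<eta> F))"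
      by (rule supp_in_eq[OF T F TF_leibniz[OF \<eta>(1) F], of "\<epsilon>/4"]) (use \<epsilon> \<eta>(2) in auto)
    moreover have "norm (T (emb (leibniz \<eta> F))) \<le> C * (K * B)"
    proof (rule b[rule_format])
      show "leibniz \<eta> F \<in> TF" by (rule TF_leibniz[OF \<eta>(1) F])
      fix j x
      show "norm (leibniz \<eta> F j x) \<le> K * B * M q j"
      proof (cases "x \<le> b - \<epsilon> \<or> d + \<epsilon> \<le> x")
        case True
        then have "leibniz \<eta> F j x = 0" using \<eta>(3) by (simp add: leibniz_def)
        then show ?thesis using K(1) B0 M_pos[of q j] by simp
      next
        case False
        have "\<forall>j. \<forall>x\<in>{b - \<epsilon>..d + \<epsilon>}. norm (F j x) \<le> B * M p j" using B by simp
        then have "\<forall>j. \<forall>x\<in>{b - \<epsilon>..d + \<epsilon>}. norm (leibniz \<eta> F j x) \<le> K * B * M q j" using K(2) by blast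
        then show ?thesis using False by simp
      qed
    qed
    ultimately show ?thesis by (simp add: mult.assoc)
  qed
  then show ?thesis using p q(3) K(1) by (intro exI[of _ p] exI[of _ "C * K"]) auto
qed

lemma w_small:
  assumes e: "0 < e"
  shows "\<exists>K. \<forall>x\<ge>0. \<omega> (max 1 x) \<le> e * x + K"
proof -
  have "\<omega> \<in> o[at_top](\<lambda>x. x)" using w by (simp add: weight_def)
  from landau_o.smallD[OF this e] obtain X where X: "\<And>x. X \<le> x \<Longrightarrow> \<bar>\<omega> x\<bar> \<le> e * \<bar>x\<bar>"
    by (auto simp: eventually_at_top_linorder)
  have "\<omega> (max 1 x) \<le> e * x + (\<omega> (max 1 \<bar>X\<bar>) + e)" if x: "0 \<le> x" for x
  proof (cases "max 1 x \<le> max 1 \<bar>X\<bar>")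
    case True
    then have "\<omega> (max 1 x) \<le> \<omega> (max 1 \<bar>X\<bar>)" by (intro w_mono) auto
    moreover have "0 \<le> e * x" using e x by simp
    ultimately show ?thesis using e by linarith
  next
    case False
    then have "X \<le> max 1 x" by linarith
    from X[OF this] have "\<omega> (max 1 x) \<le> e * max 1 x" by linarith
    also have "\<dots> \<le> e * (x + 1)" using e x by (intro mult_left_mono) auto
    finally have "\<omega> (max 1 x) \<le> e * x + e" by (simp add: distrib_left)
    moreover have "0 \<le> \<omega> (max 1 \<bar>X\<bar>)" by (rule w_nonneg) simp
    ultimately show ?thesis by linarith
  qed
  then show ?thesis by blast
qed

text \<open>The easy half of the Paley-Wiener theorem, with the support function max (b * Im z) (d *
  Im z) of [b;d]. One half of e pays for the enlarged support, the other for \<omega>.\<close>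

lemma supp_in_growth:
  assumes T: "lf T" "supp_in T b d" and bd: "b \<le> d" and e: "0 < e"
  shows "\<exists>C\<ge>0. \<forall>z. norm (T (emb (exp_fam 0 z))) \<le> C * exp (e * norm z + max (b * Im z) (d * Im z))"
proof -
  obtain q C where q: "0 < q" "q < 1" "0 \<le> C" and
    b: "\<forall>F B. F \<in> TF \<longrightarrow> (\<forall>j x. b - e/2 \<le> x \<and> x \<le> d + e/2 \<longrightarrow> norm (F j x) \<le> B * M q j) \<longrightarrow> norm (T (emb F)) \<le> C * B"
    using supp_in_bound[OF T bd half_gt_zero[OF e]] by (elim exE conjE)
  obtain K where K: "\<And>x. 0 \<le> x \<Longrightarrow> \<omega> (max 1 x) \<le> e/2 * x + K" using w_small[of "e/2"] e by auto
  have "norm (T (emb (exp_fam 0 z))) \<le> (C * exp \<bar>K\<bar>) * exp (e * norm z + max (b * Im z) (d * Im z))" for z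
  proof -
    have "norm (T (emb (exp_fam 0 z))) \<le> C * (exp (e/2 * norm z + max (b * Im z) (d * Im z)) * exp (q * \<omega> (max 1 (norm z))))"
    proof (rule b[rule_format, OF TF_exp])
      fix j x assume x: "b - e/2 \<le> x \<and> x \<le> d + e/2"
      have "norm (exp_fam 0 z j x) \<le> exp (x * Im z) * max 1 (norm z) ^ j"
        using exp_fam_bound[of 0 z j x] by simp
      also have "\<dots> \<le> exp (e/2 * norm z + max (b * Im z) (d * Im z)) * (exp (q * \<omega> (max 1 (norm z))) * M q j)"
      proof (intro mult_mono)
        have "x * Im z \<le> e/2 * \<bar>Im z\<bar> + max (b * Im z) (d * Im z)"
        proof (cases "0 \<le> Im z")
          case True
          then have "x * Im z \<le> (d + e/2) * Im z" using x by (intro mult_right_mono) auto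
          then show ?thesis using True by (simp add: algebra_simps)
        next
          case False
          then have "x * Im z \<le> (b - e/2) * Im z" using x by (intro mult_right_mono_neg) auto
          then show ?thesis using False by (simp add: algebra_simps)
        qed
        also have "e/2 * \<bar>Im z\<bar> \<le> e/2 * norm z" using e abs_Im_le_cmod[of z] by (intro mult_left_mono) auto
        finally show "exp (x * Im z) \<le> exp (e/2 * norm z + max (b * Im z) (d * Im z))" by simp
        show "max 1 (norm z) ^ j \<le> exp (q * \<omega> (max 1 (norm z))) * M q j"
          by (rule power_le_M[OF q(1)]) simp
      qed auto
      finally show "norm (exp_fam 0 z j x) \<le> exp (e/2 * norm z + max (b * Im z) (d * Im z)) * exp (q * \<omega> (max 1 (norm z))) * M q j"
        by (simp add: mult.assoc)
    qed
    also have "\<dots> \<le> C * (exp (e/2 * norm z + max (b * Im z) (d * Im z)) * exp (e/2 * norm z + \<bar>K\<bar>))"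
    proof (intro mult_left_mono)
      have "q * \<omega> (max 1 (norm z)) \<le> 1 * \<omega> (max 1 (norm z))" using q w_nonneg by (intro mult_right_mono) auto
      also have "\<dots> \<le> e/2 * norm z + \<bar>K\<bar>" using K[of "norm z"] by simp
      finally show "exp (q * \<omega> (max 1 (norm z))) \<le> exp (e/2 * norm z + \<bar>K\<bar>)" by simp
    qed (use q in auto)
    also have "\<dots> = (C * exp \<bar>K\<bar>) * exp (e * norm z + max (b * Im z) (d * Im z))"
      by (simp add: exp_add[symmetric] mult_ac algebra_simps)
    finally show ?thesis .
  qed
  then show ?thesis using q(3) by (intro exI[of _ "C * exp \<bar>K\<bar>"]) auto
qed

lemma point_lf_zero_type:
  assumes "point_lf S"
  shows "zero_type (\<lambda>z. S (emb (exp_fam 0 z)))"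
  unfolding zero_type_def
proof (intro allI impI)
  fix e :: real assume "0 < e"
  then show "\<exists>C. \<forall>z. norm (S (emb (exp_fam 0 z))) \<le> C * exp (e * norm z)"
    using supp_in_growth[of S 0 0 e] point_lf_supp_in[OF assms] assms by (auto simp: point_lf_def simp del: exp_fam.simps)
qed

text \<open>Removes the choice in the definition of \<open>local_conv\<close>: two candidates agree
  near 0, hence S takes the same value on them.\<close>

lemma local_conv_eq:
  assumes S: "point_lf S" and f: "f \<in> U" and y: "y \<in> sym_ival a" and F: "F \<in> TF"
    and \<delta>: "0 < \<delta>" and eq: "\<And>x. \<bar>x - y\<bar> < \<delta> \<Longrightarrow> F 0 x = f x"
  shows "local_conv \<omega> a c S f y = S (emb (translate y F))"
proof -
  let ?P = "\<lambda>g. g \<in> U \<and> (\<forall>\<^sub>F x in nhds 0. g x = f (x + y))"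
  have TT: "emb (translate y F) \<in> U" by (intro emb_U TF_translate F)
  have ev: "\<forall>\<^sub>F x in nhds 0. emb (translate y F) x = f (x + y)"
  proof -
    have "\<forall>\<^sub>F x in nhds 0. x \<in> sym_ival a" using sym_ival_open zero_in_sym by (rule eventually_nhds_in_open)
    moreover have "\<forall>\<^sub>F x in nhds 0. x \<in> ball 0 \<delta>" using \<delta> by (intro eventually_nhds_in_open) auto
    ultimately show ?thesis
    proof eventually_elim
      case (elim x)
      then show ?case using eq[of "x + y"] by (simp add: emb_def translate_def dist_real_def)
    qed
  qed
  have P: "?P (SOME g. ?P g)" by (rule someI[of ?P "emb (translate y F)"]) (use TT ev in blast)
  define g where "g = (SOME g. ?P g)"
  have g: "g \<in> U" "\<forall>\<^sub>F x in nhds 0. g x = f (x + y)" using P by (simp_all add: g_def)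
  have "\<forall>\<^sub>F x in nhds 0. (g - emb (translate y F)) x = 0" using g(2) ev by eventually_elim simp
  then obtain e where "0 < e" "\<forall>x. \<bar>x\<bar> < e \<longrightarrow> (g - emb (translate y F)) x = 0"
    by (auto simp: eventually_nhds_metric dist_real_def)
  then have "S (g - emb (translate y F)) = 0" using S U_diff[OF g(1) TT] unfolding point_lf_def by blast
  then have "S g = S (emb (translate y F))" using lf_diff[OF point_lf_lf[OF S] g(1) TT] by simp
  then show ?thesis by (simp add: local_conv_def g_def)
qed

section \<open>Resolvents of the derivative\<close>

text \<open>The equation g' + i z g = F, with all higher members of g determined by it; only the
  first derivative has to be asked for.\<close>

definition resolvent :: "complex \<Rightarrow> (nat \<Rightarrow> real \<Rightarrow> complex) \<Rightarrow> (nat \<Rightarrow> real \<Rightarrow> complex) \<Rightarrow> bool" where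
  "resolvent z F g \<longleftrightarrow> (\<forall>t. (g 0 has_vector_derivative g 1 t) (at t)) \<and> (\<forall>j t. g (Suc j) t = F j t - \<i> * z * g j t)"

lemma resolvent_deriv:
  assumes g: "resolvent z F g" and F: "F \<in> TF"
  shows "(g j has_vector_derivative g (Suc j) t) (at t)"
proof (induction j)
  case 0
  then show ?case using g unfolding resolvent_def One_nat_def by blast
next
  case (Suc j)
  have "((\<lambda>t. F j t - \<i> * z * g j t) has_vector_derivative F (Suc j) t - \<i> * z * g (Suc j) t) (at t)"
    by (intro has_vector_derivative_diff has_vector_derivative_mult_right TF_D[OF F] Suc)
  moreover have "g (Suc j) = (\<lambda>t. F j t - \<i> * z * g j t)" "g (Suc (Suc j)) t = F (Suc j) t - \<i> * z * g (Suc j) t"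
    using g by (auto simp: resolvent_def)
  ultimately show ?case by simp
qed

text \<open>With the integrating factor exp (i z (s - t)) only the right-hand side remains to be
  integrated. K bounds the real exponent of this factor on the way from t0, where g j vanishes, to
  t.\<close>

lemma resolvent_bound:
  assumes g: "resolvent z F g" and F: "F \<in> TF" and z0: "g j t0 = 0"
    and B: "\<And>s. s \<in> closed_segment t0 t \<Longrightarrow> norm (F j s) \<le> B"
    and K: "\<And>s. s \<in> closed_segment t0 t \<Longrightarrow> - Im z * (s - t) \<le> K"
  shows "norm (g j t) \<le> \<bar>t - t0\<bar> * exp K * B"
proof -
  define u where "u s = exp (\<i> * z * of_real (s - t)) * g j s" for s
  have B0: "0 \<le> B" using order_trans[OF norm_ge_zero B[of t]] by simp
  have e: "((\<lambda>s. exp (\<i> * z * of_real (s - t))) has_vector_derivative \<i> * z * exp (\<i> * z * of_real (s - t))) (at s)" for s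
  proof -
    have "((\<lambda>w. exp (\<i> * z * (w - of_real t))) has_field_derivative \<i> * z * exp (\<i> * z * (of_real s - of_real t))) (at (of_real s))"
      by (auto intro!: derivative_eq_intros)
    from has_vector_derivative_real_field[OF this] show ?thesis by (simp add: o_def)
  qed
  have du: "(u has_vector_derivative exp (\<i> * z * of_real (s - t)) * F j s) (at s)" for s
  proof -
    have "(u has_vector_derivative exp (\<i> * z * of_real (s - t)) * g (Suc j) s + \<i> * z * exp (\<i> * z * of_real (s - t)) * g j s) (at s)"
      unfolding u_def by (rule has_vector_derivative_mult[OF e resolvent_deriv[OF g F]])
    moreover have "g (Suc j) s = F j s - \<i> * z * g j s" using g by (simp add: resolvent_def)
    ultimately show ?thesis by (simp add: algebra_simps)
  qed
  have "norm (u t - u t0) \<le> (exp K * B) * \<bar>t - t0\<bar>"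
  proof (rule vector_mean_value_bound[OF du])
    fix s assume s: "s \<in> closed_segment t0 t"
    have "norm (exp (\<i> * z * of_real (s - t))) = exp (- Im z * (s - t))" by (simp add: norm_exp_eq_Re)
    then show "norm (exp (\<i> * z * of_real (s - t)) * F j s) \<le> exp K * B"
      using K[OF s] B[OF s] B0 unfolding norm_mult by (intro mult_mono) auto
  qed
  then show ?thesis using z0 by (simp add: u_def mult_ac)
qed

text \<open>Compact support in [-R;R], for all derivatives at once.\<close>

definition decaying :: "real \<Rightarrow> (nat \<Rightarrow> real \<Rightarrow> complex) \<Rightarrow> bool" where
  "decaying R F \<longleftrightarrow> F \<in> TF \<and> 0 < R \<and> (\<forall>j x. R \<le> \<bar>x\<bar> \<longrightarrow> F j x = 0)"

lemma decaying_bound: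
  assumes F: "decaying R F" and q: "0 < q" "q < 1"
  shows "\<exists>B>0. \<forall>j x. norm (F j x) \<le> B * M q j"
proof -
  have "F \<in> TF" using F by (simp add: decaying_def)
  then obtain B where B: "0 < B" "\<And>j x. \<bar>x\<bar> \<le> R \<Longrightarrow> norm (F j x) \<le> B * M q j" using TF_B[OF _ q] by blast
  have "norm (F j x) \<le> B * M q j" for j x
  proof (cases "\<bar>x\<bar> \<le> R")
    case False
    then have "F j x = 0" using F by (simp add: decaying_def)
    then show ?thesis using B(1) M_pos[of q j] by simp
  qed (use B in auto)
  then show ?thesis using B(1) by blast
qed

lemma decaying_shift: "decaying R F \<Longrightarrow> decaying R (\<lambda>j. F (Suc j))"
  by (auto simp: decaying_def intro: TF_shift)

text \<open>At t = R this is the full transform of F, the coefficient of the exponential by which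
  the two solutions below differ.\<close>

definition primitive_exp :: "(nat \<Rightarrow> real \<Rightarrow> complex) \<Rightarrow> real \<Rightarrow> complex \<Rightarrow> real \<Rightarrow> complex" where
  "primitive_exp F R z t = integral {- R..t} (\<lambda>s. exp (\<i> * z * of_real s) * F 0 s)"

primrec res_minus :: "(nat \<Rightarrow> real \<Rightarrow> complex) \<Rightarrow> real \<Rightarrow> complex \<Rightarrow> nat \<Rightarrow> real \<Rightarrow> complex" where
  "res_minus F R z 0 = (\<lambda>t. exp (- \<i> * z * of_real t) * primitive_exp F R z t)"
| "res_minus F R z (Suc j) = (\<lambda>t. F j t - \<i> * z * res_minus F R z j t)"

text \<open>
  \<open>res_minus\<close> and \<open>res_plus\<close> are the solutions of $g' + \mathrm{i} z g = F$ that vanish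
  near $-\infty$ and near $+\infty$.
\<close>

definition res_plus :: "(nat \<Rightarrow> real \<Rightarrow> complex) \<Rightarrow> real \<Rightarrow> complex \<Rightarrow> nat \<Rightarrow> real \<Rightarrow> complex" where
  "res_plus F R z = res_minus F R z - (\<lambda>j. cscale (primitive_exp F R z R) (exp_fam 0 z j))"

lemma decaying_cont:
  assumes F: "decaying R F"
  shows "continuous_on S (\<lambda>s. exp (\<i> * z * of_real s) * F 0 s)"
proof -
  have "continuous_on S (F 0)"
    using F has_vector_derivative_continuous[OF TF_D[of F 0]] by (auto simp: decaying_def intro!: continuous_at_imp_continuous_on)
  then show ?thesis by (intro continuous_intros)
qed

lemma primitive_exp_deriv:
  assumes F: "decaying R F"
  shows "(primitive_exp F R z has_vector_derivative exp (\<i> * z * of_real t) * F 0 t) (at t)"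
proof -
  let ?f = "\<lambda>s. exp (\<i> * z * of_real s) * F 0 s"
  \<comment> \<open>For u < - R the integral from - R runs over an empty interval; moving the base
    point to L, left of - R and of t, gives an ordinary primitive near t.\<close>
  define L where "L = - \<bar>t\<bar> - R - 1"
  have f0: "?f s = 0" if "s \<le> - R" for s using F that by (auto simp: decaying_def)
  have eq: "integral {L..u} ?f = primitive_exp F R z u" if u: "u \<in> {L<..<t + 1}" for u
  proof (cases "u \<le> - R")
    case True
    have "integral {L..u} ?f = integral {L..u} (\<lambda>_. 0)" by (intro integral_cong) (use f0 True in auto)
    moreover have "integral {- R..u} ?f = 0"
    proof (cases "u = - R")
      case False
      then have "{- R..u} = {}" using True by auto
      then show ?thesis by (simp only: integral_empty)
    qed simp
    ultimately show ?thesis by (simp add: primitive_exp_def)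
  next
    case False
    have "integral {L..- R} ?f + integral {- R..u} ?f = integral {L..u} ?f"
      by (rule Henstock_Kurzweil_Integration.integral_combine)
         (use False u in \<open>auto simp: L_def intro!: integrable_continuous_interval decaying_cont[OF F]\<close>)
    moreover have "integral {L..- R} ?f = integral {L..- R} (\<lambda>_. 0)" by (intro integral_cong) (use f0 in auto)
    ultimately show ?thesis by (simp add: primitive_exp_def)
  qed
  have "((\<lambda>u. integral {L..u} ?f) has_vector_derivative ?f t) (at t within {L..t + 1})"
    by (rule integral_has_vector_derivative[OF decaying_cont[OF F]]) (use F in \<open>auto simp: L_def decaying_def\<close>)
  moreover have t: "t \<in> {L<..<t + 1}" using F by (auto simp: L_def decaying_def)
  ultimately have "((\<lambda>u. integral {L..u} ?f) has_vector_derivative ?f t) (at t)"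
    using at_within_interior[of t "{L..t + 1}"] by simp
  then show ?thesis
    by (rule has_vector_derivative_transform_within_open[OF _ open_greaterThanLessThan t]) (rule eq)
qed

lemma res_minus_resolvent:
  assumes F: "decaying R F"
  shows "resolvent z F (res_minus F R z)"
  unfolding resolvent_def
proof (intro conjI allI)
  fix t
  have e: "((\<lambda>t. exp (- \<i> * z * of_real t)) has_vector_derivative - \<i> * z * exp (- \<i> * z * of_real t)) (at t)"
    using exp_fam_deriv_t[of 0 z 0 t] by (simp add: exp_fam.simps(1)[abs_def])
  have d: "((\<lambda>t. exp (- \<i> * z * of_real t) * primitive_exp F R z t) has_vector_derivative
     exp (- \<i> * z * of_real t) * (exp (\<i> * z * of_real t) * F 0 t) + - \<i> * z * exp (- \<i> * z * of_real t) * primitive_exp F R z t) (at t)"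
    by (rule has_vector_derivative_mult[OF e primitive_exp_deriv[OF F]])
  have "exp (- \<i> * z * of_real t) * exp (\<i> * z * of_real t) = 1"
    by (simp add: exp_add[symmetric])
  then have "exp (- \<i> * z * of_real t) * (exp (\<i> * z * of_real t) * F 0 t) = F 0 t"
    by (metis mult.assoc mult_1)
  then have eq: "exp (- \<i> * z * of_real t) * (exp (\<i> * z * of_real t) * F 0 t) + - \<i> * z * exp (- \<i> * z * of_real t) * primitive_exp F R z t
     = res_minus F R z 1 t"
    by (simp add: mult.assoc)
  show "(res_minus F R z 0 has_vector_derivative res_minus F R z 1 t) (at t)"
    using d unfolding eq by simp
qed simp

lemma res_plus_resolvent:
  assumes F: "decaying R F"
  shows "resolvent z F (res_plus F R z)"
  unfolding resolvent_def
proof (intro conjI allI)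
  have "(res_minus F R z 0 has_vector_derivative res_minus F R z 1 t) (at t)" for t
    using res_minus_resolvent[OF F, of z] by (simp add: resolvent_def)
  moreover have "((\<lambda>t. cscale (primitive_exp F R z R) (exp_fam 0 z 0) t) has_vector_derivative cscale (primitive_exp F R z R) (exp_fam 0 z (Suc 0)) t) (at t)" for t
    unfolding cscale_def by (intro has_vector_derivative_mult_right exp_fam_deriv_t)
  ultimately show "(res_plus F R z 0 has_vector_derivative res_plus F R z 1 t) (at t)" for t
    unfolding res_plus_def fun_diff_def One_nat_def by (intro has_vector_derivative_diff)
  show "res_plus F R z (Suc j) t = F j t - \<i> * z * res_plus F R z j t" for j t
    by (simp add: res_plus_def cscale_def algebra_simps)
qed

lemma res_minus_left: "decaying R F \<Longrightarrow> t \<le> - R \<Longrightarrow> res_minus F R z j t = 0"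
proof (induction j)
  case 0
  have "primitive_exp F R z t = 0"
  proof (cases "t = - R")
    case False
    then have "{- R..t} = {}" using 0 by auto
    then show ?thesis unfolding primitive_exp_def by (simp only: integral_empty)
  qed (simp add: primitive_exp_def)
  then show ?case by simp
next
  case (Suc j)
  then show ?case by (auto simp: decaying_def)
qed

lemma primitive_exp_right: "decaying R F \<Longrightarrow> R \<le> t \<Longrightarrow> primitive_exp F R z t = primitive_exp F R z R"
proof -
  assume F: "decaying R F" and t: "R \<le> t"
  let ?f = "\<lambda>s. exp (\<i> * z * of_real s) * F 0 s"
  have "integral {- R..R} ?f + integral {R..t} ?f = integral {- R..t} ?f"
    by (rule Henstock_Kurzweil_Integration.integral_combine)
       (use F t in \<open>auto simp: decaying_def intro!: integrable_continuous_interval decaying_cont[OF F]\<close>)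
  moreover have "integral {R..t} ?f = integral {R..t} (\<lambda>_. 0)" by (intro integral_cong) (use F in \<open>auto simp: decaying_def\<close>)
  ultimately show ?thesis by (simp add: primitive_exp_def)
qed

lemma res_plus_right: "decaying R F \<Longrightarrow> R \<le> t \<Longrightarrow> res_plus F R z j t = 0"
proof (induction j)
  case 0
  then show ?case using primitive_exp_right[of R F t z] by (simp add: res_plus_def cscale_def)
next
  case (Suc j)
  have "res_plus F R z (Suc j) t = F j t - \<i> * z * res_plus F R z j t"
    using res_plus_resolvent[OF Suc.prems(1)] by (simp add: resolvent_def)
  moreover have "F j t = 0" using Suc.prems by (auto simp: decaying_def)
  ultimately show ?case using Suc by simp
qed

text \<open>For Im z \<le> 0 and s \<le> t the kernel exp (i z (s - t)) has modulus at most 1, so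
  the second bound is uniform in the lower half-plane.\<close>

lemma res_minus_bound:
  assumes F: "decaying R F" and B: "\<And>x. norm (F j x) \<le> B"
  shows "norm (res_minus F R z j t) \<le> (\<bar>t\<bar> + R) * exp (\<bar>Im z\<bar> * (\<bar>t\<bar> + R)) * B"
    and "Im z \<le> 0 \<Longrightarrow> norm (res_minus F R z j t) \<le> (\<bar>t\<bar> + R) * B"
proof -
  have R: "0 < R" "F \<in> TF" using F by (auto simp: decaying_def)
  have B0: "0 \<le> B" using order_trans[OF norm_ge_zero B] .
  have *: "norm (res_minus F R z j t) \<le> (\<bar>t\<bar> + R) * exp K * B"
    if K: "\<And>s. - R \<le> s \<Longrightarrow> s \<le> t \<Longrightarrow> - Im z * (s - t) \<le> K" for K
  proof (cases "t \<le> - R")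
    case True
    then show ?thesis using res_minus_left[OF F True] B0 R by simp
  next
    case False
    have "norm (res_minus F R z j t) \<le> \<bar>t - (- R)\<bar> * exp K * B"
      by (rule resolvent_bound[OF res_minus_resolvent[OF F] R(2) res_minus_left[OF F]])
         (use False B K in \<open>auto simp: closed_segment_eq_real_ivl\<close>)
    also have "\<dots> \<le> (\<bar>t\<bar> + R) * exp K * B" using B0 R by (intro mult_right_mono) auto
    finally show ?thesis .
  qed
  show "norm (res_minus F R z j t) \<le> (\<bar>t\<bar> + R) * exp (\<bar>Im z\<bar> * (\<bar>t\<bar> + R)) * B"
  proof (rule *)
    fix s assume s: "- R \<le> s" "s \<le> t"
    have "- Im z * (s - t) \<le> \<bar>Im z\<bar> * \<bar>s - t\<bar>" by (metis abs_ge_self abs_minus_cancel abs_mult)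
    also have "\<dots> \<le> \<bar>Im z\<bar> * (\<bar>t\<bar> + R)" using s by (intro mult_left_mono) auto
    finally show "- Im z * (s - t) \<le> \<bar>Im z\<bar> * (\<bar>t\<bar> + R)" .
  qed
  show "norm (res_minus F R z j t) \<le> (\<bar>t\<bar> + R) * B" if y: "Im z \<le> 0"
    using *[of 0] y by (simp add: mult_nonpos_nonpos)
qed

lemma res_plus_bound:
  assumes F: "decaying R F" and B: "\<And>x. norm (F j x) \<le> B" and y: "0 \<le> Im z"
  shows "norm (res_plus F R z j t) \<le> (\<bar>t\<bar> + R) * B"
proof -
  have R: "0 < R" "F \<in> TF" using F by (auto simp: decaying_def)
  have B0: "0 \<le> B" using order_trans[OF norm_ge_zero B] .
  show ?thesis
  proof (cases "R \<le> t")
    case True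
    then show ?thesis using res_plus_right[OF F True] B0 R by simp
  next
    case False
    have "norm (res_plus F R z j t) \<le> \<bar>t - R\<bar> * exp 0 * B"
      by (rule resolvent_bound[OF res_plus_resolvent[OF F] R(2) res_plus_right[OF F]])
         (use False B y in \<open>auto simp: closed_segment_eq_real_ivl mult_nonneg_nonneg\<close>)
    also have "\<dots> \<le> (\<bar>t\<bar> + R) * exp 0 * B" using B0 R by (intro mult_right_mono) auto
    finally show ?thesis by simp
  qed
qed

lemma primitive_exp_holomorphic:
  assumes F: "decaying R F"
  shows "(\<lambda>z. primitive_exp F R z t) holomorphic_on UNIV"
proof -
  have contF: "continuous_on UNIV (F 0)"
    using decaying_cont[OF F, of UNIV 0] by simp
  have "(\<lambda>z. integral (cbox (- R) t) (\<lambda>s. exp (\<i> * z * of_real s) * F 0 s)) holomorphic_on UNIV"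
  proof (rule leibniz_rule_holomorphic[where fx="\<lambda>z s. \<i> * of_real s * exp (\<i> * z * of_real s) * F 0 s"])
    show "((\<lambda>z. exp (\<i> * z * of_real s) * F 0 s) has_field_derivative \<i> * of_real s * exp (\<i> * z * of_real s) * F 0 s) (at z within UNIV)" for z s
      by (auto intro!: derivative_eq_intros)
    show "(\<lambda>s. exp (\<i> * z * of_real s) * F 0 s) integrable_on cbox (- R) t" for z
      by (intro integrable_continuous decaying_cont[OF F])
    have "continuous_on (UNIV \<times> cbox (- R) t) (\<lambda>p. \<i> * of_real (snd p) * exp (\<i> * fst p * of_real (snd p)) * F 0 (snd p))"
      by (intro continuous_intros continuous_on_compose2[OF contF]) auto
    then show "continuous_on (UNIV \<times> cbox (- R) t) (\<lambda>(z, s). \<i> * of_real s * exp (\<i> * z * of_real s) * F 0 s)"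
      by (simp add: case_prod_beta')
  qed simp
  then show ?thesis by (simp add: primitive_exp_def)
qed

lemma hol_fam_res_minus:
  assumes F: "decaying R F"
  shows "hol_fam (res_minus F R)"
proof -
  have R: "0 < R" "F \<in> TF" using F by (auto simp: decaying_def)
  have b: "\<exists>B. \<forall>z j t. norm z \<le> \<rho> \<longrightarrow> \<bar>t\<bar> \<le> T \<longrightarrow> norm (res_minus F R z j t) \<le> B * M q j" if q: "0 < q" "q < 1" for \<rho> T q
  proof -
    obtain B where B: "0 < B" "\<And>j x. norm (F j x) \<le> B * M q j" using decaying_bound[OF F q] by blast
    have "norm (res_minus F R z j t) \<le> ((T + R) * exp (\<rho> * (T + R)) * B) * M q j" if z: "norm z \<le> \<rho>" and t: "\<bar>t\<bar> \<le> T" for z j t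
    proof -
      have "\<bar>Im z\<bar> \<le> \<rho>" using z abs_Im_le_cmod[of z] by linarith
      then have "\<bar>Im z\<bar> * (\<bar>t\<bar> + R) \<le> \<rho> * (T + R)" using t R by (intro mult_mono) auto
      have "norm (res_minus F R z j t) \<le> (\<bar>t\<bar> + R) * exp (\<bar>Im z\<bar> * (\<bar>t\<bar> + R)) * (B * M q j)"
        by (rule res_minus_bound(1)[OF F B(2)])
      also have "\<dots> \<le> (T + R) * exp (\<rho> * (T + R)) * (B * M q j)"
        using t R B(1) M_pos[of q j] \<open>\<bar>Im z\<bar> * (\<bar>t\<bar> + R) \<le> \<rho> * (T + R)\<close> by (intro mult_mono) auto
      finally show ?thesis by (simp add: mult.assoc)
    qed
    then show ?thesis by blast
  qed
  have TF: "res_minus F R z \<in> TF" for z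
    unfolding TF_def
  proof (intro CollectI conjI allI impI)
    show "(res_minus F R z j has_vector_derivative res_minus F R z (Suc j) t) (at t)" for j t
      by (rule resolvent_deriv[OF res_minus_resolvent[OF F] R(2)])
    show "\<exists>B. \<forall>j x. \<bar>x\<bar> \<le> T \<longrightarrow> norm (res_minus F R z j x) \<le> B * M q j" if "0 < q" "q < 1" for q T
      using b[OF that, of "norm z" T] by blast
  qed
  have hol: "(\<lambda>z. res_minus F R z j t) holomorphic_on UNIV" for j t
    by (induction j) (auto intro!: holomorphic_intros primitive_exp_holomorphic[OF F])
  show ?thesis unfolding hol_fam_def using TF hol b by blast
qed

lemma res_minus_TF: "decaying R F \<Longrightarrow> res_minus F R z \<in> TF"
  using hol_fam_res_minus by (auto simp: hol_fam_def)

lemma res_plus_TF: "decaying R F \<Longrightarrow> res_plus F R z \<in> TF"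
  unfolding res_plus_def by (intro TF_diff TF_scale res_minus_TF TF_exp)

lemma hol_fam_translate:
  assumes G: "hol_fam G"
  shows "hol_fam (\<lambda>z. translate y (G z))"
  unfolding hol_fam_def
proof (intro conjI allI impI)
  show "translate y (G z) \<in> TF" for z using G by (intro TF_translate) (simp add: hol_fam_def)
  show "(\<lambda>z. translate y (G z) j t) holomorphic_on UNIV" for j t using G by (simp add: hol_fam_def translate_def)
  fix \<rho> R q :: real assume q: "0 < q" "q < 1"
  obtain B where "\<forall>z j t. norm z \<le> \<rho> \<longrightarrow> \<bar>t\<bar> \<le> R + \<bar>y\<bar> \<longrightarrow> norm (G z j t) \<le> B * M q j"
    using G q unfolding hol_fam_def by blast
  then show "\<exists>B. \<forall>z j t. norm z \<le> \<rho> \<longrightarrow> \<bar>t\<bar> \<le> R \<longrightarrow> norm (translate y (G z) j t) \<le> B * M q j"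
    by (intro exI[of _ B]) (auto simp: translate_def)
qed

text \<open>The function y to exp (i z y) S (g (. + y)) has derivative exp (i z y) S (F (. + y)),
  which vanishes on [b;d].\<close>

lemma conv_resolvent:
  assumes S: "lf S" and F: "F \<in> TF" and g: "resolvent z F g" "g \<in> TF"
    and zero: "\<And>y. y \<in> {b..d} \<Longrightarrow> S (emb (translate y F)) = 0" and y: "y1 \<in> {b..d}" "y2 \<in> {b..d}"
  shows "exp (\<i> * z * of_real y1) * S (emb (translate y1 g)) = exp (\<i> * z * of_real y2) * S (emb (translate y2 g))"
proof -
  define v where "v y = exp (\<i> * z * of_real y) * S (emb (translate y g))" for y
  have "(v has_vector_derivative 0) (at y)" if y: "y \<in> {b..d}" for y
  proof -
    have e: "((\<lambda>y. exp (\<i> * z * of_real y)) has_vector_derivative \<i> * z * exp (\<i> * z * of_real y)) (at y)"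
    proof -
      have "((\<lambda>w. exp (\<i> * z * w)) has_field_derivative \<i> * z * exp (\<i> * z * of_real y)) (at (of_real y))"
        by (auto intro!: derivative_eq_intros)
      from has_vector_derivative_real_field[OF this] show ?thesis by (simp add: o_def)
    qed
    have "translate y (\<lambda>j. g (Suc j)) = translate y F - (\<lambda>j. cscale (\<i> * z) (translate y g j))"
      using g(1) by (auto simp: translate_def cscale_def resolvent_def fun_eq_iff)
    then have "S (emb (translate y (\<lambda>j. g (Suc j)))) = S (emb (translate y F)) - \<i> * z * S (emb (translate y g))"
      using lf_emb_diff[OF S TF_translate[OF F] TF_scale[OF TF_translate[OF g(2)]]] lf_emb_scale[OF S TF_translate[OF g(2)]] by simp
    then have d: "((\<lambda>y. S (emb (translate y g))) has_vector_derivative - \<i> * z * S (emb (translate y g))) (at y)"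
      using translate_deriv[OF S g(2), of y] zero[OF y] by simp
    have "(v has_vector_derivative exp (\<i> * z * of_real y) * (- \<i> * z * S (emb (translate y g))) + \<i> * z * exp (\<i> * z * of_real y) * S (emb (translate y g))) (at y)"
      unfolding v_def by (rule has_vector_derivative_mult[OF e d])
    then show ?thesis by (simp add: algebra_simps)
  qed
  then have "\<exists>k. \<forall>y\<in>{b..d}. v y = k"
    by (intro has_derivative_zero_constant) (auto simp: has_vector_derivative_def intro: has_derivative_at_withinI)
  then show ?thesis using y by (auto simp: v_def)
qed

end

section \<open>Zeros of entire functions and resolvents bounded in the parameter\<close>

lemma entire_mult_zero:
  fixes f g :: "complex \<Rightarrow> complex"
  assumes f: "f holomorphic_on UNIV" and g: "g holomorphic_on UNIV" and nz: "g w \<noteq> 0"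
    and z: "\<And>z. f z * g z = 0"
  shows "f u = 0"
proof -
  have "\<forall>\<^sub>F v in at u. g v \<noteq> 0 \<and> v \<in> UNIV"
    by (rule non_zero_neighbour_alt[OF g open_UNIV connected_UNIV UNIV_I UNIV_I nz])
  then have "\<forall>\<^sub>F v in at u. f v = 0" by eventually_elim (use z in \<open>auto simp: mult_eq_0_iff\<close>)
  then have "(f \<longlongrightarrow> 0) (at u)" by (rule tendsto_eventually)
  moreover have "(f \<longlongrightarrow> f u) (at u)"
    using f by (metis UNIV_I continuous_on_def holomorphic_on_imp_continuous_on)
  ultimately show ?thesis using tendsto_unique[OF at_neq_bot] by blast
qed

lemma higher_deriv_factor:
  fixes q :: "complex \<Rightarrow> complex"
  assumes "q holomorphic_on UNIV" "\<And>z. f z = (z - l) ^ k * q z"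
  shows "(\<forall>i<k. (deriv ^^ i) f l = 0) \<and> (deriv ^^ k) f l = fact k * q l"
  using assms
proof (induction k arbitrary: f q)
  case 0
  then show ?case by simp
next
  case (Suc k)
  define q2 where "q2 z = of_nat (Suc k) * q z + (z - l) * deriv q z" for z
  have hq2: "q2 holomorphic_on UNIV" unfolding q2_def
    by (intro holomorphic_intros Suc.prems(1) holomorphic_deriv) auto
  have dq: "(q has_field_derivative deriv q z) (at z)" for z
    using holomorphic_derivI[OF Suc.prems(1) open_UNIV] by auto
  have "deriv f z = (z - l) ^ k * q2 z" for z
  proof -
    have "f = (\<lambda>z. (z - l) ^ Suc k * q z)" using Suc.prems(2) by auto
    moreover have "((\<lambda>z. (z - l) ^ Suc k * q z) has_field_derivative (z - l) ^ k * q2 z) (at z)"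
      by (rule derivative_eq_intros dq refl | simp add: q2_def algebra_simps)+
    ultimately show ?thesis by (simp add: DERIV_imp_deriv)
  qed
  from Suc.IH[OF hq2 this] have IH: "\<And>i. i < k \<Longrightarrow> (deriv ^^ i) (deriv f) l = 0" "(deriv ^^ k) (deriv f) l = fact k * q2 l"
    by auto
  have sw: "(deriv ^^ Suc i) f = (deriv ^^ i) (deriv f)" for i by (simp only: funpow_Suc_right o_apply)
  have "(deriv ^^ i) f l = 0" if "i < Suc k" for i
    using that IH(1) Suc.prems(2)[of l] sw by (cases i) auto
  moreover have "(deriv ^^ Suc k) f l = fact (Suc k) * q l"
    unfolding sw IH(2) by (simp add: q2_def algebra_simps)
  ultimately show ?case by blast
qed

lemma entire_factor_of_derivs:
  fixes f :: "complex \<Rightarrow> complex"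
  assumes hol: "f holomorphic_on UNIV" and z: "\<And>i. i < n \<Longrightarrow> (deriv ^^ i) f l = 0"
  shows "\<exists>r. r holomorphic_on UNIV \<and> (\<forall>z. f z = (z - l) ^ n * r z)"
proof (cases "\<forall>z. f z = 0")
  case True
  then show ?thesis by (intro exI[of _ "\<lambda>_. 0"]) auto
next
  case False
  then obtain w where "f w \<noteq> 0" by blast
  then obtain q k where q: "q holomorphic_on UNIV" "q l \<noteq> 0" "\<And>z. f z = (z - l) ^ k * q z"
    using entire_factor_zero[OF hol] by blast
  have "(deriv ^^ k) f l \<noteq> 0" using higher_deriv_factor[OF q(1,3)] q(2) by auto
  then have "n \<le> k" using z not_le_imp_less by blast
  then have "f z = (z - l) ^ n * ((z - l) ^ (k - n) * q z)" for z
    using q(3)[of z] by (simp add: power_add[symmetric] mult.assoc[symmetric])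
  moreover have "(\<lambda>z. (z - l) ^ (k - n) * q z) holomorphic_on UNIV" by (intro holomorphic_intros q)
  ultimately show ?thesis by blast
qed

text \<open>By Liouville u does not depend on z; comparing the equation at two values of z gives u =
  0, hence v = 0. In this way resolvent bounds in both half-planes force a right-hand side to
  vanish.\<close>

lemma bounded_resolvent_imp_zero:
  fixes u :: "complex \<Rightarrow> real \<Rightarrow> complex"
  assumes hol: "\<And>t. (\<lambda>z. u z t) holomorphic_on UNIV" and bdd: "\<And>t. \<exists>K. \<forall>z. norm (u z t) \<le> K"
    and der: "\<And>z t. (u z has_vector_derivative v t - \<i> * z * u z t) (at t)"
  shows "v t = 0"
proof -
  have const: "u z t = u 0 t" for z t
  proof -
    have "bounded (range (\<lambda>z. u z t))" using bdd[of t] by (auto simp: bounded_iff)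
    from Liouville_theorem[OF hol this] show ?thesis by (auto simp: constant_on_def)
  qed
  then have fn: "u z = u 0" for z by (rule ext)
  have eq: "v t - \<i> * z * u 0 t = v t - \<i> * 0 * u 0 t" for z t
    using der[of z t] der[of 0 t] unfolding fn[of z] by (rule vector_derivative_unique_at)
  have u0: "u 0 t = 0" for t using eq[of t 1] by simp
  then have "u 0 = (\<lambda>_. 0)" by (rule ext)
  then have "((\<lambda>_. 0) has_vector_derivative v t) (at t)" using der[of 0 t] by simp
  then show ?thesis using vector_derivative_unique_at[OF _ has_vector_derivative_const] by blast
qed

context weight_setting
begin

definition FL :: "((real \<Rightarrow> complex) \<Rightarrow> complex) \<Rightarrow> complex \<Rightarrow> complex" where
  "FL S z = S (emb (exp_fam 0 z))"

lemma FL_hol: "lf S \<Longrightarrow> FL S holomorphic_on UNIV"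
  unfolding FL_def[abs_def] by (rule lf_holomorphic[OF _ hol_fam_exp])

lemma translate_add: "translate y (F + G) = translate y F + translate y G" by (auto simp: translate_def fun_eq_iff)
lemma translate_exp: "translate y (\<lambda>j. cscale k (exp_fam 0 z j)) = (\<lambda>j. cscale (k * exp (- \<i> * z * of_real y)) (exp_fam 0 z j))"
proof -
  have "exp (- \<i> * z * of_real (x + y)) = exp (- \<i> * z * of_real y) * exp (- \<i> * z * of_real x)" for x
    by (simp add: exp_add[symmetric] algebra_simps)
  then show ?thesis by (auto simp: translate_def cscale_def fun_eq_iff)
qed

text \<open>The two solutions differ by the transform of F times an exponential, on which S acts
  through its own transform.\<close>

lemma lf_translate_res:
  assumes S: "lf S" and F: "decaying R F"
  shows "S (emb (translate y (res_minus F R z))) = S (emb (translate y (res_plus F R z))) + primitive_exp F R z R * exp (- \<i> * z * of_real y) * FL S z"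
proof -
  have "res_minus F R z = res_plus F R z + (\<lambda>j. cscale (primitive_exp F R z R) (exp_fam 0 z j))"
    by (simp add: res_plus_def)
  then have "translate y (res_minus F R z) = translate y (res_plus F R z) + (\<lambda>j. cscale (primitive_exp F R z R * exp (- \<i> * z * of_real y)) (exp_fam 0 z j))"
    by (simp only: translate_add translate_exp)
  then show ?thesis
    by (simp only: lf_emb_add[OF S TF_translate[OF res_plus_TF[OF F]] TF_scale[OF TF_exp]] lf_emb_scale[OF S TF_exp] FL_def)
qed

lemma lf_res_bound:
  assumes S: "lf S" and F: "decaying R F"
  shows "\<exists>C\<ge>0. (\<forall>z. Im z \<le> 0 \<longrightarrow> norm (S (emb (translate y (res_minus F R z)))) \<le> C)
    \<and> (\<forall>z. 0 \<le> Im z \<longrightarrow> norm (S (emb (translate y (res_plus F R z)))) \<le> C)"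
proof -
  obtain q k C where q: "0 < q" "q < 1" "0 \<le> C" and
    b: "\<forall>F B. F \<in> TF \<longrightarrow> (\<forall>j x. \<bar>x\<bar> \<le> c k \<longrightarrow> norm (F j x) \<le> B * M q j) \<longrightarrow> norm (S (emb F)) \<le> C * B"
    using lf_TF_bound[OF S] by (elim exE conjE)
  obtain B where B: "0 < B" "\<And>j x. norm (F j x) \<le> B * M q j" using decaying_bound[OF F q(1,2)] by blast
  have R: "0 < R" using F by (simp add: decaying_def)
  define K where "K = (c k + \<bar>y\<bar> + R) * B"
  have le: "(\<bar>x + y\<bar> + R) * (B * M q j) \<le> K * M q j" if "\<bar>x\<bar> \<le> c k" for x j
  proof -
    have "(\<bar>x + y\<bar> + R) * (B * M q j) \<le> (c k + \<bar>y\<bar> + R) * (B * M q j)"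
      using that B(1) M_pos[of q j] by (intro mult_right_mono) auto
    then show ?thesis by (simp add: K_def mult.assoc)
  qed
  have "norm (S (emb (translate y (res_minus F R z)))) \<le> C * K" if "Im z \<le> 0" for z
  proof (rule b[rule_format, OF TF_translate[OF res_minus_TF[OF F]]])
    fix j x assume "\<bar>x\<bar> \<le> c k"
    then show "norm (translate y (res_minus F R z) j x) \<le> K * M q j"
      using res_minus_bound(2)[OF F B(2) that, of j "x + y"] le[of x j] unfolding translate_def by linarith
  qed
  moreover have "norm (S (emb (translate y (res_plus F R z)))) \<le> C * K" if "0 \<le> Im z" for z
  proof (rule b[rule_format, OF TF_translate[OF res_plus_TF[OF F]]])
    fix j x assume "\<bar>x\<bar> \<le> c k"
    then show "norm (translate y (res_plus F R z) j x) \<le> K * M q j"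
      using res_plus_bound[OF F B(2) that, of j "x + y"] le[of x j] unfolding translate_def by linarith
  qed
  moreover have "0 \<le> C * K" using q B R c_pos[of k] by (simp add: K_def)
  ultimately show ?thesis by blast
qed

lemma res_z_hol:
  assumes "lf S" "decaying R F"
  shows "(\<lambda>z. S (emb (translate y (res_minus F R z)))) holomorphic_on UNIV"
  by (rule lf_holomorphic[OF assms(1) hol_fam_translate[OF hol_fam_res_minus[OF assms(2)]]])

text \<open>If the transform vanished, S would not distinguish the two solutions, which differ by an
  exponential. Their bounds in the two half-planes would combine, and
  \<open>bounded_resolvent_imp_zero\<close> would make S vanish on every compactly supported family,
  hence on the whole space.\<close>

lemma FL_nonzero:
  assumes S: "point_lf S"
  shows "\<exists>z. FL S z \<noteq> 0"
proof (rule ccontr)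
  assume "\<not> (\<exists>z. FL S z \<noteq> 0)"
  then have \<phi>: "FL S z = 0" for z by blast
  have lS: "lf S" by (rule point_lf_lf[OF S])
  obtain f where f: "f \<in> U" "S f \<noteq> 0" using S by (auto simp: point_lf_def)
  obtain F e R where F: "F \<in> TF" "0 < e" "\<And>x. \<bar>x\<bar> \<le> c 0 + e \<Longrightarrow> F 0 x = f x \<and> x \<in> sym_ival a"
      and R: "\<And>j x. R \<le> \<bar>x\<bar> \<Longrightarrow> F j x = 0" "R \<in> sym_ival a" "0 < R"
    by (rule extension[OF f(1), where k=0]) (rule that)
  have dF: "decaying R F" using F R by (simp add: decaying_def)
  have "S (emb (translate 0 F)) = 0"
  proof (rule bounded_resolvent_imp_zero[where u="\<lambda>z y. S (emb (translate y (res_minus F R z)))"])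
    show "(\<lambda>z. S (emb (translate t (res_minus F R z)))) holomorphic_on UNIV" for t by (rule res_z_hol[OF lS dF])
    fix t
    obtain C where C: "\<And>z. Im z \<le> 0 \<Longrightarrow> norm (S (emb (translate t (res_minus F R z)))) \<le> C"
      "\<And>z. 0 \<le> Im z \<Longrightarrow> norm (S (emb (translate t (res_plus F R z)))) \<le> C"
      using lf_res_bound[OF lS dF, of t] by blast
    have "norm (S (emb (translate t (res_minus F R z)))) \<le> C" for z
      using C(1)[of z] C(2)[of z] lf_translate_res[OF lS dF, where y=t and z=z] \<phi> by (cases "Im z \<le> 0") auto
    then show "\<exists>K. \<forall>z. norm (S (emb (translate t (res_minus F R z)))) \<le> K" by blast
    fix z
    have "translate t (\<lambda>j. res_minus F R z (Suc j)) = translate t F - (\<lambda>j. cscale (\<i> * z) (translate t (res_minus F R z) j))"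
      by (auto simp: translate_def cscale_def fun_eq_iff)
    then have "S (emb (translate t (\<lambda>j. res_minus F R z (Suc j)))) = S (emb (translate t F)) - \<i> * z * S (emb (translate t (res_minus F R z)))"
      using lf_emb_diff[OF lS TF_translate[OF F(1)] TF_scale[OF TF_translate[OF res_minus_TF[OF dF]]]] lf_emb_scale[OF lS TF_translate[OF res_minus_TF[OF dF]]]
      by simp
    with translate_deriv[OF lS res_minus_TF[OF dF, where z=z], where y=t]
    show "((\<lambda>y. S (emb (translate y (res_minus F R z)))) has_vector_derivative S (emb (translate t F)) - \<i> * z * S (emb (translate t (res_minus F R z)))) (at t)"
      by (simp only:)
  qed
  moreover have "translate 0 F = F" by (simp add: translate_def[abs_def])
  moreover have "S f = S (emb F)"
  proof -
    have "\<forall>x. \<bar>x\<bar> < c 0 \<longrightarrow> (f - emb F) x = 0" using F(2,3) by (auto simp: emb_def)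
    then have "S (f - emb F) = 0" using S U_diff[OF f(1) emb_U[OF F(1)]] c_pos[of 0] unfolding point_lf_def by blast
    then show ?thesis using lf_diff[OF lS f(1) emb_U[OF F(1)]] by simp
  qed
  ultimately show False using f(2) by simp
qed

text \<open>Near b the left solution vanishes, near d the right one. Since S * g has the same
  coefficient at both ends, the transform of F times that of S is 0; so the two solutions coincide
  and are bounded in z on the whole plane. This yields the minimality of I as residual
  interval.\<close>

lemma bump_not_annihilated:
  assumes S: "point_lf S" and F: "decaying R F" and pq: "b < p" "p < p'" "p' < d"
    and sF: "\<And>j x. x \<le> p \<or> p' \<le> x \<Longrightarrow> F j x = 0"
    and zero: "\<And>y. y \<in> {b..d} \<Longrightarrow> S (emb (translate y F)) = 0"
  shows "F 0 t = 0"
proof -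
  have lS: "lf S" by (rule point_lf_lf[OF S])
  have TF: "F \<in> TF" and R: "0 < R" using F by (auto simp: decaying_def)
  \<comment> \<open>The solutions must be seen to vanish up to the actual support in [p;p'], not
    merely up to - R and R.\<close>
  have left: "res_minus F R z j t = 0" if "t \<le> p" for z j t
  proof (cases "t \<le> - R")
    case False
    have "norm (res_minus F R z j t) \<le> \<bar>t - (- R)\<bar> * exp (\<bar>Im z\<bar> * (\<bar>t\<bar> + R)) * 0"
    proof (rule resolvent_bound[OF res_minus_resolvent[OF F] TF res_minus_left[OF F]])
      fix s assume s: "s \<in> closed_segment (- R) t"
      then have s: "- R \<le> s" "s \<le> t" using False by (auto simp: closed_segment_eq_real_ivl)
      then show "norm (F j s) \<le> 0" using sF[of s j] that by simp
      have "- Im z * (s - t) \<le> \<bar>Im z\<bar> * \<bar>s - t\<bar>" by (metis abs_ge_self abs_minus_cancel abs_mult)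
      also have "\<dots> \<le> \<bar>Im z\<bar> * (\<bar>t\<bar> + R)" using s by (intro mult_left_mono) auto
      finally show "- Im z * (s - t) \<le> \<bar>Im z\<bar> * (\<bar>t\<bar> + R)" .
    qed simp
    then show ?thesis by simp
  qed (rule res_minus_left[OF F])
  have right: "res_plus F R z j t = 0" if "p' \<le> t" for z j t
  proof (cases "R \<le> t")
    case False
    have "norm (res_plus F R z j t) \<le> \<bar>t - R\<bar> * exp (\<bar>Im z\<bar> * (\<bar>t\<bar> + R)) * 0"
    proof (rule resolvent_bound[OF res_plus_resolvent[OF F] TF res_plus_right[OF F]])
      fix s assume s: "s \<in> closed_segment R t"
      then have s: "t \<le> s" "s \<le> R" using False by (auto simp: closed_segment_eq_real_ivl)
      then show "norm (F j s) \<le> 0" using sF[of s j] that by simp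
      have "- Im z * (s - t) \<le> \<bar>Im z\<bar> * \<bar>s - t\<bar>" by (metis abs_ge_self abs_minus_cancel abs_mult)
      also have "\<dots> \<le> \<bar>Im z\<bar> * (\<bar>t\<bar> + R)" using s by (intro mult_left_mono) auto
      finally show "- Im z * (s - t) \<le> \<bar>Im z\<bar> * (\<bar>t\<bar> + R)" .
    qed simp
    then show ?thesis by simp
  qed (rule res_plus_right[OF F])
  have zf: "S (emb G) = 0" if G: "G \<in> TF" and e: "0 < e" and z: "\<And>x. \<bar>x\<bar> < e \<Longrightarrow> G 0 x = 0" for G e
    using point_lf_supp_in[OF S] G e z unfolding supp_in_def by (auto simp: abs_less_iff)
  have "primitive_exp F R z R * FL S z = 0" for z
  proof -
    have "S (emb (translate b (res_minus F R z))) = 0"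
      by (rule zf[OF TF_translate[OF res_minus_TF[OF F]], of "p - b"]) (use pq left in \<open>auto simp: translate_def simp del: res_minus.simps\<close>)
    moreover have "S (emb (translate d (res_plus F R z))) = 0"
      by (rule zf[OF TF_translate[OF res_plus_TF[OF F]], of "d - p'"]) (use pq right in \<open>auto simp: translate_def\<close>)
    moreover have "exp (\<i> * z * of_real b) * S (emb (translate b (res_minus F R z))) = exp (\<i> * z * of_real d) * S (emb (translate d (res_minus F R z)))"
      by (rule conv_resolvent[OF lS TF res_minus_resolvent[OF F] res_minus_TF[OF F] zero]) (use pq in auto)
    ultimately show ?thesis using lf_translate_res[OF lS F, where y=d and z=z] by simp
  qed
  then have hat: "primitive_exp F R z R = 0" for z
    using entire_mult_zero[OF primitive_exp_holomorphic[OF F] FL_hol[OF lS]] FL_nonzero[OF S] by blast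
  then have pm: "res_minus F R z = res_plus F R z" for z by (simp add: res_plus_def cscale_def fun_eq_iff)
  obtain B where B: "0 < B" "\<And>j x. norm (F j x) \<le> B * M (1/2) j" using decaying_bound[OF F, of "1/2"] by auto
  show ?thesis
  proof (rule bounded_resolvent_imp_zero[where u="\<lambda>z t. res_minus F R z 0 t"])
    show "(\<lambda>z. res_minus F R z 0 t) holomorphic_on UNIV" for t using hol_fam_res_minus[OF F] by (simp add: hol_fam_def del: res_minus.simps)
    show "((\<lambda>t. res_minus F R z 0 t) has_vector_derivative F 0 t - \<i> * z * res_minus F R z 0 t) (at t)" for z t
      using res_minus_resolvent[OF F, of z] by (simp add: resolvent_def)
    fix t
    have "norm (res_minus F R z 0 t) \<le> (\<bar>t\<bar> + R) * (B * M (1/2) 0)" for z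
    proof (cases "Im z \<le> 0")
      case True
      then show ?thesis by (rule res_minus_bound(2)[OF F B(2)])
    next
      case False
      then show ?thesis unfolding pm by (intro res_plus_bound[OF F B(2)]) simp
    qed
    then show "\<exists>K. \<forall>z. norm (res_minus F R z 0 t) \<le> K" by blast
  qed
qed

section \<open>Functionals annihilating the exponential solutions\<close>

text \<open>
  Where $F$ is annihilated, $S * g$ solves $u' + \mathrm{i} z u = 0$ for both solutions $g$ of
  $g' + \mathrm{i} z g = F$; \<open>conv_minus\<close> and \<open>conv_plus\<close> are its coefficients at $e^{-\mathrm{i} z y}$,
  and the choice of the base point $b$ is immaterial.
\<close>

definition conv_minus :: "real \<Rightarrow> (nat \<Rightarrow> real \<Rightarrow> complex) \<Rightarrow> real \<Rightarrow> ((real \<Rightarrow> complex) \<Rightarrow> complex) \<Rightarrow> complex \<Rightarrow> complex" where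
  "conv_minus b F R S z = exp (\<i> * z * of_real b) * S (emb (translate b (res_minus F R z)))"

definition conv_plus :: "real \<Rightarrow> (nat \<Rightarrow> real \<Rightarrow> complex) \<Rightarrow> real \<Rightarrow> ((real \<Rightarrow> complex) \<Rightarrow> complex) \<Rightarrow> complex \<Rightarrow> complex" where
  "conv_plus b F R S z = exp (\<i> * z * of_real b) * S (emb (translate b (res_plus F R z)))"

lemma conv_minus_hol: "lf S \<Longrightarrow> decaying R F \<Longrightarrow> conv_minus b F R S holomorphic_on UNIV"
  unfolding conv_minus_def[abs_def] by (intro holomorphic_intros res_z_hol)

lemma conv_minus_eq:
  assumes S: "lf S" and F: "decaying R F"
  shows "conv_minus b F R S z = conv_plus b F R S z + primitive_exp F R z R * FL S z"
proof -
  have "exp (\<i> * z * of_real b) * exp (- \<i> * z * of_real b) = 1" by (simp add: exp_add[symmetric])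
  then have "exp (\<i> * z * of_real b) * (primitive_exp F R z R * exp (- \<i> * z * of_real b) * FL S z) = primitive_exp F R z R * FL S z"
    by (metis mult.commute mult.left_commute mult_1)
  then show ?thesis unfolding conv_minus_def conv_plus_def lf_translate_res[OF S F, where y=b and z=z]
    by (simp add: distrib_left)
qed

definition solves :: "((real \<Rightarrow> complex) \<Rightarrow> complex) \<Rightarrow> real \<Rightarrow> real \<Rightarrow> (nat \<Rightarrow> real \<Rightarrow> complex) \<Rightarrow> bool" where
  "solves S b d F \<longleftrightarrow> (\<forall>y\<in>{b..d}. S (emb (translate y F)) = 0)"

text \<open>The coefficient may be computed at b or at d; b is the end to use in the lower
  half-plane and d in the upper one.\<close>

lemma conv_bounds:
  assumes S: "lf S" and F: "decaying R F" and sol: "solves S b d F" and bd: "b < d"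
  shows "\<exists>C\<ge>0. (\<forall>z. Im z \<le> 0 \<longrightarrow> norm (conv_minus b F R S z) \<le> C * exp (- b * Im z)) \<and>
    (\<forall>z. 0 \<le> Im z \<longrightarrow> norm (conv_plus b F R S z) \<le> C * exp (- d * Im z))"
proof -
  have TF: "F \<in> TF" using F by (simp add: decaying_def)
  obtain C1 where C1: "C1 \<ge> 0" "\<forall>z. Im z \<le> 0 \<longrightarrow> norm (S (emb (translate b (res_minus F R z)))) \<le> C1"
    using lf_res_bound[OF S F, of b] by blast
  obtain C2 where C2: "C2 \<ge> 0" "\<forall>z. 0 \<le> Im z \<longrightarrow> norm (S (emb (translate d (res_plus F R z)))) \<le> C2"
    using lf_res_bound[OF S F, of d] by blast
  have "norm (conv_minus b F R S z) \<le> (C1 + C2) * exp (- b * Im z)" if "Im z \<le> 0" for z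
  proof -
    have "norm (conv_minus b F R S z) = exp (- b * Im z) * norm (S (emb (translate b (res_minus F R z))))"
      by (simp add: conv_minus_def norm_mult norm_exp_eq_Re mult.commute)
    also have "\<dots> \<le> exp (- b * Im z) * (C1 + C2)"
      using C1 C2(1) that by (intro mult_left_mono) (auto intro: add_increasing2)
    finally show ?thesis by (simp add: mult.commute)
  qed
  moreover have "norm (conv_plus b F R S z) \<le> (C1 + C2) * exp (- d * Im z)" if "0 \<le> Im z" for z
  proof -
    have "conv_plus b F R S z = conv_plus d F R S z" unfolding conv_plus_def
      by (rule conv_resolvent[OF S TF res_plus_resolvent[OF F] res_plus_TF[OF F], of b d])
         (use sol bd in \<open>auto simp: solves_def\<close>)
    then have "norm (conv_plus b F R S z) = exp (- d * Im z) * norm (S (emb (translate d (res_plus F R z))))"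
      by (simp add: conv_plus_def norm_mult norm_exp_eq_Re mult.commute)
    also have "\<dots> \<le> exp (- d * Im z) * (C1 + C2)"
      using C2 C1(1) that by (intro mult_left_mono) (auto intro: add_increasing)
    finally show ?thesis by (simp add: mult.commute)
  qed
  ultimately show ?thesis using C1(1) C2(1) by (intro exI[of _ "C1 + C2"]) auto
qed

text \<open>In the cross difference the terms containing \<open>primitive_exp F R z R\<close>
  cancel, so it may be written with either solution; this lets the bounds from the two half-planes
  be joined for one entire function.\<close>

lemma conv_commute:
  assumes S: "point_lf S" "point_lf S'" and F: "decaying R F" and sol: "solves S b d F" "solves S' b d F" and bd: "b < d"
  shows "conv_minus b F R S z * FL S' z = conv_minus b F R S' z * FL S z"
proof -
  have l: "lf S" "lf S'" using S point_lf_lf by auto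
  \<comment> \<open>Recentring at the midpoint makes the rates of decay in the two half-planes
    equal.\<close>
  define m where "m = (b + d) / 2"
  define E where "E z = (conv_minus b F R S z * FL S' z - conv_minus b F R S' z * FL S z) * exp (- \<i> * z * of_real m)" for z
  have Ep: "E z = (conv_plus b F R S z * FL S' z - conv_plus b F R S' z * FL S z) * exp (- \<i> * z * of_real m)" for z
    unfolding E_def conv_minus_eq[OF l(1) F] conv_minus_eq[OF l(2) F] by (simp add: algebra_simps)
  obtain C where C: "C \<ge> 0" "\<And>z. Im z \<le> 0 \<Longrightarrow> norm (conv_minus b F R S z) \<le> C * exp (- b * Im z)"
    "\<And>z. 0 \<le> Im z \<Longrightarrow> norm (conv_plus b F R S z) \<le> C * exp (- d * Im z)"
    using conv_bounds[OF l(1) F sol(1) bd] by blast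
  obtain C' where C': "C' \<ge> 0" "\<And>z. Im z \<le> 0 \<Longrightarrow> norm (conv_minus b F R S' z) \<le> C' * exp (- b * Im z)"
    "\<And>z. 0 \<le> Im z \<Longrightarrow> norm (conv_plus b F R S' z) \<le> C' * exp (- d * Im z)"
    using conv_bounds[OF l(2) F sol(2) bd] by blast
  have "E z = 0"
  proof (rule entire_decay_imp_zero[of E "(d - b) / 2"])
    show "E holomorphic_on UNIV" unfolding E_def[abs_def]
      by (intro holomorphic_intros conv_minus_hol FL_hol l F)
    show "0 < (d - b) / 2" using bd by simp
    fix e :: real assume e: "0 < e"
    obtain K where K: "\<And>z. norm (FL S z) \<le> K * exp (e * norm z)"
      using point_lf_zero_type[OF S(1)] e unfolding zero_type_def FL_def[symmetric] by blast
    obtain K' where K': "\<And>z. norm (FL S' z) \<le> K' * exp (e * norm z)"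
      using point_lf_zero_type[OF S(2)] e unfolding zero_type_def FL_def[symmetric] by blast
    have K0: "0 \<le> K" "0 \<le> K'" using order_trans[OF norm_ge_zero K[of 0]] order_trans[OF norm_ge_zero K'[of 0]] by auto
    have gen: "norm ((u * FL S' z - u' * FL S z) * exp (- \<i> * z * of_real m)) \<le> (C * K' + C' * K) * exp (e * norm z - (d - b) / 2 * \<bar>Im z\<bar>)"
      if u: "norm u \<le> C * exp t" "norm u' \<le> C' * exp t" and t: "t + m * Im z = - ((d - b) / 2 * \<bar>Im z\<bar>)" for u u' t z
    proof -
      have "norm (u * FL S' z - u' * FL S z) \<le> norm u * norm (FL S' z) + norm u' * norm (FL S z)"
        by (metis norm_mult norm_triangle_ineq4)
      also have "\<dots> \<le> (C * exp t) * (K' * exp (e * norm z)) + (C' * exp t) * (K * exp (e * norm z))"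
        using u K K' C(1) C'(1) K0 by (intro add_mono mult_mono) auto
      also have "\<dots> = (C * K' + C' * K) * (exp t * exp (e * norm z))" by (simp add: algebra_simps)
      finally have "norm (u * FL S' z - u' * FL S z) \<le> (C * K' + C' * K) * (exp t * exp (e * norm z))" .
      note fin = this
      have ne: "norm (exp (- \<i> * z * of_real m)) = exp (m * Im z)" by (simp add: norm_exp_eq_Re mult.commute)
      have "norm ((u * FL S' z - u' * FL S z) * exp (- \<i> * z * of_real m)) \<le> (C * K' + C' * K) * (exp t * exp (e * norm z)) * exp (m * Im z)"
        unfolding norm_mult[of _ "exp (- \<i> * z * of_real m)"] ne by (rule mult_right_mono[OF fin]) simp
      also have "\<dots> = (C * K' + C' * K) * exp (e * norm z + (t + m * Im z))" by (simp add: exp_add algebra_simps)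
      finally show ?thesis unfolding t by simp
    qed
    have "norm (E z) \<le> (C * K' + C' * K) * exp (e * norm z - (d - b) / 2 * \<bar>Im z\<bar>)" for z
    proof (cases "0 \<le> Im z")
      case True
      show ?thesis unfolding Ep
        by (rule gen[OF C(3)[OF True] C'(3)[OF True]]) (use True in \<open>simp add: m_def field_simps\<close>)
    next
      case False
      then have le: "Im z \<le> 0" by simp
      show ?thesis unfolding E_def
        by (rule gen[OF C(2)[OF le] C'(2)[OF le]]) (use False in \<open>simp add: m_def field_simps\<close>)
    qed
    then show "\<exists>C. \<forall>z. norm (E z) \<le> C * exp (e * norm z - (d - b) / 2 * \<bar>Im z\<bar>)" by blast
  qed
  then show ?thesis by (simp add: E_def)
qed

text \<open>
  By \<open>conv_commute\<close> the quotient \<open>conv_minus b F R (S j) / FL (S j)\<close> does not depend on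
  $j$, so its pole at a point is at most the common zero of the transforms there, which \<open>FL T\<close> cancels.
\<close>

lemma meromorphic_quotient_entire:
  assumes J: "j0 \<in> J" "finite J" and S: "\<And>j. j \<in> J \<Longrightarrow> point_lf (S j)" and F: "decaying R F"
    and sol: "\<And>j. j \<in> J \<Longrightarrow> solves (S j) b d F" and bd: "b < d" and T: "lf T"
    and van: "\<And>l n. \<forall>j\<in>J. \<forall>i<n. (deriv ^^ i) (FL (S j)) l = 0 \<Longrightarrow> \<forall>i<n. (deriv ^^ i) (FL T) l = 0"
  shows "\<exists>A. A holomorphic_on UNIV \<and>
    (\<forall>z. A z * FL (S j0) z = FL (S j0) z * T (emb (res_minus F R z)) - conv_minus b F R (S j0) z * FL T z)"
proof -
  define E where "E j z = FL (S j) z * T (emb (res_minus F R z)) - conv_minus b F R (S j) z * FL T z" for j z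
  have lS: "lf (S j)" if "j \<in> J" for j using S[OF that] point_lf_lf by blast
  have hT: "(\<lambda>z. T (emb (res_minus F R z))) holomorphic_on UNIV"
    by (rule lf_holomorphic[OF T hol_fam_res_minus[OF F]])
  have hE: "E j holomorphic_on UNIV" if "j \<in> J" for j unfolding E_def[abs_def]
    by (intro holomorphic_intros FL_hol conv_minus_hol lS that T F hT)
  have EE: "E j z * FL (S k) z = E k z * FL (S j) z" if "j \<in> J" "k \<in> J" for j k z
    using conv_commute[OF S[OF that(1)] S[OF that(2)] F sol[OF that(1)] sol[OF that(2)] bd, of z]
    unfolding E_def by (simp add: algebra_simps)
  define f where "f z = E j0 z / FL (S j0) z" for z
  define A where "A = remove_sings f"
  note h0 = FL_hol[OF lS[OF J(1)]]
  obtain w0 where w0: "FL (S j0) w0 \<noteq> 0" using FL_nonzero[OF S[OF J(1)]] by blast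
  have an: "h analytic_on X" if "h holomorphic_on UNIV" for h :: "complex \<Rightarrow> complex" and X
    using that by (metis analytic_on_open analytic_on_subset open_UNIV subset_UNIV)
  have anA: "A analytic_on {l}" for l
  proof -
    have "\<exists>q k. q holomorphic_on UNIV \<and> q l \<noteq> 0 \<and> (\<forall>z. FL (S j) z = (z - l) ^ k * q z)" if j: "j \<in> J" for j
    proof -
      obtain w where "FL (S j) w \<noteq> 0" using FL_nonzero[OF S[OF j]] by blast
      from entire_factor_zero[OF FL_hol[OF lS[OF j]] this, of l] show ?thesis by blast
    qed
    then obtain q k where qk: "\<And>j. j \<in> J \<Longrightarrow> q j holomorphic_on UNIV \<and> q j l \<noteq> 0 \<and> (\<forall>z. FL (S j) z = (z - l) ^ k j * q j z)"
      by metis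
    \<comment> \<open>The least order of vanishing among the transforms at l, attained for j1; by
      hypothesis FL T is divisible by (z - l)^n.\<close>
    define n where "n = Min (k ` J)"
    have "n \<in> k ` J" unfolding n_def by (rule Min_in) (use J in auto)
    then obtain j1 where j1: "j1 \<in> J" "k j1 = n" by auto
    have nk: "n \<le> k j" if "j \<in> J" for j unfolding n_def by (rule Min_le) (use J that in auto)
    have "(deriv ^^ i) (FL (S j)) l = 0" if "j \<in> J" "i < n" for j i
    proof -
      have "(\<forall>i<k j. (deriv ^^ i) (FL (S j)) l = 0)"
        using higher_deriv_factor[of "q j" "FL (S j)" l "k j"] qk[OF that(1)] by blast
      then show ?thesis using nk[OF that(1)] that(2) by simp
    qed
    then have vT: "\<forall>i<n. (deriv ^^ i) (FL T) l = 0" by (intro van) blast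
    have "(deriv ^^ i) (FL T) l = 0" if "i < n" for i using vT that by blast
    from entire_factor_of_derivs[OF FL_hol[OF T] this]
    obtain r where r: "r holomorphic_on UNIV" "\<And>z. FL T z = (z - l) ^ n * r z" by blast
    define s where "s z = q j1 z * T (emb (res_minus F R z)) - conv_minus b F R (S j1) z * r z" for z
    have hs: "s holomorphic_on UNIV" unfolding s_def[abs_def]
      by (intro holomorphic_intros conv_minus_hol lS j1 F hT r) (use qk j1 in blast)
    have Es: "E j1 z = (z - l) ^ n * s z" for z
    proof -
      have "FL (S j1) z = (z - l) ^ n * q j1 z" using qk[OF j1(1)] j1(2) by blast
      then show ?thesis unfolding E_def s_def r(2) by (simp add: algebra_simps)
    qed
    \<comment> \<open>Near l the quotient for j0 is rewritten as the one for j1, whose denominator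
      no longer vanishes at l.\<close>
    have ev: "\<forall>\<^sub>F z in at l. f z = s z / q j1 z"
    proof -
      have "\<forall>\<^sub>F z in at l. FL (S j0) z \<noteq> 0 \<and> z \<in> UNIV"
        by (rule non_zero_neighbour_alt[OF h0 open_UNIV connected_UNIV UNIV_I UNIV_I w0])
      moreover have "\<forall>\<^sub>F z in at l. q j1 z \<noteq> 0 \<and> z \<in> UNIV"
        by (rule non_zero_neighbour_alt[OF _ open_UNIV connected_UNIV UNIV_I UNIV_I, of _ l]) (use qk j1 in blast)+
      moreover have "\<forall>\<^sub>F z in at l. z \<noteq> l" by (simp add: eventually_at_filter)
      ultimately show ?thesis
      proof eventually_elim
        case (elim z)
        have "E j0 z * ((z - l) ^ n * q j1 z) = ((z - l) ^ n * s z) * FL (S j0) z"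
          using EE[OF J(1) j1(1), of z] qk[OF j1(1)] j1(2) Es[of z] by auto
        then have "E j0 z * q j1 z = s z * FL (S j0) z" using elim by (simp add: mult_ac)
        then show ?case using elim by (simp add: f_def field_simps)
      qed
    qed
    have "f meromorphic_on {l}" unfolding f_def[abs_def]
      by (intro meromorphic_intros analytic_on_imp_meromorphic_on an hE h0 J(1))
    then have iso: "isolated_singularity_at f l" by (simp add: meromorphic_at_iff)
    have "(\<lambda>z. s z / q j1 z) \<midarrow>l\<rightarrow> s l / q j1 l"
    proof (intro tendsto_divide)
      show "s \<midarrow>l\<rightarrow> s l" using hs by (metis UNIV_I continuous_on_def holomorphic_on_imp_continuous_on)
      show "q j1 \<midarrow>l\<rightarrow> q j1 l" using qk[OF j1(1)] by (metis UNIV_I continuous_on_def holomorphic_on_imp_continuous_on)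
      show "q j1 l \<noteq> 0" using qk[OF j1(1)] by blast
    qed
    then have "f \<midarrow>l\<rightarrow> s l / q j1 l" using tendsto_cong[OF ev] by blast
    then show ?thesis unfolding A_def by (rule remove_sings_analytic_at[OF iso])
  qed
  then have hA: "A holomorphic_on UNIV"
    by (intro analytic_imp_holomorphic) (subst analytic_on_analytic_at, blast)
  have "A z * FL (S j0) z - E j0 z = 0" for z
  proof (rule entire_mult_zero[of "\<lambda>z. A z * FL (S j0) z - E j0 z" "FL (S j0)"])
    show "(\<lambda>z. A z * FL (S j0) z - E j0 z) holomorphic_on UNIV" by (intro holomorphic_intros hA h0 hE J(1))
    show "(A z * FL (S j0) z - E j0 z) * FL (S j0) z = 0" for z
    proof (cases "FL (S j0) z = 0")
      case False
      have "f analytic_on {z}" unfolding f_def[abs_def]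
        by (intro analytic_intros an hE h0 J(1)) (use False in auto)
      then have "A z = f z" unfolding A_def by simp
      then show ?thesis using False by (simp add: f_def)
    qed simp
  qed (use h0 w0 in auto)
  then show ?thesis using hA unfolding E_def by (intro exI[of _ A]) auto
qed

text \<open>
  \<open>A\<close> does not change when \<open>res_minus\<close> and \<open>conv_minus\<close> are replaced by \<open>res_plus\<close> and
  \<open>conv_plus\<close>; the former are estimated in the lower half-plane and the latter in the upper one.
\<close>

lemma quotient_bounded:
  assumes S: "point_lf S" and F: "decaying R F" and sol: "solves S b d F" and bd: "b < d"
    and T: "lf T" "supp_in T b d" and A: "A holomorphic_on UNIV"
    and eq: "\<And>z. A z * FL S z = FL S z * T (emb (res_minus F R z)) - conv_minus b F R S z * FL T z"
  shows "\<exists>K. \<forall>z. norm (A z) \<le> K"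
proof -
  have lS: "lf S" by (rule point_lf_lf[OF S])
  define m where "m = (b + d) / 2"
  define l where "l = (d - b) / 2"
  \<comment> \<open>Recentring makes the growth of FL T symmetric: a support of half-length l
    contributes l |Im z|, exactly what the factor exp (- l |Im z|) in the estimate below takes
    away.\<close>
  define \<psi> where "\<psi> z = FL T z * exp (\<i> * z * of_real m)" for z
  have l: "0 < l" using bd by (simp add: l_def)
  have T0: "T (emb (res_minus F R z)) = T (emb (res_plus F R z)) + primitive_exp F R z R * FL T z" for z
    using lf_translate_res[OF T(1) F, where y=0 and z=z] by (simp add: translate_def[abs_def])
  have eqp: "A z * FL S z = FL S z * T (emb (res_plus F R z)) - conv_plus b F R S z * FL T z" for z
    unfolding eq T0 conv_minus_eq[OF lS F] by (simp add: algebra_simps)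
  obtain C1 where C1: "C1 \<ge> 0" "\<And>z. Im z \<le> 0 \<Longrightarrow> norm (conv_minus b F R S z) \<le> C1 * exp (- b * Im z)"
    "\<And>z. 0 \<le> Im z \<Longrightarrow> norm (conv_plus b F R S z) \<le> C1 * exp (- d * Im z)"
    using conv_bounds[OF lS F sol bd] by blast
  obtain C2 where C2: "C2 \<ge> 0" "\<And>z. Im z \<le> 0 \<Longrightarrow> norm (T (emb (translate 0 (res_minus F R z)))) \<le> C2"
    "\<And>z. 0 \<le> Im z \<Longrightarrow> norm (T (emb (translate 0 (res_plus F R z)))) \<le> C2"
    using lf_res_bound[OF T(1) F, of 0] by blast
  have tr0: "translate 0 G = G" for G by (simp add: translate_def[abs_def])
  define C where "C = C1 + C2"
  have npsi: "norm (\<psi> z) = norm (FL T z) * exp (- m * Im z)" for z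
    by (simp add: \<psi>_def norm_mult norm_exp_eq_Re mult.commute)
  have gen: "norm (FL S z * u - v * FL T z) \<le> C * (norm (FL S z) + exp (- l * \<bar>Im z\<bar>) * norm (\<psi> z))"
    if u: "norm u \<le> C2" and v: "norm v \<le> C1 * exp t" and t: "t = - l * \<bar>Im z\<bar> - m * Im z" for u v t z
  proof -
    have "norm (FL S z * u - v * FL T z) \<le> norm (FL S z) * norm u + norm v * norm (FL T z)"
      by (metis norm_mult norm_triangle_ineq4)
    also have "\<dots> \<le> norm (FL S z) * C + (C * exp t) * norm (FL T z)"
    proof (intro add_mono mult_left_mono mult_right_mono)
      show "norm u \<le> C" using u C1(1) by (simp add: C_def)
      show "norm v \<le> C * exp t"
        by (rule order_trans[OF v mult_right_mono]) (use C2(1) in \<open>auto simp: C_def\<close>)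
    qed auto
    also have "(C * exp t) * norm (FL T z) = C * (exp (- l * \<bar>Im z\<bar>) * norm (\<psi> z))"
      unfolding npsi t by (simp add: exp_diff exp_minus field_simps)
    finally show ?thesis by (simp add: algebra_simps)
  qed
  have le: "norm (A z * FL S z) \<le> C * (norm (FL S z) + exp (- l * \<bar>Im z\<bar>) * norm (\<psi> z))" for z
  proof (cases "0 \<le> Im z")
    case True
    show ?thesis unfolding eqp
      by (rule gen[OF C2(3)[OF True, unfolded tr0] C1(3)[OF True]]) (use True in \<open>simp add: m_def l_def field_simps\<close>)
  next
    case False
    then have le: "Im z \<le> 0" by simp
    show ?thesis unfolding eq
      by (rule gen[OF C2(2)[OF le, unfolded tr0] C1(2)[OF le]]) (use False in \<open>simp add: m_def l_def field_simps\<close>)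
  qed
  have ztS: "zero_type (FL S)" using point_lf_zero_type[OF S] by (simp add: FL_def[abs_def])
  have ztE: "zero_type (\<lambda>z. A z * FL S z)"
    unfolding zero_type_def
  proof (intro allI impI)
    fix e :: real assume e: "0 < e"
    obtain K where K: "\<And>z. norm (FL S z) \<le> K * exp (e * norm z)" using ztS e unfolding zero_type_def by blast
    obtain K' where K': "K' \<ge> 0" "\<And>z. norm (FL T z) \<le> K' * exp (e * norm z + max (b * Im z) (d * Im z))"
      using supp_in_growth[OF T _ e] bd unfolding FL_def by auto
    have "norm (A z * FL S z) \<le> (C * (K + K')) * exp (e * norm z)" for z
    proof -
      have "exp (- l * \<bar>Im z\<bar>) * norm (\<psi> z) \<le> exp (- l * \<bar>Im z\<bar>) * (K' * exp (e * norm z + max (b * Im z) (d * Im z)) * exp (- m * Im z))"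
        unfolding npsi by (intro mult_left_mono mult_right_mono K') auto
      also have "\<dots> = K' * exp (e * norm z + (max (b * Im z) (d * Im z) - l * \<bar>Im z\<bar> - m * Im z))"
        by (simp add: exp_add exp_diff exp_minus field_simps)
      also have "max (b * Im z) (d * Im z) - l * \<bar>Im z\<bar> - m * Im z = 0"
      proof (cases "0 \<le> Im z")
        case True
        then have "b * Im z \<le> d * Im z" using bd by (intro mult_right_mono) auto
        then show ?thesis using True by (simp add: m_def l_def field_simps)
      next
        case False
        then have "d * Im z \<le> b * Im z" using bd by (intro mult_right_mono_neg) auto
        then show ?thesis using False by (simp add: m_def l_def field_simps)
      qed
      finally have "norm (FL S z) + exp (- l * \<bar>Im z\<bar>) * norm (\<psi> z) \<le> (K + K') * exp (e * norm z)"
        using K[of z] by (simp add: distrib_right)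
      then have "C * (norm (FL S z) + exp (- l * \<bar>Im z\<bar>) * norm (\<psi> z)) \<le> C * ((K + K') * exp (e * norm z))"
        using C1(1) C2(1) by (intro mult_left_mono) (auto simp: C_def)
      then show ?thesis using le[of z] by simp
    qed
    then show "\<exists>C. \<forall>z. norm (A z * FL S z) \<le> C * exp (e * norm z)" by blast
  qed
  obtain z0 where z0: "FL S z0 \<noteq> 0" using FL_nonzero[OF S] by blast
  have "zero_type A" by (rule zero_type_quotient[OF A FL_hol[OF lS] z0 ztS ztE])
  moreover have "\<psi> holomorphic_on UNIV" unfolding \<psi>_def[abs_def] by (intro holomorphic_intros FL_hol T)
  ultimately show ?thesis
    using bounded_of_bounded_modulo[OF A FL_hol[OF lS] _ z0 _ l _ le] C1(1) C2(1) by (simp add: C_def)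
qed

text \<open>Both sides solve the equation for F' and vanish at - R; their difference solves the
  homogeneous equation with zero initial value.\<close>

lemma res_minus_shift:
  assumes F: "decaying R F"
  shows "res_minus (\<lambda>j. F (Suc j)) R z = (\<lambda>j. res_minus F R z (Suc j))"
proof -
  have R: "0 < R" "F \<in> TF" using F by (auto simp: decaying_def)
  let ?D = "\<lambda>j. F (Suc j)"
  have FD: "decaying R ?D" by (rule decaying_shift[OF F])
  have r1: "resolvent z ?D (res_minus ?D R z)" by (rule res_minus_resolvent[OF FD])
  have r2: "resolvent z ?D (\<lambda>j. res_minus F R z (Suc j))"
    using resolvent_deriv[OF res_minus_resolvent[OF F] R(2), of z]
      res_minus_resolvent[OF F, of z] resolvent_deriv[OF res_minus_resolvent[OF F] R(2), of z 1]
    unfolding resolvent_def One_nat_def by (simp del: res_minus.simps)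
  have r: "resolvent z 0 (res_minus ?D R z - (\<lambda>j. res_minus F R z (Suc j)))"
    unfolding resolvent_def
  proof (intro conjI allI)
    fix j t
    show "((res_minus ?D R z - (\<lambda>j. res_minus F R z (Suc j))) 0 has_vector_derivative (res_minus ?D R z - (\<lambda>j. res_minus F R z (Suc j))) 1 t) (at t)"
      unfolding fun_diff_def using r1 r2 unfolding resolvent_def by (intro has_vector_derivative_diff) blast+
    show "(res_minus ?D R z - (\<lambda>j. res_minus F R z (Suc j))) (Suc j) t = 0 j t - \<i> * z * (res_minus ?D R z - (\<lambda>j. res_minus F R z (Suc j))) j t"
      by (simp add: algebra_simps)
  qed
  have "0 \<in> TF" by (auto simp: TF_def zero_fun_def intro: exI[of _ 0])
  have "(res_minus ?D R z - (\<lambda>j. res_minus F R z (Suc j))) j t = 0" for j t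
  proof -
    have "norm ((res_minus ?D R z - (\<lambda>j. res_minus F R z (Suc j))) j t) \<le> \<bar>t - (- R)\<bar> * exp (\<bar>Im z\<bar> * \<bar>t + R\<bar>) * 0"
    proof (rule resolvent_bound[OF r \<open>0 \<in> TF\<close>])
      show "(res_minus ?D R z - (\<lambda>j. res_minus F R z (Suc j))) j (- R) = 0"
        using res_minus_left[OF FD, of "- R" z j] res_minus_left[OF F, of "- R" z "Suc j"] by (simp del: res_minus.simps)
      fix s assume s: "s \<in> closed_segment (- R) t"
      show "norm ((0 :: nat \<Rightarrow> real \<Rightarrow> complex) j s) \<le> 0" by simp
      have "- Im z * (s - t) \<le> \<bar>Im z\<bar> * \<bar>s - t\<bar>" by (metis abs_ge_self abs_minus_cancel abs_mult)
      also have "\<dots> \<le> \<bar>Im z\<bar> * \<bar>t + R\<bar>"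
        using s by (intro mult_left_mono) (auto simp: closed_segment_eq_real_ivl split: if_splits)
      finally show "- Im z * (s - t) \<le> \<bar>Im z\<bar> * \<bar>t + R\<bar>" .
    qed
    then show ?thesis by simp
  qed
  then show ?thesis by (auto simp: fun_eq_iff simp del: res_minus.simps)
qed

text \<open>S * F vanishes identically on an interval of positive length, hence so does its
  derivative, at the endpoints by continuity.\<close>

lemma solves_shift:
  assumes S: "lf S" and F: "F \<in> TF" and sol: "solves S b d F" and bd: "b < d"
  shows "solves S b d (\<lambda>j. F (Suc j))"
proof -
  define G where "G j y = S (emb (translate y (\<lambda>i. F (i + j))))" for j y
  have Fj: "(\<lambda>i. F (i + j)) \<in> TF" for j
  proof (induction j)
    case (Suc j)
    from TF_shift[OF this] show ?case by simp
  qed (simp add: F)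
  have d: "(G j has_vector_derivative G (Suc j) y) (at y)" for j y
    using translate_deriv[OF S Fj[of j], of y] by (simp add: G_def[abs_def])
  have "G 1 y = 0" if "y \<in> {b..d}" for y
    by (rule family_zero_on_interval[of G b d, OF d bd]) (use that sol in \<open>auto simp: G_def solves_def\<close>)
  then show ?thesis by (simp add: solves_def G_def)
qed

theorem annihilator_of_exponentials:
  assumes J: "J \<noteq> {}" "finite J" and S: "\<And>j. j \<in> J \<Longrightarrow> point_lf (S j)" and F: "decaying R F"
    and sol: "\<And>j. j \<in> J \<Longrightarrow> solves (S j) b d F" and bd: "b < d" and T: "lf T" "supp_in T b d"
    and van: "\<And>l n. \<forall>j\<in>J. \<forall>i<n. (deriv ^^ i) (FL (S j)) l = 0 \<Longrightarrow> \<forall>i<n. (deriv ^^ i) (FL T) l = 0"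
  shows "T (emb F) = 0"
proof -
  obtain j0 where j0: "j0 \<in> J" using J(1) by blast
  let ?\<phi> = "FL (S j0)"
  have lS: "lf (S j0)" using S[OF j0] by (rule point_lf_lf)
  \<comment> \<open>Says that the entire quotient belonging to F is the constant \<alpha>, written
    without division.\<close>
  define rep where "rep F \<alpha> \<longleftrightarrow> (\<forall>z. \<alpha> * ?\<phi> z = ?\<phi> z * T (emb (res_minus F R z)) - conv_minus b F R (S j0) z * FL T z)" for F \<alpha>
  have ex: "\<exists>\<alpha>. rep F \<alpha>" if F: "decaying R F" and sol: "\<And>j. j \<in> J \<Longrightarrow> solves (S j) b d F" for F
  proof -
    obtain A where A: "A holomorphic_on UNIV" "\<And>z. A z * ?\<phi> z = ?\<phi> z * T (emb (res_minus F R z)) - conv_minus b F R (S j0) z * FL T z"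
      using meromorphic_quotient_entire[where S=S and J=J, OF j0 J(2) S F sol bd T(1) van] by blast
    obtain K where "\<And>z. norm (A z) \<le> K" using quotient_bounded[OF S[OF j0] F sol[OF j0] bd T A] by blast
    then have "bounded (range A)" by (auto simp: bounded_iff)
    then have "A constant_on UNIV" by (rule Liouville_theorem[OF A(1)])
    then show ?thesis using A(2) unfolding rep_def constant_on_def by (metis UNIV_I)
  qed
  \<comment> \<open>The constants for F and F' satisfy \<beta> = T F - i z \<alpha> for every z, so
    comparing coefficients determines both.\<close>
  have key: "\<alpha> = 0 \<and> \<beta> = T (emb F)"
    if F: "decaying R F" and sol: "solves (S j0) b d F" and r: "rep F \<alpha>" "rep (\<lambda>j. F (Suc j)) \<beta>" for F \<alpha> \<beta>
  proof -
    have TF: "F \<in> TF" using F by (simp add: decaying_def)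
    have rT: "res_minus F R z \<in> TF" for z by (rule res_minus_TF[OF F])
    have sh: "(\<lambda>j. res_minus F R z (Suc j)) = F - (\<lambda>j. cscale (\<i> * z) (res_minus F R z j))" for z
      by (auto simp: cscale_def fun_eq_iff)
    have T1: "T (emb (res_minus (\<lambda>j. F (Suc j)) R z)) = T (emb F) - \<i> * z * T (emb (res_minus F R z))" for z
      unfolding res_minus_shift[OF F] sh lf_emb_diff[OF T(1) TF TF_scale[OF rT]] lf_emb_scale[OF T(1) rT] ..
    have tsh: "translate b (F - (\<lambda>j. cscale (\<i> * z) (res_minus F R z j))) = translate b F - (\<lambda>j. cscale (\<i> * z) (translate b (res_minus F R z) j))" for z
      by (auto simp: translate_def cscale_def fun_eq_iff)
    have "S j0 (emb (translate b F)) = 0" using sol bd by (auto simp: solves_def)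
    then have C1: "conv_minus b (\<lambda>j. F (Suc j)) R (S j0) z = - \<i> * z * conv_minus b F R (S j0) z" for z
      unfolding conv_minus_def res_minus_shift[OF F] sh tsh lf_emb_diff[OF lS TF_translate[OF TF] TF_scale[OF TF_translate[OF rT]]]
        lf_emb_scale[OF lS TF_translate[OF rT]] by simp
    have "(\<beta> - T (emb F) + \<i> * z * \<alpha>) * ?\<phi> z = 0" for z
    proof -
      have "\<beta> * ?\<phi> z = ?\<phi> z * (T (emb F) - \<i> * z * T (emb (res_minus F R z))) - (- \<i> * z * conv_minus b F R (S j0) z) * FL T z"
        using r(2) unfolding rep_def T1 C1 by blast
      also have "\<dots> = ?\<phi> z * T (emb F) - \<i> * z * (?\<phi> z * T (emb (res_minus F R z)) - conv_minus b F R (S j0) z * FL T z)"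
        by (simp add: algebra_simps)
      also have "\<dots> = ?\<phi> z * T (emb F) - \<i> * z * (\<alpha> * ?\<phi> z)" using r(1) unfolding rep_def by simp
      finally show ?thesis by (simp add: algebra_simps)
    qed
    note prod = this
    obtain w where w: "?\<phi> w \<noteq> 0" using FL_nonzero[OF S[OF j0]] by blast
    have hol: "(\<lambda>z. \<beta> - T (emb F) + \<i> * z * \<alpha>) holomorphic_on UNIV" by (intro holomorphic_intros)
    have "\<beta> - T (emb F) + \<i> * z * \<alpha> = 0" for z
      by (rule entire_mult_zero[OF hol FL_hol[OF lS] w prod])
    from this[of 0] this[of 1] show ?thesis by auto
  qed
  \<comment> \<open>Uses \<open>key\<close> for a family and its derivative. Below it is applied to
    F' itself, so F'' enters as well.\<close>
  have zero: "\<alpha> = 0" if dF: "decaying R F" and sF: "\<And>j. j \<in> J \<Longrightarrow> solves (S j) b d F" and rF: "rep F \<alpha>" for F \<alpha>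
  proof -
    have TF: "F \<in> TF" using dF by (simp add: decaying_def)
    have sh: "solves (S j) b d (\<lambda>j. F (Suc j))" if jJ: "j \<in> J" for j
      by (rule solves_shift[OF point_lf_lf[OF S[OF jJ]] TF sF[OF jJ] bd])
    obtain \<beta> where \<beta>: "rep (\<lambda>j. F (Suc j)) \<beta>" using ex[OF decaying_shift[OF dF] sh] by blast
    show ?thesis using key[OF dF sF[OF j0] rF \<beta>] by blast
  qed
  have solD: "solves (S j) b d (\<lambda>j. F (Suc j))" if "j \<in> J" for j
    using solves_shift[OF point_lf_lf[OF S[OF that]] _ sol[OF that] bd] F by (simp add: decaying_def)
  obtain \<alpha> where \<alpha>: "rep F \<alpha>" using ex[OF F sol] by blast
  obtain \<beta> where \<beta>: "rep (\<lambda>j. F (Suc j)) \<beta>" using ex[OF decaying_shift[OF F] solD] by blast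
  have "\<beta> = 0" by (rule zero[OF decaying_shift[OF F] solD \<beta>])
  then show ?thesis using key[OF F sol[OF j0] \<alpha> \<beta>] by simp
qed

end

section \<open>The Hahn-Banach theorem for a semi-norm\<close>

lemma cscale_simps:
  "cscale z (f + g) = cscale z f + cscale z g" "cscale (x + y) f = cscale x f + cscale y f"
  "cscale x (cscale y f) = cscale (x * y) f" "cscale 1 f = f" "cscale 0 f = 0" "cscale z 0 = 0"
  "- cscale z f = cscale (- z) f" "cscale z (f - g) = cscale z f - cscale z g"
  by (auto simp: cscale_def fun_eq_iff algebra_simps)

text \<open>Partial real-linear functionals below p, as graphs ordered by inclusion.
  Single-valuedness is recovered from the domination, since p 0 = 0 for a semi-norm.\<close>

definition dominated_graph ::
  "(real \<Rightarrow> complex) set \<Rightarrow> ((real \<Rightarrow> complex) \<Rightarrow> real) \<Rightarrow> ((real \<Rightarrow> complex) \<times> real) set \<Rightarrow> bool" where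
  "dominated_graph X p G \<longleftrightarrow> G \<subseteq> X \<times> UNIV \<and> (0, 0) \<in> G \<and>
     (\<forall>x s y t. (x, s) \<in> G \<longrightarrow> (y, t) \<in> G \<longrightarrow> (x + y, s + t) \<in> G) \<and>
     (\<forall>x s r. (x, s) \<in> G \<longrightarrow> (cscale (of_real r) x, r * s) \<in> G) \<and>
     (\<forall>x s. (x, s) \<in> G \<longrightarrow> s \<le> p x)"

text \<open>The value k at x0 must lie between the numbers s - p (y - x0) and p (y + x0) - s; the
  triangle inequality separates the two sets, and the supremum of the former will do.\<close>

lemma dominated_graph_extend:
  assumes X: "module.subspace cscale X"
    and p: "\<And>f g. f \<in> X \<Longrightarrow> g \<in> X \<Longrightarrow> p (f + g) \<le> p f + p g"
    and ps: "\<And>z f. f \<in> X \<Longrightarrow> p (cscale z f) = norm z * p f"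
    and G: "dominated_graph X p G" and x0: "x0 \<in> X"
  shows "\<exists>G'. dominated_graph X p G' \<and> G \<subseteq> G' \<and> x0 \<in> fst ` G'"
proof -
  have Xadd: "f + g \<in> X" if "f \<in> X" "g \<in> X" for f g using X that by (simp add: cfun.subspace_add)
  have Xs: "cscale z f \<in> X" if "f \<in> X" for z f using X that by (simp add: cfun.subspace_scale)
  have Xd: "f - g \<in> X" if "f \<in> X" "g \<in> X" for f g using X that by (simp add: cfun.subspace_diff)
  have GX: "x \<in> X" if "(x, s) \<in> G" for x s using G that by (auto simp: dominated_graph_def)
  have Gadd: "(x + y, s + t) \<in> G" if "(x, s) \<in> G" "(y, t) \<in> G" for x y s t using G that by (simp add: dominated_graph_def)
  have Gs: "(cscale (of_real r) x, r * s) \<in> G" if "(x, s) \<in> G" for x r s using G that by (simp add: dominated_graph_def)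
  have Gle: "s \<le> p x" if "(x, s) \<in> G" for x s using G that by (simp add: dominated_graph_def)
  have G0: "(0, 0) \<in> G" using G by (simp add: dominated_graph_def)
  define L where "L = (\<lambda>(y, s). s - p (y - x0)) ` G"
  have sep: "s - p (y - x0) \<le> p (y' + x0) - s'" if "(y, s) \<in> G" "(y', s') \<in> G" for y s y' s'
  proof -
    have "s + s' \<le> p (y + y')" by (rule Gle[OF Gadd[OF that]])
    also have "y + y' = (y - x0) + (y' + x0)" by simp
    also have "p \<dots> \<le> p (y - x0) + p (y' + x0)" using that GX x0 by (intro p Xadd Xd)
    finally show ?thesis by simp
  qed
  define k where "k = Sup L"
  have bdd: "bdd_above L" unfolding L_def
    by (rule bdd_aboveI2[where M="p (0 + x0) - 0"]) (use sep[OF _ G0] in \<open>auto split: prod.splits\<close>)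
  have L0: "L \<noteq> {}" using G0 by (auto simp: L_def)
  have low: "s - p (y - x0) \<le> k" if "(y, s) \<in> G" for y s
    unfolding k_def using that bdd by (intro cSup_upper) (auto simp: L_def)
  have up: "k \<le> p (y + x0) - s" if "(y, s) \<in> G" for y s
    unfolding k_def using that sep L0 by (intro cSup_least) (auto simp: L_def)
  define G' where "G' = {(y + cscale (of_real r) x0, s + r * k) | y s r. (y, s) \<in> G}"
  have "s + r * k \<le> p (y + cscale (of_real r) x0)" if ys: "(y, s) \<in> G" for y s r
  proof -
    \<comment> \<open>By homogeneity only r = 1 and r = -1 matter besides 0; these are
      \<open>up\<close> and \<open>low\<close>.\<close>
    consider "r = 0" | "r > 0" | "r < 0" by linarith
    then show ?thesis
    proof cases
      case 1
      then show ?thesis using Gle[OF ys] by (simp add: cscale_simps)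
    next
      case 2
      have "y + cscale (of_real r) x0 = cscale (of_real r) (cscale (of_real (1 / r)) y + x0)"
        using 2 by (simp add: cscale_simps)
      moreover have "cscale (of_real (1 / r)) y + x0 \<in> X" by (intro Xadd Xs GX[OF ys] x0)
      ultimately have "p (y + cscale (of_real r) x0) = r * p (cscale (of_real (1 / r)) y + x0)"
        using 2 ps by simp
      moreover have "k \<le> p (cscale (of_real (1 / r)) y + x0) - 1 / r * s" by (rule up[OF Gs[OF ys]])
      then have "r * k \<le> r * (p (cscale (of_real (1 / r)) y + x0) - 1 / r * s)" using 2 by (intro mult_left_mono) auto
      ultimately show ?thesis using 2 by (simp add: right_diff_distrib)
    next
      case 3
      define t where "t = - r"
      have t: "0 < t" using 3 by (simp add: t_def)
      have "y + cscale (of_real r) x0 = cscale (of_real t) (cscale (of_real (1 / t)) y - x0)"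
        using 3 by (auto simp: cscale_def fun_eq_iff t_def algebra_simps)
      moreover have "cscale (of_real (1 / t)) y - x0 \<in> X" by (intro Xd Xs GX[OF ys] x0)
      ultimately have "p (y + cscale (of_real r) x0) = t * p (cscale (of_real (1 / t)) y - x0)"
        using t ps by simp
      moreover have "1 / t * s - p (cscale (of_real (1 / t)) y - x0) \<le> k" by (rule low[OF Gs[OF ys]])
      then have "t * (1 / t * s - p (cscale (of_real (1 / t)) y - x0)) \<le> t * k" using t by (intro mult_left_mono) auto
      ultimately show ?thesis using t by (simp add: right_diff_distrib t_def)
    qed
  qed
  note le = this
  have G'I: "(y + cscale (of_real r) x0, s + r * k) \<in> G'" if "(y, s) \<in> G" for y s r
    using that unfolding G'_def by blast
  have "dominated_graph X p G'"
    unfolding dominated_graph_def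
  proof (intro conjI allI impI)
    show "G' \<subseteq> X \<times> UNIV" using GX x0 by (auto simp: G'_def intro!: Xadd Xs)
    show "(0, 0) \<in> G'" using G'I[OF G0, of 0] by (simp add: cscale_simps)
    show "s \<le> p x" if "(x, s) \<in> G'" for x s using that le by (auto simp: G'_def)
    show "(x + y, s + t) \<in> G'" if xs: "(x, s) \<in> G'" and yt: "(y, t) \<in> G'" for x s y t
    proof -
      obtain x1 s1 r1 where 1: "x = x1 + cscale (of_real r1) x0" "s = s1 + r1 * k" "(x1, s1) \<in> G" using xs unfolding G'_def by blast
      obtain x2 s2 r2 where 2: "y = x2 + cscale (of_real r2) x0" "t = s2 + r2 * k" "(x2, s2) \<in> G" using yt unfolding G'_def by blast
      have "x + y = (x1 + x2) + cscale (of_real (r1 + r2)) x0" by (simp add: 1 2 cscale_simps)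
      moreover have "s + t = (s1 + s2) + (r1 + r2) * k" by (simp add: 1 2 algebra_simps)
      ultimately show ?thesis using G'I[OF Gadd[OF 1(3) 2(3)]] by metis
    qed
    show "(cscale (of_real r) x, r * s) \<in> G'" if xs: "(x, s) \<in> G'" for x s r
    proof -
      obtain x1 s1 r1 where 1: "x = x1 + cscale (of_real r1) x0" "s = s1 + r1 * k" "(x1, s1) \<in> G" using xs unfolding G'_def by blast
      have "cscale (of_real r) x = cscale (of_real r) x1 + cscale (of_real (r * r1)) x0" by (simp add: 1 cscale_simps)
      moreover have "r * s = r * s1 + (r * r1) * k" by (simp add: 1 algebra_simps)
      ultimately show ?thesis using G'I[OF Gs[OF 1(3)]] by metis
    qed
  qed
  moreover have "G \<subseteq> G'"
  proof clarify
    fix y s assume "(y, s) \<in> G"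
    from G'I[OF this, of 0] show "(y, s) \<in> G'" by (simp add: cscale_simps)
  qed
  moreover have "x0 \<in> fst ` G'"
    using G'I[OF G0, of 1] by (force simp: cscale_simps image_iff)
  ultimately show ?thesis by blast
qed

text \<open>The real functional sending v + t f0 to t is dominated by p because f0 stays at
  p-distance at least 1 from V; a maximal dominated extension u is complexified as u f - i u (i
  f).\<close>

theorem hahn_banach_separation:
  assumes X: "module.subspace cscale X"
    and p: "\<And>f g. f \<in> X \<Longrightarrow> g \<in> X \<Longrightarrow> p (f + g) \<le> p f + p g"
    and ps: "\<And>z f. f \<in> X \<Longrightarrow> p (cscale z f) = norm z * p f"
    and V: "module.subspace cscale V" "V \<subseteq> X" and f0: "f0 \<in> X"
    and dist: "\<And>v. v \<in> V \<Longrightarrow> 1 \<le> p (f0 + v)"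
  shows "\<exists>T :: (real \<Rightarrow> complex) \<Rightarrow> complex.
    (\<forall>f\<in>X. \<forall>g\<in>X. T (f + g) = T f + T g) \<and> (\<forall>z. \<forall>f\<in>X. T (cscale z f) = z * T f) \<and>
    (\<forall>f\<in>X. norm (T f) \<le> p f) \<and> (\<forall>v\<in>V. T v = 0) \<and> T f0 \<noteq> 0"
proof -
  have X0: "0 \<in> X" using X by (rule cfun.subspace_0)
  have Xadd: "f + g \<in> X" if "f \<in> X" "g \<in> X" for f g using X that by (simp add: cfun.subspace_add)
  have Xs: "cscale z f \<in> X" if "f \<in> X" for z f using X that by (simp add: cfun.subspace_scale)
  have Vs: "cscale z v \<in> V" if "v \<in> V" for z v using V(1) that by (simp add: cfun.subspace_scale)
  have Vadd: "f + g \<in> V" if "f \<in> V" "g \<in> V" for f g using V(1) that by (simp add: cfun.subspace_add)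
  have V0: "0 \<in> V" using V(1) by (rule cfun.subspace_0)
  have p0: "p 0 = 0" using ps[OF X0, of 0] by (simp add: cscale_simps)
  have pnn: "0 \<le> p f" if "f \<in> X" for f
  proof -
    have "p (f + cscale (-1) f) \<le> p f + p (cscale (-1) f)" by (rule p[OF that Xs[OF that]])
    moreover have "f + cscale (-1) f = 0" by (auto simp: cscale_def)
    ultimately show ?thesis using ps[OF that, of "-1"] p0 by simp
  qed
  define G0 where "G0 = {(v + cscale (of_real t) f0, t) | v t. v \<in> V}"
  have G0: "dominated_graph X p G0"
    unfolding dominated_graph_def
  proof (intro conjI allI impI)
    show "G0 \<subseteq> X \<times> UNIV" using V(2) f0 by (auto simp: G0_def intro!: Xadd Xs)
    show "(0, 0) \<in> G0" unfolding G0_def using V0 by (force simp: cscale_simps)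
    show "(x + y, s + t) \<in> G0" if xs: "(x, s) \<in> G0" and yt: "(y, t) \<in> G0" for x s y t
    proof -
      obtain v1 where 1: "x = v1 + cscale (of_real s) f0" "v1 \<in> V" using xs unfolding G0_def by blast
      obtain v2 where 2: "y = v2 + cscale (of_real t) f0" "v2 \<in> V" using yt unfolding G0_def by blast
      have "x + y = (v1 + v2) + cscale (of_real (s + t)) f0" by (simp add: 1 2 cscale_simps)
      then show ?thesis unfolding G0_def using Vadd[OF 1(2) 2(2)] by blast
    qed
    show "(cscale (of_real r) x, r * s) \<in> G0" if xs: "(x, s) \<in> G0" for x s r
    proof -
      obtain v1 where 1: "x = v1 + cscale (of_real s) f0" "v1 \<in> V" using xs unfolding G0_def by blast
      have "cscale (of_real r) x = cscale (of_real r) v1 + cscale (of_real (r * s)) f0" by (simp add: 1 cscale_simps)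
      then show ?thesis unfolding G0_def using Vs[OF 1(2)] by blast
    qed
    show "s \<le> p x" if xs: "(x, s) \<in> G0" for x s
    proof -
      obtain v where v: "x = v + cscale (of_real s) f0" "v \<in> V" using xs unfolding G0_def by blast
      show ?thesis
      proof (cases "s \<le> 0")
        case True
        moreover have "x \<in> X" unfolding v(1) using v(2) V(2) f0 by (intro Xadd Xs) auto
        ultimately show ?thesis using pnn by fastforce
      next
        case False
        have "x = cscale (of_real s) (f0 + cscale (of_real (1 / s)) v)"
          using False by (simp add: v(1) cscale_simps add.commute)
        moreover have "f0 + cscale (of_real (1 / s)) v \<in> X"
          using v(2) V(2) f0 by (intro Xadd Xs) auto
        ultimately have "p x = s * p (f0 + cscale (of_real (1 / s)) v)"
          using False ps by simp
        moreover have "s * 1 \<le> s * p (f0 + cscale (of_real (1 / s)) v)"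
          using False by (intro mult_left_mono dist Vs v(2)) auto
        ultimately show ?thesis by simp
      qed
    qed
  qed
  define \<A> where "\<A> = {G. dominated_graph X p G \<and> G0 \<subseteq> G}"
  have "\<exists>M\<in>\<A>. \<forall>Y\<in>\<A>. M \<subseteq> Y \<longrightarrow> Y = M"
  proof (rule subset_Zorn_nonempty)
    show "\<A> \<noteq> {}" using G0 by (auto simp: \<A>_def)
    fix C assume C: "C \<noteq> {}" "subset.chain \<A> C"
    have CA: "dominated_graph X p G" "G0 \<subseteq> G" if "G \<in> C" for G
      using C(2) that by (auto simp: \<A>_def subset_chain_def)
    have two: "\<exists>G\<in>C. x \<in> G \<and> y \<in> G" if "x \<in> \<Union>C" "y \<in> \<Union>C" for x y
      using C(2) that unfolding subset_chain_def by blast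
    have "dominated_graph X p (\<Union>C)"
      unfolding dominated_graph_def
    proof (intro conjI allI impI)
      have d: "G \<subseteq> X \<times> UNIV" "(0, 0) \<in> G" "(x, s) \<in> G \<Longrightarrow> (y, t) \<in> G \<Longrightarrow> (x + y, s + t) \<in> G"
        "(x, s) \<in> G \<Longrightarrow> (cscale (of_real r) x, r * s) \<in> G" "(x, s) \<in> G \<Longrightarrow> s \<le> p x"
        if "G \<in> C" for G x y s t r
        using CA(1)[OF that] by (auto simp: dominated_graph_def)
      show "\<Union>C \<subseteq> X \<times> UNIV" using d(1) by (rule Union_least)
      show "(0, 0) \<in> \<Union>C" using C(1) d(2) by blast
      show "(x + y, s + t) \<in> \<Union>C" if xy: "(x, s) \<in> \<Union>C" "(y, t) \<in> \<Union>C" for x s y t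
      proof -
        obtain G where G: "G \<in> C" "(x, s) \<in> G" "(y, t) \<in> G" using two[OF xy] by blast
        show ?thesis by (rule UnionI[OF G(1) d(3)[OF G]])
      qed
      show "(cscale (of_real r) x, r * s) \<in> \<Union>C" if "(x, s) \<in> \<Union>C" for x s r
      proof -
        obtain G where G: "G \<in> C" "(x, s) \<in> G" using \<open>(x, s) \<in> \<Union>C\<close> by blast
        show ?thesis by (rule UnionI[OF G(1) d(4)[OF G]])
      qed
      show "s \<le> p x" if "(x, s) \<in> \<Union>C" for x s
      proof -
        obtain G where G: "G \<in> C" "(x, s) \<in> G" using \<open>(x, s) \<in> \<Union>C\<close> by blast
        show ?thesis by (rule d(5)[OF G])
      qed
    qed
    then show "\<Union>C \<in> \<A>" using C(1) CA(2) by (auto simp: \<A>_def)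
  qed
  then obtain M where MA: "M \<in> \<A>" and max: "\<forall>Y\<in>\<A>. M \<subseteq> Y \<longrightarrow> Y = M" by (elim bexE) (rule that)
  have M: "dominated_graph X p M" "G0 \<subseteq> M" using MA by (auto simp: \<A>_def)
  have dom: "\<exists>s. (x, s) \<in> M" if xX: "x \<in> X" for x
  proof -
    have "\<exists>G'. dominated_graph X p G' \<and> M \<subseteq> G' \<and> x \<in> fst ` G'"
      by (rule dominated_graph_extend[OF X _ _ M(1) xX]) (rule p ps; assumption)+
    then obtain G' where G': "dominated_graph X p G'" "M \<subseteq> G'" "x \<in> fst ` G'"
      by (elim exE conjE) (rule that)
    have "G' \<in> \<A>" using G' M(2) by (auto simp: \<A>_def)
    then have "G' = M" using max G'(2) by auto
    then show ?thesis using G'(3) by force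
  qed
  have Madd: "(x + y, s + t) \<in> M" if "(x, s) \<in> M" "(y, t) \<in> M" for x y s t using M(1) that by (simp add: dominated_graph_def)
  have Ms: "(cscale (of_real r) x, r * s) \<in> M" if "(x, s) \<in> M" for x r s using M(1) that by (simp add: dominated_graph_def)
  have Mle: "s \<le> p x" if "(x, s) \<in> M" for x s using M(1) that by (simp add: dominated_graph_def)
  have le: "s \<le> t" if "(x, s) \<in> M" "(x, t) \<in> M" for x s t
  proof -
    have "(x + cscale (of_real (-1)) x, s + (-1) * t) \<in> M" by (intro Madd Ms that)
    moreover have "x + cscale (of_real (-1)) x = 0" by (auto simp: cscale_def)
    ultimately show ?thesis using Mle[of 0] p0 by fastforce
  qed
  define u where "u x = (THE s. (x, s) \<in> M)" for x
  have u: "(x, u x) \<in> M" if "x \<in> X" for x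
    unfolding u_def by (rule theI') (use dom[OF that] le in \<open>blast intro: order_antisym\<close>)
  have ueq: "u x = s" if "(x, s) \<in> M" for x s
    unfolding u_def by (rule the_equality) (use that le in \<open>blast intro: order_antisym\<close>)+
  have uadd: "u (f + g) = u f + u g" if "f \<in> X" "g \<in> X" for f g by (intro ueq Madd u that)
  have us: "u (cscale (of_real r) f) = r * u f" if "f \<in> X" for r f by (intro ueq Ms u that)
  have ule: "u f \<le> p f" if "f \<in> X" for f by (intro Mle u that)
  have uV: "u v = 0" if "v \<in> V" for v
  proof (intro ueq subsetD[OF M(2)])
    have "v = v + cscale (of_real 0) f0" by (simp add: cscale_simps)
    then show "(v, 0) \<in> G0" unfolding G0_def using that by blast
  qed
  have uf0: "u f0 = 1"
  proof (intro ueq subsetD[OF M(2)])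
    have "f0 = 0 + cscale (of_real 1) f0" by (simp add: cscale_simps)
    then show "(f0, 1) \<in> G0" unfolding G0_def using V0 by blast
  qed
  define T where "T f = Complex (u f) (- u (cscale \<i> f))" for f
  have Tadd: "T (f + g) = T f + T g" if "f \<in> X" "g \<in> X" for f g
    using that by (simp add: T_def cscale_simps uadd Xs complex_eq_iff)
  have Tr: "T (cscale (of_real r) f) = of_real r * T f" if "f \<in> X" for r f
  proof -
    have "cscale \<i> (cscale (of_real r) f) = cscale (of_real r) (cscale \<i> f)" by (simp add: cscale_simps mult.commute)
    then have "u (cscale \<i> (cscale (of_real r) f)) = r * u (cscale \<i> f)" by (simp only: us[OF Xs[OF that]])
    then show ?thesis using us[OF that] by (simp add: T_def complex_eq_iff)
  qed
  have Ti: "T (cscale \<i> f) = \<i> * T f" if "f \<in> X" for f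
  proof -
    have "cscale \<i> (cscale \<i> f) = cscale (of_real (-1)) f" by (simp add: cscale_simps)
    then have "u (cscale \<i> (cscale \<i> f)) = - u f" by (simp only: us[OF that])
    then show ?thesis by (simp add: T_def complex_eq_iff)
  qed
  have Ts: "T (cscale z f) = z * T f" if "f \<in> X" for z f
  proof -
    have "z = of_real (Re z) + of_real (Im z) * \<i>" by (simp add: complex_eq_iff)
    then have "cscale z f = cscale (of_real (Re z)) f + cscale (of_real (Im z)) (cscale \<i> f)"
      unfolding cscale_simps(2)[symmetric] cscale_simps(3) by (rule arg_cong)
    then have "T (cscale z f) = of_real (Re z) * T f + of_real (Im z) * (\<i> * T f)"
      by (simp only: Tadd[OF Xs[OF that] Xs[OF Xs[OF that]]] Tr[OF that] Tr[OF Xs[OF that]] Ti[OF that])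
    also have "\<dots> = z * T f" by (simp add: complex_eq_iff algebra_simps)
    finally show ?thesis .
  qed
  have Tle: "norm (T f) \<le> p f" if "f \<in> X" for f
  proof (cases "T f = 0")
    case True
    then show ?thesis using pnn[OF that] by simp
  next
    case False
    \<comment> \<open>Rotating f makes T real, so norm (T f) is a value of u and the domination by p
      carries over with the same constant.\<close>
    define z where "z = cnj (T f) / of_real (norm (T f))"
    have nz: "norm z = 1" using False by (simp add: z_def norm_divide)
    have "z * T f = of_real (norm (T f))"
      using False by (simp add: z_def complex_norm_square[symmetric] power2_eq_square mult.commute)
    then have "T (cscale z f) = of_real (norm (T f))" using Ts[OF that] by simp
    then have "norm (T f) = u (cscale z f)" by (simp add: T_def complex_eq_iff)
    also have "\<dots> \<le> p (cscale z f)" by (rule ule[OF Xs[OF that]])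
    finally show ?thesis using ps[OF that, of z] nz by simp
  qed
  have "T v = 0" if "v \<in> V" for v using uV[OF that] uV[OF Vs[OF that]] by (simp add: T_def complex_eq_iff)
  moreover have "T f0 \<noteq> 0" using uf0 by (simp add: T_def complex_eq_iff)
  ultimately show ?thesis using Tadd Ts Tle by (intro exI[of _ T]) auto
qed

context weight_setting
begin

section \<open>Kernels of local convolutions\<close>

lemma extension_Dn:
  assumes f: "f \<in> U" and F: "F \<in> TF" and e: "0 < e"
    and eq: "\<And>x. \<bar>x\<bar> \<le> c k + e \<Longrightarrow> F 0 x = f x \<and> x \<in> sym_ival a" and x: "\<bar>x\<bar> < c k + e"
  shows "F j x = Dn f j x"
proof -
  have "(\<lambda>j x. F j x - Dn f j x) j x = 0"
  proof (rule family_zero_on_open[where S="{- (c k + e)<..<c k + e}"])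
    fix j y assume y: "y \<in> {- (c k + e)<..<c k + e}"
    then have "y \<in> sym_ival a" using eq[of y] by auto
    then show "((\<lambda>x. F j x - Dn f j x) has_vector_derivative F (Suc j) y - Dn f (Suc j) y) (at y)"
      by (intro has_vector_derivative_diff TF_D[OF F] U_D[OF f])
  next
    fix y assume y: "y \<in> {- (c k + e)<..<c k + e}"
    then show "F 0 y - Dn f 0 y = 0" using eq[of y] by auto
  qed (use x in auto)
  then show ?thesis by simp
qed

lemma local_conv_extension:
  assumes S: "point_lf S" and f: "f \<in> U" and F: "F \<in> TF" and e: "0 < e"
    and eq: "\<And>x. \<bar>x\<bar> \<le> c k + e \<Longrightarrow> F 0 x = f x" and y: "\<bar>y\<bar> \<le> c k"
  shows "local_conv \<omega> a c S f y = S (emb (translate y F))"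
proof (rule local_conv_eq[OF S f sym_c[OF y] F e])
  fix x assume "\<bar>x - y\<bar> < e"
  then show "F 0 x = f x" using y by (intro eq) auto
qed

lemma local_conv_emb:
  assumes S: "point_lf S" and F: "F \<in> TF" and y: "y \<in> sym_ival a"
  shows "local_conv \<omega> a c S (emb F) y = S (emb (translate y F))"
proof -
  obtain \<delta> where \<delta>: "0 < \<delta>" "ball y \<delta> \<subseteq> sym_ival a"
    using sym_ival_open y open_contains_ball by blast
  show ?thesis
  proof (rule local_conv_eq[OF S emb_U[OF F] y F \<delta>(1)])
    fix x assume "\<bar>x - y\<bar> < \<delta>"
    then have "x \<in> sym_ival a" using \<delta>(2) by (auto simp: dist_real_def)
    then show "F 0 x = emb F x" by (simp add: emb_def)
  qed
qed

lemma local_conv_add: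
  assumes S: "point_lf S" and f: "f \<in> U" and g: "g \<in> U" and y: "y \<in> sym_ival a"
  shows "local_conv \<omega> a c S (f + g) y = local_conv \<omega> a c S f y + local_conv \<omega> a c S g y"
proof -
  obtain k where k: "\<bar>y\<bar> < c k" using sym_obtain[OF y] by blast
  obtain F e R where F: "F \<in> TF" "0 < e" "\<And>x. \<bar>x\<bar> \<le> c k + e \<Longrightarrow> F 0 x = f x \<and> x \<in> sym_ival a"
    by (rule extension[OF f, where k=k]) (rule that)
  obtain G e' R' where G: "G \<in> TF" "0 < e'" "\<And>x. \<bar>x\<bar> \<le> c k + e' \<Longrightarrow> G 0 x = g x \<and> x \<in> sym_ival a"
    by (rule extension[OF g, where k=k]) (rule that)
  have 1: "local_conv \<omega> a c S f y = S (emb (translate y F))"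
    by (rule local_conv_extension[OF S f F(1,2)]) (use F(3) k in auto)
  have 2: "local_conv \<omega> a c S g y = S (emb (translate y G))"
    by (rule local_conv_extension[OF S g G(1,2)]) (use G(3) k in auto)
  have 3: "local_conv \<omega> a c S (f + g) y = S (emb (translate y (F + G)))"
  proof (rule local_conv_extension[OF S U_add[OF f g] TF_add[OF F(1) G(1)], where e="min e e'" and k=k])
    fix x assume "\<bar>x\<bar> \<le> c k + min e e'"
    then show "(F + G) 0 x = (f + g) x" using F(3)[of x] G(3)[of x] by auto
  qed (use F G k in auto)
  show ?thesis unfolding 1 2 3 translate_add
    by (rule lf_emb_add[OF point_lf_lf[OF S] TF_translate[OF F(1)] TF_translate[OF G(1)]])
qed

lemma translate_scale: "translate y (\<lambda>j. cscale z (F j)) = (\<lambda>j. cscale z (translate y F j))"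
  by (auto simp: translate_def cscale_def fun_eq_iff)

lemma local_conv_scale:
  assumes S: "point_lf S" and f: "f \<in> U" and y: "y \<in> sym_ival a"
  shows "local_conv \<omega> a c S (cscale z f) y = z * local_conv \<omega> a c S f y"
proof -
  obtain k where k: "\<bar>y\<bar> < c k" using sym_obtain[OF y] by blast
  obtain F e R where F: "F \<in> TF" "0 < e" "\<And>x. \<bar>x\<bar> \<le> c k + e \<Longrightarrow> F 0 x = f x \<and> x \<in> sym_ival a"
    by (rule extension[OF f, where k=k]) (rule that)
  have 1: "local_conv \<omega> a c S f y = S (emb (translate y F))"
    by (rule local_conv_extension[OF S f F(1,2)]) (use F(3) k in auto)
  have 3: "local_conv \<omega> a c S (cscale z f) y = S (emb (translate y (\<lambda>j. cscale z (F j))))"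
    by (rule local_conv_extension[OF S U_scale[OF f] TF_scale[OF F(1)] F(2), where k=k])
      (use F(3) k in \<open>auto simp: cscale_def\<close>)
  show ?thesis unfolding 1 3 translate_scale
    by (rule lf_emb_scale[OF point_lf_lf[OF S] TF_translate[OF F(1)]])
qed

lemma local_conv_bound:
  assumes S: "point_lf S" and y: "y \<in> sym_ival a"
  shows "\<exists>q k C. 0 < q \<and> q < 1 \<and> 0 \<le> C \<and>
    (\<forall>f\<in>U. \<forall>B. bd q k B f \<longrightarrow> norm (local_conv \<omega> a c S f y) \<le> C * B)"
proof -
  obtain k where k: "\<bar>y\<bar> < c k" using sym_obtain[OF y] by blast
  \<comment> \<open>The \<epsilon>-neighbourhood of 0, translated by y, stays inside the window
    [-c k;c k].\<close>
  define \<epsilon> where "\<epsilon> = c k - \<bar>y\<bar>"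
  have \<epsilon>: "0 < \<epsilon>" using k by (simp add: \<epsilon>_def)
  obtain q C where q: "0 < q" "q < 1" "0 \<le> C"
    and C: "\<forall>F B. F \<in> TF \<longrightarrow> (\<forall>j x. 0 - \<epsilon> \<le> x \<and> x \<le> 0 + \<epsilon> \<longrightarrow> norm (F j x) \<le> B * M q j) \<longrightarrow> norm (S (emb F)) \<le> C * B"
    using supp_in_bound[OF point_lf_lf[OF S] point_lf_supp_in[OF S] order_refl \<epsilon>]
    by (elim exE conjE) (rule that)
  have "norm (local_conv \<omega> a c S f y) \<le> C * B" if f: "f \<in> U" and B: "bd q k B f" for f B
  proof -
    obtain F e R where F: "F \<in> TF" "0 < e" "\<And>x. \<bar>x\<bar> \<le> c k + e \<Longrightarrow> F 0 x = f x \<and> x \<in> sym_ival a"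
      by (rule extension[OF f, where k=k]) (rule that)
    have 1: "local_conv \<omega> a c S f y = S (emb (translate y F))"
      by (rule local_conv_extension[OF S f F(1,2)]) (use F(3) k in auto)
    have "norm (translate y F j x) \<le> B * M q j" if x: "0 - \<epsilon> \<le> x \<and> x \<le> 0 + \<epsilon>" for j x
    proof -
      have xy: "\<bar>x + y\<bar> \<le> c k" using x k by (auto simp: \<epsilon>_def)
      have "F j (x + y) = Dn f j (x + y)"
        by (rule extension_Dn[OF f F]) (use xy F(2) in auto)
      then show ?thesis using B xy by (simp add: bd_def translate_def)
    qed
    then show ?thesis unfolding 1 using C TF_translate[OF F(1)] by blast
  qed
  then show ?thesis using q by (intro exI[of _ q] exI[of _ k] exI[of _ C]) blast
qed

definition joint_kernel :: "'i set \<Rightarrow> ('i \<Rightarrow> (real \<Rightarrow> complex) \<Rightarrow> complex) \<Rightarrow> real set \<Rightarrow> (real \<Rightarrow> complex) set" where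
  "joint_kernel J S I = {f \<in> U. \<forall>j\<in>J. \<forall>y\<in>I. local_conv \<omega> a c (S j) f y = 0}"

lemma rel_closed_subset: "rel_closed_interval a I \<Longrightarrow> I \<subseteq> sym_ival a"
  unfolding rel_closed_interval_def by (auto dest!: closedin_imp_subset)

lemma subspace_joint_kernel:
  assumes S: "\<And>j. j \<in> J \<Longrightarrow> point_lf (S j)" and I: "I \<subseteq> sym_ival a"
  shows "module.subspace cscale (joint_kernel J S I)"
proof (rule cfun.subspaceI)
  have z: "local_conv \<omega> a c (S j) 0 y = 0" if "j \<in> J" "y \<in> I" for j y
    using local_conv_scale[OF S[OF that(1)] U_zero, of y 0] that I by (auto simp: cscale_simps)
  show "0 \<in> joint_kernel J S I" using z by (simp add: joint_kernel_def U_zero)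
next
  fix f g assume fg: "f \<in> joint_kernel J S I" "g \<in> joint_kernel J S I"
  then have "local_conv \<omega> a c (S j) (f + g) y = 0" if "j \<in> J" "y \<in> I" for j y
    using local_conv_add[OF S[OF that(1)], of f g y] that I by (auto simp: joint_kernel_def)
  then show "f + g \<in> joint_kernel J S I" using fg by (simp add: joint_kernel_def U_add)
next
  fix z f assume f: "f \<in> joint_kernel J S I"
  then have "local_conv \<omega> a c (S j) (cscale z f) y = 0" if "j \<in> J" "y \<in> I" for j y
    using local_conv_scale[OF S[OF that(1)], of f y z] that I by (auto simp: joint_kernel_def)
  then show "cscale z f \<in> joint_kernel J S I" using f by (simp add: joint_kernel_def U_scale)
qed

lemma closed_joint_kernel:
  assumes S: "\<And>j. j \<in> J \<Longrightarrow> point_lf (S j)" and I: "I \<subseteq> sym_ival a"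
  shows "closedin (U_top \<omega> a c) (joint_kernel J S I)"
proof -
  have "\<exists>T. openin (U_top \<omega> a c) T \<and> f \<in> T \<and> T \<subseteq> U - joint_kernel J S I" if f: "f \<in> U - joint_kernel J S I" for f
  proof -
    obtain j y where jy: "j \<in> J" "y \<in> I" and nz: "local_conv \<omega> a c (S j) f y \<noteq> 0" and fU: "f \<in> U"
      using f by (auto simp: joint_kernel_def)
    let ?v = "local_conv \<omega> a c (S j) f y"
    have y: "y \<in> sym_ival a" using jy I by blast
    obtain q k C where q: "0 < q" "q < 1" "0 \<le> C"
      and C: "\<forall>f\<in>U. \<forall>B. bd q k B f \<longrightarrow> norm (local_conv \<omega> a c (S j) f y) \<le> C * B"
      using local_conv_bound[OF S[OF jy(1)] y] by (elim exE conjE) (rule that)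
    \<comment> \<open>The divisor contains C + 1 because C may be 0; the radius keeps the change
      below half of the value at f.\<close>
    define \<epsilon> where "\<epsilon> = norm ?v / (2 * (C + 1))"
    have \<epsilon>: "0 < \<epsilon>" using nz q(3) by (simp add: \<epsilon>_def)
    define T where "T = {g \<in> U. seminorm_U \<omega> a c q k (g - f) < ereal \<epsilon>}"
    have "openin (U_top \<omega> a c) T" unfolding T_def by (rule semiball_open[OF fU q(1,2) \<epsilon>])
    moreover have "f \<in> T"
    proof -
      have "seminorm_U \<omega> a c q k (f - f) \<le> ereal 0" unfolding seminorm_le_iff by (rule bd_diff_self)
      also have "\<dots> < ereal \<epsilon>" using \<epsilon> by simp
      finally show ?thesis using fU by (simp add: T_def)
    qed
    moreover have "g \<in> U - joint_kernel J S I" if g: "g \<in> T" for g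
    proof -
      have gU: "g \<in> U" and "seminorm_U \<omega> a c q k (g - f) \<le> ereal \<epsilon>" using g by (auto simp: T_def)
      then have "bd q k \<epsilon> (g - f)" by (simp add: seminorm_le_iff)
      then have "norm (local_conv \<omega> a c (S j) (g - f) y) \<le> C * \<epsilon>" using C U_diff[OF gU fU] by blast
      also have "C * \<epsilon> < norm ?v" using nz q(3) by (simp add: \<epsilon>_def field_simps add_nonneg_pos)
      finally have lt: "norm (local_conv \<omega> a c (S j) (g - f) y) < norm ?v" .
      have "local_conv \<omega> a c (S j) ((g - f) + f) y = local_conv \<omega> a c (S j) (g - f) y + ?v"
        by (rule local_conv_add[OF S[OF jy(1)] U_diff[OF gU fU] fU y])
      moreover have "(g - f) + f = g" by simp
      ultimately have "local_conv \<omega> a c (S j) g y = local_conv \<omega> a c (S j) (g - f) y + ?v" by simp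
      then have "local_conv \<omega> a c (S j) g y \<noteq> 0" using lt by (metis add_eq_0_iff norm_minus_cancel order_less_irrefl)
      then show ?thesis using gU jy by (auto simp: joint_kernel_def)
    qed
    ultimately show ?thesis by blast
  qed
  then have "openin (U_top \<omega> a c) (U - joint_kernel J S I)" by (subst openin_subopen) blast
  then show ?thesis unfolding closedin_def topspace_U_top by (auto simp: joint_kernel_def)
qed

lemma interval_window:
  assumes I: "rel_closed_interval a I" and xy: "x0 \<in> I" "y0 \<in> I" "x0 < y0" and y: "y \<in> I"
  shows "\<exists>b d k. b < d \<and> y \<in> {b..d} \<and> {b..d} \<subseteq> I \<and> {b..d} \<subseteq> {- c k..c k}"
proof -
  define b where "b = min y x0"
  define d where "d = max y y0"
  have bI: "b \<in> I" "d \<in> I" using xy y by (auto simp: b_def d_def min_def max_def)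
  have bd: "b < d" using xy by (auto simp: b_def d_def)
  obtain k1 where k1: "\<bar>b\<bar> < c k1" using sym_obtain bI rel_closed_subset[OF I] by blast
  obtain k2 where k2: "\<bar>d\<bar> < c k2" using sym_obtain bI rel_closed_subset[OF I] by blast
  have "{b..d} \<subseteq> I"
    using mem_is_interval_1_I[OF _ bI] I by (auto simp: rel_closed_interval_def)
  moreover have "{b..d} \<subseteq> {- c (max k1 k2)..c (max k1 k2)}"
    using k1 k2 c_mono[of k1 "max k1 k2"] c_mono[of k2 "max k1 k2"] by auto
  moreover have "y \<in> {b..d}" by (auto simp: b_def d_def)
  ultimately show ?thesis using bd by blast
qed

lemma D_joint_kernel:
  assumes S: "\<And>j. j \<in> J \<Longrightarrow> point_lf (S j)" and I: "rel_closed_interval a I"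
    and xy: "x0 \<in> I" "y0 \<in> I" "x0 < y0" and f: "f \<in> joint_kernel J S I"
  shows "D_op a f \<in> joint_kernel J S I"
proof -
  have fU: "f \<in> U" using f by (simp add: joint_kernel_def)
  have "local_conv \<omega> a c (S j) (D_op a f) y = 0" if j: "j \<in> J" and y: "y \<in> I" for j y
  proof -
    obtain b d k where bdk: "b < d" "y \<in> {b..d}" "{b..d} \<subseteq> I" "{b..d} \<subseteq> {- c k..c k}"
      using interval_window[OF I xy y] by (elim exE conjE) (rule that)
    obtain F e R where F: "F \<in> TF" "0 < e" "\<And>x. \<bar>x\<bar> \<le> c k + e \<Longrightarrow> F 0 x = f x \<and> x \<in> sym_ival a"
      by (rule extension[OF fU, where k=k]) (rule that)
    have "solves (S j) b d F" unfolding solves_def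
    proof
      fix t assume t: "t \<in> {b..d}"
      then have tI: "t \<in> I" "\<bar>t\<bar> \<le> c k" using bdk(3,4) by (auto simp: abs_le_iff)
      have "local_conv \<omega> a c (S j) f t = S j (emb (translate t F))"
        by (rule local_conv_extension[OF S[OF j] fU F(1,2) _ tI(2)]) (use F(3) in auto)
      then show "S j (emb (translate t F)) = 0" using f j tI(1) by (auto simp: joint_kernel_def)
    qed
    then have "solves (S j) b d (\<lambda>j. F (Suc j))"
      by (rule solves_shift[OF point_lf_lf[OF S[OF j]] F(1) _ bdk(1)])
    then have "S j (emb (translate y (\<lambda>j. F (Suc j)))) = 0" using bdk(2) by (simp add: solves_def)
    moreover have "local_conv \<omega> a c (S j) (D_op a f) y = S j (emb (translate y (\<lambda>j. F (Suc j))))"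
    proof (rule local_conv_extension[OF S[OF j] U_Dop[OF fU] TF_shift[OF F(1)], where e="e/2" and k=k])
      fix x assume "\<bar>x\<bar> \<le> c k + e / 2"
      then have "F 1 x = Dn f 1 x" using F(2) by (intro extension_Dn[OF fU F]) auto
      then show "F (Suc 0) x = D_op a f x" by (simp add: Dn_Suc)
    qed (use F(2) bdk(2,4) in \<open>auto simp: abs_le_iff\<close>)
    ultimately show ?thesis by simp
  qed
  then show ?thesis using U_Dop[OF fU] by (simp add: joint_kernel_def)
qed

text \<open>At interior points of a window the translate of f vanishes near 0, so S kills it. At an
  end of I there may be no such neighbourhood; there continuity in y takes over.\<close>

lemma W_ival_subset_joint_kernel:
  assumes S: "\<And>j. j \<in> J \<Longrightarrow> point_lf (S j)" and I: "rel_closed_interval a I"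
    and xy: "x0 \<in> I" "y0 \<in> I" "x0 < y0"
  shows "W_ival \<omega> a c I \<subseteq> joint_kernel J S I"
proof
  fix f assume f: "f \<in> W_ival \<omega> a c I"
  then have fU: "f \<in> U" and f0: "\<And>x. x \<in> I \<Longrightarrow> f x = 0" by (auto simp: W_ival_def)
  have "local_conv \<omega> a c (S j) f y = 0" if j: "j \<in> J" and y: "y \<in> I" for j y
  proof -
    obtain b d k where bdk: "b < d" "y \<in> {b..d}" "{b..d} \<subseteq> I" "{b..d} \<subseteq> {- c k..c k}"
      using interval_window[OF I xy y] by (elim exE conjE) (rule that)
    obtain F e R where F: "F \<in> TF" "0 < e" "\<And>x. \<bar>x\<bar> \<le> c k + e \<Longrightarrow> F 0 x = f x \<and> x \<in> sym_ival a"
      by (rule extension[OF fU, where k=k]) (rule that)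
    have lS: "lf (S j)" by (rule point_lf_lf[OF S[OF j]])
    have F0: "F 0 x = 0" if "x \<in> {b..d}" for x
      using F(3)[of x] f0[of x] bdk(3,4) F(2) that by (force simp: abs_le_iff subset_iff)
    have inner: "S j (emb (translate t F)) = 0" if t: "t \<in> {b<..<d}" for t
    proof -
      have 0: "emb (translate t F) x = 0" if "\<bar>x\<bar> < min (t - b) (d - t)" for x
      proof -
        have "x + t \<in> {b..d}" using that by auto
        then show ?thesis by (simp add: emb_def translate_def F0)
      qed
      have "0 < min (t - b) (d - t)" using t by auto
      then show ?thesis using S[OF j] emb_U[OF TF_translate[OF F(1), of t]] 0 unfolding point_lf_def by blast
    qed
    have "S j (emb (translate y F)) = 0"
    proof (rule continuous_constant_on_closure[where S="{b<..<d}" and f="\<lambda>t. S j (emb (translate t F))"])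
      show "continuous_on (closure {b<..<d}) (\<lambda>t. S j (emb (translate t F)))"
        by (rule continuous_at_imp_continuous_on) (rule ballI, rule has_vector_derivative_continuous, rule translate_deriv[OF lS F(1)])
      show "y \<in> closure {b<..<d}" using bdk by simp
    qed (rule inner)
    moreover have "local_conv \<omega> a c (S j) f y = S j (emb (translate y F))"
      by (rule local_conv_extension[OF S[OF j] fU F(1,2), where k=k]) (use F(3) bdk(2,4) in \<open>auto simp: abs_le_iff\<close>)
    ultimately show ?thesis by simp
  qed
  then show "f \<in> joint_kernel J S I" using fU by (simp add: joint_kernel_def)
qed

text \<open>The witness is a bump inside a part of I that misses I'. Stated for any I' not
  containing I, so that it serves both the minimality and the uniqueness of the residual
  interval.\<close>

lemma W_ival_not_subset_joint_kernel:
  assumes j0: "j0 \<in> J" "point_lf (S j0)" and I: "rel_closed_interval a I"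
    and xy: "x0 \<in> I" "y0 \<in> I" "x0 < y0" and I': "rel_closed_interval a I'" and t: "t \<in> I" "t \<notin> I'"
  shows "W_ival \<omega> a c I' - joint_kernel J S I \<noteq> {}"
proof -
  have "openin (top_of_set (sym_ival a)) (sym_ival a - I')"
    using I' by (simp add: rel_closed_interval_def closedin_def)
  then have "open (sym_ival a - I')" by (simp add: openin_open_eq[OF sym_ival_open])
  moreover have "t \<in> sym_ival a - I'" using t rel_closed_subset[OF I] by blast
  ultimately obtain \<delta> where \<delta>: "0 < \<delta>" "ball t \<delta> \<subseteq> sym_ival a - I'" using open_contains_ball by blast
  obtain s where s: "s \<in> I" "s \<noteq> t" using xy by (metis order_less_irrefl)
  \<comment> \<open>[b;d] has t as one end and runs towards s, so it stays in I; it is short enough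
    to avoid I'.\<close>
  define b where "b = (if t < s then t else max s (t - \<delta>/2))"
  define d where "d = (if t < s then min s (t + \<delta>/2) else t)"
  have bd: "b < d" using s \<delta> by (auto simp: b_def d_def)
  have ii: "is_interval I" using I by (simp add: rel_closed_interval_def)
  have bI: "{b..d} \<subseteq> I"
  proof
    fix x assume x: "x \<in> {b..d}"
    show "x \<in> I"
    proof (cases "t < s")
      case True
      then show ?thesis using x by (intro mem_is_interval_1_I[OF ii t(1) s(1)]) (auto simp: b_def d_def)
    next
      case False
      then show ?thesis using x by (intro mem_is_interval_1_I[OF ii s(1) t(1)]) (auto simp: b_def d_def)
    qed
  qed
  have bs: "{b..d} \<subseteq> sym_ival a - I'" using \<delta>
    by (intro subset_trans[OF _ \<delta>(2)]) (auto simp: b_def d_def dist_real_def split: if_splits)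
  define m where "m = (b + d) / 2"
  define e where "e = (d - b) / 4"
  have e: "0 < e" using bd by (simp add: e_def)
  obtain \<eta> where \<eta>: "step_fam \<eta>" "\<And>x. m - e/4 \<le> x \<Longrightarrow> x \<le> m + e/4 \<Longrightarrow> \<eta> 0 x = 1"
    "\<And>j x. x \<le> m - e \<or> m + e \<le> x \<Longrightarrow> \<eta> j x = 0"
    by (rule cutoff[OF order_refl e, where s=m]) (rule that)
  define F where "F = leibniz \<eta> (exp_fam 0 0)"
  have F: "F \<in> TF" unfolding F_def by (rule TF_leibniz[OF \<eta>(1) TF_exp])
  have F0: "F j x = 0" if "x \<le> m - e \<or> m + e \<le> x" for j x
    using \<eta>(3)[OF that] by (simp add: F_def leibniz_def)
  have Fm: "F 0 m = 1" using \<eta>(2)[of m] e by (simp add: F_def)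
  have in_bd: "b < m - e" "m - e < m + e" "m + e < d" using bd by (auto simp: m_def e_def field_simps)
  have dec: "decaying (\<bar>m\<bar> + e + 1) F" unfolding decaying_def using F e F0 by (auto simp: abs_if split: if_splits)
  have "emb F x = 0" if "x \<in> I'" for x
  proof -
    have "x \<notin> {b..d}" using bs that by blast
    then have "x \<le> m - e \<or> m + e \<le> x" using in_bd by auto
    then show ?thesis by (simp add: emb_def F0)
  qed
  then have "emb F \<in> W_ival \<omega> a c I'" by (simp add: W_ival_def emb_U[OF F])
  moreover have "emb F \<notin> joint_kernel J S I"
  proof
    assume "emb F \<in> joint_kernel J S I"
    then have *: "local_conv \<omega> a c (S j0) (emb F) y = 0" if "y \<in> {b..d}" for y
      using bI that j0(1) by (auto simp: joint_kernel_def)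
    have "S j0 (emb (translate y F)) = 0" if "y \<in> {b..d}" for y
      using *[OF that] local_conv_emb[OF j0(2) F, of y] bs that by (auto simp: subset_iff)
    then have "F 0 m = 0" by (intro bump_not_annihilated[OF j0(2) dec in_bd F0]) auto
    then show False using Fm by simp
  qed
  ultimately show ?thesis by blast
qed

text \<open>For uniqueness, a competing interval L cannot miss a point of I, by the bump argument,
  and cannot properly contain I, by its own minimality.\<close>

lemma residual_joint_kernel:
  assumes J: "J \<noteq> {}" and S: "\<And>j. j \<in> J \<Longrightarrow> point_lf (S j)" and I: "rel_closed_interval a I"
    and xy: "x0 \<in> I" "y0 \<in> I" "x0 < y0"
  shows "is_residual_interval \<omega> a c (joint_kernel J S I) I" "residual_interval \<omega> a c (joint_kernel J S I) = I"
proof -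
  obtain j0 where j0: "j0 \<in> J" using J by blast
  have sub: "W_ival \<omega> a c I \<subseteq> joint_kernel J S I" by (rule W_ival_subset_joint_kernel[OF S I xy])
  have ne: "W_ival \<omega> a c I' - joint_kernel J S I \<noteq> {}" if I': "rel_closed_interval a I'" "\<not> I \<subseteq> I'" for I'
  proof -
    obtain t where "t \<in> I" "t \<notin> I'" using I'(2) by blast
    then show ?thesis by (rule W_ival_not_subset_joint_kernel[where S=S, OF j0 S[OF j0] I xy I'(1)])
  qed
  have ne2: "W_ival \<omega> a c I' - joint_kernel J S I \<noteq> {}" if "rel_closed_interval a I' \<and> I' \<subset> I" for I'
    using ne[of I'] that by auto
  show res: "is_residual_interval \<omega> a c (joint_kernel J S I) I"
    unfolding is_residual_interval_def by (intro conjI allI impI I sub) (rule ne2)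
  show "residual_interval \<omega> a c (joint_kernel J S I) = I"
    unfolding residual_interval_def
  proof (rule the_equality[OF _])
    fix L assume L: "is_residual_interval \<omega> a c (joint_kernel J S I) L"
    have "I \<subseteq> L"
    proof (rule ccontr)
      assume "\<not> I \<subseteq> L"
      then show False using ne[of L] L by (auto simp: is_residual_interval_def)
    qed
    moreover have "\<not> I \<subset> L" using L I sub unfolding is_residual_interval_def by blast
    ultimately show "L = I" by blast
  qed (rule res)
qed

end

lemma higher_deriv_zero_iff_zorder:
  fixes f :: "complex \<Rightarrow> complex"
  assumes hol: "f holomorphic_on UNIV" and nz: "f w \<noteq> 0"
  shows "(\<forall>i\<le>n. (deriv ^^ i) f l = 0) \<longleftrightarrow> n < nat (zorder f l)"
proof -
  obtain q k where q: "q holomorphic_on UNIV" "q l \<noteq> 0" "\<And>z. f z = (z - l) ^ k * q z"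
    by (rule entire_factor_zero[OF hol nz, where a=l]) (rule that)
  have "zorder f l = int k"
    by (rule zorder_eqI[OF open_UNIV UNIV_I q(1,2)]) (simp add: q(3))
  moreover have "(\<forall>i<k. (deriv ^^ i) f l = 0) \<and> (deriv ^^ k) f l = fact k * q l"
    by (rule higher_deriv_factor[OF q(1) q(3)])
  then have "(\<forall>i\<le>n. (deriv ^^ i) f l = 0) \<longleftrightarrow> n < k"
    using q(2) by (metis fact_nonzero mult_eq_0_iff not_le order_le_less_trans)
  ultimately show ?thesis by simp
qed

lemma countable_zeros_entire:
  fixes f :: "complex \<Rightarrow> complex"
  assumes hol: "f holomorphic_on UNIV" and nz: "f w \<noteq> 0"
  shows "countable {z. f z = 0}"
proof (cases "f constant_on UNIV")
  case True
  then have "{z. f z = 0} = {}" using nz unfolding constant_on_def by (metis (mono_tags) UNIV_I empty_Collect_eq)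
  then show ?thesis by simp
next
  case False
  show ?thesis using holomorphic_countable_zeros[OF hol open_UNIV connected_UNIV _ False] by simp
qed

lemma exp_fam_0_eq: "exp_fam n z 0 t = of_real t ^ n * exp (- \<i> * z * of_real t)"
  by (induction n) auto

lemma sum_fun_apply: "(\<Sum>i\<in>A. f i) x = (\<Sum>i\<in>A. f i x)"
  by (induction A rule: infinite_finite_induct) auto

context weight_setting
begin

lemma lf_sum:
  assumes T: "lf T" and f: "\<And>i. i \<in> A \<Longrightarrow> f i \<in> U" and A: "finite A"
  shows "(\<Sum>i\<in>A. f i) \<in> U \<and> T (\<Sum>i\<in>A. f i) = (\<Sum>i\<in>A. T (f i))"
  using A f
proof (induction A rule: finite_induct)
  case empty
  show ?case unfolding sum.empty using lf_zero[OF T] U_zero by blast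
next
  case (insert i A)
  then have "f i \<in> U" "sum f A \<in> U" "T (sum f A) = (\<Sum>i\<in>A. T (f i))" by auto
  then show ?case unfolding sum.insert[OF insert.hyps] using lf_add[OF T] U_add by metis
qed

text \<open>The binomial theorem for (x + y)^n: as a function of y the result is an exponential
  times a polynomial whose coefficients are values of S on exponential monomials.\<close>

lemma lf_translate_exp_fam:
  assumes S: "lf S"
  shows "S (emb (translate y (exp_fam n l))) =
    exp (- \<i> * l * of_real y) * (\<Sum>i\<le>n. of_nat (n choose i) * S (emb (exp_fam (n - i) l)) * of_real y ^ i)"
proof -
  let ?e = "exp (- \<i> * l * of_real y)"
  have "emb (translate y (exp_fam n l)) =
    (\<Sum>i\<le>n. cscale (?e * of_nat (n choose i) * of_real y ^ i) (emb (exp_fam (n - i) l)))"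
  proof
    fix x
    have "exp (- \<i> * l * of_real (x + y)) = exp (- \<i> * l * of_real x) * ?e"
      by (simp add: algebra_simps flip: exp_add)
    moreover have "(of_real (x + y) :: complex) ^ n = (\<Sum>i\<le>n. of_nat (n choose i) * of_real y ^ i * of_real x ^ (n - i))"
      using binomial_ring[of "of_real y :: complex" "of_real x" n] by (simp add: add.commute)
    ultimately show "emb (translate y (exp_fam n l)) x =
      (\<Sum>i\<le>n. cscale (?e * of_nat (n choose i) * of_real y ^ i) (emb (exp_fam (n - i) l))) x"
      unfolding emb_def translate_def exp_fam_0_eq cscale_def sum_fun_apply
      by (simp add: sum_distrib_left sum_distrib_right mult_ac)
  qed
  then show ?thesis
    using lf_sum[OF S U_scale[OF emb_U[OF TF_exp]] finite_atMost[of n]]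
    by (simp add: lf_scale[OF S emb_U[OF TF_exp]] sum_distrib_left mult_ac)
qed

text \<open>The polynomial from \<open>lf_translate_exp_fam\<close> vanishes on the infinite set I
  only if all its coefficients do, and these are, up to nonzero factors, the derivatives of the
  transform at l.\<close>

lemma exp_monomial_joint_kernel:
  assumes S: "\<And>j. j \<in> J \<Longrightarrow> point_lf (S j)" and I: "rel_closed_interval a I"
    and xy: "x0 \<in> I" "y0 \<in> I" "x0 < y0"
  shows "exp_monomial a n l \<in> joint_kernel J S I \<longleftrightarrow> (\<forall>j\<in>J. \<forall>i\<le>n. (deriv ^^ i) (FL (S j)) l = 0)"
proof -
  have Is: "I \<subseteq> sym_ival a" by (rule rel_closed_subset[OF I])
  have inf: "infinite (complex_of_real ` I)"
  proof -
    have "{x0..y0} \<subseteq> I" using mem_is_interval_1_I[OF _ xy(1,2)] I by (auto simp: rel_closed_interval_def)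
    then have "infinite I" using infinite_Icc[OF xy(3)] finite_subset by blast
    then show ?thesis by (simp add: finite_image_iff inj_on_def)
  qed
  have "(\<forall>y\<in>I. local_conv \<omega> a c (S j) (emb (exp_fam n l)) y = 0) \<longleftrightarrow> (\<forall>i\<le>n. (deriv ^^ i) (FL (S j)) l = 0)"
    if j: "j \<in> J" for j
  proof -
    have lS: "lf (S j)" by (rule point_lf_lf[OF S[OF j]])
    let ?s = "\<lambda>i. S j (emb (exp_fam i l))"
    have D: "(deriv ^^ i) (FL (S j)) l = 0 \<longleftrightarrow> ?s i = 0" for i
      using lf_exp_higher_deriv[OF lS, of i l] by (simp add: FL_def[abs_def])
    have P: "local_conv \<omega> a c (S j) (emb (exp_fam n l)) y = 0 \<longleftrightarrow>
        (\<Sum>i\<le>n. of_nat (n choose i) * ?s (n - i) * of_real y ^ i) = 0" if "y \<in> I" for y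
      using Is that by (simp add: local_conv_emb[OF S[OF j] TF_exp] lf_translate_exp_fam[OF lS] subset_iff)
    show ?thesis
    proof
      assume "\<forall>y\<in>I. local_conv \<omega> a c (S j) (emb (exp_fam n l)) y = 0"
      then have "complex_of_real ` I \<subseteq> {z. (\<Sum>i\<le>n. (of_nat (n choose i) * ?s (n - i)) * z ^ i) = 0}"
        using P by auto
      then have "infinite {z. (\<Sum>i\<le>n. (of_nat (n choose i) * ?s (n - i)) * z ^ i) = 0}"
        using inf finite_subset by blast
      then have z: "\<forall>i\<le>n. of_nat (n choose i) * ?s (n - i) = 0" unfolding polyfun_finite_roots by blast
      have "?s i = 0" if "i \<le> n" for i using z[rule_format, of "n - i"] that by (simp add: binomial_symmetric[symmetric])
      then show "\<forall>i\<le>n. (deriv ^^ i) (FL (S j)) l = 0" using D by blast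
    next
      assume "\<forall>i\<le>n. (deriv ^^ i) (FL (S j)) l = 0"
      then have "?s (n - i) = 0" for i using D by simp
      then show "\<forall>y\<in>I. local_conv \<omega> a c (S j) (emb (exp_fam n l)) y = 0" using P by simp
    qed
  qed
  then show ?thesis unfolding joint_kernel_def exp_monomial_eq using emb_U[OF TF_exp] by blast
qed

lemma exponent_sequence_joint_kernel:
  assumes J: "J \<noteq> {}" "finite J" and S: "\<And>j. j \<in> J \<Longrightarrow> point_lf (S j)" and I: "rel_closed_interval a I"
    and xy: "x0 \<in> I" "y0 \<in> I" "x0 < y0"
  shows "exponent_sequence a (joint_kernel J S I) (inter_mult J (\<lambda>j. zero_set (FL (S j))))"
proof -
  let ?m = "\<lambda>j l. nat (zorder (FL (S j)) l)"
  let ?L = "inter_mult J (\<lambda>j. zero_set (FL (S j)))"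
  have hol: "FL (S j) holomorphic_on UNIV" if "j \<in> J" for j by (rule FL_hol[OF point_lf_lf[OF S[OF that]]])
  have ord: "(\<forall>i\<le>n. (deriv ^^ i) (FL (S j)) l = 0) \<longleftrightarrow> n < ?m j l" if j: "j \<in> J" for j n l
  proof -
    obtain z where "FL (S j) z \<noteq> 0" using FL_nonzero[OF S[OF j]] by blast
    then show ?thesis by (rule higher_deriv_zero_iff_zorder[OF hol[OF j]])
  qed
  have pos: "FL (S j) l = 0 \<longleftrightarrow> 0 < ?m j l" if j: "j \<in> J" for j l using ord[OF j, of 0 l] by simp
  have L: "?L = {(l, Min ((\<lambda>j. ?m j l) ` J)) | l. \<forall>j\<in>J. FL (S j) l = 0}"
  proof -
    have "{k. \<exists>j\<in>J. (l, k) \<in> zero_set (FL (S j))} = (\<lambda>j. ?m j l) ` J" if "\<forall>j\<in>J. FL (S j) l = 0" for l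
      using that by (auto simp: zero_set_def)
    moreover have "l \<in> Domain (zero_set (FL (S j))) \<longleftrightarrow> FL (S j) l = 0" for l j by (auto simp: zero_set_def)
    ultimately show ?thesis unfolding inter_mult_def by auto
  qed
  obtain j0 where j0: "j0 \<in> J" using J by blast
  obtain z0 where z0: "FL (S j0) z0 \<noteq> 0" using FL_nonzero[OF S[OF j0]] by blast
  have "countable ?L"
  proof (rule countable_subset)
    show "?L \<subseteq> (\<lambda>l. (l, Min ((\<lambda>j. ?m j l) ` J))) ` {l. FL (S j0) l = 0}" unfolding L using j0 by auto
    show "countable ((\<lambda>l. (l, Min ((\<lambda>j. ?m j l) ` J))) ` {l. FL (S j0) l = 0})"
      by (rule countable_image[OF countable_zeros_entire[OF hol[OF j0] z0]])
  qed
  moreover have "single_valued ?L" unfolding L by (auto simp: single_valued_def)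
  moreover have "\<forall>(l, n)\<in>?L. 0 < n" unfolding L using J pos by auto
  moreover have "Exp_set a (joint_kernel J S I) = {exp_monomial a j l | j l n. (l, n) \<in> ?L \<and> j < n}"
  proof -
    have "exp_monomial a n l \<in> joint_kernel J S I \<longleftrightarrow> (\<exists>N. (l, N) \<in> ?L \<and> n < N)" for n l
    proof -
      have "exp_monomial a n l \<in> joint_kernel J S I \<longleftrightarrow> (\<forall>j\<in>J. \<forall>i\<le>n. (deriv ^^ i) (FL (S j)) l = 0)"
        by (rule exp_monomial_joint_kernel[OF _ I xy]) (rule S)
      also have "\<dots> \<longleftrightarrow> (\<forall>j\<in>J. n < ?m j l)"
        by (rule ball_cong[OF refl]) (rule ord)
      also have "\<dots> \<longleftrightarrow> (\<forall>j\<in>J. FL (S j) l = 0) \<and> n < Min ((\<lambda>j. ?m j l) ` J)"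
        using J pos by (auto intro: order_le_less_trans)
      finally show ?thesis unfolding L by auto
    qed
    note iff = this
    show ?thesis unfolding Exp_set_def using iff by blast
  qed
  ultimately show ?thesis unfolding exponent_sequence_def by blast
qed

section \<open>Weak spectral synthesis\<close>

text \<open>Real-valued form for the Hahn-Banach theorem; on the space the extended semi-norm is
  finite and nonnegative, so nothing is lost.\<close>

definition real_seminorm :: "real \<Rightarrow> nat \<Rightarrow> (real \<Rightarrow> complex) \<Rightarrow> real" where
  "real_seminorm q k f = real_of_ereal (seminorm_U \<omega> a c q k f)"

lemma real_seminorm_le_iff:
  assumes f: "f \<in> U" and q: "0 < q" "q < 1"
  shows "real_seminorm q k f \<le> B \<longleftrightarrow> bd q k B f"
proof -
  have "seminorm_U \<omega> a c q k f < \<infinity>" using U_bd[OF f q] unfolding seminorm_finite_iff by blast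
  moreover have "seminorm_U \<omega> a c q k f \<noteq> - \<infinity>"
  proof
    assume "seminorm_U \<omega> a c q k f = - \<infinity>"
    then have "bd q k (-1) f" by (simp flip: seminorm_le_iff)
    then show False using bd_nonneg by fastforce
  qed
  ultimately have "ereal (real_seminorm q k f) = seminorm_U \<omega> a c q k f" unfolding real_seminorm_def by (cases "seminorm_U \<omega> a c q k f") auto
  then show ?thesis by (metis ereal_less_eq(3) seminorm_le_iff)
qed

lemma real_seminorm_nonneg: "f \<in> U \<Longrightarrow> 0 < q \<Longrightarrow> q < 1 \<Longrightarrow> 0 \<le> real_seminorm q k f"
  using real_seminorm_le_iff bd_nonneg by blast

lemma real_seminorm_add:
  assumes "f \<in> U" "g \<in> U" "0 < q" "q < 1"
  shows "real_seminorm q k (f + g) \<le> real_seminorm q k f + real_seminorm q k g"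
proof -
  have "bd q k (real_seminorm q k f) f" "bd q k (real_seminorm q k g) g" using real_seminorm_le_iff assms by blast+
  then have "bd q k (real_seminorm q k f + real_seminorm q k g) (f + g)" by (rule bd_add[OF assms(1,2)])
  then show ?thesis by (subst real_seminorm_le_iff[OF U_add[OF assms(1,2)] assms(3,4)])
qed

lemma real_seminorm_scale:
  assumes f: "f \<in> U" and q: "0 < q" "q < 1"
  shows "real_seminorm q k (cscale z f) = norm z * real_seminorm q k f"
proof -
  have le: "real_seminorm q k (cscale z f) \<le> norm z * real_seminorm q k f" if f: "f \<in> U" for z f
  proof -
    have "bd q k (real_seminorm q k f) f" using real_seminorm_le_iff[OF f q] by blast
    then have "bd q k (norm z * real_seminorm q k f) (cscale z f)" by (rule bd_scale[OF f])
    then show ?thesis by (subst real_seminorm_le_iff[OF U_scale[OF f] q])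
  qed
  show ?thesis
  proof (cases "z = 0")
    case True
    then show ?thesis using le[OF f, of 0] real_seminorm_nonneg[OF U_scale[OF f] q, of k z] by simp
  next
    case False
    have "cscale (inverse z) (cscale z f) = f" using False by (simp add: cscale_simps)
    then have "real_seminorm q k f \<le> norm (inverse z) * real_seminorm q k (cscale z f)" using le[OF U_scale[OF f], of "inverse z" z] by simp
    then have "norm z * real_seminorm q k f \<le> norm z * (norm (inverse z) * real_seminorm q k (cscale z f))" by (rule mult_left_mono) simp
    also have "\<dots> = real_seminorm q k (cscale z f)" using False by (simp add: norm_inverse)
    finally have "norm z * real_seminorm q k f \<le> real_seminorm q k (cscale z f)" .
    then show ?thesis using le[OF f, of z] by simp
  qed
qed

text \<open>The index k' lies beyond the given k, so the window can be made to contain the one seen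
  by a functional and still meet I in an interval of positive length.\<close>

lemma rel_closed_window:
  assumes I: "rel_closed_interval a I" and xy: "x0 \<in> I" "y0 \<in> I" "x0 < y0"
  shows "\<exists>b d k'. k \<le> k' \<and> b < d \<and> I \<inter> {- c k'..c k'} = {b..d}"
proof -
  obtain k1 where k1: "\<bar>x0\<bar> < c k1" using sym_obtain xy rel_closed_subset[OF I] by blast
  obtain k2 where k2: "\<bar>y0\<bar> < c k2" using sym_obtain xy rel_closed_subset[OF I] by blast
  define k' where "k' = max k (max k1 k2)"
  have ck: "c k1 \<le> c k'" "c k2 \<le> c k'" by (auto intro!: c_mono simp: k'_def)
  have in': "x0 \<in> {- c k'..c k'}" "y0 \<in> {- c k'..c k'}" using k1 k2 ck by (auto simp: abs_less_iff)
  obtain C where C: "closed C" "I = sym_ival a \<inter> C"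
    using I by (auto simp: rel_closed_interval_def closedin_closed)
  have "{- c k'..c k'} \<subseteq> sym_ival a" by (auto intro!: sym_c simp: abs_le_iff)
  then have "I \<inter> {- c k'..c k'} = C \<inter> {- c k'..c k'}" using C(2) by blast
  then have "compact (I \<inter> {- c k'..c k'})" using C(1) by (simp add: closed_Int_compact)
  moreover have "is_interval (I \<inter> {- c k'..c k'})"
    using I by (intro is_interval_Int) (auto simp: rel_closed_interval_def is_interval_cc)
  ultimately obtain b d where bd: "I \<inter> {- c k'..c k'} = cbox b d" using is_interval_compact by blast
  have "x0 \<in> cbox b d" "y0 \<in> cbox b d" using in' xy unfolding bd[symmetric] by blast+
  then have "b < d" using xy(3) by auto
  then show ?thesis using bd by (intro exI[of _ b] exI[of _ d] exI[of _ k']) (simp add: k'_def)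
qed

lemma emb_bd_zero:
  assumes G: "G \<in> TF" and z: "\<And>x. \<bar>x\<bar> \<le> c k \<Longrightarrow> G 0 x = 0"
  shows "bd q k 0 (emb G)"
proof -
  have "G j x = 0" if "\<bar>x\<bar> \<le> c k" for j x
    by (rule family_zero_on_interval[where s="- c k" and t="c k" and F=G])
      (use TF_D[OF G] c_pos[of k] z that in \<open>auto simp: abs_le_iff\<close>)
  then show ?thesis unfolding bd_emb[OF G] by simp
qed

text \<open>Since G vanishes near m, a sharp cut there preserves smoothness and all bounds.\<close>

lemma TF_restrict:
  assumes G: "G \<in> TF" and \<delta>: "0 < \<delta>" and z: "\<And>x. \<bar>x - m\<bar> < \<delta> \<Longrightarrow> G 0 x = 0"
  shows "(\<lambda>j x. if x < m then G j x else 0) \<in> TF"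
proof -
  have near: "G j x = 0" if "\<bar>x - m\<bar> < \<delta>" for j x
    by (rule family_zero_on_open[where S="{m - \<delta><..<m + \<delta>}" and F=G])
      (use TF_D[OF G] z that in \<open>auto simp: abs_less_iff\<close>)
  have "((\<lambda>x. if x < m then G j x else 0) has_vector_derivative (if x < m then G (Suc j) x else 0)) (at x)" for j x
  proof -
    consider "x < m" | "m - \<delta> < x \<and> x < m + \<delta>" | "m < x" using \<delta> by fastforce
    then show ?thesis
    proof cases
      case 1
      have "((\<lambda>x. if x < m then G j x else 0) has_vector_derivative G (Suc j) x) (at x)"
        by (rule has_vector_derivative_transform_within_open[OF TF_D[OF G], where S="{..<m}"]) (use 1 in auto)
      then show ?thesis using 1 by simp
    next
      case 2
      have "((\<lambda>x. if x < m then G j x else 0) has_vector_derivative 0) (at x)"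
        by (rule has_vector_derivative_transform_within_open[OF has_vector_derivative_const, where S="{m - \<delta><..<m + \<delta>}"])
          (use 2 near in \<open>auto simp: abs_less_iff\<close>)
      then show ?thesis using 2 near[of x "Suc j"] by (simp add: abs_less_iff)
    next
      case 3
      have "((\<lambda>x. if x < m then G j x else 0) has_vector_derivative 0) (at x)"
        by (rule has_vector_derivative_transform_within_open[OF has_vector_derivative_const, where S="{m<..}"])
          (use 3 in auto)
      then show ?thesis using 3 by simp
    qed
  qed
  moreover have "\<exists>B. \<forall>j x. \<bar>x\<bar> \<le> R \<longrightarrow> norm (if x < m then G j x else 0) \<le> B * M q j" if q: "0 < q" "q < 1" for q R
  proof -
    obtain B where B: "0 < B" "\<And>j x. \<bar>x\<bar> \<le> R \<Longrightarrow> norm (G j x) \<le> B * M q j"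
      by (rule TF_B[OF G q, where R=R]) (rule that)
    show ?thesis using B M_pos by (intro exI[of _ B]) (auto intro: mult_nonneg_nonneg less_imp_le)
  qed
  ultimately show ?thesis unfolding TF_def by blast
qed

text \<open>G is split at the midpoint into a part left of b and one right of d. If b > - c k, then
  b is the left end of I and the left part vanishes on I; if b = - c k, it vanishes on the window
  that T sees. The right part is treated in the same way.\<close>

lemma supp_in_window:
  assumes T: "lf T" and z: "\<And>f. f \<in> W_ival \<omega> a c I \<Longrightarrow> T f = 0"
    and k: "\<And>f. f \<in> U \<Longrightarrow> bd q k 0 f \<Longrightarrow> T f = 0"
    and I: "rel_closed_interval a I" and win: "I \<inter> {- c k..c k} = {b..d}" and bd: "b < d"
  shows "supp_in T b d"
  unfolding supp_in_def
proof (intro ballI allI impI)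
  fix G :: "nat \<Rightarrow> real \<Rightarrow> complex" and \<delta> :: real
  assume G: "G \<in> TF" and \<delta>: "0 < \<delta>" and zero: "\<forall>x. b - \<delta> < x \<and> x < d + \<delta> \<longrightarrow> G 0 x = 0"
  define m where "m = (b + d) / 2"
  define G1 where "G1 = (\<lambda>j x. if x < m then G j x else 0)"
  define G2 where "G2 = G - G1"
  have G1: "G1 \<in> TF" unfolding G1_def
  proof (rule TF_restrict[OF G, where \<delta>="(d - b) / 2"])
    fix x assume "\<bar>x - m\<bar> < (d - b) / 2"
    then have "b < x \<and> x < d" by (auto simp: m_def abs_less_iff field_simps)
    then show "G 0 x = 0" using zero \<delta> by auto
  qed (use bd in simp)
  have G2: "G2 \<in> TF" unfolding G2_def by (rule TF_diff[OF G G1])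
  have "b \<in> I \<inter> {- c k..c k}" "d \<in> I \<inter> {- c k..c k}" unfolding win using bd by auto
  then have bdI: "b \<in> I" "d \<in> I" and bdk: "- c k \<le> b" "d \<le> c k" by auto
  have ii: "is_interval I" using I by (simp add: rel_closed_interval_def)
  have T0: "T (emb H) = 0" if H: "H \<in> TF" and dis: "(\<forall>x\<in>I. H 0 x = 0) \<or> (\<forall>x. \<bar>x\<bar> \<le> c k \<longrightarrow> H 0 x = 0)" for H
    using dis
  proof
    assume "\<forall>x\<in>I. H 0 x = 0"
    then have "emb H \<in> W_ival \<omega> a c I" by (simp add: W_ival_def emb_U[OF H] emb_def)
    then show ?thesis by (rule z)
  next
    assume "\<forall>x. \<bar>x\<bar> \<le> c k \<longrightarrow> H 0 x = 0"
    then have "bd q k 0 (emb H)" by (intro emb_bd_zero[OF H]) simp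
    then show ?thesis by (rule k[OF emb_U[OF H]])
  qed
  have z1: "G1 0 x = 0" if "b \<le> x" for x
    using that zero[rule_format, of x] \<delta> bd by (simp add: G1_def m_def field_simps)
  have z2: "G2 0 x = 0" if "x \<le> d" for x
    using that zero[rule_format, of x] \<delta> bd by (simp add: G2_def G1_def m_def field_simps)
  have "T (emb G1) = 0"
  proof (cases "b = - c k")
    case True
    then show ?thesis using z1 by (intro T0[OF G1] disjI2) (auto simp: abs_le_iff)
  next
    case False
    have "b \<le> x" if x: "x \<in> I" for x
    proof (rule ccontr)
      assume n: "\<not> b \<le> x"
      have "max x (- c k) \<in> I" by (rule mem_is_interval_1_I[OF ii x bdI(1)]) (use n bdk in auto)
      then have "max x (- c k) \<in> {b..d}" unfolding win[symmetric] using n bdk bd by auto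
      then show False using n bdk False by auto
    qed
    then show ?thesis using z1 by (intro T0[OF G1] disjI1) auto
  qed
  moreover have "T (emb G2) = 0"
  proof (cases "d = c k")
    case True
    then show ?thesis using z2 by (intro T0[OF G2] disjI2) (auto simp: abs_le_iff)
  next
    case False
    have "x \<le> d" if x: "x \<in> I" for x
    proof (rule ccontr)
      assume n: "\<not> x \<le> d"
      have "min x (c k) \<in> I" by (rule mem_is_interval_1_I[OF ii bdI(2) x]) (use n bdk in auto)
      then have "min x (c k) \<in> {b..d}" unfolding win[symmetric] using n bdk bd by auto
      then show False using n bdk False by auto
    qed
    then show ?thesis using z2 by (intro T0[OF G2] disjI1) auto
  qed
  moreover have "T (emb G2) = T (emb G) - T (emb G1)" unfolding G2_def by (rule lf_emb_diff[OF T G G1])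
  ultimately show "T (emb G) = 0" by simp
qed

theorem joint_kernel_subset_closure:
  assumes J: "J \<noteq> {}" "finite J" and S: "\<And>j. j \<in> J \<Longrightarrow> point_lf (S j)" and I: "rel_closed_interval a I"
    and xy: "x0 \<in> I" "y0 \<in> I" "x0 < y0"
  defines "W \<equiv> joint_kernel J S I"
  assumes f: "f \<in> W"
  shows "f \<in> U_top \<omega> a c closure_of {f + g | f g. f \<in> module.span cscale (Exp_set a W) \<and> g \<in> W_ival \<omega> a c I}"
    (is "f \<in> _ closure_of ?V")
proof (rule ccontr)
  assume nf: "f \<notin> U_top \<omega> a c closure_of ?V"
  have Is: "I \<subseteq> sym_ival a" by (rule rel_closed_subset[OF I])
  have sW: "module.subspace cscale W" unfolding W_def by (rule subspace_joint_kernel[OF S Is])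
  have WU: "W \<subseteq> U" by (auto simp: W_def joint_kernel_def)
  have fU: "f \<in> U" using f WU by blast
  have sI: "module.subspace cscale (W_ival \<omega> a c I)"
  proof (rule cfun.subspaceI)
    show "cscale z g \<in> W_ival \<omega> a c I" if "g \<in> W_ival \<omega> a c I" for z g
      using that U_scale[of g z] by (auto simp: W_ival_def cscale_def)
    show "g + h \<in> W_ival \<omega> a c I" if "g \<in> W_ival \<omega> a c I" "h \<in> W_ival \<omega> a c I" for g h
      using that U_add[of g h] by (auto simp: W_ival_def)
  qed (use U_zero in \<open>auto simp: W_ival_def\<close>)
  have sV: "module.subspace cscale ?V" by (rule cfun.subspace_sums[OF cfun.subspace_span sI])
  have WI: "W_ival \<omega> a c I \<subseteq> W" unfolding W_def by (rule W_ival_subset_joint_kernel[OF S I xy])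
  have "module.span cscale (Exp_set a W) \<subseteq> W" by (rule cfun.span_minimal[OF _ sW]) (auto simp: Exp_set_def)
  then have VW: "?V \<subseteq> W" using WI cfun.subspace_add[OF sW] by blast
  have VI: "g \<in> ?V" if "g \<in> W_ival \<omega> a c I" for g
  proof -
    have "g = 0 + g" by simp
    then show ?thesis using that cfun.span_zero[of "Exp_set a W"] by blast
  qed
  have VE: "g \<in> ?V" if "g \<in> Exp_set a W" for g
  proof -
    have "g = g + 0" by simp
    then show ?thesis using cfun.span_base[OF that] cfun.subspace_0[OF sI] by blast
  qed
  obtain A where A: "openin (U_top \<omega> a c) A" "f \<in> A" "A \<inter> ?V = {}"
    using nf fU unfolding in_closure_of topspace_U_top by blast
  obtain q k \<epsilon> where q: "0 < q" "q < 1" "0 < \<epsilon>" and near: "\<forall>g\<in>U. bd q k \<epsilon> (g - f) \<longrightarrow> g \<in> A"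
    using U_nhds[OF A(1,2)] by (elim exE conjE) (rule that)
  \<comment> \<open>Normalised so that the semi-ball around f that misses the sum becomes the unit
    ball, as the separation theorem expects.\<close>
  define p where "p g = real_seminorm q k g / \<epsilon>" for g
  have dist: "1 \<le> p (f + v)" if v: "v \<in> ?V" for v
  proof -
    have vU: "v \<in> U" using v VW WU by blast
    let ?v = "cscale (-1) v"
    have v': "?v \<in> ?V" by (rule cfun.subspace_scale[OF sV v])
    have "?v \<notin> A" using A(3) v' by blast
    then have "\<not> bd q k \<epsilon> (?v - f)" using near U_scale[OF vU] by blast
    then have "\<not> real_seminorm q k (?v - f) \<le> \<epsilon>" by (subst real_seminorm_le_iff[OF U_diff[OF U_scale[OF vU] fU] q(1,2)])
    moreover have eq: "?v - f = cscale (-1) (f + v)" by (simp add: cscale_def fun_eq_iff)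
    have "real_seminorm q k (?v - f) = norm (-1 :: complex) * real_seminorm q k (f + v)"
      unfolding eq by (rule real_seminorm_scale[OF U_add[OF fU vU] q(1,2)])
    ultimately have "\<epsilon> < real_seminorm q k (f + v)" by (simp only: norm_minus_cancel norm_one mult_1 not_le)
    then show ?thesis using q(3) by (simp add: p_def)
  qed
  have pa: "p (g + h) \<le> p g + p h" if "g \<in> U" "h \<in> U" for g h
    using divide_right_mono[OF real_seminorm_add[OF that q(1,2)], of \<epsilon> k] q(3) by (simp add: p_def add_divide_distrib)
  have ps: "p (cscale z g) = norm z * p g" if "g \<in> U" for z g
    using real_seminorm_scale[OF that q(1,2), of k z] by (simp add: p_def)
  have "\<exists>T. (\<forall>f\<in>U. \<forall>g\<in>U. T (f + g) = T f + T g) \<and> (\<forall>z. \<forall>f\<in>U. T (cscale z f) = z * T f) \<and>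
    (\<forall>f\<in>U. norm (T f) \<le> p f) \<and> (\<forall>v\<in>?V. T v = 0) \<and> T f \<noteq> 0"
    by (rule hahn_banach_separation[OF subspace_U _ _ sV _ fU])
      ((rule pa ps dist; assumption) | rule subset_trans[OF VW WU])+
  then obtain T where Tlin: "\<forall>f\<in>U. \<forall>g\<in>U. T (f + g) = T f + T g" "\<forall>z. \<forall>f\<in>U. T (cscale z f) = z * T f"
    and Tp: "\<forall>f\<in>U. norm (T f) \<le> p f" and TV: "\<forall>v\<in>?V. T v = 0" and Tf: "T f \<noteq> 0"
    by (elim exE conjE) (rule that)
  have Tb: "norm (T g) \<le> 1 / \<epsilon> * B" if g: "g \<in> U" and B: "bd q k B g" for g B
  proof -
    have "norm (T g) \<le> p g" using Tp g by blast
    also have "\<dots> \<le> B / \<epsilon>" unfolding p_def using B real_seminorm_le_iff[OF g q(1,2)] q(3) by (intro divide_right_mono) auto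
    finally show ?thesis by simp
  qed
  have "\<exists>q k C. 0 < q \<and> q < 1 \<and> 0 \<le> C \<and> (\<forall>f\<in>U. \<forall>B. bd q k B f \<longrightarrow> norm (T f) \<le> C * B)"
    by (rule exI[of _ q], rule exI[of _ k], rule exI[of _ "1 / \<epsilon>"]) (use q Tb in auto)
  then have lT: "lf T" unfolding lf_def using Tlin by blast
  \<comment> \<open>The window must contain the one seen by T and cut I in an interval of positive
    length; both are achieved by enlarging k.\<close>
  obtain b d k' where win: "k \<le> k'" "b < d" "I \<inter> {- c k'..c k'} = {b..d}"
    using rel_closed_window[OF I xy, of k] by (elim exE conjE) (rule that)
  have T0: "T g = 0" if g: "g \<in> U" and z: "bd q k' 0 g" for g
  proof -
    have "bd q k 0 g" by (rule bd_mono[OF z]) (use q win in auto)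
    then show ?thesis using Tb[OF g, of 0] by simp
  qed
  have supp: "supp_in T b d"
  proof (rule supp_in_window[OF lT _ _ I win(3,2)])
    show "T g = 0" if "g \<in> W_ival \<omega> a c I" for g using TV VI[OF that] by (rule bspec)
  qed (rule T0)
  \<comment> \<open>The exponential monomials of W lie in the annihilated sum, so the transform of T
    vanishes at the common zeros with their multiplicities.\<close>
  have van: "\<forall>i<n. (deriv ^^ i) (FL T) l = 0" if *: "\<forall>j\<in>J. \<forall>i<n. (deriv ^^ i) (FL (S j)) l = 0" for l n
  proof (intro allI impI)
    fix i assume i: "i < n"
    have "exp_monomial a i l \<in> joint_kernel J S I \<longleftrightarrow> (\<forall>j\<in>J. \<forall>i'\<le>i. (deriv ^^ i') (FL (S j)) l = 0)"
      by (rule exp_monomial_joint_kernel[OF _ I xy]) (rule S)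
    then have "exp_monomial a i l \<in> Exp_set a W" using * i by (auto simp: Exp_set_def W_def)
    then have "T (emb (exp_fam i l)) = 0" using TV VE unfolding exp_monomial_eq by blast
    then show "(deriv ^^ i) (FL T) l = 0"
      using lf_exp_higher_deriv[OF lT, of i l] by (simp add: FL_def[abs_def])
  qed
  obtain F e R where F: "F \<in> TF" "0 < e" "\<And>x. \<bar>x\<bar> \<le> c k' + e \<Longrightarrow> F 0 x = f x \<and> x \<in> sym_ival a"
    and R: "\<And>j x. R \<le> \<bar>x\<bar> \<Longrightarrow> F j x = 0" "0 < R"
    by (rule extension[OF fU, where k=k']) (rule that)
  have dec: "decaying R F" using F(1) R by (simp add: decaying_def)
  have sol: "solves (S j) b d F" if j: "j \<in> J" for j
    unfolding solves_def
  proof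
    fix y assume "y \<in> {b..d}"
    then have "y \<in> I \<inter> {- c k'..c k'}" unfolding win(3) .
    then have yI: "y \<in> I" "\<bar>y\<bar> \<le> c k'" by auto
    have "local_conv \<omega> a c (S j) f y = S j (emb (translate y F))"
      by (rule local_conv_extension[OF S[OF j] fU F(1,2) _ yI(2)]) (use F(3) in auto)
    then show "S j (emb (translate y F)) = 0" using f j yI(1) by (auto simp: W_def joint_kernel_def)
  qed
  have "T (emb F) = 0" by (rule annihilator_of_exponentials[OF J S dec sol win(2) lT supp van])
  \<comment> \<open>f and F agree on a neighbourhood of the enlarged window, so T does not see their
    difference.\<close>
  moreover have "T (f - emb F) = 0"
  proof (rule T0[OF U_diff[OF fU emb_U[OF F(1)]]])
    have eq: "f - emb F = f + cscale (-1) (emb F)" by (auto simp: cscale_def)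
    have "Dn (f - emb F) j x = 0" if x: "\<bar>x\<bar> \<le> c k'" for j x
    proof -
      have "F j x = Dn f j x" by (rule extension_Dn[OF fU F]) (use x F(2) in auto)
      then show ?thesis unfolding eq Dn_add[OF fU U_scale[OF emb_U[OF F(1)]] sym_c[OF x]]
          Dn_scale[OF emb_U[OF F(1)] sym_c[OF x]] Dn_emb[OF F(1) sym_c[OF x]] by simp
    qed
    then show "bd q k' 0 (f - emb F)" by (simp add: bd_def)
  qed
  ultimately show False using Tf lf_diff[OF lT fU emb_U[OF F(1)]] by simp
qed

theorem weak_synthesis_joint_kernel:
  assumes J: "J \<noteq> {}" "finite J" and S: "\<And>j. j \<in> J \<Longrightarrow> point_lf (S j)" and I: "rel_closed_interval a I"
    and xy: "x0 \<in> I" "y0 \<in> I" "x0 < y0"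
  shows "weak_spectral_synthesis \<omega> a c (joint_kernel J S I)"
proof -
  let ?W = "joint_kernel J S I"
  let ?V = "{f + g | f g. f \<in> module.span cscale (Exp_set a ?W) \<and> g \<in> W_ival \<omega> a c I}"
  have Is: "I \<subseteq> sym_ival a" by (rule rel_closed_subset[OF I])
  have sW: "module.subspace cscale ?W" by (rule subspace_joint_kernel[OF S Is])
  have cW: "closedin (U_top \<omega> a c) ?W" by (rule closed_joint_kernel[OF S Is])
  have WI: "W_ival \<omega> a c I \<subseteq> ?W" by (rule W_ival_subset_joint_kernel[OF S I xy])
  have "module.span cscale (Exp_set a ?W) \<subseteq> ?W" by (rule cfun.span_minimal[OF _ sW]) (auto simp: Exp_set_def)
  then have "?V \<subseteq> ?W" using WI cfun.subspace_add[OF sW] by blast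
  then have "U_top \<omega> a c closure_of ?V \<subseteq> ?W" by (rule closure_of_minimal[OF _ cW])
  moreover have "?W \<subseteq> U_top \<omega> a c closure_of ?V" by (rule subsetI, rule joint_kernel_subset_closure[OF J S I xy])
  ultimately have cl: "?W = U_top \<omega> a c closure_of ?V" by (rule equalityI[rotated])
  have "D_op a ` ?W \<subseteq> ?W" by (rule image_subsetI, rule D_joint_kernel[OF _ I xy], rule S, assumption+)
  moreover have res: "residual_interval \<omega> a c ?W = I" by (rule residual_joint_kernel(2)[OF J(1) S I xy])
  ultimately show ?thesis unfolding weak_spectral_synthesis_def D_invariant_subspace_def res
    by (intro conjI sW cW cl)
qed

end

theorem corollary3p6:
  fixes \<omega> :: "real \<Rightarrow> real" and a :: ereal and c r :: "nat \<Rightarrow> real"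
    and I :: "real set" and m :: nat
    and S :: "nat \<Rightarrow> (real \<Rightarrow> complex) \<Rightarrow> complex"
    and W :: "(real \<Rightarrow> complex) set"
  assumes "weight \<omega>" and "0 < a" and "exhausting_seq a c" and "unit_seq r"
    and "rel_closed_interval a I" and "\<exists>x\<in>I. \<exists>y\<in>I. x < y"
    and "1 \<le> m"
    and "\<And>j. j \<in> {1..m} \<Longrightarrow> S j \<in> U_dual \<omega> a c"
    and "\<And>j. j \<in> {1..m} \<Longrightarrow> supp_U \<omega> a c (S j) = {0}"
    and "\<And>j. j \<in> {1..<m} \<Longrightarrow> convolution_in_dual \<omega> a c r (S j) (S (Suc j))"
    and "W = (\<Inter>j\<in>{1..m}. ker_local_conv \<omega> a c (S j) I)"
  shows "weak_spectral_synthesis \<omega> a c W \<and>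
    is_residual_interval \<omega> a c W I \<and> residual_interval \<omega> a c W = I \<and>
    exponent_sequence a W (inter_mult {1..m} (\<lambda>j. zero_set (fourier_laplace a (S j))))"
proof -
  interpret weight_setting \<omega> a c by unfold_locales (fact assms)+
  have S: "point_lf (S j)" if "j \<in> {1..m}" for j
    by (rule supp_imp_point_lf[OF U_dual_lf[OF assms(8)[OF that]] assms(9)[OF that]])
  obtain x0 y0 where xy: "x0 \<in> I" "y0 \<in> I" "x0 < y0" using assms(6) by blast
  have J: "{1..m} \<noteq> {}" "finite {1..m}" using \<open>1 \<le> m\<close> by auto
  have W: "W = joint_kernel {1..m} S I"
    using J(1) unfolding assms(11) joint_kernel_def ker_local_conv_def by blast
  have FL: "fourier_laplace a (S j) = FL (S j)" for j
    by (rule ext) (simp add: fourier_laplace_eq FL_def)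
  show ?thesis unfolding W FL
    by (intro conjI weak_synthesis_joint_kernel[OF J S assms(5) xy] residual_joint_kernel[OF J(1) S assms(5) xy]
        exponent_sequence_joint_kernel[OF J S assms(5) xy])
qed

end
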